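(* Let $R$ be a nonzero, unital, commutative, indecomposable ring, let $G$ be a group, and let $\mathcal{R}$ be a set of relations on the set $\{\varepsilon_g:g\in G\}$. Suppose that for every $\xi\in X_G\setminus \Omega_{\mathcal{R}}$ there is $f\in \Theta(\ker \rho)$ such that $f(\xi)=1$ (which holds when $R$ is a field). Then: (i) There is an isomorphism $\Theta_{\mathcal{R}}:A_{\operatorname{par}}(G,\mathcal{R}) \to \operatorname{Lc}(\Omega_{\mathcal{R}},R)$ such that $\Theta_{\mathcal{R}}(\varepsilon_g) = 1_g$ for all $g\in G$, where $1_g\in\operatorname{Lc}(\Omega_{\mathcal{R}},R)$ is the characteristic function of $\Omega_g = \{\xi\in \Omega_{\mathcal{R}} : g\in\xi\}$. (ii) For each $g\in G$, let $\widehat{\theta}_g:\Omega_{g^{-1}}\to\Omega_{g}$ be given by $\widehat{\theta}_g(\xi)=g\xi$. Then $\widehat{\theta}=(\{\Omega_g\}_{g\in G},\{\widehat\theta_g\}_{g\in G})$ is a topological partial action of $G$ on $\Omega_{\mathcal{R}}$. (iii) For each $g\in G$, let $D_g = \{f\in \operatorname{Lc}(\Omega_{\mathcal{R}},R) : f(\xi) = 0 \ \forall \xi\notin\Omega_g\}$ and define $\theta_g : D_{g^{-1}}\to D_g$ by $\theta_g(f) =1_{g}\, (f\circ\widehat{\theta}_{g^{-1}})$ (understood as $0$ outside $\Omega_g$). Then $\theta$ is a partial action of $G$ on $\operatorname{Lc}(\Omega_{\mathcal{R}},R)$ such that $\theta_g(1_h1_{g^{-1}}) = 1_{gh}1_g$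 for all $g,h\in G$. Moreover, under the isomorphism $\Theta_{\mathcal{R}}$, $\theta$ is equivalent to the partial action of $G$ on $A_{\operatorname{par}}(G,\mathcal{R})$ with ideals $A_{\operatorname{par}}(G,\mathcal{R})\varepsilon_g$ and isomorphisms $A_{\operatorname{par}}(G,\mathcal{R})\varepsilon_{g^{-1}}\to A_{\operatorname{par}}(G,\mathcal{R})\varepsilon_g$ determined by $\varepsilon_h\varepsilon_{g^{-1}}\mapsto\varepsilon_{gh}\varepsilon_g$. (iv) The map $$R_{\operatorname{par}}(G,\mathcal{R}) \to \operatorname{Lc}(\Omega_{\mathcal{R}},R)\rtimes_\theta G,\qquad [g] \mapsto 1_g\delta_g,$$ is an isomorphism of $R$-algebras.
   Context: Indecomposable: the only idempotents of $R$ are $0$ and $1$. $R_{\operatorname{par}}(G)$ is the universal unital $R$-algebra with generators $\{[g]: g\in G\}$ subject to, for all $g,h\in G$: $[e]=1$; $[g^{-1}][g][h]=[g^{-1}][gh]$; $[g][h][h^{-1}]=[gh][h^{-1}]$. Put $\varepsilon_g:=[g][g^{-1}]$. A set of relations $\mathcal{R}$ on $\{\varepsilon_g:g\in G\}$ is a set of relations each of the form $\sum_i\lambda_i\prod_j\varepsilon_{g_{ij}}=0$ (finite sums and products, $\lambda_i\in R$, $g_{ij}\in G$); one writes $\sum_i\lambda_i\prod_j\varepsilon_{g_{ij}}\in\mathcal{R}$ when this relation is in $\mathcal{R}$. $R_{\operatorname{par}}(G,\mathcal{R})$ is the universal unital $R$-algebra with the same generators and relations plus those in $\mathcal{R}$.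 $A_{\operatorname{par}}(G)$ and $A_{\operatorname{par}}(G,\mathcal{R})$ are the (commutative) $R$-subalgebras of $R_{\operatorname{par}}(G)$ and $R_{\operatorname{par}}(G,\mathcal{R})$, respectively, generated by $\{\varepsilon_g: g\in G\}$. $\rho:A_{\operatorname{par}}(G)\to A_{\operatorname{par}}(G,\mathcal{R})$ is the canonical surjective homomorphism with $\rho(\varepsilon_g)=\varepsilon_g$ for all $g$. $X_G=\{\xi\subseteq G: e\in\xi\}$, with the subspace topology from the power set of $G$ identified with $\{0,1\}^G$ (product topology). For a Hausdorff space $X$ with a basis of compact-open sets, $\operatorname{Lc}(X,R)$ is the $R$-algebra of locally constant functions $X\to R$ with compact support. $\Theta:A_{\operatorname{par}}(G)\to\operatorname{Lc}(X_G,R)$ is the isomorphism sending $\varepsilon_g$ to the characteristic function $1_g$ of $\{\xi\in X_G: g\in\xi\}$ (it exists since $R$ is indecomposable). Put $$\Theta(\mathcal{R})=\Big\{\sum_i\lambda_i\prod_j 1_{g_{ij}} : \sum_i\lambda_i\prod_j\varepsilon_{g_{ij}}\in\mathcal{R}\Big\},\qquad \Omega_{\mathcal{R}}=\{\xi\in X_G: f(g^{-1}\xi)=0\ \forall f\in\Theta(\mathcal{R}),\ \forall g\in\xi\},$$ where $g\xi=\{gh: h\in\xi\}$. $\Omega_{\mathcal{R}}$ is closed in $X_G$ and has the subspace topology. A partial action of $G$ on an $R$-algebra $A$ is a family of ideals $D_g$ and algebra isomorphisms $\theta_g:D_{g^{-1}}\to D_g$ with $D_e=A$, $\theta_e=\mathrm{id}$,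 $\theta_g(D_{g^{-1}}\cap D_h)\subseteq D_{gh}$ and $\theta_g\theta_h=\theta_{gh}$ on $D_{h^{-1}}\cap D_{(gh)^{-1}}$; a topological partial action on a space is defined the same way with open subsets and homeomorphisms. The partial skew group ring $A\rtimes_\theta G$ is $\bigoplus_{g\in G}D_g\delta_g$ with product $(a\delta_g)(b\delta_h)=\theta_g(\theta_{g^{-1}}(a)b)\delta_{gh}$. Two algebraic partial actions are equivalent under an algebra isomorphism if it maps the ideals of one onto those of the other and intertwines the partial isomorphisms. *)

theory Defs
  imports "HOL-Analysis.Function_Topology" "HOL-Algebra.QuotRing" "HOL-Algebra.Module"
begin

section \<open>Algebras over a commutative ring\<close>

definition indecomposable :: "('r, 'k) ring_scheme \<Rightarrow> bool" where
  "indecomposable R \<longleftrightarrow>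
     (\<forall>x\<in>carrier R. x \<otimes>\<^bsub>R\<^esub> x = x \<longrightarrow> x = \<zero>\<^bsub>R\<^esub> \<or> x = \<one>\<^bsub>R\<^esub>)"

text \<open>The locale \<^locale>\<open>algebra\<close> of the library is for commutative algebras only.\<close>

locale assoc_algebra = module R M + ring M for R (structure) and M (structure) +
  assumes smult_mult_left:
      "\<lbrakk>a \<in> carrier R; x \<in> carrier M; y \<in> carrier M\<rbrakk> \<Longrightarrow>
        (a \<odot>\<^bsub>M\<^esub> x) \<otimes>\<^bsub>M\<^esub> y = a \<odot>\<^bsub>M\<^esub> (x \<otimes>\<^bsub>M\<^esub> y)"
    and smult_mult_right:
      "\<lbrakk>a \<in> carrier R; x \<in> carrier M; y \<in> carrier M\<rbrakk> \<Longrightarrow>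
        x \<otimes>\<^bsub>M\<^esub> (a \<odot>\<^bsub>M\<^esub> y) = a \<odot>\<^bsub>M\<^esub> (x \<otimes>\<^bsub>M\<^esub> y)"

definition algebra_iso ::
  "('r, 'k) ring_scheme \<Rightarrow> ('r, 'a, 'm) module_scheme \<Rightarrow> ('r, 'b, 'n) module_scheme
    \<Rightarrow> ('a \<Rightarrow> 'b) \<Rightarrow> bool" where
  "algebra_iso R A B h \<longleftrightarrow>
     assoc_algebra R A \<and> assoc_algebra R B \<and>
     h \<in> ring_hom A B \<and>
     (\<forall>r\<in>carrier R. \<forall>x\<in>carrier A. h (r \<odot>\<^bsub>A\<^esub> x) = r \<odot>\<^bsub>B\<^esub> h x) \<and>
     bij_betw h (carrier A) (carrier B)"

text \<open>Isomorphisms between ideals of an algebra; these are algebras that need not share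
  the unit of the ambient algebra.\<close>

definition ideal_iso ::
  "('r, 'k) ring_scheme \<Rightarrow> ('r, 'a, 'm) module_scheme \<Rightarrow> 'a set \<Rightarrow> 'a set
    \<Rightarrow> ('a \<Rightarrow> 'a) \<Rightarrow> bool" where
  "ideal_iso R A I J h \<longleftrightarrow>
     bij_betw h I J \<and>
     (\<forall>x\<in>I. \<forall>y\<in>I. h (x \<oplus>\<^bsub>A\<^esub> y) = h x \<oplus>\<^bsub>A\<^esub> h y) \<and>
     (\<forall>x\<in>I. \<forall>y\<in>I. h (x \<otimes>\<^bsub>A\<^esub> y) = h x \<otimes>\<^bsub>A\<^esub> h y) \<and>
     (\<forall>r\<in>carrier R. \<forall>x\<in>I. h (r \<odot>\<^bsub>A\<^esub> x) = r \<odot>\<^bsub>A\<^esub> h x)"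

definition subalgebra_carrier ::
  "('r, 'k) ring_scheme \<Rightarrow> ('r, 'a, 'm) module_scheme \<Rightarrow> 'a set \<Rightarrow> bool" where
  "subalgebra_carrier R A B \<longleftrightarrow>
     B \<subseteq> carrier A \<and> \<zero>\<^bsub>A\<^esub> \<in> B \<and> \<one>\<^bsub>A\<^esub> \<in> B \<and>
     (\<forall>x\<in>B. \<forall>y\<in>B. x \<oplus>\<^bsub>A\<^esub> y \<in> B \<and> x \<otimes>\<^bsub>A\<^esub> y \<in> B) \<and>
     (\<forall>r\<in>carrier R. \<forall>x\<in>B. r \<odot>\<^bsub>A\<^esub> x \<in> B)"

definition generated_subalgebra ::
  "('r, 'k) ring_scheme \<Rightarrow> ('r, 'a, 'm) module_scheme \<Rightarrow> 'a set
    \<Rightarrow> ('r, 'a, 'm) module_scheme" where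
  "generated_subalgebra R A S =
     A\<lparr>carrier := \<Inter>{B. subalgebra_carrier R A B \<and> S \<subseteq> B}\<rparr>"


section \<open>Universal algebras\<close>

text \<open>The free unital associative algebra on a set \<open>S\<close>: finitely supported functions on
  the words over \<open>S\<close>, multiplied by convolution with respect to concatenation.\<close>

definition free_algebra ::
  "('r, 'k) ring_scheme \<Rightarrow> 'g set \<Rightarrow> ('r, 'g list \<Rightarrow> 'r) module" where
  "free_algebra R S =
     \<lparr>carrier = {f. (\<forall>w. f w \<in> carrier R) \<and> finite {w. f w \<noteq> \<zero>\<^bsub>R\<^esub>} \<and>
                    {w. f w \<noteq> \<zero>\<^bsub>R\<^esub>} \<subseteq> lists S},
      mult = (\<lambda>f h w. \<Oplus>\<^bsub>R\<^esub>i\<in>{..length w}. f (take i w) \<otimes>\<^bsub>R\<^esub> h (drop i w)),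
      one = (\<lambda>w. if w = [] then \<one>\<^bsub>R\<^esub> else \<zero>\<^bsub>R\<^esub>),
      zero = (\<lambda>w. \<zero>\<^bsub>R\<^esub>),
      add = (\<lambda>f h w. f w \<oplus>\<^bsub>R\<^esub> h w),
      smult = (\<lambda>r f w. r \<otimes>\<^bsub>R\<^esub> f w)\<rparr>"

definition free_gen :: "('r, 'k) ring_scheme \<Rightarrow> 'g \<Rightarrow> 'g list \<Rightarrow> 'r" where
  "free_gen R g = (\<lambda>w. if w = [g] then \<one>\<^bsub>R\<^esub> else \<zero>\<^bsub>R\<^esub>)"

definition quotient_algebra ::
  "('r, 'a, 'm) module_scheme \<Rightarrow> 'a set \<Rightarrow> ('r, 'a set) module" where
  "quotient_algebra A I =
     \<lparr>carrier = carrier (A Quot I), mult = mult (A Quot I), one = one (A Quot I),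
      zero = zero (A Quot I), add = add (A Quot I),
      smult = (\<lambda>r X. \<Union>x\<in>X. I +>\<^bsub>A\<^esub> (r \<odot>\<^bsub>A\<^esub> x))\<rparr>"

text \<open>A relation \<open>\<Sum>\<^sub>i \<lambda>\<^sub>i \<Prod>\<^sub>j \<epsilon>(g\<^sub>i\<^sub>j) = 0\<close> is represented by the list of
  the pairs \<open>(\<lambda>\<^sub>i, [g\<^sub>i\<^sub>1, g\<^sub>i\<^sub>2, \<dots>])\<close>. Its left-hand side is evaluated in any algebra \<open>A\<close>
  in which a meaning \<open>e g\<close> has been given to each \<open>\<epsilon>(g)\<close>.\<close>

type_synonym ('r, 'g) eps_relation = "('r \<times> 'g list) list"

definition eval_relation ::
  "('r, 'a, 'm) module_scheme \<Rightarrow> ('g \<Rightarrow> 'a) \<Rightarrow> ('r, 'g) eps_relation \<Rightarrow> 'a" where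
  "eval_relation A e rel =
     foldr (\<lambda>(l, gs) s. (l \<odot>\<^bsub>A\<^esub> foldr (\<lambda>g p. e g \<otimes>\<^bsub>A\<^esub> p) gs \<one>\<^bsub>A\<^esub>) \<oplus>\<^bsub>A\<^esub> s) rel \<zero>\<^bsub>A\<^esub>"

definition eps_relations_on ::
  "('r, 'k) ring_scheme \<Rightarrow> ('g, 'l) monoid_scheme \<Rightarrow> ('r, 'g) eps_relation set \<Rightarrow> bool" where
  "eps_relations_on R G \<R> \<longleftrightarrow>
     (\<forall>rel\<in>\<R>. \<forall>(l, gs)\<in>set rel. l \<in> carrier R \<and> set gs \<subseteq> carrier G)"

definition par_relators ::
  "('r, 'k) ring_scheme \<Rightarrow> ('g, 'l) monoid_scheme \<Rightarrow> ('r, 'g) eps_relation set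
    \<Rightarrow> ('g list \<Rightarrow> 'r) set" where
  "par_relators R G \<R> =
     (let F = free_algebra R (carrier G); \<gamma> = free_gen R in
        {\<gamma> \<one>\<^bsub>G\<^esub> \<ominus>\<^bsub>F\<^esub> \<one>\<^bsub>F\<^esub>}
        \<union> {\<gamma> (inv\<^bsub>G\<^esub> g) \<otimes>\<^bsub>F\<^esub> \<gamma> g \<otimes>\<^bsub>F\<^esub> \<gamma> h \<ominus>\<^bsub>F\<^esub> \<gamma> (inv\<^bsub>G\<^esub> g) \<otimes>\<^bsub>F\<^esub> \<gamma> (g \<otimes>\<^bsub>G\<^esub> h)
             | g h. g \<in> carrier G \<and> h \<in> carrier G}
        \<union> {\<gamma> g \<otimes>\<^bsub>F\<^esub> \<gamma> h \<otimes>\<^bsub>F\<^esub> \<gamma> (inv\<^bsub>G\<^esub> h) \<ominus>\<^bsub>F\<^esub> \<gamma> (g \<otimes>\<^bsub>G\<^esub> h) \<otimes>\<^bsub>F\<^esub> \<gamma> (inv\<^bsub>G\<^esub> h)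
             | g h. g \<in> carrier G \<and> h \<in> carrier G}
        \<union> eval_relation F (\<lambda>g. \<gamma> g \<otimes>\<^bsub>F\<^esub> \<gamma> (inv\<^bsub>G\<^esub> g)) ` \<R>)"

definition par_ideal ::
  "('r, 'k) ring_scheme \<Rightarrow> ('g, 'l) monoid_scheme \<Rightarrow> ('r, 'g) eps_relation set
    \<Rightarrow> ('g list \<Rightarrow> 'r) set" where
  "par_ideal R G \<R> = Idl\<^bsub>free_algebra R (carrier G)\<^esub> (par_relators R G \<R>)"

text \<open>\<open>R_par R G \<R>\<close> is the algebra with the additional relations \<open>\<R>\<close>;
  the algebra without additional relations is \<open>R_par R G {}\<close>. Likewise for \<open>A_par\<close>.\<close>

definition R_par ::
  "('r, 'k) ring_scheme \<Rightarrow> ('g, 'l) monoid_scheme \<Rightarrow> ('r, 'g) eps_relation set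
    \<Rightarrow> ('r, ('g list \<Rightarrow> 'r) set) module" where
  "R_par R G \<R> = quotient_algebra (free_algebra R (carrier G)) (par_ideal R G \<R>)"

definition par_gen ::
  "('r, 'k) ring_scheme \<Rightarrow> ('g, 'l) monoid_scheme \<Rightarrow> ('r, 'g) eps_relation set
    \<Rightarrow> 'g \<Rightarrow> ('g list \<Rightarrow> 'r) set" where
  "par_gen R G \<R> g = par_ideal R G \<R> +>\<^bsub>free_algebra R (carrier G)\<^esub> free_gen R g"

definition par_eps ::
  "('r, 'k) ring_scheme \<Rightarrow> ('g, 'l) monoid_scheme \<Rightarrow> ('r, 'g) eps_relation set
    \<Rightarrow> 'g \<Rightarrow> ('g list \<Rightarrow> 'r) set" where
  "par_eps R G \<R> g = par_gen R G \<R> g \<otimes>\<^bsub>R_par R G \<R>\<^esub> par_gen R G \<R> (inv\<^bsub>G\<^esub> g)"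

definition A_par ::
  "('r, 'k) ring_scheme \<Rightarrow> ('g, 'l) monoid_scheme \<Rightarrow> ('r, 'g) eps_relation set
    \<Rightarrow> ('r, ('g list \<Rightarrow> 'r) set) module" where
  "A_par R G \<R> = generated_subalgebra R (R_par R G \<R>) (par_eps R G \<R> ` carrier G)"

text \<open>The canonical map \<open>A_par R G {} \<rightarrow> A_par R G \<R>\<close>: a coset modulo \<open>par_ideal R G {}\<close>
  is sent to the coset modulo the larger ideal \<open>par_ideal R G \<R>\<close> that contains it.\<close>

definition par_rho ::
  "('r, 'k) ring_scheme \<Rightarrow> ('g, 'l) monoid_scheme \<Rightarrow> ('r, 'g) eps_relation set
    \<Rightarrow> ('g list \<Rightarrow> 'r) set \<Rightarrow> ('g list \<Rightarrow> 'r) set" where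
  "par_rho R G \<R> X = par_ideal R G \<R> <+>\<^bsub>free_algebra R (carrier G)\<^esub> X"


section \<open>Locally constant functions\<close>

text \<open>Functions on \<open>X\<close> are extensional, that is \<^const>\<open>undefined\<close> outside \<^term>\<open>topspace X\<close>.
  If \<open>X\<close> is not compact then the field \<^const>\<open>one\<close> does not belong to the carrier.\<close>

definition Lc :: "'x topology \<Rightarrow> ('r, 'k) ring_scheme \<Rightarrow> ('r, 'x \<Rightarrow> 'r) module" where
  "Lc X R =
     \<lparr>carrier = {f \<in> topspace X \<rightarrow>\<^sub>E carrier R.
                  (\<forall>x\<in>topspace X. \<exists>U. openin X U \<and> x \<in> U \<and> (\<forall>y\<in>U. f y = f x)) \<and>
                  compactin X (X closure_of {x \<in> topspace X. f x \<noteq> \<zero>\<^bsub>R\<^esub>})},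
      mult = (\<lambda>f h. \<lambda>x\<in>topspace X. f x \<otimes>\<^bsub>R\<^esub> h x),
      one = (\<lambda>x\<in>topspace X. \<one>\<^bsub>R\<^esub>),
      zero = (\<lambda>x\<in>topspace X. \<zero>\<^bsub>R\<^esub>),
      add = (\<lambda>f h. \<lambda>x\<in>topspace X. f x \<oplus>\<^bsub>R\<^esub> h x),
      smult = (\<lambda>r f. \<lambda>x\<in>topspace X. r \<otimes>\<^bsub>R\<^esub> f x)\<rparr>"

text \<open>For a space \<open>X\<close> of subsets of \<open>G\<close>, the characteristic function of \<open>{\<xi> \<in> X. g \<in> \<xi>}\<close>.\<close>

definition char_fun :: "'g set topology \<Rightarrow> ('r, 'k) ring_scheme \<Rightarrow> 'g \<Rightarrow> 'g set \<Rightarrow> 'r" where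
  "char_fun X R g = (\<lambda>\<xi>\<in>topspace X. if g \<in> \<xi> then \<one>\<^bsub>R\<^esub> else \<zero>\<^bsub>R\<^esub>)"


section \<open>The spectrum of a set of relations\<close>

text \<open>The power set of \<open>G\<close> is identified with \<open>{0,1}\<^sup>G\<close> through indicator functions.\<close>

definition powerset_topology :: "('g, 'l) monoid_scheme \<Rightarrow> 'g set topology" where
  "powerset_topology G =
     pullback_topology (Pow (carrier G)) (\<lambda>\<xi>. \<lambda>g\<in>carrier G. g \<in> \<xi>)
       (product_topology (\<lambda>_. discrete_topology (UNIV :: bool set)) (carrier G))"

definition X_top :: "('g, 'l) monoid_scheme \<Rightarrow> 'g set topology" where
  "X_top G = subtopology (powerset_topology G) {\<xi>. \<xi> \<subseteq> carrier G \<and> \<one>\<^bsub>G\<^esub> \<in> \<xi>}"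

text \<open>The isomorphism chosen here exists for indecomposable \<open>R\<close>, and it is unique on the
  carrier of \<^term>\<open>A_par R G {}\<close> because that algebra is generated by the \<open>\<epsilon>(g)\<close>.\<close>

definition Theta ::
  "('r, 'k) ring_scheme \<Rightarrow> ('g, 'l) monoid_scheme
    \<Rightarrow> ('g list \<Rightarrow> 'r) set \<Rightarrow> 'g set \<Rightarrow> 'r" where
  "Theta R G =
     (SOME T. algebra_iso R (A_par R G {}) (Lc (X_top G) R) T \<and>
        (\<forall>g\<in>carrier G. T (par_eps R G {} g) = char_fun (X_top G) R g))"

definition Theta_rel ::
  "('r, 'k) ring_scheme \<Rightarrow> ('g, 'l) monoid_scheme \<Rightarrow> ('r, 'g) eps_relation set
    \<Rightarrow> ('g set \<Rightarrow> 'r) set" where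
  "Theta_rel R G \<R> = eval_relation (Lc (X_top G) R) (char_fun (X_top G) R) ` \<R>"

definition Omega ::
  "('r, 'k) ring_scheme \<Rightarrow> ('g, 'l) monoid_scheme \<Rightarrow> ('r, 'g) eps_relation set
    \<Rightarrow> 'g set set" where
  "Omega R G \<R> =
     {\<xi> \<in> topspace (X_top G).
        \<forall>f\<in>Theta_rel R G \<R>. \<forall>g\<in>\<xi>. f (inv\<^bsub>G\<^esub> g <#\<^bsub>G\<^esub> \<xi>) = \<zero>\<^bsub>R\<^esub>}"

definition Omega_top ::
  "('r, 'k) ring_scheme \<Rightarrow> ('g, 'l) monoid_scheme \<Rightarrow> ('r, 'g) eps_relation set
    \<Rightarrow> 'g set topology" where
  "Omega_top R G \<R> = subtopology (X_top G) (Omega R G \<R>)"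

definition Omega_at ::
  "('r, 'k) ring_scheme \<Rightarrow> ('g, 'l) monoid_scheme \<Rightarrow> ('r, 'g) eps_relation set
    \<Rightarrow> 'g \<Rightarrow> 'g set set" where
  "Omega_at R G \<R> g = {\<xi> \<in> Omega R G \<R>. g \<in> \<xi>}"

definition kernel_separates ::
  "('r, 'k) ring_scheme \<Rightarrow> ('g, 'l) monoid_scheme \<Rightarrow> ('r, 'g) eps_relation set \<Rightarrow> bool" where
  "kernel_separates R G \<R> \<longleftrightarrow>
     (\<forall>\<xi> \<in> topspace (X_top G) - Omega R G \<R>.
        \<exists>f \<in> Theta R G ` a_kernel (A_par R G {}) (A_par R G \<R>) (par_rho R G \<R>).
          f \<xi> = \<one>\<^bsub>R\<^esub>)"


section \<open>Partial actions\<close>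

definition algebra_partial_action ::
  "('r, 'k) ring_scheme \<Rightarrow> ('g, 'l) monoid_scheme \<Rightarrow> ('r, 'a, 'm) module_scheme
    \<Rightarrow> ('g \<Rightarrow> 'a set) \<Rightarrow> ('g \<Rightarrow> 'a \<Rightarrow> 'a) \<Rightarrow> bool" where
  "algebra_partial_action R G A D \<theta> \<longleftrightarrow>
     assoc_algebra R A \<and>
     (\<forall>g\<in>carrier G. ideal (D g) A) \<and>
     (\<forall>g\<in>carrier G. ideal_iso R A (D (inv\<^bsub>G\<^esub> g)) (D g) (\<theta> g)) \<and>
     D \<one>\<^bsub>G\<^esub> = carrier A \<and> (\<forall>x\<in>carrier A. \<theta> \<one>\<^bsub>G\<^esub> x = x) \<and>
     (\<forall>g\<in>carrier G. \<forall>h\<in>carrier G. \<theta> g ` (D (inv\<^bsub>G\<^esub> g) \<inter> D h) \<subseteq> D (g \<otimes>\<^bsub>G\<^esub> h)) \<and>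
     (\<forall>g\<in>carrier G. \<forall>h\<in>carrier G. \<forall>x\<in>D (inv\<^bsub>G\<^esub> h) \<inter> D (inv\<^bsub>G\<^esub> (g \<otimes>\<^bsub>G\<^esub> h)).
        \<theta> g (\<theta> h x) = \<theta> (g \<otimes>\<^bsub>G\<^esub> h) x)"

definition topological_partial_action ::
  "('g, 'l) monoid_scheme \<Rightarrow> 'x topology \<Rightarrow> ('g \<Rightarrow> 'x set) \<Rightarrow> ('g \<Rightarrow> 'x \<Rightarrow> 'x) \<Rightarrow> bool" where
  "topological_partial_action G X D \<theta> \<longleftrightarrow>
     (\<forall>g\<in>carrier G. openin X (D g)) \<and>
     (\<forall>g\<in>carrier G.
        homeomorphic_map (subtopology X (D (inv\<^bsub>G\<^esub> g))) (subtopology X (D g)) (\<theta> g)) \<and>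
     D \<one>\<^bsub>G\<^esub> = topspace X \<and> (\<forall>x\<in>topspace X. \<theta> \<one>\<^bsub>G\<^esub> x = x) \<and>
     (\<forall>g\<in>carrier G. \<forall>h\<in>carrier G. \<theta> g ` (D (inv\<^bsub>G\<^esub> g) \<inter> D h) \<subseteq> D (g \<otimes>\<^bsub>G\<^esub> h)) \<and>
     (\<forall>g\<in>carrier G. \<forall>h\<in>carrier G. \<forall>x\<in>D (inv\<^bsub>G\<^esub> h) \<inter> D (inv\<^bsub>G\<^esub> (g \<otimes>\<^bsub>G\<^esub> h)).
        \<theta> g (\<theta> h x) = \<theta> (g \<otimes>\<^bsub>G\<^esub> h) x)"

definition equivalent_under ::
  "('g, 'l) monoid_scheme \<Rightarrow> ('a \<Rightarrow> 'b) \<Rightarrow> ('g \<Rightarrow> 'a set) \<Rightarrow> ('g \<Rightarrow> 'a \<Rightarrow> 'a)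
    \<Rightarrow> ('g \<Rightarrow> 'b set) \<Rightarrow> ('g \<Rightarrow> 'b \<Rightarrow> 'b) \<Rightarrow> bool" where
  "equivalent_under G \<phi> D \<theta> D' \<theta>' \<longleftrightarrow>
     (\<forall>g\<in>carrier G. \<phi> ` D g = D' g) \<and>
     (\<forall>g\<in>carrier G. \<forall>x\<in>D (inv\<^bsub>G\<^esub> g). \<phi> (\<theta> g x) = \<theta>' g (\<phi> x))"

definition support :: "('g, 'l) monoid_scheme \<Rightarrow> ('a, 'm) ring_scheme \<Rightarrow> ('g \<Rightarrow> 'a) \<Rightarrow> 'g set" where
  "support G A x = {g \<in> carrier G. x g \<noteq> \<zero>\<^bsub>A\<^esub>}"

text \<open>An element \<open>\<Sum>\<^sub>g x\<^sub>g \<delta>\<^sub>g\<close> of the partial skew group ring is represented by its extensional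
  coefficient function; the product is the biadditive extension of
  \<open>(a \<delta>\<^sub>g)(b \<delta>\<^sub>h) = \<theta>\<^sub>g(\<theta>(g\<inverse>)(a) b) \<delta>\<^sub>g\<^sub>h\<close>.\<close>

definition skew_group_ring ::
  "('g, 'l) monoid_scheme \<Rightarrow> ('r, 'a, 'm) module_scheme \<Rightarrow> ('g \<Rightarrow> 'a set)
    \<Rightarrow> ('g \<Rightarrow> 'a \<Rightarrow> 'a) \<Rightarrow> ('r, 'g \<Rightarrow> 'a) module" where
  "skew_group_ring G A D \<theta> =
     \<lparr>carrier = {x \<in> \<Pi>\<^sub>E g\<in>carrier G. D g. finite (support G A x)},
      mult = (\<lambda>x y. \<lambda>k\<in>carrier G.
        finsum A (\<lambda>(g, h). \<theta> g (\<theta> (inv\<^bsub>G\<^esub> g) (x g) \<otimes>\<^bsub>A\<^esub> y h))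
          {(g, h) \<in> support G A x \<times> support G A y. g \<otimes>\<^bsub>G\<^esub> h = k}),
      one = (\<lambda>k\<in>carrier G. if k = \<one>\<^bsub>G\<^esub> then \<one>\<^bsub>A\<^esub> else \<zero>\<^bsub>A\<^esub>),
      zero = (\<lambda>k\<in>carrier G. \<zero>\<^bsub>A\<^esub>),
      add = (\<lambda>x y. \<lambda>k\<in>carrier G. x k \<oplus>\<^bsub>A\<^esub> y k),
      smult = (\<lambda>r x. \<lambda>k\<in>carrier G. r \<odot>\<^bsub>A\<^esub> x k)\<rparr>"

definition skew_monom ::
  "('g, 'l) monoid_scheme \<Rightarrow> ('a, 'm) ring_scheme \<Rightarrow> 'a \<Rightarrow> 'g \<Rightarrow> 'g \<Rightarrow> 'a" where
  "skew_monom G A a g = (\<lambda>k\<in>carrier G. if k = g then a else \<zero>\<^bsub>A\<^esub>)"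


section \<open>The partial actions on the spectrum and on its locally constant functions\<close>

definition theta_hat :: "('g, 'l) monoid_scheme \<Rightarrow> 'g \<Rightarrow> 'g set \<Rightarrow> 'g set" where
  "theta_hat G g \<xi> = g <#\<^bsub>G\<^esub> \<xi>"

definition Lc_ideal ::
  "('r, 'k) ring_scheme \<Rightarrow> ('g, 'l) monoid_scheme \<Rightarrow> ('r, 'g) eps_relation set
    \<Rightarrow> 'g \<Rightarrow> ('g set \<Rightarrow> 'r) set" where
  "Lc_ideal R G \<R> g =
     {f \<in> carrier (Lc (Omega_top R G \<R>) R).
        \<forall>\<xi> \<in> Omega R G \<R> - Omega_at R G \<R> g. f \<xi> = \<zero>\<^bsub>R\<^esub>}"

definition Lc_theta ::
  "('r, 'k) ring_scheme \<Rightarrow> ('g, 'l) monoid_scheme \<Rightarrow> ('r, 'g) eps_relation set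
    \<Rightarrow> 'g \<Rightarrow> ('g set \<Rightarrow> 'r) \<Rightarrow> 'g set \<Rightarrow> 'r" where
  "Lc_theta R G \<R> g f =
     (\<lambda>\<xi>\<in>Omega R G \<R>.
        if \<xi> \<in> Omega_at R G \<R> g then f (theta_hat G (inv\<^bsub>G\<^esub> g) \<xi>) else \<zero>\<^bsub>R\<^esub>)"

text \<open>\<open>\<eta>\<close> is a partial action on \<open>A_par R G \<R>\<close> with the ideals generated by the \<open>\<epsilon>(g)\<close> and
  with \<open>\<epsilon>(h) \<epsilon>(g\<inverse>) \<mapsto> \<epsilon>(gh) \<epsilon>(g)\<close> under \<open>\<eta> g\<close>. On the ideals, these conditions determine \<open>\<eta>\<close>.\<close>

definition A_par_ideal ::
  "('r, 'k) ring_scheme \<Rightarrow> ('g, 'l) monoid_scheme \<Rightarrow> ('r, 'g) eps_relation set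
    \<Rightarrow> 'g \<Rightarrow> ('g list \<Rightarrow> 'r) set set" where
  "A_par_ideal R G \<R> g = PIdl\<^bsub>A_par R G \<R>\<^esub> (par_eps R G \<R> g)"

definition A_par_action ::
  "('r, 'k) ring_scheme \<Rightarrow> ('g, 'l) monoid_scheme \<Rightarrow> ('r, 'g) eps_relation set
    \<Rightarrow> ('g \<Rightarrow> ('g list \<Rightarrow> 'r) set \<Rightarrow> ('g list \<Rightarrow> 'r) set) \<Rightarrow> bool" where
  "A_par_action R G \<R> \<eta> \<longleftrightarrow>
     algebra_partial_action R G (A_par R G \<R>) (A_par_ideal R G \<R>) \<eta> \<and>
     (\<forall>g\<in>carrier G. \<forall>h\<in>carrier G.
        \<eta> g (par_eps R G \<R> h \<otimes>\<^bsub>A_par R G \<R>\<^esub> par_eps R G \<R> (inv\<^bsub>G\<^esub> g)) =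
          par_eps R G \<R> (g \<otimes>\<^bsub>G\<^esub> h) \<otimes>\<^bsub>A_par R G \<R>\<^esub> par_eps R G \<R> g)"

end

theory Submission
  imports Defs
begin

text \<open>On a closed invariant set of subsets of \<open>G\<close>, compactness makes every locally constant function
  depend only on the trace \<open>\<xi> \<inter> K\<close> for one finite \<open>K\<close>; after that the arguments are combinatorial.
  The assignment \<open>[g] \<mapsto> 1\<^sub>g \<delta>\<^sub>g\<close> satisfies the relations of the universal algebra, and its restriction
  to the subalgebra generated by the \<open>\<epsilon>(g)\<close> is a homomorphism onto the locally constant functions.
  For injectivity one cuts an element \<open>a\<close> down by the products \<open>e(\<xi>, K)\<close> of the idempotents \<open>\<epsilon>(g)\<close> for
  \<open>g \<in> K \<inter> \<xi>\<close> and \<open>1 - \<epsilon>(g)\<close> for \<open>g \<in> K - \<xi>\<close>: if \<open>K\<close> is large, then \<open>a e(\<xi>, K)\<close> is a scalar multiple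
  of \<open>e(\<xi>, K)\<close>, the scalar being the value at \<open>\<xi>\<close> of the image of \<open>a\<close>, and \<open>a\<close> vanishes as soon as all
  the \<open>a e(\<xi>, K)\<close> do. The separation hypothesis says exactly that the \<open>e(\<xi>, K)\<close> with \<open>\<xi>\<close> outside the spectrum
  vanish for large \<open>K\<close>. Every element of the universal algebra is a sum of terms \<open>a\<^sub>g [g]\<close> with \<open>a\<^sub>g\<close> in the
  subalgebra, so the isomorphism of the coefficients yields the one with the skew group ring.\<close>

section \<open>Associative algebras\<close>

text \<open>\<open>A_par\<close> is given as a subalgebra and not by a presentation, so the map to
  the functions is not defined on the generators; it is read off as the coefficient at the unit of
  \<open>G\<close> of the homomorphism into the skew group ring. Hence that ring, including its
  associativity, has to be available before part (i). One locale treats an arbitrary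
  \<open>\<R>\<close>, and its instance \<open>{}\<close>, whose spectrum is all of
  \<open>X\<close>, supplies \<open>Theta\<close>. The obstacle is that \<open>R\<close> need not be
  a field. A relation that fails at \<open>\<xi>\<close> only has some nonzero value
  \<open>r\<close> there, which leads to \<open>r e(\<xi>, K) = 0\<close>, whereas injectivity asks
  for \<open>e(\<xi>, K) = 0\<close>; hence the value 1 in the hypothesis. Over a field one divides
  by \<open>r\<close>, but a violated relation may fail at a translate
  \<open>g\<inverse> \<xi>\<close> only, and it is first moved to \<open>\<xi>\<close> by
  conjugation with \<open>[g]\<close>, which preserves the kernel of \<open>\<rho>\<close>.
  Compactness is used a second time in the proof of injectivity, to replace the sets
  \<open>K\<close> found at the individual \<open>\<xi>\<close> by a common one.\<close>

definition algebra_hom ::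
  "('r, 'k) ring_scheme \<Rightarrow> ('r, 'a, 'm) module_scheme \<Rightarrow> ('r, 'b, 'n) module_scheme
    \<Rightarrow> ('a \<Rightarrow> 'b) \<Rightarrow> bool" where
  "algebra_hom R A B h \<longleftrightarrow>
     h \<in> ring_hom A B \<and> (\<forall>r\<in>carrier R. \<forall>x\<in>carrier A. h (r \<odot>\<^bsub>A\<^esub> x) = r \<odot>\<^bsub>B\<^esub> h x)"

lemma algebra_homI:
  assumes "\<And>x. x \<in> carrier A \<Longrightarrow> h x \<in> carrier B"
    and "\<And>x y. \<lbrakk>x \<in> carrier A; y \<in> carrier A\<rbrakk> \<Longrightarrow> h (x \<oplus>\<^bsub>A\<^esub> y) = h x \<oplus>\<^bsub>B\<^esub> h y"
    and "\<And>x y. \<lbrakk>x \<in> carrier A; y \<in> carrier A\<rbrakk> \<Longrightarrow> h (x \<otimes>\<^bsub>A\<^esub> y) = h x \<otimes>\<^bsub>B\<^esub> h y"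
    and "h \<one>\<^bsub>A\<^esub> = \<one>\<^bsub>B\<^esub>"
    and "\<And>r x. \<lbrakk>r \<in> carrier R; x \<in> carrier A\<rbrakk> \<Longrightarrow> h (r \<odot>\<^bsub>A\<^esub> x) = r \<odot>\<^bsub>B\<^esub> h x"
  shows "algebra_hom R A B h"
  using assms by (auto simp: algebra_hom_def intro!: ring_hom_memI)

lemma algebra_homD:
  assumes "algebra_hom R A B h"
  shows "x \<in> carrier A \<Longrightarrow> h x \<in> carrier B"
    and "\<lbrakk>x \<in> carrier A; y \<in> carrier A\<rbrakk> \<Longrightarrow> h (x \<oplus>\<^bsub>A\<^esub> y) = h x \<oplus>\<^bsub>B\<^esub> h y"
    and "\<lbrakk>x \<in> carrier A; y \<in> carrier A\<rbrakk> \<Longrightarrow> h (x \<otimes>\<^bsub>A\<^esub> y) = h x \<otimes>\<^bsub>B\<^esub> h y"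
    and "h \<one>\<^bsub>A\<^esub> = \<one>\<^bsub>B\<^esub>"
    and "\<lbrakk>r \<in> carrier R; x \<in> carrier A\<rbrakk> \<Longrightarrow> h (r \<odot>\<^bsub>A\<^esub> x) = r \<odot>\<^bsub>B\<^esub> h x"
  using assms
  by (auto simp: algebra_hom_def ring_hom_closed ring_hom_add ring_hom_mult ring_hom_one)

lemma algebra_hom_ring_hom_ring:
  assumes "algebra_hom R A B h" "ring A" "ring B"
  shows "ring_hom_ring A B h"
  using assms by (intro ring_hom_ringI2) (auto simp: algebra_hom_def)

lemma algebra_hom_zero:
  assumes "algebra_hom R A B h" "ring A" "ring B"
  shows "h \<zero>\<^bsub>A\<^esub> = \<zero>\<^bsub>B\<^esub>"
proof -
  interpret ring_hom_ring A B h by (rule algebra_hom_ring_hom_ring[OF assms])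
  show ?thesis by simp
qed

lemma algebra_hom_minus:
  assumes "algebra_hom R A B h" "ring A" "ring B" "x \<in> carrier A" "y \<in> carrier A"
  shows "h (x \<ominus>\<^bsub>A\<^esub> y) = h x \<ominus>\<^bsub>B\<^esub> h y"
proof -
  interpret ring_hom_ring A B h by (rule algebra_hom_ring_hom_ring[OF assms(1-3)])
  show ?thesis using assms(4,5) by (simp add: a_minus_def)
qed

lemma algebra_hom_comp:
  assumes "algebra_hom R A B f" "algebra_hom R B C h"
  shows "algebra_hom R A C (h \<circ> f)"
  by (rule algebra_homI) (simp_all add: algebra_homD[OF assms(1)] algebra_homD[OF assms(2)])

lemma algebra_iso_iff:
  "algebra_iso R A B h \<longleftrightarrow> assoc_algebra R A \<and> assoc_algebra R B \<and>
     algebra_hom R A B h \<and> bij_betw h (carrier A) (carrier B)"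
  by (auto simp: algebra_iso_def algebra_hom_def)

lemma (in assoc_algebra) ring_M: "ring M" ..

lemma (in assoc_algebra) cring_R: "cring R" ..

lemma assoc_algebraI:
  assumes "cring R" "ring M"
    and "\<And>a x. \<lbrakk>a \<in> carrier R; x \<in> carrier M\<rbrakk> \<Longrightarrow> a \<odot>\<^bsub>M\<^esub> x \<in> carrier M"
    and "\<And>a b x. \<lbrakk>a \<in> carrier R; b \<in> carrier R; x \<in> carrier M\<rbrakk>
      \<Longrightarrow> (a \<oplus>\<^bsub>R\<^esub> b) \<odot>\<^bsub>M\<^esub> x = a \<odot>\<^bsub>M\<^esub> x \<oplus>\<^bsub>M\<^esub> b \<odot>\<^bsub>M\<^esub> x"
    and "\<And>a x y. \<lbrakk>a \<in> carrier R; x \<in> carrier M; y \<in> carrier M\<rbrakk>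
      \<Longrightarrow> a \<odot>\<^bsub>M\<^esub> (x \<oplus>\<^bsub>M\<^esub> y) = a \<odot>\<^bsub>M\<^esub> x \<oplus>\<^bsub>M\<^esub> a \<odot>\<^bsub>M\<^esub> y"
    and "\<And>a b x. \<lbrakk>a \<in> carrier R; b \<in> carrier R; x \<in> carrier M\<rbrakk>
      \<Longrightarrow> (a \<otimes>\<^bsub>R\<^esub> b) \<odot>\<^bsub>M\<^esub> x = a \<odot>\<^bsub>M\<^esub> (b \<odot>\<^bsub>M\<^esub> x)"
    and "\<And>x. x \<in> carrier M \<Longrightarrow> \<one>\<^bsub>R\<^esub> \<odot>\<^bsub>M\<^esub> x = x"
    and "\<And>a x y. \<lbrakk>a \<in> carrier R; x \<in> carrier M; y \<in> carrier M\<rbrakk>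
      \<Longrightarrow> (a \<odot>\<^bsub>M\<^esub> x) \<otimes>\<^bsub>M\<^esub> y = a \<odot>\<^bsub>M\<^esub> (x \<otimes>\<^bsub>M\<^esub> y)"
    and "\<And>a x y. \<lbrakk>a \<in> carrier R; x \<in> carrier M; y \<in> carrier M\<rbrakk>
      \<Longrightarrow> x \<otimes>\<^bsub>M\<^esub> (a \<odot>\<^bsub>M\<^esub> y) = a \<odot>\<^bsub>M\<^esub> (x \<otimes>\<^bsub>M\<^esub> y)"
  shows "assoc_algebra R M"
proof -
  interpret ring M by fact
  have "module R M"
    by (rule moduleI) (use assms is_abelian_group in auto)
  then show ?thesis
    by (intro assoc_algebra.intro assoc_algebra_axioms.intro) (use assms in auto)
qed

lemma (in assoc_algebra) eval_relation_closed:
  assumes "\<And>l gs. (l, gs) \<in> set rel \<Longrightarrow> l \<in> carrier R \<and> e ` set gs \<subseteq> carrier M"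
  shows "eval_relation M e rel \<in> carrier M"
proof -
  have fold: "foldr (\<lambda>g p. e g \<otimes>\<^bsub>M\<^esub> p) gs \<one>\<^bsub>M\<^esub> \<in> carrier M" if "e ` set gs \<subseteq> carrier M" for gs
    using that by (induction gs) auto
  show ?thesis using assms
  proof (induction rel)
    case Nil
    then show ?case by (simp add: eval_relation_def)
  next
    case (Cons p rel)
    obtain l gs where p: "p = (l, gs)" by force
    have "l \<in> carrier R" "e ` set gs \<subseteq> carrier M" using Cons.prems p by force+
    moreover have "eval_relation M e rel \<in> carrier M"
      by (rule Cons.IH) (use Cons.prems in force)
    ultimately show ?case using fold by (simp add: eval_relation_def p)
  qed
qed

text \<open>A relation is a formal list, so one and the same relation can be evaluated in several
  algebras, and homomorphisms commute with the evaluation. \<open>e'\<close> is compared with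
  \<open>h (e g)\<close> only on the letters that occur, since nothing is known about other
  \<open>g\<close>.\<close>

lemma algebra_hom_eval_relation:
  assumes h: "algebra_hom R A B h" and A: "assoc_algebra R A" and B: "assoc_algebra R B"
    and "\<And>l gs. (l, gs) \<in> set rel \<Longrightarrow> l \<in> carrier R \<and> e ` set gs \<subseteq> carrier A"
    and "\<And>l gs g. (l, gs) \<in> set rel \<Longrightarrow> g \<in> set gs \<Longrightarrow> e' g = h (e g)"
  shows "h (eval_relation A e rel) = eval_relation B e' rel"
proof -
  interpret A: assoc_algebra R A by fact
  interpret B: assoc_algebra R B by fact
  note hD = algebra_homD[OF h]
  have fold: "foldr (\<lambda>g p. e g \<otimes>\<^bsub>A\<^esub> p) gs \<one>\<^bsub>A\<^esub> \<in> carrier A \<and>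
    h (foldr (\<lambda>g p. e g \<otimes>\<^bsub>A\<^esub> p) gs \<one>\<^bsub>A\<^esub>) = foldr (\<lambda>g p. e' g \<otimes>\<^bsub>B\<^esub> p) gs \<one>\<^bsub>B\<^esub>"
    if "e ` set gs \<subseteq> carrier A" "\<And>g. g \<in> set gs \<Longrightarrow> e' g = h (e g)" for gs
    using that by (induction gs) (auto simp: hD)
  show ?thesis using assms(4,5)
  proof (induction rel)
    case Nil
    then show ?case
      by (simp add: eval_relation_def algebra_hom_zero[OF h A.ring_M B.ring_M])
  next
    case (Cons p rel)
    obtain l gs where p: "p = (l, gs)" by force
    have 1: "l \<in> carrier R" "e ` set gs \<subseteq> carrier A" "\<And>g. g \<in> set gs \<Longrightarrow> e' g = h (e g)"
      using Cons.prems p by force+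
    have 2: "eval_relation A e rel \<in> carrier A"
      by (rule A.eval_relation_closed) (use Cons.prems in force)
    have 3: "h (eval_relation A e rel) = eval_relation B e' rel"
      by (rule Cons.IH) (use Cons.prems in force)+
    have 4: "eval_relation C f (p # rel) =
      l \<odot>\<^bsub>C\<^esub> foldr (\<lambda>g p. f g \<otimes>\<^bsub>C\<^esub> p) gs \<one>\<^bsub>C\<^esub> \<oplus>\<^bsub>C\<^esub> eval_relation C f rel" for C f
      by (simp add: eval_relation_def p)
    show ?case
      unfolding 4 using fold[OF 1(2,3)] 1(1) 2 3 by (simp add: hD)
  qed
qed

subsection \<open>Subalgebras\<close>

lemma (in assoc_algebra) subalgebra_carrier_UNIV: "subalgebra_carrier R M (carrier M)"
  by (auto simp: subalgebra_carrier_def)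

lemma (in assoc_algebra) assoc_algebra_subalgebra:
  assumes "subalgebra_carrier R M B"
  shows "assoc_algebra R (M\<lparr>carrier := B\<rparr>)"
proof -
  have B: "B \<subseteq> carrier M" "\<zero>\<^bsub>M\<^esub> \<in> B" "\<one>\<^bsub>M\<^esub> \<in> B"
    "\<And>x y. x \<in> B \<Longrightarrow> y \<in> B \<Longrightarrow> x \<oplus>\<^bsub>M\<^esub> y \<in> B" "\<And>x y. x \<in> B \<Longrightarrow> y \<in> B \<Longrightarrow> x \<otimes>\<^bsub>M\<^esub> y \<in> B"
    "\<And>r x. r \<in> carrier R \<Longrightarrow> x \<in> B \<Longrightarrow> r \<odot>\<^bsub>M\<^esub> x \<in> B"
    using assms by (auto simp: subalgebra_carrier_def)
  have c: "x \<in> carrier M" if "x \<in> B" for x using that B(1) by auto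
  \<comment> \<open>\<open>subalgebra_carrier\<close> does not mention negatives; they are multiples
    by -1.\<close>
  have neg: "\<ominus>\<^bsub>M\<^esub> x \<in> B" if "x \<in> B" for x
    using B(6)[OF _ that, of "\<ominus>\<^bsub>R\<^esub> \<one>\<^bsub>R\<^esub>"] c[OF that] by (simp add: smult_l_minus)
  show ?thesis
  proof (rule assoc_algebraI)
    show "ring (M\<lparr>carrier := B\<rparr>)"
    proof (rule ringI)
      show "abelian_group (M\<lparr>carrier := B\<rparr>)"
        by (rule abelian_groupI)
          (auto simp: B c M.a_ac M.r_neg intro!: bexI[OF _ neg])
      show "monoid (M\<lparr>carrier := B\<rparr>)"
        by (rule monoidI) (auto simp: B c m_assoc)
    qed (auto simp: B c l_distr r_distr)
  qed (auto simp: B c smult_l_distr smult_r_distr smult_assoc1 smult_mult_left smult_mult_right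
      intro: cring_R)
qed

context assoc_algebra begin

text \<open>The family that is intersected contains \<open>carrier M\<close>, which keeps the
  intersection inside \<open>carrier M\<close>.\<close>

lemma subalgebra_generated_subalgebra:
  assumes "S \<subseteq> carrier M"
  shows "subalgebra_carrier R M (carrier (generated_subalgebra R M S))"
  using subalgebra_carrier_UNIV assms
  unfolding generated_subalgebra_def subalgebra_carrier_def by simp blast

lemma assoc_algebra_generated_subalgebra:
  assumes "S \<subseteq> carrier M"
  shows "assoc_algebra R (generated_subalgebra R M S)"
  using assoc_algebra_subalgebra[OF subalgebra_generated_subalgebra[OF assms]]
  by (simp add: generated_subalgebra_def)

lemma generated_subalgebra_simps:
  "\<zero>\<^bsub>generated_subalgebra R M S\<^esub> = \<zero>\<^bsub>M\<^esub>" "\<one>\<^bsub>generated_subalgebra R M S\<^esub> = \<one>\<^bsub>M\<^esub>"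
  "mult (generated_subalgebra R M S) = mult M" "add (generated_subalgebra R M S) = add M"
  "smult (generated_subalgebra R M S) = smult M"
  by (simp_all add: generated_subalgebra_def)

lemma generated_subalgebra_gen: "x \<in> S \<Longrightarrow> x \<in> carrier (generated_subalgebra R M S)"
  by (auto simp: generated_subalgebra_def)

lemma generated_subalgebra_minimal:
  assumes "subalgebra_carrier R M B" "S \<subseteq> B"
  shows "carrier (generated_subalgebra R M S) \<subseteq> B"
  using assms by (auto simp: generated_subalgebra_def)

text \<open>The members that satisfy \<open>P\<close> form a subalgebra that contains
  \<open>S\<close>, and the generated one is the smallest such.\<close>

lemma generated_subalgebra_induct [consumes 2, case_names gen zero one add mult smult]:
  assumes x: "x \<in> carrier (generated_subalgebra R M S)" and S: "S \<subseteq> carrier M"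
    and "\<And>x. x \<in> S \<Longrightarrow> P x" "P \<zero>\<^bsub>M\<^esub>" "P \<one>\<^bsub>M\<^esub>"
    and "\<And>x y. \<lbrakk>x \<in> carrier (generated_subalgebra R M S);
      y \<in> carrier (generated_subalgebra R M S); P x; P y\<rbrakk> \<Longrightarrow> P (x \<oplus>\<^bsub>M\<^esub> y)"
    and "\<And>x y. \<lbrakk>x \<in> carrier (generated_subalgebra R M S);
      y \<in> carrier (generated_subalgebra R M S); P x; P y\<rbrakk> \<Longrightarrow> P (x \<otimes>\<^bsub>M\<^esub> y)"
    and "\<And>r x. \<lbrakk>r \<in> carrier R; x \<in> carrier (generated_subalgebra R M S); P x\<rbrakk>
      \<Longrightarrow> P (r \<odot>\<^bsub>M\<^esub> x)"
  shows "P x"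
proof -
  let ?C = "carrier (generated_subalgebra R M S)"
  have C: "subalgebra_carrier R M ?C" by (rule subalgebra_generated_subalgebra[OF S])
  have "subalgebra_carrier R M {x \<in> ?C. P x}"
    using C assms(3-) unfolding subalgebra_carrier_def by auto
  moreover have "S \<subseteq> {x \<in> ?C. P x}" using assms(3) generated_subalgebra_gen by blast
  ultimately show ?thesis using generated_subalgebra_minimal x by blast
qed

lemma generated_subalgebra_carrier:
  assumes "S \<subseteq> carrier M" "x \<in> carrier (generated_subalgebra R M S)"
  shows "x \<in> carrier M"
  using subalgebra_generated_subalgebra[OF assms(1)] assms(2) by (auto simp: subalgebra_carrier_def)

text \<open>The elements that commute with \<open>y\<close> are closed under all operations,
  including the action of the scalars.\<close>

lemma generated_subalgebra_commute:
  assumes S: "S \<subseteq> carrier M" and y: "y \<in> carrier M"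
    and c: "\<And>s. s \<in> S \<Longrightarrow> s \<otimes>\<^bsub>M\<^esub> y = y \<otimes>\<^bsub>M\<^esub> s"
    and x: "x \<in> carrier (generated_subalgebra R M S)"
  shows "x \<otimes>\<^bsub>M\<^esub> y = y \<otimes>\<^bsub>M\<^esub> x"
  using x S
proof (induction rule: generated_subalgebra_induct)
  case (add a b)
  then show ?case using y S by (simp add: generated_subalgebra_carrier l_distr r_distr)
next
  case (mult a b)
  then have ab: "a \<in> carrier M" "b \<in> carrier M" using generated_subalgebra_carrier S by auto
  have "a \<otimes>\<^bsub>M\<^esub> b \<otimes>\<^bsub>M\<^esub> y = a \<otimes>\<^bsub>M\<^esub> (y \<otimes>\<^bsub>M\<^esub> b)" using mult ab y by (simp add: m_assoc)
  also have "\<dots> = y \<otimes>\<^bsub>M\<^esub> (a \<otimes>\<^bsub>M\<^esub> b)" using mult ab y by (simp add: m_assoc[symmetric])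
  finally show ?case .
next
  case (smult r a)
  then show ?case using y S
    by (simp add: generated_subalgebra_carrier smult_mult_left smult_mult_right)
qed (use y c in auto)

text \<open>The centralizer argument is used twice: generators commute with each other, hence all
  elements commute with the generators, hence with each other.\<close>

lemma generated_subalgebra_cring:
  assumes S: "S \<subseteq> carrier M" and c: "\<And>s t. s \<in> S \<Longrightarrow> t \<in> S \<Longrightarrow> s \<otimes>\<^bsub>M\<^esub> t = t \<otimes>\<^bsub>M\<^esub> s"
  shows "cring (generated_subalgebra R M S)"
proof -
  interpret B: assoc_algebra R "generated_subalgebra R M S"
    by (rule assoc_algebra_generated_subalgebra[OF S])
  have 1: "x \<otimes>\<^bsub>M\<^esub> t = t \<otimes>\<^bsub>M\<^esub> x" if "x \<in> carrier (generated_subalgebra R M S)" "t \<in> S" for x t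
    using generated_subalgebra_commute[OF S] c that S by blast
  have 2: "x \<otimes>\<^bsub>M\<^esub> y = y \<otimes>\<^bsub>M\<^esub> x"
    if "x \<in> carrier (generated_subalgebra R M S)" "y \<in> carrier (generated_subalgebra R M S)" for x y
    using generated_subalgebra_commute[OF S generated_subalgebra_carrier[OF S that(2)] _ that(1)]
      1[OF that(2)] by metis
  show ?thesis
    by (intro cring.intro comm_monoid.intro comm_monoid_axioms.intro)
      (auto simp: generated_subalgebra_simps 2 intro: B.ring_M B.is_monoid)
qed

end

subsection \<open>Quotients\<close>

context
  fixes R :: "('r, 'k) ring_scheme" and M :: "('r, 'a, 'm) module_scheme" and I
  assumes M: "assoc_algebra R M" and I: "ideal I M"
begin

interpretation assoc_algebra R M by (rule M)
interpretation I: ideal I M by (rule I)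

text \<open>Multiplying by a scalar \<open>r\<close> is multiplying by the element
  \<open>r 1\<close>, so the ring-theoretic notion of ideal is the right one for algebras with
  unit.\<close>

lemma ideal_smult_closed:
  assumes "r \<in> carrier R" "x \<in> I" shows "r \<odot>\<^bsub>M\<^esub> x \<in> I"
proof -
  have x: "x \<in> carrier M" using assms(2) by (rule I.Icarr)
  then have "r \<odot>\<^bsub>M\<^esub> x = (r \<odot>\<^bsub>M\<^esub> \<one>\<^bsub>M\<^esub>) \<otimes>\<^bsub>M\<^esub> x"
    using assms by (simp add: smult_mult_left)
  then show ?thesis using I.I_l_closed[OF assms(2), of "r \<odot>\<^bsub>M\<^esub> \<one>\<^bsub>M\<^esub>"] assms by simp
qed

lemma rcoset_eq_iff:
  assumes "x \<in> carrier M" "y \<in> carrier M"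
  shows "I +>\<^bsub>M\<^esub> x = I +>\<^bsub>M\<^esub> y \<longleftrightarrow> x \<ominus>\<^bsub>M\<^esub> y \<in> I"
  using quotient_eq_iff_same_a_r_cos[OF I assms] by blast

lemma quotient_algebra_carrierE:
  assumes "X \<in> carrier (quotient_algebra M I)"
  obtains x where "x \<in> carrier M" "X = I +>\<^bsub>M\<^esub> x"
  using assms by (auto simp: quotient_algebra_def FactRing_simps)

text \<open>The definition takes a union over all representatives of the coset; it is a single coset
  because any two representatives differ by a member of \<open>I\<close>, which stays in
  \<open>I\<close> after scaling.\<close>

lemma quotient_algebra_smult:
  assumes r: "r \<in> carrier R" and x: "x \<in> carrier M"
  shows "r \<odot>\<^bsub>quotient_algebra M I\<^esub> (I +>\<^bsub>M\<^esub> x) = I +>\<^bsub>M\<^esub> (r \<odot>\<^bsub>M\<^esub> x)"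
proof -
  have "I +>\<^bsub>M\<^esub> (r \<odot>\<^bsub>M\<^esub> y) = I +>\<^bsub>M\<^esub> (r \<odot>\<^bsub>M\<^esub> x)" if y: "y \<in> I +>\<^bsub>M\<^esub> x" for y
  proof -
    obtain i where i: "i \<in> I" "y = i \<oplus>\<^bsub>M\<^esub> x" using y by (auto simp: a_r_coset_def')
    have "r \<odot>\<^bsub>M\<^esub> y = r \<odot>\<^bsub>M\<^esub> i \<oplus>\<^bsub>M\<^esub> r \<odot>\<^bsub>M\<^esub> x"
      using i r x I.Icarr by (simp add: smult_r_distr)
    then have "r \<odot>\<^bsub>M\<^esub> y \<ominus>\<^bsub>M\<^esub> r \<odot>\<^bsub>M\<^esub> x = r \<odot>\<^bsub>M\<^esub> i"
      using r x i I.Icarr by (simp add: a_minus_def M.a_assoc M.r_neg)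
    then show ?thesis
      using ideal_smult_closed[OF r i(1)] r x i I.Icarr by (simp add: rcoset_eq_iff)
  qed
  then have "(\<Union>y\<in>I +>\<^bsub>M\<^esub> x. I +>\<^bsub>M\<^esub> (r \<odot>\<^bsub>M\<^esub> y)) = I +>\<^bsub>M\<^esub> (r \<odot>\<^bsub>M\<^esub> x)"
    using I.a_rcos_self[OF x] by (intro SUP_eq_const) blast+
  then show ?thesis by (simp add: quotient_algebra_def)
qed

lemma quotient_algebra_simps:
  "mult (quotient_algebra M I) = mult (M Quot I)" "add (quotient_algebra M I) = add (M Quot I)"
  "\<one>\<^bsub>quotient_algebra M I\<^esub> = \<one>\<^bsub>M Quot I\<^esub>" "\<zero>\<^bsub>quotient_algebra M I\<^esub> = \<zero>\<^bsub>M Quot I\<^esub>"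
  "carrier (quotient_algebra M I) = carrier (M Quot I)"
  by (simp_all add: quotient_algebra_def)

lemma quotient_algebra_hom: "algebra_hom R M (quotient_algebra M I) (\<lambda>x. I +>\<^bsub>M\<^esub> x)"
  using I.rcos_ring_hom
  by (intro algebra_homI)
    (auto simp: quotient_algebra_smult quotient_algebra_simps ring_hom_closed ring_hom_add
      ring_hom_mult ring_hom_one)

lemma quotient_algebra_assoc_algebra: "assoc_algebra R (quotient_algebra M I)"
proof -
  note h = algebra_homD(2-5)[OF quotient_algebra_hom, symmetric]
  show ?thesis
  proof (rule assoc_algebraI)
    interpret Q: ring "M Quot I" by (rule I.quotient_is_ring)
    show "ring (quotient_algebra M I)"
    proof (rule ringI)
      show "abelian_group (quotient_algebra M I)"
      proof (rule abelian_groupI)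
        fix x assume "x \<in> carrier (quotient_algebra M I)"
        then show "\<exists>y\<in>carrier (quotient_algebra M I).
            y \<oplus>\<^bsub>quotient_algebra M I\<^esub> x = \<zero>\<^bsub>quotient_algebra M I\<^esub>"
          by (intro bexI[of _ "\<ominus>\<^bsub>M Quot I\<^esub> x"]) (auto simp: quotient_algebra_simps Q.l_neg)
      qed (simp_all add: quotient_algebra_simps, simp_all add: Q.a_ac)
      show "monoid (quotient_algebra M I)"
        by (rule monoidI) (auto simp: quotient_algebra_simps Q.m_assoc)
    qed (auto simp: quotient_algebra_simps Q.l_distr Q.r_distr)
  qed (auto elim!: quotient_algebra_carrierE intro: cring_R
      simp: h smult_l_distr smult_r_distr smult_assoc1 smult_mult_left smult_mult_right
      algebra_homD(1)[OF quotient_algebra_hom])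
qed

lemma quotient_algebra_eq_zero_iff:
  assumes "x \<in> carrier M"
  shows "I +>\<^bsub>M\<^esub> x = \<zero>\<^bsub>quotient_algebra M I\<^esub> \<longleftrightarrow> x \<in> I"
  using I.a_rcos_const[of x] I.a_rcos_self[OF assms] 
  by (auto simp: quotient_algebra_simps FactRing_def)

lemma quotient_algebra_lift:
  assumes B: "assoc_algebra R B" and h: "algebra_hom R M B h" and z: "\<And>x. x \<in> I \<Longrightarrow> h x = \<zero>\<^bsub>B\<^esub>"
  obtains k where "algebra_hom R (quotient_algebra M I) B k"
    and "\<And>x. x \<in> carrier M \<Longrightarrow> k (I +>\<^bsub>M\<^esub> x) = h x"
proof -
  interpret B: assoc_algebra R B by (rule B)
  \<comment> \<open>\<open>h\<close> is applied to an arbitrary representative; the choice does not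
    matter because \<open>h\<close> vanishes on \<open>I\<close>.\<close>
  define k where "k X = h (SOME x. x \<in> X)" for X
  have k: "k (I +>\<^bsub>M\<^esub> x) = h x" if x: "x \<in> carrier M" for x
  proof -
    have "(SOME y. y \<in> I +>\<^bsub>M\<^esub> x) \<in> I +>\<^bsub>M\<^esub> x"
      using I.a_rcos_self[OF x] by (rule someI)
    then obtain i where i: "i \<in> I" "(SOME y. y \<in> I +>\<^bsub>M\<^esub> x) = i \<oplus>\<^bsub>M\<^esub> x"
      by (auto simp: a_r_coset_def')
    then show ?thesis using z[OF i(1)] x I.Icarr[OF i(1)]
      by (simp add: k_def algebra_homD[OF h])
  qed
  have "algebra_hom R (quotient_algebra M I) B k"
    by (rule algebra_homI)
      (auto elim!: quotient_algebra_carrierE simp: k algebra_homD[OF h]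
        algebra_homD(2-5)[OF quotient_algebra_hom, symmetric])
  then show ?thesis using k that by blast
qed

end

section \<open>Free algebras\<close>

definition word_monom :: "('r, 'k) ring_scheme \<Rightarrow> 'g list \<Rightarrow> 'g list \<Rightarrow> 'r" where
  "word_monom R u = (\<lambda>w. if w = u then \<one>\<^bsub>R\<^esub> else \<zero>\<^bsub>R\<^esub>)"

context cring begin

text \<open>The product of the free algebra, detached from the set \<open>S\<close> of letters, so
  that its laws can be proved for all \<open>R\<close>-valued functions on words without regard to
  finite support.\<close>

definition conv :: "('g list \<Rightarrow> 'a) \<Rightarrow> ('g list \<Rightarrow> 'a) \<Rightarrow> 'g list \<Rightarrow> 'a" where
  "conv f h = (\<lambda>w. \<Oplus>i\<in>{..length w}. f (take i w) \<otimes> h (drop i w))"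

lemma free_algebra_simps:
  "\<one>\<^bsub>free_algebra R S\<^esub> = word_monom R []" "\<zero>\<^bsub>free_algebra R S\<^esub> = (\<lambda>w. \<zero>)"
  "f \<oplus>\<^bsub>free_algebra R S\<^esub> h = (\<lambda>w. f w \<oplus> h w)" "r \<odot>\<^bsub>free_algebra R S\<^esub> f = (\<lambda>w. r \<otimes> f w)"
  "mult (free_algebra R S) f h = conv f h"
  by (simp_all add: free_algebra_def word_monom_def conv_def)

lemma free_algebra_carrier:
  "f \<in> carrier (free_algebra R S) \<longleftrightarrow>
     range f \<subseteq> carrier R \<and> finite {w. f w \<noteq> \<zero>} \<and> (\<forall>w. f w \<noteq> \<zero> \<longrightarrow> w \<in> lists S)"
  by (auto simp: free_algebra_def)

lemma conv_Nil:
  assumes "range f \<subseteq> carrier R" "range h \<subseteq> carrier R"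
  shows "conv f h [] = f [] \<otimes> h []"
proof -
  have "f [] \<in> carrier R" "h [] \<in> carrier R" using assms by auto
  then show ?thesis by (simp add: conv_def)
qed

text \<open>The cut before the first letter is split off; all other cuts are cuts of the remaining
  word \<open>w\<close>, shifted by one. This recursion replaces the manipulation of double sums
  over cut positions.\<close>

lemma conv_Cons:
  assumes "range f \<subseteq> carrier R" "range h \<subseteq> carrier R"
  shows "conv f h (a # w) = f [] \<otimes> h (a # w) \<oplus> conv (\<lambda>v. f (a # v)) h w"
proof -
  have c: "f v \<in> carrier R" "h v \<in> carrier R" for v using assms by auto
  have "conv f h (a # w) = (\<Oplus>i\<in>{..Suc (length w)}. f (take i (a # w)) \<otimes> h (drop i (a # w)))"
    by (simp add: conv_def)
  also have "\<dots> = (\<Oplus>i\<in>{..length w}. f (take (Suc i) (a # w)) \<otimes> h (drop (Suc i) (a # w)))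
      \<oplus> f (take 0 (a # w)) \<otimes> h (drop 0 (a # w))"
    by (rule finsum_Suc2) (simp add: c)
  also have "\<dots> = conv (\<lambda>v. f (a # v)) h w \<oplus> f [] \<otimes> h (a # w)"
    by (simp add: conv_def)
  also have "\<dots> = f [] \<otimes> h (a # w) \<oplus> conv (\<lambda>v. f (a # v)) h w"
    by (rule a_comm) (auto simp: conv_def c)
  finally show ?thesis .
qed

lemma conv_closed:
  assumes "range f \<subseteq> carrier R" "range h \<subseteq> carrier R"
  shows "conv f h w \<in> carrier R"
proof -
  have c: "f v \<in> carrier R" "h v \<in> carrier R" for v using assms by auto
  show ?thesis by (auto simp: conv_def c)
qed

lemma conv_zero_left: "range h \<subseteq> carrier R \<Longrightarrow> conv (\<lambda>_. \<zero>) h w = \<zero>"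
  by (auto simp: conv_def image_subset_iff intro!: add.finprod_one_eqI)

lemma conv_add_left:
  assumes "range f \<subseteq> carrier R" "range g \<subseteq> carrier R" "range h \<subseteq> carrier R"
  shows "conv (\<lambda>v. f v \<oplus> g v) h w = conv f h w \<oplus> conv g h w"
proof -
  have c: "f v \<in> carrier R" "g v \<in> carrier R" "h v \<in> carrier R" for v using assms by auto
  show ?thesis
    by (simp add: conv_def c l_distr finsum_addf)
qed

lemma conv_add_right:
  assumes "range f \<subseteq> carrier R" "range g \<subseteq> carrier R" "range h \<subseteq> carrier R"
  shows "conv h (\<lambda>v. f v \<oplus> g v) w = conv h f w \<oplus> conv h g w"
proof -
  have c: "f v \<in> carrier R" "g v \<in> carrier R" "h v \<in> carrier R" for v using assms by auto
  show ?thesis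
    by (simp add: conv_def c r_distr finsum_addf)
qed

lemma conv_smult_left:
  assumes "range f \<subseteq> carrier R" "range h \<subseteq> carrier R" "r \<in> carrier R"
  shows "conv (\<lambda>v. r \<otimes> f v) h w = r \<otimes> conv f h w"
proof -
  have c: "f v \<in> carrier R" "h v \<in> carrier R" for v using assms by auto
  show ?thesis
    using assms(3) by (simp add: conv_def c m_assoc finsum_rdistr)
qed

lemma conv_smult_right:
  assumes "range f \<subseteq> carrier R" "range h \<subseteq> carrier R" "r \<in> carrier R"
  shows "conv f (\<lambda>v. r \<otimes> h v) w = r \<otimes> conv f h w"
proof -
  have c: "f v \<in> carrier R" "h v \<in> carrier R" for v using assms by auto
  show ?thesis
    using assms(3) by (simp add: conv_def c m_lcomm finsum_rdistr)
qed

text \<open>Induction on the word, for arbitrary functions: by the recursion the first factor is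
  replaced by its shift \<open>\<lambda>v. f (a # v)\<close>, to which the induction hypothesis is
  applied.\<close>

lemma conv_assoc:
  assumes "range f \<subseteq> carrier R" "range g \<subseteq> carrier R" "range h \<subseteq> carrier R"
  shows "conv (conv f g) h w = conv f (conv g h) w"
  using assms
proof (induction w arbitrary: f g h)
  case Nil
  have c: "f v \<in> carrier R" "g v \<in> carrier R" "h v \<in> carrier R" for v using Nil.prems by auto
  show ?case
    using Nil.prems by (simp add: conv_Nil conv_closed image_subset_iff c m_assoc)
next
  case (Cons a w)
  note r = Cons.prems
  have c: "f v \<in> carrier R" "g v \<in> carrier R" "h v \<in> carrier R" for v using r by auto
  have r': "range (\<lambda>v. f (a # v)) \<subseteq> carrier R" "range (\<lambda>v. g (a # v)) \<subseteq> carrier R"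
    "range (\<lambda>v. f [] \<otimes> g (a # v)) \<subseteq> carrier R"
    "range (conv (\<lambda>v. f (a # v)) g) \<subseteq> carrier R" "range (conv f g) \<subseteq> carrier R"
    "range (conv g h) \<subseteq> carrier R"
    using r by (auto simp: c intro!: conv_closed)
  note cl = conv_closed[OF r'(1) r'(6)] conv_closed[OF r'(2) r(3)]
  have "conv (conv f g) h (a # w) = conv f g [] \<otimes> h (a # w) \<oplus> conv (\<lambda>v. conv f g (a # v)) h w"
    using r r' by (simp add: conv_Cons)
  also have "conv (\<lambda>v. conv f g (a # v)) h w =
      conv (\<lambda>v. f [] \<otimes> g (a # v)) h w \<oplus> conv (conv (\<lambda>v. f (a # v)) g) h w"
    using r r' by (simp add: conv_Cons conv_add_left)
  also have "\<dots> = f [] \<otimes> conv (\<lambda>v. g (a # v)) h w \<oplus> conv (\<lambda>v. f (a # v)) (conv g h) w"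
    using Cons.IH[OF r'(1) r(2,3)] r r' by (simp add: conv_smult_left c)
  also have "conv f g [] \<otimes> h (a # w) \<oplus> \<dots> =
      f [] \<otimes> (g [] \<otimes> h (a # w) \<oplus> conv (\<lambda>v. g (a # v)) h w) \<oplus> conv (\<lambda>v. f (a # v)) (conv g h) w"
    using r by (simp add: conv_Nil c cl m_assoc r_distr a_assoc)
  also have "\<dots> = conv f (conv g h) (a # w)"
    using r r' by (simp add: conv_Cons)
  finally show ?case .
qed

lemma conv_eq_zero:
  assumes "\<And>i. f (take i w) = \<zero> \<or> h (drop i w) = \<zero>"
    and "range f \<subseteq> carrier R" "range h \<subseteq> carrier R"
  shows "conv f h w = \<zero>"
proof -
  have c: "f v \<in> carrier R" "h v \<in> carrier R" for v using assms by auto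
  have "f (take i w) \<otimes> h (drop i w) = \<zero>" for i
    using assms(1)[of i] c[of "take i w"] c[of "drop i w"] by auto
  then show ?thesis by (simp add: conv_def)
qed

lemma range_word_monom: "range (word_monom R u) \<subseteq> carrier R"
  by (auto simp: word_monom_def)

lemma conv_word_monom: "conv (word_monom R u) (word_monom R v) = word_monom R (u @ v)"
proof
  fix w show "conv (word_monom R u) (word_monom R v) w = word_monom R (u @ v) w"
  proof (induction w arbitrary: u)
    case Nil
    then show ?case by (simp add: conv_Nil[OF range_word_monom range_word_monom]) (simp add: word_monom_def)
  next
    case (Cons a w)
    \<comment> \<open>Removing a first letter \<open>a\<close> from the argument either kills the
      monomial or leaves the monomial of the tail of \<open>u\<close>.\<close>
    have "(\<lambda>x. word_monom R u (a # x)) =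
      (case u of [] \<Rightarrow> (\<lambda>_. \<zero>) | b # u' \<Rightarrow> if a = b then word_monom R u' else (\<lambda>_. \<zero>))"
      by (auto simp: word_monom_def split: list.split)
    then have "conv (word_monom R u) (word_monom R v) (a # w) =
      word_monom R u [] \<otimes> word_monom R v (a # w) \<oplus>
      (case u of [] \<Rightarrow> \<zero> | b # u' \<Rightarrow> if a = b then word_monom R (u' @ v) w else \<zero>)"
      by (simp add: conv_Cons[OF range_word_monom range_word_monom] conv_zero_left[OF range_word_monom]
          Cons.IH split: list.split)
    then show ?case by (cases u) (auto simp: word_monom_def)
  qed
qed

lemma conv_one:
  assumes "range f \<subseteq> carrier R"
  shows "conv (word_monom R []) f w = f w" "conv f (word_monom R []) w = f w"
proof -
  have c: "f v \<in> carrier R" for v using assms by auto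
  have z: "(\<lambda>v. word_monom R [] (a # v)) = (\<lambda>_. \<zero>)" for a :: 'g
    by (auto simp: word_monom_def)
  have e: "word_monom R [] [] = \<one>" "word_monom R [] (a # v) = \<zero>" for a :: 'g and v
    by (simp_all add: word_monom_def)
  show "conv (word_monom R []) f w = f w"
    using assms
    by (cases w) (simp_all add: conv_Nil conv_Cons range_word_monom conv_zero_left z e c)
  show "conv f (word_monom R []) w = f w" using assms
  proof (induction w arbitrary: f)
    case (Cons a w)
    then have "range (\<lambda>v. f (a # v)) \<subseteq> carrier R" and "f [] \<in> carrier R" "f (a # w) \<in> carrier R"
      by auto
    then show ?case using Cons.prems by (simp add: conv_Cons range_word_monom e Cons.IH)
  next
    case Nil
    then have "f [] \<in> carrier R" by auto
    then show ?case using Nil by (simp add: conv_Nil range_word_monom e)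
  qed
qed

lemma free_algebra_mult_closed:
  assumes f: "f \<in> carrier (free_algebra R S)" and h: "h \<in> carrier (free_algebra R S)"
  shows "conv f h \<in> carrier (free_algebra R S)"
proof -
  let ?s = "\<lambda>f. {w. f w \<noteq> \<zero>}"
  have r: "range f \<subseteq> carrier R" "range h \<subseteq> carrier R"
    and s: "finite (?s f)" "finite (?s h)" "?s f \<subseteq> lists S" "?s h \<subseteq> lists S"
    using f h by (auto simp: free_algebra_carrier)
  \<comment> \<open>A nonzero coefficient at \<open>w\<close> needs a cut of \<open>w\<close> into a
    word from each support, so the support of a product consists of concatenations.\<close>
  have sub: "?s (conv f h) \<subseteq> (\<lambda>(u, v). u @ v) ` (?s f \<times> ?s h)"
  proof
    fix w assume "w \<in> ?s (conv f h)"
    then obtain i where "f (take i w) \<noteq> \<zero>" "h (drop i w) \<noteq> \<zero>"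
      using conv_eq_zero[OF _ r, of w] by auto
    then show "w \<in> (\<lambda>(u, v). u @ v) ` (?s f \<times> ?s h)"
      by (intro image_eqI[of _ _ "(take i w, drop i w)"]) auto
  qed
  then have "finite (?s (conv f h))"
    using s by (auto intro: finite_subset)
  moreover have "w \<in> lists S" if "conv f h w \<noteq> \<zero>" for w
  proof -
    have "w \<in> (\<lambda>(u, v). u @ v) ` (?s f \<times> ?s h)" using sub that by blast
    then obtain u v where "w = u @ v" "u \<in> ?s f" "v \<in> ?s h" by auto
    then show ?thesis using s(3,4) by (auto simp: subset_iff)
  qed
  moreover have "range (conv f h) \<subseteq> carrier R" using conv_closed[OF r] by blast
  ultimately show ?thesis unfolding free_algebra_carrier by blast
qed

lemma free_algebra_add_closed:
  assumes f: "f \<in> carrier (free_algebra R S)" and h: "h \<in> carrier (free_algebra R S)"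
  shows "(\<lambda>w. f w \<oplus> h w) \<in> carrier (free_algebra R S)"
proof -
  have "f w \<noteq> \<zero> \<or> h w \<noteq> \<zero>" if "f w \<oplus> h w \<noteq> \<zero>" for w
    using that by auto
  moreover have "finite ({w. f w \<noteq> \<zero>} \<union> {w. h w \<noteq> \<zero>})"
    using f h by (simp add: free_algebra_carrier)
  ultimately have "finite {w. f w \<oplus> h w \<noteq> \<zero>}" by (elim rev_finite_subset) blast
  moreover have "f w \<oplus> h w \<in> carrier R" for w
    using f h by (auto simp: free_algebra_carrier image_subset_iff)
  ultimately show ?thesis using f h \<open>\<And>w. f w \<oplus> h w \<noteq> \<zero> \<Longrightarrow> f w \<noteq> \<zero> \<or> h w \<noteq> \<zero>\<close>
    unfolding free_algebra_carrier by blast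
qed

lemma free_algebra_smult_closed:
  assumes f: "f \<in> carrier (free_algebra R S)" and r: "r \<in> carrier R"
  shows "(\<lambda>w. r \<otimes> f w) \<in> carrier (free_algebra R S)"
proof -
  have "f w \<noteq> \<zero>" if "r \<otimes> f w \<noteq> \<zero>" for w using r that by auto
  then have "finite {w. r \<otimes> f w \<noteq> \<zero>}" "\<forall>w. r \<otimes> f w \<noteq> \<zero> \<longrightarrow> w \<in> lists S"
    using f by (auto simp: free_algebra_carrier elim!: rev_finite_subset)
  moreover have "r \<otimes> f w \<in> carrier R" for w
    using f r by (auto simp: free_algebra_carrier image_subset_iff)
  ultimately show ?thesis by (auto simp: free_algebra_carrier)
qed

lemma word_monom_closed: "u \<in> lists S \<Longrightarrow> word_monom R u \<in> carrier (free_algebra R S)"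
  by (auto simp: free_algebra_carrier word_monom_def finite_subset[of _ "{u}"])

lemma free_algebra_assoc_algebra: "assoc_algebra R (free_algebra R S)"
proof (rule assoc_algebraI)
  have r: "range f \<subseteq> carrier R" if "f \<in> carrier (free_algebra R S)" for f
    using that by (simp add: free_algebra_carrier)
  have c: "f w \<in> carrier R" if "f \<in> carrier (free_algebra R S)" for f w
    using r[OF that] by auto
  have zero_closed': "(\<lambda>w. \<zero>) \<in> carrier (free_algebra R S)"
    by (auto simp: free_algebra_carrier)
  note cl = free_algebra_add_closed free_algebra_mult_closed
  note simps = free_algebra_simps
  show "ring (free_algebra R S)"
  proof (rule ringI)
    show "abelian_group (free_algebra R S)"
    proof (rule abelian_groupI)
      fix f assume f: "f \<in> carrier (free_algebra R S)"
      show "\<exists>h\<in>carrier (free_algebra R S).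
          h \<oplus>\<^bsub>free_algebra R S\<^esub> f = \<zero>\<^bsub>free_algebra R S\<^esub>"
        using free_algebra_smult_closed[OF f, of "\<ominus> \<one>"]
        by (intro bexI[of _ "\<lambda>w. \<ominus> \<one> \<otimes> f w"]) (simp_all add: simps c[OF f] l_minus l_neg)
    qed (simp_all add: simps cl c a_ac zero_closed')
    show "monoid (free_algebra R S)"
      by (rule monoidI) (auto simp: simps cl r conv_assoc conv_one word_monom_closed)
  qed (auto simp: simps r conv_add_left conv_add_right)
  fix a b f assume "a \<in> carrier R" "b \<in> carrier R" "f \<in> carrier (free_algebra R S)"
  then show "(a \<otimes> b) \<odot>\<^bsub>free_algebra R S\<^esub> f = a \<odot>\<^bsub>free_algebra R S\<^esub> (b \<odot>\<^bsub>free_algebra R S\<^esub> f)"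
    "(a \<oplus> b) \<odot>\<^bsub>free_algebra R S\<^esub> f = a \<odot>\<^bsub>free_algebra R S\<^esub> f \<oplus>\<^bsub>free_algebra R S\<^esub> b \<odot>\<^bsub>free_algebra R S\<^esub> f"
    by (auto simp: simps c m_assoc l_distr)
next
  fix a f h assume "a \<in> carrier R" "f \<in> carrier (free_algebra R S)" "h \<in> carrier (free_algebra R S)"
  moreover from this have "range f \<subseteq> carrier R" "range h \<subseteq> carrier R"
    by (auto simp: free_algebra_carrier)
  moreover from this have "f w \<in> carrier R" "h w \<in> carrier R" for w
    by auto
  ultimately show "a \<odot>\<^bsub>free_algebra R S\<^esub> (f \<oplus>\<^bsub>free_algebra R S\<^esub> h) =
      a \<odot>\<^bsub>free_algebra R S\<^esub> f \<oplus>\<^bsub>free_algebra R S\<^esub> a \<odot>\<^bsub>free_algebra R S\<^esub> h"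
    "(a \<odot>\<^bsub>free_algebra R S\<^esub> f) \<otimes>\<^bsub>free_algebra R S\<^esub> h =
      a \<odot>\<^bsub>free_algebra R S\<^esub> (f \<otimes>\<^bsub>free_algebra R S\<^esub> h)"
    "f \<otimes>\<^bsub>free_algebra R S\<^esub> (a \<odot>\<^bsub>free_algebra R S\<^esub> h) =
      a \<odot>\<^bsub>free_algebra R S\<^esub> (f \<otimes>\<^bsub>free_algebra R S\<^esub> h)"
    by (simp_all add: free_algebra_simps conv_smult_left conv_smult_right r_distr fun_eq_iff)
next
  fix f assume "f \<in> carrier (free_algebra R S)"
  then have "f w \<in> carrier R" for w by (auto simp: free_algebra_carrier)
  then show "\<one> \<odot>\<^bsub>free_algebra R S\<^esub> f = f" by (simp add: free_algebra_simps)
qed (auto simp: free_algebra_simps free_algebra_smult_closed is_cring)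

lemma free_gen_eq: "free_gen R g = word_monom R [g]"
  by (simp add: free_gen_def word_monom_def)

lemma free_algebra_induct [consumes 1, case_names zero monom add]:
  assumes "f \<in> carrier (free_algebra R S)"
    and zero: "P (\<lambda>w. \<zero>)"
    and monom: "\<And>r u. r \<in> carrier R \<Longrightarrow> u \<in> lists S \<Longrightarrow> P (\<lambda>w. r \<otimes> word_monom R u w)"
    and add: "\<And>f h. \<lbrakk>f \<in> carrier (free_algebra R S); h \<in> carrier (free_algebra R S); P f; P h\<rbrakk>
      \<Longrightarrow> P (\<lambda>w. f w \<oplus> h w)"
  shows "P f"
proof -
  \<comment> \<open>The induction is over a finite set \<open>A\<close> that contains the support
    rather than over the support itself, so it makes no difference whether the coefficient at the
    split-off word \<open>u\<close> vanishes.\<close>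
  have "P f" if "finite A" "A \<subseteq> lists S" "range f \<subseteq> carrier R" "\<And>w. w \<notin> A \<Longrightarrow> f w = \<zero>" for A f
    using that
  proof (induction A arbitrary: f)
    case empty
    then have "f = (\<lambda>w. \<zero>)" by auto
    then show ?case using zero by simp
  next
    case (insert u A)
    have c: "f w \<in> carrier R" for w using insert.prems by auto
    let ?h = "\<lambda>w. if w = u then \<zero> else f w"
    let ?m = "\<lambda>w. f u \<otimes> word_monom R u w"
    have "P ?h" by (rule insert.IH) (use insert.prems insert.hyps in auto)
    moreover have "P ?m" using monom c insert.prems by auto
    moreover have "?h \<in> carrier (free_algebra R S)"
      using insert.prems insert.hyps by (auto simp: free_algebra_carrier intro!: finite_subset[of _ A])
    moreover have "?m \<in> carrier (free_algebra R S)"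
      by (rule free_algebra_smult_closed[OF word_monom_closed c]) (use insert.prems in auto)
    ultimately have "P (\<lambda>w. ?m w \<oplus> ?h w)" using add by blast
    moreover have "(\<lambda>w. ?m w \<oplus> ?h w) = f" by (auto simp: word_monom_def c)
    ultimately show ?case by simp
  qed
  from this[of "{w. f w \<noteq> \<zero>}" f] assms(1) show ?thesis
    unfolding free_algebra_carrier by blast
qed

end

section \<open>The universal property of the free algebra\<close>

context assoc_algebra begin

definition word_eval :: "('g \<Rightarrow> 'c) \<Rightarrow> 'g list \<Rightarrow> 'c" where
  "word_eval \<phi> w = foldr (\<lambda>g p. \<phi> g \<otimes>\<^bsub>M\<^esub> p) w \<one>\<^bsub>M\<^esub>"

lemma word_eval_closed: "\<phi> \<in> S \<rightarrow> carrier M \<Longrightarrow> w \<in> lists S \<Longrightarrow> word_eval \<phi> w \<in> carrier M"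
  by (induction w) (auto simp: word_eval_def)

lemma word_eval_append:
  "\<phi> \<in> S \<rightarrow> carrier M \<Longrightarrow> u \<in> lists S \<Longrightarrow> v \<in> lists S \<Longrightarrow>
    word_eval \<phi> (u @ v) = word_eval \<phi> u \<otimes>\<^bsub>M\<^esub> word_eval \<phi> v"
proof (induction u)
  case Nil
  then show ?case using word_eval_closed[of \<phi> S v] by (simp add: word_eval_def)
next
  case (Cons a u)
  have "word_eval \<phi> (a # w) = \<phi> a \<otimes>\<^bsub>M\<^esub> word_eval \<phi> w" for w by (simp add: word_eval_def)
  then show ?case using Cons word_eval_closed[OF Cons.prems(1)]
    by (auto simp: m_assoc Pi_iff)
qed

lemma free_algebra_universal:
  assumes \<phi>: "\<phi> \<in> S \<rightarrow> carrier M"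
  obtains E where "algebra_hom R (free_algebra R S) M E" "\<And>g. g \<in> S \<Longrightarrow> E (free_gen R g) = \<phi> g"
proof -
  let ?F = "free_algebra R S"
  interpret F: assoc_algebra R ?F by (rule R.free_algebra_assoc_algebra)
  define E where "E f = (\<Oplus>\<^bsub>M\<^esub>w\<in>{w. f w \<noteq> \<zero>}. f w \<odot>\<^bsub>M\<^esub> word_eval \<phi> w)" for f
  have carr: "f w \<in> carrier R" if "f \<in> carrier ?F" for f w
    using that by (auto simp: R.free_algebra_carrier)
  have term_closed: "f w \<odot>\<^bsub>M\<^esub> word_eval \<phi> w \<in> carrier M" if "f \<in> carrier ?F" "w \<in> lists S" for f w
    using that carr word_eval_closed[OF \<phi>] by simp
  \<comment> \<open>The sum may be extended to any larger finite set of words; sums of two elements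
    are compared over the union of their supports.\<close>
  have E_on: "E f = (\<Oplus>\<^bsub>M\<^esub>w\<in>A. f w \<odot>\<^bsub>M\<^esub> word_eval \<phi> w)"
    if "f \<in> carrier ?F" "finite A" "{w. f w \<noteq> \<zero>} \<subseteq> A" "A \<subseteq> lists S" for f A
    unfolding E_def
    by (rule M.add.finprod_mono_neutral_cong_left)
      (use that term_closed word_eval_closed[OF \<phi>] in \<open>auto simp: subset_iff\<close>)
  have E_closed: "E f \<in> carrier M" if "f \<in> carrier ?F" for f
    unfolding E_def using that term_closed[OF that]
    by (intro M.finsum_closed) (simp add: R.free_algebra_carrier)
  have E_add: "E (\<lambda>w. f w \<oplus> h w) = E f \<oplus>\<^bsub>M\<^esub> E h" if f: "f \<in> carrier ?F" and h: "h \<in> carrier ?F" for f h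
  proof -
    let ?A = "{w. f w \<noteq> \<zero>} \<union> {w. h w \<noteq> \<zero>}"
    have A: "finite ?A" "?A \<subseteq> lists S" using f h by (auto simp: R.free_algebra_carrier)
    have fh: "(\<lambda>w. f w \<oplus> h w) \<in> carrier ?F" using f h by (rule R.free_algebra_add_closed)
    have "E (\<lambda>w. f w \<oplus> h w) = (\<Oplus>\<^bsub>M\<^esub>w\<in>?A. (f w \<oplus> h w) \<odot>\<^bsub>M\<^esub> word_eval \<phi> w)"
      by (rule E_on[OF fh A(1) _ A(2)]) auto
    also have "\<dots> = (\<Oplus>\<^bsub>M\<^esub>w\<in>?A. f w \<odot>\<^bsub>M\<^esub> word_eval \<phi> w \<oplus>\<^bsub>M\<^esub> h w \<odot>\<^bsub>M\<^esub> word_eval \<phi> w)"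
      by (rule M.finsum_cong)
        (use A(2) f h term_closed carr word_eval_closed[OF \<phi>] in
          \<open>auto simp: smult_l_distr subset_iff simp_implies_def\<close>)
    also have "\<dots> = (\<Oplus>\<^bsub>M\<^esub>w\<in>?A. f w \<odot>\<^bsub>M\<^esub> word_eval \<phi> w) \<oplus>\<^bsub>M\<^esub> (\<Oplus>\<^bsub>M\<^esub>w\<in>?A. h w \<odot>\<^bsub>M\<^esub> word_eval \<phi> w)"
      by (rule M.finsum_addf) (use subsetD[OF A(2)] term_closed[OF f] term_closed[OF h] in simp_all)
    also have "\<dots> = E f \<oplus>\<^bsub>M\<^esub> E h"
      using E_on[OF f A(1) _ A(2)] E_on[OF h A(1) _ A(2)] by auto
    finally show ?thesis .
  qed
  have E_monom: "E (\<lambda>w. r \<otimes> word_monom R u w) = r \<odot>\<^bsub>M\<^esub> word_eval \<phi> u"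
    if "r \<in> carrier R" "u \<in> lists S" for r u
  proof -
    have "E (\<lambda>w. r \<otimes> word_monom R u w) = (\<Oplus>\<^bsub>M\<^esub>w\<in>{u}. (r \<otimes> word_monom R u w) \<odot>\<^bsub>M\<^esub> word_eval \<phi> w)"
    proof (rule E_on)
      show "(\<lambda>w. r \<otimes> word_monom R u w) \<in> carrier ?F"
        using that by (intro R.free_algebra_smult_closed R.word_monom_closed)
    qed (use that in \<open>auto simp: word_monom_def\<close>)
    then show ?thesis using that word_eval_closed[OF \<phi>] by (simp add: word_monom_def)
  qed
  have E_zero: "E (\<lambda>w. \<zero>) = \<zero>\<^bsub>M\<^esub>" by (simp add: E_def)
  have E_smult: "E (\<lambda>w. r \<otimes> f w) = r \<odot>\<^bsub>M\<^esub> E f" if r: "r \<in> carrier R" and "f \<in> carrier ?F" for r f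
    using that(2)
  proof (induction rule: R.free_algebra_induct)
    case zero
    then show ?case using r E_zero by simp
  next
    case (monom s u)
    then show ?case
      using E_monom[of "r \<otimes> s" u] E_monom[of s u] r word_eval_closed[OF \<phi>]
      by (simp add: R.m_assoc word_monom_def smult_assoc1 cong: if_cong)
  next
    case (add f h)
    then show ?case
      using r E_add R.free_algebra_smult_closed[OF add(1) r] R.free_algebra_smult_closed[OF add(2) r]
        carr[OF add(1)] carr[OF add(2)]
      by (simp add: R.r_distr E_closed smult_r_distr)
  qed
  \<comment> \<open>Both sides are additive in each factor, so two nested inductions reduce the
    claim to multiples of words, which \<open>conv\<close> concatenates.\<close>
  have E_mult: "E (R.conv f h) = E f \<otimes>\<^bsub>M\<^esub> E h" if "f \<in> carrier ?F" "h \<in> carrier ?F" for f h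
    using that
  proof (induction f rule: R.free_algebra_induct)
    case zero
    then have "R.conv (\<lambda>w. \<zero>) h = (\<lambda>w. \<zero>)"
      by (auto simp: R.conv_zero_left R.free_algebra_carrier)
    then show ?case using zero E_closed E_zero by simp
  next
    case (add f f')
    have "R.conv (\<lambda>w. f w \<oplus> f' w) h = (\<lambda>w. R.conv f h w \<oplus> R.conv f' h w)"
      by (rule ext, rule R.conv_add_left) (use add in \<open>auto simp: R.free_algebra_carrier\<close>)
    then show ?case
      using E_add[OF R.free_algebra_mult_closed R.free_algebra_mult_closed, of f h f' h]
        E_add[OF add(1,2)] E_closed add by (simp add: l_distr)
  next
    case (monom r u)
    note ru = monom(1,2)
    have m: "(\<lambda>w. r \<otimes> word_monom R u w) \<in> carrier ?F"
      using ru by (simp add: R.free_algebra_smult_closed R.word_monom_closed)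
    show ?case using monom(3)
    proof (induction h rule: R.free_algebra_induct)
      case zero
      have "R.conv (\<lambda>w. r \<otimes> word_monom R u w) (\<lambda>w. \<zero>) = (\<lambda>w. \<zero>)"
        by (rule ext, rule R.conv_eq_zero) (use m in \<open>simp_all add: R.free_algebra_carrier image_subset_iff\<close>)
      then show ?case using m E_closed E_zero by simp
    next
      case (add h h')
      let ?m = "\<lambda>w. r \<otimes> word_monom R u w"
      have "R.conv ?m (\<lambda>w. h w \<oplus> h' w) = (\<lambda>w. R.conv ?m h w \<oplus> R.conv ?m h' w)"
        by (rule ext, rule R.conv_add_right)
          (use add m in \<open>auto simp: R.free_algebra_carrier\<close>)
      then show ?case
        using E_add[OF R.free_algebra_mult_closed R.free_algebra_mult_closed, OF m add(1) m add(2)]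
          E_add[OF add(1,2)] E_closed add m by (simp add: r_distr)
    next
      case (monom s v)
      have wc: "word_monom R x w \<in> carrier R" for x w by (simp add: word_monom_def)
      have rg: "range (word_monom R u) \<subseteq> carrier R" "range (word_monom R v) \<subseteq> carrier R"
         "range (\<lambda>w. s \<otimes> word_monom R v w) \<subseteq> carrier R"
        using monom by (auto simp: word_monom_def)
      have "R.conv (\<lambda>w. r \<otimes> word_monom R u w) (\<lambda>w. s \<otimes> word_monom R v w) =
          (\<lambda>w. (s \<otimes> r) \<otimes> word_monom R (u @ v) w)"
        using ru monom(1,2) rg
        by (intro ext) (simp add: R.conv_smult_left R.conv_smult_right R.conv_word_monom R.m_assoc R.m_lcomm wc)
      then show ?case using ru monom word_eval_closed[OF \<phi>]
        by (simp add: E_monom smult_assoc1 word_eval_append[OF \<phi>] smult_mult_left smult_mult_right)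
    qed
  qed
  have one: "E (word_monom R []) = \<one>\<^bsub>M\<^esub>"
    using E_monom[of \<one> "[]"] by (simp add: word_monom_def word_eval_def cong: if_cong)
  have "algebra_hom R ?F M E"
    by (rule algebra_homI)
      (simp_all add: R.free_algebra_simps E_closed E_add E_mult E_smult one)
  moreover have "E (free_gen R g) = \<phi> g" if "g \<in> S" for g
    using E_monom[of \<one> "[g]"] that \<phi>
    by (auto simp: R.free_gen_eq word_monom_def word_eval_def Pi_iff cong: if_cong)
  ultimately show ?thesis using that by blast
qed

end

section \<open>The partial group algebra with relations\<close>

text \<open>The set of relations is a parameter so that everything proved here can also be
  instantiated with \<open>{}\<close>, which yields the algebra on which \<open>Theta\<close> and
  \<open>\<rho>\<close> are defined.\<close>

locale par_setup = R: cring R + G: group G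
  for R :: "('r, 'k) ring_scheme" and G :: "('g, 'l) monoid_scheme" +
  fixes \<R> :: "('r, 'g) eps_relation set"
  assumes relations: "eps_relations_on R G \<R>"
begin

abbreviation "F \<equiv> free_algebra R (carrier G)"
abbreviation "P \<equiv> R_par R G \<R>"
abbreviation "A \<equiv> A_par R G \<R>"
abbreviation "gen g \<equiv> par_gen R G \<R> g"
abbreviation "eps g \<equiv> par_eps R G \<R> g"

sublocale F: assoc_algebra R F by (rule R.free_algebra_assoc_algebra)

lemma free_gen_closed: "g \<in> carrier G \<Longrightarrow> free_gen R g \<in> carrier F"
  by (simp add: R.free_gen_eq R.word_monom_closed)

lemma relation_coeff:
  assumes "rel \<in> \<R>" "(l, gs) \<in> set rel"
  shows "l \<in> carrier R" "g \<in> set gs \<Longrightarrow> g \<in> carrier G"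
  using assms relations by (fastforce simp: eps_relations_on_def)+

lemma par_relators_closed: "par_relators R G \<R> \<subseteq> carrier F"
proof -
  have "eval_relation F (\<lambda>g. free_gen R g \<otimes>\<^bsub>F\<^esub> free_gen R (inv\<^bsub>G\<^esub> g)) rel \<in> carrier F"
    if "rel \<in> \<R>" for rel
    by (rule F.eval_relation_closed)
      (use relation_coeff[OF that] in \<open>auto intro!: F.m_closed free_gen_closed\<close>)
  then show ?thesis
    by (auto simp: par_relators_def Let_def free_gen_closed)
qed

lemma par_ideal: "ideal (par_ideal R G \<R>) F"
  unfolding par_ideal_def by (rule F.genideal_ideal[OF par_relators_closed])

sublocale P: assoc_algebra R P
  unfolding R_par_def by (rule quotient_algebra_assoc_algebra[OF F.assoc_algebra_axioms par_ideal])

lemma coset_hom: "algebra_hom R F P (\<lambda>x. par_ideal R G \<R> +>\<^bsub>F\<^esub> x)"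
  unfolding R_par_def by (rule quotient_algebra_hom[OF F.assoc_algebra_axioms par_ideal])

lemma gen_closed [simp]: "g \<in> carrier G \<Longrightarrow> gen g \<in> carrier P"
  unfolding par_gen_def by (rule algebra_homD(1)[OF coset_hom]) (rule free_gen_closed)

lemma eps_closed [simp]: "g \<in> carrier G \<Longrightarrow> eps g \<in> carrier P"
  by (simp add: par_eps_def)

text \<open>Words arise from the empty word by putting letters in front, and their cosets span
  \<open>P\<close>. Left multiplication by one generator therefore takes the place of a case for
  general products; this is what the normal form \<open>\<Sum> a\<^sub>g [g]\<close> is proved
  with.\<close>

lemma R_par_induct [consumes 1, case_names zero one gen add smult]:
  assumes "x \<in> carrier P"
    and "Q \<zero>\<^bsub>P\<^esub>" and one: "Q \<one>\<^bsub>P\<^esub>"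
    and gen: "\<And>g x. \<lbrakk>g \<in> carrier G; x \<in> carrier P; Q x\<rbrakk> \<Longrightarrow> Q (gen g \<otimes>\<^bsub>P\<^esub> x)"
    and add: "\<And>x y. \<lbrakk>x \<in> carrier P; y \<in> carrier P; Q x; Q y\<rbrakk> \<Longrightarrow> Q (x \<oplus>\<^bsub>P\<^esub> y)"
    and smult: "\<And>r x. \<lbrakk>r \<in> carrier R; x \<in> carrier P; Q x\<rbrakk> \<Longrightarrow> Q (r \<odot>\<^bsub>P\<^esub> x)"
  shows "Q x"
proof -
  let ?c = "\<lambda>x. par_ideal R G \<R> +>\<^bsub>F\<^esub> x"
  note h = algebra_homD[OF coset_hom]
  have word: "Q (?c (word_monom R w))" if "w \<in> lists (carrier G)" for w
    using that
  proof (induction w)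
    case Nil
    have "?c (word_monom R []) = \<one>\<^bsub>P\<^esub>" using h(4) by (simp add: R.free_algebra_simps)
    then show ?case using one by simp
  next
    case (Cons g w)
    have "word_monom R (g # w) = free_gen R g \<otimes>\<^bsub>F\<^esub> word_monom R w"
      by (simp add: R.free_gen_eq R.free_algebra_simps R.conv_word_monom)
    then have "?c (word_monom R (g # w)) = gen g \<otimes>\<^bsub>P\<^esub> ?c (word_monom R w)"
      using h(3)[OF free_gen_closed R.word_monom_closed] Cons.hyps by (simp add: par_gen_def)
    then show ?case
      using gen Cons h(1)[OF R.word_monom_closed] by simp
  qed
  have "Q (?c f)" if "f \<in> carrier F" for f
    using that
  proof (induction rule: R.free_algebra_induct)
    case zero
    have "?c (\<lambda>w. \<zero>\<^bsub>R\<^esub>) = \<zero>\<^bsub>P\<^esub>"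
      using algebra_hom_zero[OF coset_hom F.ring_M P.ring_M] by (simp add: R.free_algebra_simps)
    then show ?case using assms(2) by simp
  next
    case (monom r u)
    then show ?case
      using smult[OF monom(1) h(1)[OF R.word_monom_closed] word] h(5)[OF monom(1) R.word_monom_closed]
      by (simp add: R.free_algebra_simps)
  next
    case (add f k)
    then show ?case using assms(5) h(1)[OF add(1)] h(1)[OF add(2)] h(2)[OF add(1,2)]
      by (simp add: R.free_algebra_simps)
  qed
  moreover obtain f where "f \<in> carrier F" "x = ?c f"
    using assms(1) unfolding R_par_def
    by (rule quotient_algebra_carrierE[OF F.assoc_algebra_axioms par_ideal])
  ultimately show ?thesis by simp
qed

lemma relator_eq:
  assumes "x \<ominus>\<^bsub>F\<^esub> y \<in> par_relators R G \<R>" "x \<in> carrier F" "y \<in> carrier F"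
  shows "par_ideal R G \<R> +>\<^bsub>F\<^esub> x = par_ideal R G \<R> +>\<^bsub>F\<^esub> y"
  using assms F.genideal_self[OF par_relators_closed]
  by (subst rcoset_eq_iff[OF F.assoc_algebra_axioms par_ideal]) (auto simp: par_ideal_def)

lemma gen_one: "gen \<one>\<^bsub>G\<^esub> = \<one>\<^bsub>P\<^esub>"
  using algebra_homD(4)[OF coset_hom] relator_eq[of "free_gen R \<one>\<^bsub>G\<^esub>" "\<one>\<^bsub>F\<^esub>"]
  by (simp add: par_gen_def par_relators_def Let_def free_gen_closed)

lemma coset_free_gen:
  assumes "g \<in> carrier G" "x \<in> carrier F"
  shows "par_ideal R G \<R> +>\<^bsub>F\<^esub> (x \<otimes>\<^bsub>F\<^esub> free_gen R g) = (par_ideal R G \<R> +>\<^bsub>F\<^esub> x) \<otimes>\<^bsub>P\<^esub> gen g"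
  using algebra_homD(3)[OF coset_hom assms(2) free_gen_closed[OF assms(1)]] by (simp add: par_gen_def)

lemma gen_inv_gen_gen:
  assumes g: "g \<in> carrier G" and h: "h \<in> carrier G"
  shows "gen (inv\<^bsub>G\<^esub> g) \<otimes>\<^bsub>P\<^esub> gen g \<otimes>\<^bsub>P\<^esub> gen h = gen (inv\<^bsub>G\<^esub> g) \<otimes>\<^bsub>P\<^esub> gen (g \<otimes>\<^bsub>G\<^esub> h)"
proof -
  let ?x = "free_gen R (inv\<^bsub>G\<^esub> g) \<otimes>\<^bsub>F\<^esub> free_gen R g \<otimes>\<^bsub>F\<^esub> free_gen R h"
  let ?y = "free_gen R (inv\<^bsub>G\<^esub> g) \<otimes>\<^bsub>F\<^esub> free_gen R (g \<otimes>\<^bsub>G\<^esub> h)"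
  have "?x \<ominus>\<^bsub>F\<^esub> ?y \<in> par_relators R G \<R>" using g h by (auto simp: par_relators_def Let_def)
  from relator_eq[OF this] show ?thesis
    using g h by (simp add: coset_free_gen free_gen_closed par_gen_def[symmetric])
qed

lemma gen_gen_gen_inv:
  assumes g: "g \<in> carrier G" and h: "h \<in> carrier G"
  shows "gen g \<otimes>\<^bsub>P\<^esub> gen h \<otimes>\<^bsub>P\<^esub> gen (inv\<^bsub>G\<^esub> h) = gen (g \<otimes>\<^bsub>G\<^esub> h) \<otimes>\<^bsub>P\<^esub> gen (inv\<^bsub>G\<^esub> h)"
proof -
  let ?x = "free_gen R g \<otimes>\<^bsub>F\<^esub> free_gen R h \<otimes>\<^bsub>F\<^esub> free_gen R (inv\<^bsub>G\<^esub> h)"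
  let ?y = "free_gen R (g \<otimes>\<^bsub>G\<^esub> h) \<otimes>\<^bsub>F\<^esub> free_gen R (inv\<^bsub>G\<^esub> h)"
  have "?x \<ominus>\<^bsub>F\<^esub> ?y \<in> par_relators R G \<R>" using g h by (auto simp: par_relators_def Let_def)
  from relator_eq[OF this] show ?thesis
    using g h by (simp add: coset_free_gen free_gen_closed par_gen_def[symmetric])
qed

lemma eval_relation_eps:
  assumes "rel \<in> \<R>"
  shows "eval_relation P (par_eps R G \<R>) rel = \<zero>\<^bsub>P\<^esub>"
proof -
  let ?e = "\<lambda>g. free_gen R g \<otimes>\<^bsub>F\<^esub> free_gen R (inv\<^bsub>G\<^esub> g)"
  have "eval_relation F ?e rel \<in> par_relators R G \<R>"
    using assms by (auto simp: par_relators_def Let_def)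
  then have 1: "eval_relation F ?e rel \<in> par_ideal R G \<R>"
    using F.genideal_self[OF par_relators_closed] by (auto simp: par_ideal_def)
  have "eval_relation P (par_eps R G \<R>) rel = par_ideal R G \<R> +>\<^bsub>F\<^esub> eval_relation F ?e rel"
  proof (rule algebra_hom_eval_relation[OF coset_hom F.assoc_algebra_axioms P.assoc_algebra_axioms, symmetric])
    show "l \<in> carrier R \<and> ?e ` set gs \<subseteq> carrier F" if "(l, gs) \<in> set rel" for l gs
      using relation_coeff[OF assms that] by (auto intro!: F.m_closed free_gen_closed)
    show "eps g = par_ideal R G \<R> +>\<^bsub>F\<^esub> ?e g" if "(l, gs) \<in> set rel" "g \<in> set gs" for l gs g
      using relation_coeff[OF assms that(1)] that(2)
      by (subst coset_free_gen) (auto simp: par_eps_def par_gen_def[symmetric] intro: free_gen_closed)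
  qed
  also have "\<dots> = \<zero>\<^bsub>P\<^esub>"
    using 1 ideal.Icarr[OF par_ideal 1]
    unfolding R_par_def by (simp add: quotient_algebra_eq_zero_iff[OF F.assoc_algebra_axioms par_ideal])
  finally show ?thesis .
qed

text \<open>The values \<open>\<phi> g\<close> extend to the free algebra, and the assumptions say
  that each relator lies in the kernel of the extension. The kernel is an ideal, so it contains
  \<open>par_ideal\<close>.\<close>

lemma R_par_universal:
  assumes B: "assoc_algebra R B" and \<phi>: "\<phi> \<in> carrier G \<rightarrow> carrier B"
    and one: "\<phi> \<one>\<^bsub>G\<^esub> = \<one>\<^bsub>B\<^esub>"
    and left: "\<And>g h. \<lbrakk>g \<in> carrier G; h \<in> carrier G\<rbrakk> \<Longrightarrow>
      \<phi> (inv\<^bsub>G\<^esub> g) \<otimes>\<^bsub>B\<^esub> \<phi> g \<otimes>\<^bsub>B\<^esub> \<phi> h = \<phi> (inv\<^bsub>G\<^esub> g) \<otimes>\<^bsub>B\<^esub> \<phi> (g \<otimes>\<^bsub>G\<^esub> h)"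
    and right: "\<And>g h. \<lbrakk>g \<in> carrier G; h \<in> carrier G\<rbrakk> \<Longrightarrow>
      \<phi> g \<otimes>\<^bsub>B\<^esub> \<phi> h \<otimes>\<^bsub>B\<^esub> \<phi> (inv\<^bsub>G\<^esub> h) = \<phi> (g \<otimes>\<^bsub>G\<^esub> h) \<otimes>\<^bsub>B\<^esub> \<phi> (inv\<^bsub>G\<^esub> h)"
    and rel: "\<And>rel. rel \<in> \<R> \<Longrightarrow> eval_relation B (\<lambda>g. \<phi> g \<otimes>\<^bsub>B\<^esub> \<phi> (inv\<^bsub>G\<^esub> g)) rel = \<zero>\<^bsub>B\<^esub>"
  obtains h where "algebra_hom R P B h" "\<And>g. g \<in> carrier G \<Longrightarrow> h (gen g) = \<phi> g"
proof -
  interpret B: assoc_algebra R B by (rule B)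
  obtain E where E: "algebra_hom R F B E" and Eg: "\<And>g. g \<in> carrier G \<Longrightarrow> E (free_gen R g) = \<phi> g"
    using B.free_algebra_universal[OF \<phi>] by blast
  interpret E: ring_hom_ring F B E
    by (rule algebra_hom_ring_hom_ring[OF E F.ring_M B.ring_M])
  have \<phi>c: "\<phi> g \<in> carrier B" if "g \<in> carrier G" for g
    using \<phi> that by (rule funcset_mem)
  have kerI: "x \<in> a_kernel F B E" if "x \<in> carrier F" "E x = \<zero>\<^bsub>B\<^esub>" for x
    using that unfolding a_kernel_def' by blast
  have "par_relators R G \<R> \<subseteq> a_kernel F B E"
  proof -
    have minus: "x \<ominus>\<^bsub>F\<^esub> y \<in> a_kernel F B E"
      if "x \<in> carrier F" "y \<in> carrier F" "E x = E y" for x y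
    proof -
      have "E (x \<ominus>\<^bsub>F\<^esub> y) = E y \<ominus>\<^bsub>B\<^esub> E y"
        using algebra_hom_minus[OF E F.ring_M B.ring_M that(1,2)] that(3) by simp
      also have "\<dots> = \<zero>\<^bsub>B\<^esub>"
        using E.hom_closed[OF that(2)] by (simp add: a_minus_def B.M.r_neg)
      finally show ?thesis using F.minus_closed[OF that(1,2)] by (rule kerI[rotated])
    qed
    have "eval_relation F (\<lambda>g. free_gen R g \<otimes>\<^bsub>F\<^esub> free_gen R (inv\<^bsub>G\<^esub> g)) rel \<in> a_kernel F B E"
      if r: "rel \<in> \<R>" for rel
    proof -
      let ?e = "\<lambda>g. free_gen R g \<otimes>\<^bsub>F\<^esub> free_gen R (inv\<^bsub>G\<^esub> g)"
      have c: "l \<in> carrier R \<and> ?e ` set gs \<subseteq> carrier F" if "(l, gs) \<in> set rel" for l gs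
        using relation_coeff[OF r that] by (auto intro!: F.m_closed free_gen_closed)
      have "E (eval_relation F ?e rel) = eval_relation B (\<lambda>g. \<phi> g \<otimes>\<^bsub>B\<^esub> \<phi> (inv\<^bsub>G\<^esub> g)) rel"
      proof (rule algebra_hom_eval_relation[OF E F.assoc_algebra_axioms B c])
        show "\<phi> g \<otimes>\<^bsub>B\<^esub> \<phi> (inv\<^bsub>G\<^esub> g) = E (?e g)" if "(l, gs) \<in> set rel" "g \<in> set gs" for l gs g
        proof -
          have "g \<in> carrier G" using relation_coeff[OF r that(1)] that(2) by simp
          then show ?thesis by (simp add: Eg free_gen_closed)
        qed
      qed
      also have "\<dots> = \<zero>\<^bsub>B\<^esub>" by (rule rel[OF r])
      finally show ?thesis using F.eval_relation_closed[OF c] by (rule kerI[rotated])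
    qed
    then show ?thesis
      by (auto simp: par_relators_def Let_def Eg free_gen_closed one left right \<phi>c intro!: minus)
  qed
  then have "par_ideal R G \<R> \<subseteq> a_kernel F B E"
    unfolding par_ideal_def by (rule F.genideal_minimal[OF E.kernel_is_ideal])
  then have "E x = \<zero>\<^bsub>B\<^esub>" if "x \<in> par_ideal R G \<R>" for x
    using that unfolding a_kernel_def' by blast
  then obtain h where "algebra_hom R P B h"
      "\<And>x. x \<in> carrier F \<Longrightarrow> h (par_ideal R G \<R> +>\<^bsub>F\<^esub> x) = E x"
    using quotient_algebra_lift[OF F.assoc_algebra_axioms par_ideal B E] unfolding R_par_def by metis
  then show ?thesis using that Eg by (simp add: par_gen_def free_gen_closed)
qed

subsection \<open>The idempotents\<close>

text \<open>This is the relation \<open>[g\<inverse>][g][h] = [g\<inverse>][gh]\<close> with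
  \<open>g\<close> replaced by \<open>g\<inverse>\<close> and \<open>h\<close> by \<open>gh\<close>,
  read from right to left. It says that \<open>[g]\<close> is multiplicative up to an
  idempotent.\<close>

lemma gen_mult_gen:
  assumes "g \<in> carrier G" "h \<in> carrier G"
  shows "gen g \<otimes>\<^bsub>P\<^esub> gen h = eps g \<otimes>\<^bsub>P\<^esub> gen (g \<otimes>\<^bsub>G\<^esub> h)"
  using gen_inv_gen_gen[of "inv\<^bsub>G\<^esub> g" "g \<otimes>\<^bsub>G\<^esub> h"] assms
  by (simp add: par_eps_def G.m_assoc[symmetric])

lemma eps_one: "eps \<one>\<^bsub>G\<^esub> = \<one>\<^bsub>P\<^esub>"
  by (simp add: par_eps_def gen_one)

lemma eps_gen: "g \<in> carrier G \<Longrightarrow> eps g \<otimes>\<^bsub>P\<^esub> gen g = gen g"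
  using gen_mult_gen[of g "\<one>\<^bsub>G\<^esub>"] by (simp add: gen_one)

lemma eps_idem: "g \<in> carrier G \<Longrightarrow> eps g \<otimes>\<^bsub>P\<^esub> eps g = eps g"
  using eps_gen by (simp add: par_eps_def P.m_assoc[symmetric])

text \<open>The product \<open>[g][h][h\<inverse>]\<close> shrinks to
  \<open>[gh][h\<inverse>]\<close>, whose product of indices is \<open>g\<close> again. Moving
  \<open>[g]\<close> past an idempotent thus translates the index of the idempotent; commutativity
  of \<open>A\<close> and the partial action both come from here.\<close>

lemma gen_eps:
  assumes "g \<in> carrier G" "h \<in> carrier G"
  shows "gen g \<otimes>\<^bsub>P\<^esub> eps h = eps (g \<otimes>\<^bsub>G\<^esub> h) \<otimes>\<^bsub>P\<^esub> gen g"
proof -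
  have "gen g \<otimes>\<^bsub>P\<^esub> eps h = gen (g \<otimes>\<^bsub>G\<^esub> h) \<otimes>\<^bsub>P\<^esub> gen (inv\<^bsub>G\<^esub> h)"
    using assms gen_gen_gen_inv by (simp add: par_eps_def P.m_assoc)
  also have "\<dots> = eps (g \<otimes>\<^bsub>G\<^esub> h) \<otimes>\<^bsub>P\<^esub> gen g"
    using assms by (simp add: gen_mult_gen G.m_assoc)
  finally show ?thesis .
qed

text \<open>\<open>eps h\<close> is moved to the left past both factors of
  \<open>eps g = [g][g\<inverse>]\<close>; its index becomes \<open>g\<inverse> h\<close> and then
  \<open>h\<close> again.\<close>

lemma eps_commute:
  assumes "g \<in> carrier G" "h \<in> carrier G"
  shows "eps g \<otimes>\<^bsub>P\<^esub> eps h = eps h \<otimes>\<^bsub>P\<^esub> eps g"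
proof -
  have "eps g \<otimes>\<^bsub>P\<^esub> eps h = gen g \<otimes>\<^bsub>P\<^esub> (gen (inv\<^bsub>G\<^esub> g) \<otimes>\<^bsub>P\<^esub> eps h)"
    using assms unfolding par_eps_def[of R G \<R> g] by (simp add: P.m_assoc)
  also have "\<dots> = (gen g \<otimes>\<^bsub>P\<^esub> eps (inv\<^bsub>G\<^esub> g \<otimes>\<^bsub>G\<^esub> h)) \<otimes>\<^bsub>P\<^esub> gen (inv\<^bsub>G\<^esub> g)"
    using assms gen_eps[of "inv\<^bsub>G\<^esub> g" h] by (simp add: P.m_assoc)
  also have "\<dots> = eps h \<otimes>\<^bsub>P\<^esub> gen g \<otimes>\<^bsub>P\<^esub> gen (inv\<^bsub>G\<^esub> g)"
    using assms by (simp add: gen_eps G.m_assoc[symmetric])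
  also have "\<dots> = eps h \<otimes>\<^bsub>P\<^esub> eps g"
    using assms by (simp add: P.m_assoc par_eps_def[of R G \<R> g])
  finally show ?thesis .
qed

lemma gen_eps_gen:
  assumes "g \<in> carrier G" "h \<in> carrier G"
  shows "gen g \<otimes>\<^bsub>P\<^esub> eps h \<otimes>\<^bsub>P\<^esub> gen (inv\<^bsub>G\<^esub> g) = eps (g \<otimes>\<^bsub>G\<^esub> h) \<otimes>\<^bsub>P\<^esub> eps g"
  using assms by (simp add: gen_eps P.m_assoc par_eps_def[of R G \<R> g])

lemma eps_image_closed: "par_eps R G \<R> ` carrier G \<subseteq> carrier P"
  by auto

sublocale A: assoc_algebra R A
  unfolding A_par_def by (rule P.assoc_algebra_generated_subalgebra[OF eps_image_closed])

sublocale Ac: cring A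
  unfolding A_par_def
  by (rule P.generated_subalgebra_cring[OF eps_image_closed]) (use eps_commute in blast)

lemma A_par_simps [simp]:
  "\<zero>\<^bsub>A\<^esub> = \<zero>\<^bsub>P\<^esub>" "\<one>\<^bsub>A\<^esub> = \<one>\<^bsub>P\<^esub>" "mult A = mult P" "add A = add P" "smult A = smult P"
  by (simp_all add: A_par_def P.generated_subalgebra_simps)

lemma A_par_carrier: "x \<in> carrier A \<Longrightarrow> x \<in> carrier P"
  unfolding A_par_def by (rule P.generated_subalgebra_carrier[OF eps_image_closed])

lemma eps_in_A: "g \<in> carrier G \<Longrightarrow> eps g \<in> carrier A"
  unfolding A_par_def by (rule P.generated_subalgebra_gen) simp

lemma A_par_induct [consumes 1, case_names eps zero one add mult smult]:
  assumes "x \<in> carrier A"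
    and "\<And>g. g \<in> carrier G \<Longrightarrow> Q (eps g)" "Q \<zero>\<^bsub>P\<^esub>" "Q \<one>\<^bsub>P\<^esub>"
    and "\<And>x y. \<lbrakk>x \<in> carrier A; y \<in> carrier A; Q x; Q y\<rbrakk> \<Longrightarrow> Q (x \<oplus>\<^bsub>P\<^esub> y)"
    and "\<And>x y. \<lbrakk>x \<in> carrier A; y \<in> carrier A; Q x; Q y\<rbrakk> \<Longrightarrow> Q (x \<otimes>\<^bsub>P\<^esub> y)"
    and "\<And>r x. \<lbrakk>r \<in> carrier R; x \<in> carrier A; Q x\<rbrakk> \<Longrightarrow> Q (r \<odot>\<^bsub>P\<^esub> x)"
  shows "Q x"
  by (rule P.generated_subalgebra_induct[OF assms(1)[unfolded A_par_def] eps_image_closed])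
    (use assms(2-) in \<open>auto simp: A_par_def\<close>)

lemma A_par_one: "\<one>\<^bsub>P\<^esub> \<in> carrier A" and A_par_zero: "\<zero>\<^bsub>P\<^esub> \<in> carrier A"
  using A.one_closed A.M.zero_closed by simp_all

lemma A_par_closed:
  "\<lbrakk>x \<in> carrier A; y \<in> carrier A\<rbrakk> \<Longrightarrow> x \<oplus>\<^bsub>P\<^esub> y \<in> carrier A"
  "\<lbrakk>x \<in> carrier A; y \<in> carrier A\<rbrakk> \<Longrightarrow> x \<otimes>\<^bsub>P\<^esub> y \<in> carrier A"
  "\<lbrakk>r \<in> carrier R; x \<in> carrier A\<rbrakk> \<Longrightarrow> r \<odot>\<^bsub>P\<^esub> x \<in> carrier A"
  using A.M.a_closed A.m_closed A.smult_closed by simp_all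

lemma A_par_commute: "\<lbrakk>x \<in> carrier A; y \<in> carrier A\<rbrakk> \<Longrightarrow> x \<otimes>\<^bsub>P\<^esub> y = y \<otimes>\<^bsub>P\<^esub> x"
  using Ac.m_comm by simp

end

section \<open>The topology of the spectrum\<close>

text \<open>A basic open set of the product restricts finitely many coordinates. Prescribing the
  value of \<open>y\<close> on \<open>K\<close> is the same as prescribing the trace on
  \<open>K\<close> of the set that \<open>y\<close> indicates.\<close>

lemma openin_product_preimage:
  fixes I :: "'g set"
  assumes "\<And>\<xi>. \<xi> \<in> U \<Longrightarrow>
    \<exists>K. finite K \<and> K \<subseteq> I \<and> (\<forall>\<eta>\<in>Pow I. \<eta> \<inter> K = \<xi> \<inter> K \<longrightarrow> \<eta> \<in> U)"
  shows "openin (product_topology (\<lambda>_. discrete_topology (UNIV :: bool set)) I)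
    {y \<in> I \<rightarrow>\<^sub>E UNIV. {i \<in> I. y i} \<in> U}"
  unfolding openin_product_topology_alt
proof
  fix y assume y: "y \<in> {y \<in> I \<rightarrow>\<^sub>E UNIV. {i \<in> I. y i} \<in> U}"
  let ?\<xi> = "{i \<in> I. y i}"
  obtain K where K: "finite K" "K \<subseteq> I" "\<And>\<eta>. \<eta> \<subseteq> I \<Longrightarrow> \<eta> \<inter> K = ?\<xi> \<inter> K \<Longrightarrow> \<eta> \<in> U"
  proof -
    have "?\<xi> \<in> U" using y by simp
    from assms[OF this] that show thesis by auto
  qed
  let ?V = "\<lambda>i. if i \<in> K then {y i} else UNIV"
  have "{i \<in> I. ?V i \<noteq> topspace (discrete_topology UNIV)} \<subseteq> K" by auto
  then have "finite {i \<in> I. ?V i \<noteq> topspace (discrete_topology UNIV)}"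
    using K(1) finite_subset by blast
  moreover have "y \<in> Pi\<^sub>E I ?V" using y by auto
  moreover have "Pi\<^sub>E I ?V \<subseteq> {y \<in> I \<rightarrow>\<^sub>E UNIV. {i \<in> I. y i} \<in> U}"
  proof
    fix z assume z: "z \<in> Pi\<^sub>E I ?V"
    have "z i = y i" if "i \<in> K" for i
      using PiE_mem[OF z, of i] K(2) that by auto
    then have "{i \<in> I. z i} \<inter> K = ?\<xi> \<inter> K" by auto
    then have "{i \<in> I. z i} \<in> U" by (intro K(3)) auto
    then show "z \<in> {y \<in> I \<rightarrow>\<^sub>E UNIV. {i \<in> I. y i} \<in> U}" using z by (auto simp: PiE_iff)
  qed
  ultimately show "\<exists>V. finite {i \<in> I. V i \<noteq> topspace (discrete_topology (UNIV :: bool set))} \<and>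
      (\<forall>i\<in>I. openin (discrete_topology UNIV) (V i)) \<and> y \<in> Pi\<^sub>E I V \<and>
      Pi\<^sub>E I V \<subseteq> {y \<in> I \<rightarrow>\<^sub>E UNIV. {i \<in> I. y i} \<in> U}"
    by (intro exI[of _ ?V]) simp
qed

text \<open>From here on the product topology enters only in this form: a neighbourhood of
  \<open>\<xi>\<close> is given by the sets with the same trace on some finite
  \<open>K\<close>.\<close>

lemma openin_powerset_topology:
  "openin (powerset_topology G) U \<longleftrightarrow> U \<subseteq> Pow (carrier G) \<and>
    (\<forall>\<xi>\<in>U. \<exists>K. finite K \<and> K \<subseteq> carrier G \<and>
      (\<forall>\<eta>\<in>Pow (carrier G). \<eta> \<inter> K = \<xi> \<inter> K \<longrightarrow> \<eta> \<in> U))"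
proof -
  let ?I = "carrier G"
  let ?T = "product_topology (\<lambda>_. discrete_topology (UNIV :: bool set)) ?I"
  let ?\<phi> = "\<lambda>\<xi>. \<lambda>g\<in>?I. g \<in> \<xi>"
  show ?thesis
  proof (intro iffI conjI ballI)
    assume "openin (powerset_topology G) U"
    then obtain V where V: "openin ?T V" "U = ?\<phi> -` V \<inter> Pow ?I"
      by (auto simp: powerset_topology_def openin_pullback_topology)
    then show "U \<subseteq> Pow ?I" by auto
    fix \<xi> assume \<xi>: "\<xi> \<in> U"
    then have "?\<phi> \<xi> \<in> V" using V(2) by auto
    then obtain W where W: "finite {i \<in> ?I. W i \<noteq> topspace (discrete_topology (UNIV :: bool set))}"
        "?\<phi> \<xi> \<in> Pi\<^sub>E ?I W" "Pi\<^sub>E ?I W \<subseteq> V"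
      using V(1) unfolding openin_product_topology_alt by blast
    let ?K = "{i \<in> ?I. W i \<noteq> UNIV}"
    have "\<eta> \<in> U" if \<eta>: "\<eta> \<in> Pow ?I" "\<eta> \<inter> ?K = \<xi> \<inter> ?K" for \<eta>
    proof -
      have "(i \<in> \<eta>) \<in> W i" if "i \<in> ?I" for i
      proof (cases "i \<in> ?K")
        case True
        then have "(i \<in> \<eta>) = (i \<in> \<xi>)" using \<eta>(2) by blast
        then show ?thesis using PiE_mem[OF W(2) that] that by simp
      qed (use that in auto)
      then have "?\<phi> \<eta> \<in> Pi\<^sub>E ?I W" by auto
      then have "?\<phi> \<eta> \<in> V" using W(3) by blast
      then show ?thesis using V(2) \<eta>(1) by simp
    qed
    then show "\<exists>K. finite K \<and> K \<subseteq> ?I \<and> (\<forall>\<eta>\<in>Pow ?I. \<eta> \<inter> K = \<xi> \<inter> K \<longrightarrow> \<eta> \<in> U)"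
      using W(1) by (intro exI[of _ ?K]) auto
  next
    assume U: "U \<subseteq> Pow ?I \<and>
      (\<forall>\<xi>\<in>U. \<exists>K. finite K \<and> K \<subseteq> ?I \<and> (\<forall>\<eta>\<in>Pow ?I. \<eta> \<inter> K = \<xi> \<inter> K \<longrightarrow> \<eta> \<in> U))"
    have mem: "?\<phi> \<xi> \<in> {y \<in> ?I \<rightarrow>\<^sub>E UNIV. {i \<in> ?I. y i} \<in> U} \<longleftrightarrow> \<xi> \<in> U" if "\<xi> \<subseteq> ?I" for \<xi>
    proof -
      have "{i \<in> ?I. ?\<phi> \<xi> i} = \<xi>" using that by auto
      then show ?thesis by simp
    qed
    have "U = ?\<phi> -` {y \<in> ?I \<rightarrow>\<^sub>E UNIV. {i \<in> ?I. y i} \<in> U} \<inter> Pow ?I"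
    proof (rule Set.set_eqI)
      fix \<xi> show "\<xi> \<in> U \<longleftrightarrow> \<xi> \<in> ?\<phi> -` {y \<in> ?I \<rightarrow>\<^sub>E UNIV. {i \<in> ?I. y i} \<in> U} \<inter> Pow ?I"
        using U mem[of \<xi>] by (cases "\<xi> \<subseteq> ?I") (simp_all only: vimage_eq Int_iff Pow_iff simp_thms, blast)
    qed
    then show "openin (powerset_topology G) U"
      unfolding powerset_topology_def openin_pullback_topology
      using openin_product_preimage[of U ?I] U by blast
  qed
qed

lemma topspace_powerset_topology: "topspace (powerset_topology G) = Pow (carrier G)"
proof -
  have "openin (powerset_topology G) (Pow (carrier G))"
    unfolding openin_powerset_topology by (intro conjI ballI exI[of _ "{}"]) auto
  moreover have "U \<subseteq> Pow (carrier G)" if "openin (powerset_topology G) U" for U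
    using that by (simp add: openin_powerset_topology)
  ultimately show ?thesis unfolding topspace_def by blast
qed

text \<open>Tychonoff's theorem for the power of a two-point space, carried over by the continuous
  surjection that sends a truth-valued function to the set on which it holds.\<close>

lemma compact_powerset_topology: "compact_space (powerset_topology G)"
proof -
  let ?I = "carrier G"
  let ?T = "product_topology (\<lambda>_. discrete_topology (UNIV :: bool set)) ?I"
  have top: "topspace ?T = ?I \<rightarrow>\<^sub>E UNIV" by simp
  have "compact_space ?T"
    unfolding compact_space_product_topology by (simp add: compact_space_discrete_topology)
  moreover have "continuous_map ?T (powerset_topology G) (\<lambda>y. {i \<in> ?I. y i})"
    unfolding continuous_map_def top topspace_powerset_topology
  proof (intro conjI allI impI)
    fix U assume "openin (powerset_topology G) U"
    then show "openin ?T {y \<in> ?I \<rightarrow>\<^sub>E UNIV. {i \<in> ?I. y i} \<in> U}"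
      by (intro openin_product_preimage) (auto simp: openin_powerset_topology)
  qed auto
  ultimately have "compactin (powerset_topology G) ((\<lambda>y. {i \<in> ?I. y i}) ` topspace ?T)"
    by (intro image_compactin) (auto simp: compact_space_def)
  moreover have "(\<lambda>y. {i \<in> ?I. y i}) ` topspace ?T = Pow ?I"
  proof
    show "Pow ?I \<subseteq> (\<lambda>y. {i \<in> ?I. y i}) ` topspace ?T"
    proof
      fix \<xi> assume "\<xi> \<in> Pow ?I"
      then show "\<xi> \<in> (\<lambda>y. {i \<in> ?I. y i}) ` topspace ?T"
        by (intro image_eqI[of _ _ "\<lambda>g\<in>?I. g \<in> \<xi>"]) auto
    qed
  qed auto
  ultimately show ?thesis by (simp add: compact_space_def topspace_powerset_topology)
qed

lemma topspace_X_top: "topspace (X_top G) = {\<xi>. \<xi> \<subseteq> carrier G \<and> \<one>\<^bsub>G\<^esub> \<in> \<xi>}"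
  by (auto simp: X_top_def topspace_powerset_topology)

lemma openin_subtopology_X_top:
  assumes W: "W \<subseteq> topspace (X_top G)"
  shows "openin (subtopology (X_top G) W) U \<longleftrightarrow> U \<subseteq> W \<and>
    (\<forall>\<xi>\<in>U. \<exists>K. finite K \<and> K \<subseteq> carrier G \<and> (\<forall>\<eta>\<in>W. \<eta> \<inter> K = \<xi> \<inter> K \<longrightarrow> \<eta> \<in> U))"
proof -
  have WP: "W \<subseteq> Pow (carrier G)" and WI: "{\<xi>. \<xi> \<subseteq> carrier G \<and> \<one>\<^bsub>G\<^esub> \<in> \<xi>} \<inter> W = W"
    using W by (auto simp: topspace_X_top)
  have "openin (subtopology (X_top G) W) U \<longleftrightarrow> (\<exists>V. openin (powerset_topology G) V \<and> U = V \<inter> W)"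
    unfolding X_top_def subtopology_subtopology WI openin_subtopology ..
  also have "\<dots> \<longleftrightarrow> U \<subseteq> W \<and>
    (\<forall>\<xi>\<in>U. \<exists>K. finite K \<and> K \<subseteq> carrier G \<and> (\<forall>\<eta>\<in>W. \<eta> \<inter> K = \<xi> \<inter> K \<longrightarrow> \<eta> \<in> U))"
    (is "?l \<longleftrightarrow> ?r")
  proof
    assume ?l
    then obtain V where V: "openin (powerset_topology G) V" "U = V \<inter> W" by blast
    show ?r
    proof (intro conjI ballI)
      fix \<xi> assume "\<xi> \<in> U"
      then obtain K where "finite K" "K \<subseteq> carrier G"
          "\<forall>\<eta>\<in>Pow (carrier G). \<eta> \<inter> K = \<xi> \<inter> K \<longrightarrow> \<eta> \<in> V"
        using V by (auto simp: openin_powerset_topology)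
      then show "\<exists>K. finite K \<and> K \<subseteq> carrier G \<and> (\<forall>\<eta>\<in>W. \<eta> \<inter> K = \<xi> \<inter> K \<longrightarrow> \<eta> \<in> U)"
        using V(2) WP by (intro exI[of _ K]) auto
    qed (use V in auto)
  next
    assume r: ?r
    then obtain K where K: "\<And>\<xi>. \<xi> \<in> U \<Longrightarrow> finite (K \<xi>) \<and> K \<xi> \<subseteq> carrier G \<and>
        (\<forall>\<eta>\<in>W. \<eta> \<inter> K \<xi> = \<xi> \<inter> K \<xi> \<longrightarrow> \<eta> \<in> U)"
      by metis
    \<comment> \<open>The union of basic neighbourhoods, now formed in the whole power set, of the
      points of \<open>U\<close>; inside \<open>W\<close> it does not exceed
      \<open>U\<close>.\<close>
    let ?V = "{\<eta> \<in> Pow (carrier G). \<exists>\<xi>\<in>U. \<eta> \<inter> K \<xi> = \<xi> \<inter> K \<xi>}"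
    have "openin (powerset_topology G) ?V"
      unfolding openin_powerset_topology
    proof (intro conjI ballI)
      fix \<eta> assume "\<eta> \<in> ?V"
      then obtain \<xi> where \<xi>: "\<xi> \<in> U" "\<eta> \<inter> K \<xi> = \<xi> \<inter> K \<xi>" by blast
      then show "\<exists>K. finite K \<and> K \<subseteq> carrier G \<and>
          (\<forall>\<zeta>\<in>Pow (carrier G). \<zeta> \<inter> K = \<eta> \<inter> K \<longrightarrow> \<zeta> \<in> ?V)"
        using K[OF \<xi>(1)] by (intro exI[of _ "K \<xi>"]) auto
    qed auto
    moreover have "U = ?V \<inter> W"
      using r K WP by auto
    ultimately show ?l by blast
  qed
  finally show ?thesis .
qed

lemma closedin_X_top_I:
  assumes W: "W \<subseteq> topspace (X_top G)"
    and "\<And>\<xi>. \<lbrakk>\<xi> \<in> topspace (X_top G); \<xi> \<notin> W\<rbrakk> \<Longrightarrow> \<exists>K. finite K \<and> K \<subseteq> carrier G \<and>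
      (\<forall>\<eta>\<in>topspace (X_top G). \<eta> \<inter> K = \<xi> \<inter> K \<longrightarrow> \<eta> \<notin> W)"
  shows "closedin (X_top G) W"
proof -
  have "openin (subtopology (X_top G) (topspace (X_top G))) (topspace (X_top G) - W)"
    unfolding openin_subtopology_X_top[OF subset_refl]
    using assms(2) by auto
  then show ?thesis using W by (simp add: closedin_def)
qed

lemma compact_X_top: "compact_space (X_top G)"
proof -
  let ?X = "{\<xi>. \<xi> \<subseteq> carrier G \<and> \<one>\<^bsub>G\<^esub> \<in> \<xi>}"
  have "openin (powerset_topology G) (Pow (carrier G) - ?X)"
    unfolding openin_powerset_topology
  proof (intro conjI ballI)
    fix \<xi> assume "\<xi> \<in> Pow (carrier G) - ?X"
    then show "\<exists>K. finite K \<and> K \<subseteq> carrier G \<and>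
        (\<forall>\<eta>\<in>Pow (carrier G). \<eta> \<inter> K = \<xi> \<inter> K \<longrightarrow> \<eta> \<in> Pow (carrier G) - ?X)"
      \<comment> \<open>One coordinate decides membership in \<open>?X\<close>. \<open>G\<close> is
        not assumed to be a group at this point, so the unit is intersected with the carrier; if it
        lies outside, then \<open>?X\<close> is empty and so is the \<open>K\<close> given
        here.\<close>
      by (intro exI[of _ "{\<one>\<^bsub>G\<^esub>} \<inter> carrier G"]) auto
  qed auto
  then have "closedin (powerset_topology G) ?X"
    by (auto simp: closedin_def topspace_powerset_topology)
  then show ?thesis
    unfolding X_top_def by (intro compact_space_subtopology closedin_compact_space compact_powerset_topology)
qed

text \<open>The sets that agree with \<open>\<xi>\<close> on its \<open>K\<close> form an open
  neighbourhood, finitely many of these cover \<open>W\<close>, and the union of their sets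
  \<open>K\<close> is the common one. \<open>Q\<close> need not persist when \<open>K\<close> grows
  or \<open>\<xi>\<close> varies, so the conclusion hands back the centre \<open>\<xi>\<close> and
  its own \<open>K'\<close>. It is used for functions on the spectrum and for the vanishing of
  \<open>a e(\<xi>, K)\<close> on all of \<open>X\<close>.\<close>

lemma X_top_uniform:
  assumes W: "closedin (X_top G) W"
    and ex: "\<And>\<xi>. \<xi> \<in> W \<Longrightarrow> \<exists>K. finite K \<and> K \<subseteq> carrier G \<and> Q \<xi> K"
  obtains K where "finite K" "K \<subseteq> carrier G"
    and "\<And>\<eta>. \<eta> \<in> W \<Longrightarrow> \<exists>\<xi>\<in>W. \<exists>K'\<subseteq>K. Q \<xi> K' \<and> \<eta> \<inter> K' = \<xi> \<inter> K'"
proof -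
  have Wsub: "W \<subseteq> topspace (X_top G)" by (rule closedin_subset[OF W])
  obtain k where k: "\<And>\<xi>. \<xi> \<in> W \<Longrightarrow> finite (k \<xi>) \<and> k \<xi> \<subseteq> carrier G \<and> Q \<xi> (k \<xi>)"
    using ex by metis
  let ?N = "\<lambda>\<xi>. {\<eta> \<in> W. \<eta> \<inter> k \<xi> = \<xi> \<inter> k \<xi>}"
  let ?T = "subtopology (X_top G) W"
  have top: "topspace ?T = W" using Wsub by auto
  have open_N: "openin ?T (?N \<xi>)" if "\<xi> \<in> W" for \<xi>
    unfolding openin_subtopology_X_top[OF Wsub]
    using k[OF that] by (intro conjI ballI exI[of _ "k \<xi>"]) auto
  have "compact_space ?T"
    by (intro compact_space_subtopology closedin_compact_space compact_X_top W)
  moreover have "\<forall>U\<in>?N ` W. openin ?T U" using open_N by simp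
  moreover have "topspace ?T \<subseteq> \<Union>(?N ` W)" unfolding top by auto
  ultimately have "\<exists>\<F>. finite \<F> \<and> \<F> \<subseteq> ?N ` W \<and> topspace ?T \<subseteq> \<Union>\<F>"
    unfolding compact_space_alt by (elim allE[of _ "?N ` W"]) simp
  then obtain \<F> where \<F>: "finite \<F>" "\<F> \<subseteq> ?N ` W" "W \<subseteq> \<Union>\<F>" unfolding top by blast
  then obtain W' where W': "finite W'" "W' \<subseteq> W" "\<F> = ?N ` W'"
    by (meson finite_subset_image)
  show ?thesis
  proof (rule that[of "\<Union>(k ` W')"])
    fix \<eta> assume "\<eta> \<in> W"
    then obtain \<xi> where "\<xi> \<in> W'" "\<eta> \<in> ?N \<xi>" using \<F>(3) W'(3) by blast
    then show "\<exists>\<xi>\<in>W. \<exists>K'\<subseteq>\<Union>(k ` W'). Q \<xi> K' \<and> \<eta> \<inter> K' = \<xi> \<inter> K'"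
      using W'(2) k by (intro bexI[of _ \<xi>] exI[of _ "k \<xi>"]) auto
  qed (use W'(1,2) k in auto)
qed

section \<open>Translates of subsets, and the values of relations at a point\<close>

lemma (in group) mem_l_coset_iff:
  assumes "g \<in> carrier G" "H \<subseteq> carrier G"
  shows "k \<in> g <# H \<longleftrightarrow> k \<in> carrier G \<and> inv g \<otimes> k \<in> H"
proof
  assume "k \<in> g <# H"
  then obtain h where "h \<in> H" "k = g \<otimes> h" by (auto simp: l_coset_def)
  then show "k \<in> carrier G \<and> inv g \<otimes> k \<in> H" using assms by (auto simp: m_assoc[symmetric])
next
  assume k: "k \<in> carrier G \<and> inv g \<otimes> k \<in> H"
  then have "k = g \<otimes> (inv g \<otimes> k)" using assms by (simp add: m_assoc[symmetric])
  then show "k \<in> g <# H" using k by (auto simp: l_coset_def)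
qed

text \<open>Translation by \<open>g\<close> turns a condition on the coordinates in \<open>K\<close>
  into one on those in \<open>g\<inverse> K\<close>. At the level of finite sets this is the
  continuity of translations.\<close>

lemma (in group) l_coset_Int_eq:
  assumes "g \<in> carrier G" "H \<subseteq> carrier G" "H' \<subseteq> carrier G" "K \<subseteq> carrier G"
    and "H \<inter> (inv g <# K) = H' \<inter> (inv g <# K)"
  shows "(g <# H) \<inter> K = (g <# H') \<inter> K"
proof -
  have *: "inv g \<otimes> k \<in> inv g <# K" if "k \<in> K" for k using that by (auto simp: l_coset_def)
  show ?thesis using assms * by (auto simp: mem_l_coset_iff)
qed

text \<open>The value at \<open>\<xi>\<close> of the function that the relation becomes: a product
  of characteristic functions is 1 if \<open>\<xi>\<close> contains all its letters and 0
  otherwise.\<close>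

definition eval_at :: "('r, 'k) ring_scheme \<Rightarrow> 'g set \<Rightarrow> ('r, 'g) eps_relation \<Rightarrow> 'r" where
  "eval_at R \<xi> rel =
     foldr (\<lambda>(l, gs) s. (l \<otimes>\<^bsub>R\<^esub> (if set gs \<subseteq> \<xi> then \<one>\<^bsub>R\<^esub> else \<zero>\<^bsub>R\<^esub>)) \<oplus>\<^bsub>R\<^esub> s) rel \<zero>\<^bsub>R\<^esub>"

lemma (in cring) eval_relation_Lc:
  assumes "\<xi> \<in> topspace Y"
  shows "eval_relation (Lc Y R) (char_fun Y R) rel \<xi> = eval_at R \<xi> rel"
proof -
  have "foldr (\<lambda>g p. char_fun Y R g \<otimes>\<^bsub>Lc Y R\<^esub> p) gs \<one>\<^bsub>Lc Y R\<^esub> \<xi> =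
    (if set gs \<subseteq> \<xi> then \<one> else \<zero>)" for gs
    using assms by (induction gs) (auto simp: Lc_def char_fun_def)
  note prod = this
  show ?thesis
  proof (induction rel)
    case Nil
    show ?case using assms by (simp add: eval_relation_def eval_at_def Lc_def)
  next
    case (Cons p rel)
    obtain l gs where p: "p = (l, gs)" by force
    have "eval_relation (Lc Y R) (char_fun Y R) (p # rel) \<xi> =
      l \<otimes> foldr (\<lambda>g p. char_fun Y R g \<otimes>\<^bsub>Lc Y R\<^esub> p) gs \<one>\<^bsub>Lc Y R\<^esub> \<xi>
        \<oplus> eval_relation (Lc Y R) (char_fun Y R) rel \<xi>"
      using assms by (simp add: eval_relation_def p) (simp add: Lc_def)
    also have "\<dots> = eval_at R \<xi> (p # rel)"
      unfolding prod Cons.IH by (simp add: eval_at_def p)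
    finally show ?case .
  qed
qed

lemma eval_at_cong:
  assumes "\<xi> \<inter> \<Union>((set \<circ> snd) ` set rel) = \<eta> \<inter> \<Union>((set \<circ> snd) ` set rel)"
  shows "eval_at R \<xi> rel = eval_at R \<eta> rel"
proof -
  have "set gs \<subseteq> \<xi> \<longleftrightarrow> set gs \<subseteq> \<eta>" if "(l, gs) \<in> set rel" for l gs
  proof -
    have "set gs \<subseteq> \<Union>((set \<circ> snd) ` set rel)" using that by force
    then show ?thesis using assms by blast
  qed
  then have "foldr (\<lambda>(l, gs) s. (l \<otimes>\<^bsub>R\<^esub> (if set gs \<subseteq> \<xi> then \<one>\<^bsub>R\<^esub> else \<zero>\<^bsub>R\<^esub>)) \<oplus>\<^bsub>R\<^esub> s) rel \<zero>\<^bsub>R\<^esub> =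
     foldr (\<lambda>(l, gs) s. (l \<otimes>\<^bsub>R\<^esub> (if set gs \<subseteq> \<eta> then \<one>\<^bsub>R\<^esub> else \<zero>\<^bsub>R\<^esub>)) \<oplus>\<^bsub>R\<^esub> s) rel \<zero>\<^bsub>R\<^esub>"
    by (intro foldr_cong) auto
  then show ?thesis by (simp add: eval_at_def)
qed

section \<open>The spectrum as a compact invariant set and its algebra of functions\<close>

context par_setup begin

abbreviation "X \<equiv> topspace (X_top G)"
abbreviation "\<Omega> \<equiv> Omega R G \<R>"
abbreviation "L \<equiv> Lc (Omega_top R G \<R>) R"
abbreviation "c g \<equiv> char_fun (Omega_top R G \<R>) R g"

lemma X_iff: "\<xi> \<in> X \<longleftrightarrow> \<xi> \<subseteq> carrier G \<and> \<one>\<^bsub>G\<^esub> \<in> \<xi>"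
  by (simp add: topspace_X_top)

lemma translate_in_X:
  assumes "\<xi> \<in> X" "g \<in> \<xi>"
  shows "inv\<^bsub>G\<^esub> g <#\<^bsub>G\<^esub> \<xi> \<in> X"
  using assms by (auto simp: X_iff G.mem_l_coset_iff subset_iff)

lemma Omega_iff:
  "\<xi> \<in> \<Omega> \<longleftrightarrow> \<xi> \<in> X \<and> (\<forall>rel\<in>\<R>. \<forall>g\<in>\<xi>. eval_at R (inv\<^bsub>G\<^esub> g <#\<^bsub>G\<^esub> \<xi>) rel = \<zero>\<^bsub>R\<^esub>)"
  unfolding Omega_def Theta_rel_def
  by (auto simp: R.eval_relation_Lc translate_in_X)

lemma Omega_subset_X: "\<Omega> \<subseteq> X"
  by (auto simp: Omega_iff)

lemma OmegaD:
  assumes "\<xi> \<in> \<Omega>" shows "\<xi> \<subseteq> carrier G" "\<one>\<^bsub>G\<^esub> \<in> \<xi>" "\<xi> \<in> X"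
  using assms by (auto simp: Omega_iff X_iff)

text \<open>For \<open>k \<in> g\<inverse> \<xi>\<close> one has
  \<open>k\<inverse> g\<inverse> \<xi> = (gk)\<inverse> \<xi>\<close> with
  \<open>gk \<in> \<xi>\<close>, so each condition on the translate is one of the conditions on
  \<open>\<xi>\<close>. This is the reason why the spectrum is defined by means of all
  translates.\<close>

lemma translate_in_Omega:
  assumes \<xi>: "\<xi> \<in> \<Omega>" and g: "g \<in> \<xi>"
  shows "inv\<^bsub>G\<^esub> g <#\<^bsub>G\<^esub> \<xi> \<in> \<Omega>"
  unfolding Omega_iff
proof (intro conjI ballI)
  note \<xi>D = OmegaD[OF \<xi>]
  have gG: "g \<in> carrier G" using \<xi>D g by auto
  show "inv\<^bsub>G\<^esub> g <#\<^bsub>G\<^esub> \<xi> \<in> X" using \<xi>D g by (auto intro: translate_in_X)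
  fix rel k assume rel: "rel \<in> \<R>" and "k \<in> inv\<^bsub>G\<^esub> g <#\<^bsub>G\<^esub> \<xi>"
  then have k: "k \<in> carrier G" "g \<otimes>\<^bsub>G\<^esub> k \<in> \<xi>" using gG \<xi>D by (auto simp: G.mem_l_coset_iff)
  have "inv\<^bsub>G\<^esub> k <#\<^bsub>G\<^esub> (inv\<^bsub>G\<^esub> g <#\<^bsub>G\<^esub> \<xi>) = inv\<^bsub>G\<^esub> (g \<otimes>\<^bsub>G\<^esub> k) <#\<^bsub>G\<^esub> \<xi>"
    using gG k \<xi>D by (simp add: G.lcos_m_assoc G.inv_mult_group)
  then show "eval_at R (inv\<^bsub>G\<^esub> k <#\<^bsub>G\<^esub> (inv\<^bsub>G\<^esub> g <#\<^bsub>G\<^esub> \<xi>)) rel = \<zero>\<^bsub>R\<^esub>"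
    using \<xi> rel k by (simp add: Omega_iff)
qed

lemma closed_Omega: "closedin (X_top G) \<Omega>"
proof (rule closedin_X_top_I[OF Omega_subset_X])
  fix \<xi> assume \<xi>: "\<xi> \<in> X" "\<xi> \<notin> \<Omega>"
  then obtain rel g where rg: "rel \<in> \<R>" "g \<in> \<xi>" "eval_at R (inv\<^bsub>G\<^esub> g <#\<^bsub>G\<^esub> \<xi>) rel \<noteq> \<zero>\<^bsub>R\<^esub>"
    by (auto simp: Omega_iff)
  have gG: "g \<in> carrier G" using rg \<xi> by (auto simp: X_iff)
  let ?M = "\<Union>((set \<circ> snd) ` set rel)"
  have M: "finite ?M" "?M \<subseteq> carrier G" using relation_coeff(2)[OF rg(1)] by auto
  \<comment> \<open>The letters of the relation, translated by \<open>g\<close>, fix its value at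
    \<open>g\<inverse> \<eta>\<close>; \<open>g\<close> itself is added because the condition at
    \<open>g\<close> counts only for sets that contain \<open>g\<close>.\<close>
  let ?K = "insert g (g <#\<^bsub>G\<^esub> ?M)"
  have "finite ?K" using M(1) by (auto simp: l_coset_def)
  moreover have "?K \<subseteq> carrier G" using gG M(2) by (auto simp: l_coset_def)
  moreover have "\<eta> \<notin> \<Omega>" if \<eta>: "\<eta> \<in> X" "\<eta> \<inter> ?K = \<xi> \<inter> ?K" for \<eta>
  proof -
    have "g \<in> \<eta>" using rg(2) \<eta>(2) by blast
    moreover have "(inv\<^bsub>G\<^esub> g <#\<^bsub>G\<^esub> \<eta>) \<inter> ?M = (inv\<^bsub>G\<^esub> g <#\<^bsub>G\<^esub> \<xi>) \<inter> ?M"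
      by (rule G.l_coset_Int_eq) (use gG \<eta> \<xi> M in \<open>auto simp: X_iff\<close>)
    then have "eval_at R (inv\<^bsub>G\<^esub> g <#\<^bsub>G\<^esub> \<eta>) rel \<noteq> \<zero>\<^bsub>R\<^esub>"
      using rg(3) eval_at_cong by metis
    ultimately show ?thesis using rg(1) by (auto simp: Omega_iff)
  qed
  ultimately show "\<exists>K. finite K \<and> K \<subseteq> carrier G \<and> (\<forall>\<eta>\<in>X. \<eta> \<inter> K = \<xi> \<inter> K \<longrightarrow> \<eta> \<notin> \<Omega>)"
    by (intro exI[of _ ?K]) auto
qed

lemma topspace_Omega_top [simp]: "topspace (Omega_top R G \<R>) = \<Omega>"
  using Omega_subset_X by (auto simp: Omega_top_def)

lemma openin_Omega_top:
  "openin (Omega_top R G \<R>) U \<longleftrightarrow> U \<subseteq> \<Omega> \<and>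
    (\<forall>\<xi>\<in>U. \<exists>K. finite K \<and> K \<subseteq> carrier G \<and> (\<forall>\<eta>\<in>\<Omega>. \<eta> \<inter> K = \<xi> \<inter> K \<longrightarrow> \<eta> \<in> U))"
  unfolding Omega_top_def by (rule openin_subtopology_X_top[OF Omega_subset_X])

lemma compact_Omega_top: "compact_space (Omega_top R G \<R>)"
  unfolding Omega_top_def
  by (intro compact_space_subtopology closedin_compact_space compact_X_top closed_Omega)

text \<open>The function factors through the traces on one finite set. On the compact spectrum this
  is equivalent to local constancy, and it supports inductions on \<open>K\<close>.\<close>

definition determined_by :: "('g set \<Rightarrow> 'r) \<Rightarrow> 'g set \<Rightarrow> bool" where
  "determined_by f K \<longleftrightarrow> finite K \<and> K \<subseteq> carrier G \<and>
     (\<forall>\<xi>\<in>\<Omega>. \<forall>\<eta>\<in>\<Omega>. \<xi> \<inter> K = \<eta> \<inter> K \<longrightarrow> f \<xi> = f \<eta>)"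

lemma determined_byI:
  assumes "finite K" "K \<subseteq> carrier G"
    and "\<And>\<xi> \<eta>. \<lbrakk>\<xi> \<in> \<Omega>; \<eta> \<in> \<Omega>; \<xi> \<inter> K = \<eta> \<inter> K\<rbrakk> \<Longrightarrow> f \<xi> = f \<eta>"
  shows "determined_by f K"
  unfolding determined_by_def by (intro conjI ballI impI assms)

lemma determined_byD:
  assumes "determined_by f K"
  shows "finite K" "K \<subseteq> carrier G"
    and "\<lbrakk>\<xi> \<in> \<Omega>; \<eta> \<in> \<Omega>; \<xi> \<inter> K = \<eta> \<inter> K\<rbrakk> \<Longrightarrow> f \<xi> = f \<eta>"
  using assms unfolding determined_by_def by metis+

lemma determined_by_mono:
  assumes "determined_by f K" "K \<subseteq> K'" "finite K'" "K' \<subseteq> carrier G"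
  shows "determined_by f K'"
proof (rule determined_byI[OF assms(3,4)])
  fix \<xi> \<eta> assume "\<xi> \<in> \<Omega>" "\<eta> \<in> \<Omega>" "\<xi> \<inter> K' = \<eta> \<inter> K'"
  moreover from this(3) assms(2) have "\<xi> \<inter> K = \<eta> \<inter> K" by blast
  ultimately show "f \<xi> = f \<eta>" by (intro determined_byD(3)[OF assms(1)])
qed

text \<open>Local constancy gives a finite set at every point, and \<open>X_top_uniform\<close>
  merges them. The compactness of the support is automatic, since every closed subset of the
  spectrum is compact.\<close>

lemma L_carrier_iff: "f \<in> carrier L \<longleftrightarrow> f \<in> \<Omega> \<rightarrow>\<^sub>E carrier R \<and> (\<exists>K. determined_by f K)"
proof
  assume f: "f \<in> carrier L"
  then have loc: "\<exists>U. openin (Omega_top R G \<R>) U \<and> \<xi> \<in> U \<and> (\<forall>\<eta>\<in>U. f \<eta> = f \<xi>)" if "\<xi> \<in> \<Omega>" for \<xi>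
    using that by (auto simp: Lc_def)
  have "\<exists>K. finite K \<and> K \<subseteq> carrier G \<and> (\<forall>\<eta>\<in>\<Omega>. \<eta> \<inter> K = \<xi> \<inter> K \<longrightarrow> f \<eta> = f \<xi>)" if "\<xi> \<in> \<Omega>" for \<xi>
    using loc[OF that] unfolding openin_Omega_top by metis
  then obtain K where K: "finite K" "K \<subseteq> carrier G"
    "\<And>\<eta>. \<eta> \<in> \<Omega> \<Longrightarrow> \<exists>\<xi>\<in>\<Omega>. \<exists>K'\<subseteq>K. (\<forall>\<eta>\<in>\<Omega>. \<eta> \<inter> K' = \<xi> \<inter> K' \<longrightarrow> f \<eta> = f \<xi>) \<and> \<eta> \<inter> K' = \<xi> \<inter> K'"
    using X_top_uniform[OF closed_Omega, of "\<lambda>\<xi> K. \<forall>\<eta>\<in>\<Omega>. \<eta> \<inter> K = \<xi> \<inter> K \<longrightarrow> f \<eta> = f \<xi>"]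
    by (smt (verit))
  have "f \<eta> = f \<zeta>" if \<eta>: "\<eta> \<in> \<Omega>" and \<zeta>: "\<zeta> \<in> \<Omega>" and eq: "\<eta> \<inter> K = \<zeta> \<inter> K" for \<eta> \<zeta>
  proof -
    obtain \<xi> K' where *: "\<xi> \<in> \<Omega>" "K' \<subseteq> K" "\<forall>\<eta>\<in>\<Omega>. \<eta> \<inter> K' = \<xi> \<inter> K' \<longrightarrow> f \<eta> = f \<xi>" "\<eta> \<inter> K' = \<xi> \<inter> K'"
      using K(3)[OF \<eta>] by (elim bexE exE conjE) (rule that)
    have "\<zeta> \<inter> K' = \<eta> \<inter> K'" using *(2) eq by blast
    then show ?thesis using *(3,4) \<eta> \<zeta> by metis
  qed
  then have "determined_by f K" by (rule determined_byI[OF K(1,2)])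
  moreover have "f \<in> \<Omega> \<rightarrow>\<^sub>E carrier R" using f by (simp add: Lc_def)
  ultimately show "f \<in> \<Omega> \<rightarrow>\<^sub>E carrier R \<and> (\<exists>K. determined_by f K)" by blast
next
  assume f: "f \<in> \<Omega> \<rightarrow>\<^sub>E carrier R \<and> (\<exists>K. determined_by f K)"
  then obtain K where "determined_by f K" by blast
  note K = determined_byD[OF this]
  have "\<exists>U. openin (Omega_top R G \<R>) U \<and> \<xi> \<in> U \<and> (\<forall>\<eta>\<in>U. f \<eta> = f \<xi>)" if \<xi>: "\<xi> \<in> \<Omega>" for \<xi>
  proof (intro exI conjI)
    show "openin (Omega_top R G \<R>) {\<eta> \<in> \<Omega>. \<eta> \<inter> K = \<xi> \<inter> K}"
      unfolding openin_Omega_top using K(1,2) by (intro conjI ballI exI[of _ K]) auto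
    show "\<forall>\<eta>\<in>{\<eta> \<in> \<Omega>. \<eta> \<inter> K = \<xi> \<inter> K}. f \<eta> = f \<xi>" using K(3)[OF _ \<xi>] by simp
  qed (simp add: \<xi>)
  moreover have "compactin (Omega_top R G \<R>) (Omega_top R G \<R> closure_of S)" for S
    by (rule closedin_compact_space[OF compact_Omega_top closedin_closure_of])
  ultimately show "f \<in> carrier L" using f by (simp add: Lc_def)
qed

lemma L_simps:
  "f \<otimes>\<^bsub>L\<^esub> h = (\<lambda>\<xi>\<in>\<Omega>. f \<xi> \<otimes>\<^bsub>R\<^esub> h \<xi>)" "\<one>\<^bsub>L\<^esub> = (\<lambda>\<xi>\<in>\<Omega>. \<one>\<^bsub>R\<^esub>)" "\<zero>\<^bsub>L\<^esub> = (\<lambda>\<xi>\<in>\<Omega>. \<zero>\<^bsub>R\<^esub>)"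
  "f \<oplus>\<^bsub>L\<^esub> h = (\<lambda>\<xi>\<in>\<Omega>. f \<xi> \<oplus>\<^bsub>R\<^esub> h \<xi>)" "r \<odot>\<^bsub>L\<^esub> f = (\<lambda>\<xi>\<in>\<Omega>. r \<otimes>\<^bsub>R\<^esub> f \<xi>)"
  by (simp_all add: Lc_def)

lemma L_closed: "f \<in> carrier L \<Longrightarrow> \<xi> \<in> \<Omega> \<Longrightarrow> f \<xi> \<in> carrier R"
  by (auto simp: L_carrier_iff)

lemma L_ext:
  assumes "f \<in> carrier L" "h \<in> carrier L" "\<And>\<xi>. \<xi> \<in> \<Omega> \<Longrightarrow> f \<xi> = h \<xi>"
  shows "f = h"
  by (rule PiE_ext[of f \<Omega> "\<lambda>_. carrier R" h]) (use assms L_carrier_iff in auto)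

text \<open>The two finite sets are joined. Stated for an arbitrary operation, it covers sums and
  products, and, with the second argument ignored, negatives and scalar multiples.\<close>

lemma L_binop_closed:
  assumes f: "f \<in> carrier L" and h: "h \<in> carrier L"
    and op: "\<And>a b. a \<in> carrier R \<Longrightarrow> b \<in> carrier R \<Longrightarrow> op a b \<in> carrier R"
  shows "(\<lambda>\<xi>\<in>\<Omega>. op (f \<xi>) (h \<xi>)) \<in> carrier L"
proof -
  obtain K K' where K: "determined_by f K" "determined_by h K'"
    using f h L_carrier_iff by blast
  have fin: "finite (K \<union> K')" "K \<union> K' \<subseteq> carrier G"
    using determined_byD(1,2)[OF K(1)] determined_byD(1,2)[OF K(2)] by auto
  have "determined_by f (K \<union> K')" "determined_by h (K \<union> K')"
    using determined_by_mono[OF K(1) _ fin] determined_by_mono[OF K(2) _ fin] by auto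
  note D = determined_byD(3)[OF this(1)] determined_byD(3)[OF this(2)]
  have "determined_by (\<lambda>\<xi>\<in>\<Omega>. op (f \<xi>) (h \<xi>)) (K \<union> K')"
  proof (rule determined_byI[OF fin])
    fix \<xi> \<eta> assume "\<xi> \<in> \<Omega>" "\<eta> \<in> \<Omega>" "\<xi> \<inter> (K \<union> K') = \<eta> \<inter> (K \<union> K')"
    then show "(\<lambda>\<xi>\<in>\<Omega>. op (f \<xi>) (h \<xi>)) \<xi> = (\<lambda>\<xi>\<in>\<Omega>. op (f \<xi>) (h \<xi>)) \<eta>"
      using D[of \<xi> \<eta>] by simp
  qed
  then show ?thesis using op L_closed[OF f] L_closed[OF h] by (auto simp: L_carrier_iff)
qed

lemma L_const_closed: "a \<in> carrier R \<Longrightarrow> (\<lambda>\<xi>\<in>\<Omega>. a) \<in> carrier L"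
  by (auto simp: L_carrier_iff intro!: exI[of _ "{}"] determined_byI)

lemma c_eq: "c g = (\<lambda>\<xi>\<in>\<Omega>. if g \<in> \<xi> then \<one>\<^bsub>R\<^esub> else \<zero>\<^bsub>R\<^esub>)"
  by (simp add: char_fun_def)

lemma c_closed: "g \<in> carrier G \<Longrightarrow> c g \<in> carrier L"
  unfolding c_eq L_carrier_iff by (auto intro!: exI[of _ "{g}"] determined_byI)

lemma L_assoc_algebra: "assoc_algebra R L" and L_cring: "cring L"
proof -
  note cl = L_binop_closed L_const_closed L_closed
  \<comment> \<open>The unit laws reproduce \<open>f\<close> only up to a restriction to the
    spectrum, which is harmless because members of the carrier are extensional.\<close>
  have r: "(\<lambda>\<xi>\<in>\<Omega>. F \<xi>) = f" if "f \<in> carrier L" "\<And>\<xi>. \<xi> \<in> \<Omega> \<Longrightarrow> F \<xi> = f \<xi>" for f F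
  proof -
    have "f \<in> extensional \<Omega>" using that(1) by (auto simp: L_carrier_iff PiE_def)
    then show ?thesis using that(2) by (intro extensionalityI[of _ \<Omega>]) auto
  qed
  have "abelian_group L"
  proof (rule abelian_groupI)
    fix f assume f: "f \<in> carrier L"
    show "\<exists>h\<in>carrier L. h \<oplus>\<^bsub>L\<^esub> f = \<zero>\<^bsub>L\<^esub>"
      by (rule bexI[of _ "\<lambda>\<xi>\<in>\<Omega>. \<ominus>\<^bsub>R\<^esub> f \<xi>"])
        (use L_binop_closed[OF f f, of "\<lambda>a _. \<ominus>\<^bsub>R\<^esub> a"] in
          \<open>auto simp: L_simps L_closed[OF f] R.l_neg intro!: restrict_ext\<close>)
  qed (auto simp: L_simps cl R.a_ac intro!: restrict_ext, auto intro!: r simp: L_closed)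
  moreover have "comm_monoid L"
    by (rule comm_monoidI) (auto simp: L_simps cl R.m_ac intro!: restrict_ext, auto intro!: r simp: L_closed)
  ultimately show cr: "cring L"
    by (rule cringI) (auto simp: L_simps cl R.l_distr intro!: restrict_ext)
  have sm: "(\<lambda>\<xi>\<in>\<Omega>. a \<otimes>\<^bsub>R\<^esub> f \<xi>) \<in> carrier L" if "a \<in> carrier R" "f \<in> carrier L" for a f
    using L_binop_closed[OF that(2) that(2), of "\<lambda>b _. a \<otimes>\<^bsub>R\<^esub> b"] that(1) by simp
  show "assoc_algebra R L"
    by (rule assoc_algebraI[OF R.is_cring cring.axioms(1)[OF cr]])
      (auto simp: L_simps cl sm R.l_distr R.r_distr R.m_ac intro!: restrict_ext, auto intro!: r simp: L_closed)
qed

sublocale L: assoc_algebra R L by (rule L_assoc_algebra)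
sublocale Lc: cring L by (rule L_cring)

end

section \<open>The partial actions\<close>

context par_setup begin

abbreviation "D g \<equiv> Lc_ideal R G \<R> g"
abbreviation "\<theta> g \<equiv> Lc_theta R G \<R> g"
abbreviation "tr g \<xi> \<equiv> inv\<^bsub>G\<^esub> g <#\<^bsub>G\<^esub> \<xi>"

lemma mem_tr_iff:
  assumes "g \<in> carrier G" "\<xi> \<in> \<Omega>"
  shows "k \<in> tr g \<xi> \<longleftrightarrow> k \<in> carrier G \<and> g \<otimes>\<^bsub>G\<^esub> k \<in> \<xi>"
  using assms OmegaD[OF assms(2)] by (simp add: G.mem_l_coset_iff)

lemma tr_one: "\<xi> \<in> \<Omega> \<Longrightarrow> tr \<one>\<^bsub>G\<^esub> \<xi> = \<xi>"
  using OmegaD by (simp add: G.lcos_mult_one)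

lemma tr_tr:
  assumes "g \<in> carrier G" "h \<in> carrier G" "\<xi> \<in> \<Omega>"
  shows "tr h (tr g \<xi>) = tr (g \<otimes>\<^bsub>G\<^esub> h) \<xi>"
  using assms OmegaD[OF assms(3)] by (simp add: G.lcos_m_assoc G.inv_mult_group)

lemma translate_in_Omega': "\<lbrakk>\<xi> \<in> \<Omega>; inv\<^bsub>G\<^esub> g \<in> \<xi>; g \<in> carrier G\<rbrakk> \<Longrightarrow> g <#\<^bsub>G\<^esub> \<xi> \<in> \<Omega>"
  using translate_in_Omega[of \<xi> "inv\<^bsub>G\<^esub> g"] by simp

lemma Omega_at_iff: "\<xi> \<in> Omega_at R G \<R> g \<longleftrightarrow> \<xi> \<in> \<Omega> \<and> g \<in> \<xi>"
  by (auto simp: Omega_at_def)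

lemma openin_Omega_at:
  assumes "g \<in> carrier G"
  shows "openin (Omega_top R G \<R>) (Omega_at R G \<R> g)"
  unfolding openin_Omega_top
  using assms by (intro conjI ballI exI[of _ "{g}"]) (auto simp: Omega_at_iff)

lemma theta_hat_mem:
  assumes "g \<in> carrier G" "\<xi> \<in> Omega_at R G \<R> (inv\<^bsub>G\<^esub> g)"
  shows "theta_hat G g \<xi> \<in> Omega_at R G \<R> g"
    and "theta_hat G (inv\<^bsub>G\<^esub> g) (theta_hat G g \<xi>) = \<xi>"
proof -
  have \<xi>: "\<xi> \<in> \<Omega>" "inv\<^bsub>G\<^esub> g \<in> \<xi>" using assms by (auto simp: Omega_at_iff)
  note \<xi>D = OmegaD[OF \<xi>(1)]
  show "theta_hat G g \<xi> \<in> Omega_at R G \<R> g"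
    using assms(1) \<xi> \<xi>D by (simp add: Omega_at_iff theta_hat_def translate_in_Omega' G.mem_l_coset_iff)
  show "theta_hat G (inv\<^bsub>G\<^esub> g) (theta_hat G g \<xi>) = \<xi>"
    using assms(1) \<xi>D by (simp add: theta_hat_def G.lcos_m_assoc G.lcos_mult_one)
qed

lemma theta_hat_continuous:
  assumes g: "g \<in> carrier G"
  shows "continuous_map (subtopology (Omega_top R G \<R>) (Omega_at R G \<R> (inv\<^bsub>G\<^esub> g)))
    (subtopology (Omega_top R G \<R>) (Omega_at R G \<R> g)) (theta_hat G g)"
proof -
  let ?T = "Omega_top R G \<R>" and ?g' = "inv\<^bsub>G\<^esub> g"
  let ?D = "Omega_at R G \<R> ?g'"
  have top: "topspace (subtopology ?T ?D) = ?D" by (auto simp: Omega_at_iff)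
  show ?thesis
    unfolding continuous_map_in_subtopology
  proof
    show "theta_hat G g \<in> topspace (subtopology ?T ?D) \<rightarrow> Omega_at R G \<R> g"
      using theta_hat_mem(1)[OF g] unfolding top by blast
    show "continuous_map (subtopology ?T ?D) ?T (theta_hat G g)"
      unfolding continuous_map_def top topspace_Omega_top
    proof (intro conjI allI impI)
      show "theta_hat G g \<in> ?D \<rightarrow> \<Omega>" using theta_hat_mem(1)[OF g] by (auto simp: Omega_at_iff)
      fix U assume U: "openin ?T U"
      have "openin ?T {\<xi> \<in> ?D. theta_hat G g \<xi> \<in> U}"
        unfolding openin_Omega_top
      proof (intro conjI ballI)
        fix \<xi> assume \<xi>: "\<xi> \<in> {\<xi> \<in> ?D. theta_hat G g \<xi> \<in> U}"
        then obtain K where K: "finite K" "K \<subseteq> carrier G"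
            "\<forall>\<eta>\<in>\<Omega>. \<eta> \<inter> K = theta_hat G g \<xi> \<inter> K \<longrightarrow> \<eta> \<in> U"
          using U unfolding openin_Omega_top by (metis (no_types, lifting) mem_Collect_eq)
        \<comment> \<open>The set found at the image point, pulled back along the translation,
          together with \<open>g\<inverse>\<close>, which keeps \<open>\<eta>\<close> in the
          domain.\<close>
        let ?K = "insert ?g' (?g' <#\<^bsub>G\<^esub> K)"
        have "\<eta> \<in> {\<xi> \<in> ?D. theta_hat G g \<xi> \<in> U}" if \<eta>: "\<eta> \<in> \<Omega>" "\<eta> \<inter> ?K = \<xi> \<inter> ?K" for \<eta>
        proof -
          have \<xi>': "\<xi> \<in> \<Omega>" "?g' \<in> \<xi>" using \<xi> by (auto simp: Omega_at_iff)
          have D: "\<eta> \<in> ?D" using \<xi>' \<eta> by (auto simp: Omega_at_iff)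
          have "\<eta> \<inter> (?g' <#\<^bsub>G\<^esub> K) = \<xi> \<inter> (?g' <#\<^bsub>G\<^esub> K)" using \<eta>(2) by blast
          then have "theta_hat G g \<eta> \<inter> K = theta_hat G g \<xi> \<inter> K"
            unfolding theta_hat_def
            by (intro G.l_coset_Int_eq) (use g K(2) OmegaD[OF \<eta>(1)] OmegaD[OF \<xi>'(1)] in auto)
          moreover have "theta_hat G g \<eta> \<in> \<Omega>"
            using theta_hat_mem(1)[OF g D] by (simp add: Omega_at_iff)
          ultimately show ?thesis using K(3) D by blast
        qed
        moreover have "finite ?K" "?K \<subseteq> carrier G" using K(1,2) g by (auto simp: l_coset_def)
        ultimately show "\<exists>K. finite K \<and> K \<subseteq> carrier G \<and>
            (\<forall>\<eta>\<in>\<Omega>. \<eta> \<inter> K = \<xi> \<inter> K \<longrightarrow> \<eta> \<in> {\<xi> \<in> ?D. theta_hat G g \<xi> \<in> U})"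
          by (intro exI[of _ ?K]) blast
      qed (auto simp: Omega_at_iff)
      then show "openin (subtopology ?T ?D) {\<xi> \<in> ?D. theta_hat G g \<xi> \<in> U}"
        unfolding openin_open_subtopology[OF openin_Omega_at[OF G.inv_closed[OF g]]] by blast
    qed
  qed
qed

lemma topological_partial_action_theta_hat:
  "topological_partial_action G (Omega_top R G \<R>) (Omega_at R G \<R>) (theta_hat G)"
  unfolding topological_partial_action_def topspace_Omega_top
proof (intro conjI ballI)
  fix g assume g: "g \<in> carrier G"
  show "openin (Omega_top R G \<R>) (Omega_at R G \<R> g)" by (rule openin_Omega_at[OF g])
  show "homeomorphic_map (subtopology (Omega_top R G \<R>) (Omega_at R G \<R> (inv\<^bsub>G\<^esub> g)))
      (subtopology (Omega_top R G \<R>) (Omega_at R G \<R> g)) (theta_hat G g)"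
    unfolding homeomorphic_map_maps homeomorphic_maps_def
    using theta_hat_continuous[OF g] theta_hat_continuous[OF G.inv_closed[OF g]]
      theta_hat_mem(2)[OF g] theta_hat_mem(2)[OF G.inv_closed[OF g]] g
    by (intro exI[of _ "theta_hat G (inv\<^bsub>G\<^esub> g)"]) simp
next
  show "Omega_at R G \<R> \<one>\<^bsub>G\<^esub> = \<Omega>" using OmegaD by (auto simp: Omega_at_iff)
next
  fix \<xi> assume "\<xi> \<in> \<Omega>"
  then show "theta_hat G \<one>\<^bsub>G\<^esub> \<xi> = \<xi>" using OmegaD by (simp add: theta_hat_def G.lcos_mult_one)
next
  fix g h assume gh: "g \<in> carrier G" "h \<in> carrier G"
  show "theta_hat G g ` (Omega_at R G \<R> (inv\<^bsub>G\<^esub> g) \<inter> Omega_at R G \<R> h) \<subseteq> Omega_at R G \<R> (g \<otimes>\<^bsub>G\<^esub> h)"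
  proof
    fix \<eta> assume "\<eta> \<in> theta_hat G g ` (Omega_at R G \<R> (inv\<^bsub>G\<^esub> g) \<inter> Omega_at R G \<R> h)"
    then obtain \<xi> where \<xi>: "\<xi> \<in> Omega_at R G \<R> (inv\<^bsub>G\<^esub> g)" "h \<in> \<xi>" "\<eta> = theta_hat G g \<xi>"
      by (auto simp: Omega_at_iff)
    then have "\<eta> \<in> \<Omega>" using theta_hat_mem(1)[OF gh(1) \<xi>(1)] by (simp add: Omega_at_iff)
    then show "\<eta> \<in> Omega_at R G \<R> (g \<otimes>\<^bsub>G\<^esub> h)"
      using \<xi> gh by (auto simp: Omega_at_iff theta_hat_def l_coset_def)
  qed
  fix \<xi> assume "\<xi> \<in> Omega_at R G \<R> (inv\<^bsub>G\<^esub> h) \<inter> Omega_at R G \<R> (inv\<^bsub>G\<^esub> (g \<otimes>\<^bsub>G\<^esub> h))"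
  then have "\<xi> \<subseteq> carrier G" using OmegaD by (auto simp: Omega_at_iff)
  then show "theta_hat G g (theta_hat G h \<xi>) = theta_hat G (g \<otimes>\<^bsub>G\<^esub> h) \<xi>"
    using gh by (simp add: theta_hat_def G.lcos_m_assoc)
qed

section \<open>The algebraic partial action on the locally constant functions\<close>

lemma D_iff: "f \<in> D g \<longleftrightarrow> f \<in> carrier L \<and> (\<forall>\<xi>\<in>\<Omega>. g \<notin> \<xi> \<longrightarrow> f \<xi> = \<zero>\<^bsub>R\<^esub>)"
  by (auto simp: Lc_ideal_def Omega_at_iff)

lemma D_carrier: "f \<in> D g \<Longrightarrow> f \<in> carrier L"
  by (simp add: D_iff)

lemma theta_eval:
  "\<xi> \<in> \<Omega> \<Longrightarrow> \<theta> g f \<xi> = (if g \<in> \<xi> then f (tr g \<xi>) else \<zero>\<^bsub>R\<^esub>)"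
  by (simp add: Lc_theta_def Omega_at_iff theta_hat_def)

text \<open>Extended by 0, \<open>\<theta> g\<close> is a map on all of \<open>L\<close> with values
  in \<open>D g\<close>. Its value at \<open>\<xi>\<close> depends on whether
  \<open>g \<in> \<xi>\<close> and on the trace of \<open>g\<inverse> \<xi>\<close> on
  \<open>K\<close>, hence on the trace of \<open>\<xi>\<close> on \<open>gK\<close>.\<close>

lemma theta_closed:
  assumes g: "g \<in> carrier G" and f: "f \<in> carrier L"
  shows "\<theta> g f \<in> D g"
proof -
  obtain K where K: "determined_by f K" using f L_carrier_iff by blast
  note KD = determined_byD[OF K]
  let ?K = "insert g (g <#\<^bsub>G\<^esub> K)"
  have "determined_by (\<theta> g f) ?K"
  proof (rule determined_byI)
    show "finite ?K" "?K \<subseteq> carrier G" using KD(1,2) g by (auto simp: l_coset_def)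
    fix \<xi> \<eta> assume \<xi>: "\<xi> \<in> \<Omega>" and \<eta>: "\<eta> \<in> \<Omega>" and eq: "\<xi> \<inter> ?K = \<eta> \<inter> ?K"
    have mem: "g \<in> \<xi> \<longleftrightarrow> g \<in> \<eta>" using eq by blast
    have "\<xi> \<inter> (g <#\<^bsub>G\<^esub> K) = \<eta> \<inter> (g <#\<^bsub>G\<^esub> K)" using eq by blast
    then have "tr g \<xi> \<inter> K = tr g \<eta> \<inter> K"
      by (intro G.l_coset_Int_eq) (use g KD(2) OmegaD[OF \<xi>] OmegaD[OF \<eta>] in auto)
    then show "\<theta> g f \<xi> = \<theta> g f \<eta>"
      using mem KD(3)[OF translate_in_Omega[OF \<xi>] translate_in_Omega[OF \<eta>]]
      by (simp add: theta_eval[OF \<xi>] theta_eval[OF \<eta>])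
  qed
  moreover have "\<theta> g f \<in> \<Omega> \<rightarrow>\<^sub>E carrier R"
    using L_closed[OF f] translate_in_Omega
    by (auto simp: Lc_theta_def Omega_at_iff theta_hat_def)
  ultimately show ?thesis unfolding D_iff L_carrier_iff by (auto simp: theta_eval)
qed

lemma L_eval:
  assumes "\<xi> \<in> \<Omega>"
  shows "(f \<otimes>\<^bsub>L\<^esub> h) \<xi> = f \<xi> \<otimes>\<^bsub>R\<^esub> h \<xi>" "(f \<oplus>\<^bsub>L\<^esub> h) \<xi> = f \<xi> \<oplus>\<^bsub>R\<^esub> h \<xi>"
    "(r \<odot>\<^bsub>L\<^esub> f) \<xi> = r \<otimes>\<^bsub>R\<^esub> f \<xi>" "\<one>\<^bsub>L\<^esub> \<xi> = \<one>\<^bsub>R\<^esub>" "\<zero>\<^bsub>L\<^esub> \<xi> = \<zero>\<^bsub>R\<^esub>"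
    "c g \<xi> = (if g \<in> \<xi> then \<one>\<^bsub>R\<^esub> else \<zero>\<^bsub>R\<^esub>)"
  using assms by (simp_all add: L_simps c_eq)

lemma mult_c_eq:
  assumes "f \<in> D g" "g \<in> carrier G"
  shows "f \<otimes>\<^bsub>L\<^esub> c g = f"
  by (rule L_ext) (use assms D_iff in \<open>auto simp: c_closed L_eval L_closed\<close>)

text \<open>Multiplication by the idempotent \<open>c g\<close> sets a function to 0 at the points
  that do not contain \<open>g\<close>, so it fixes exactly the members of \<open>D g\<close>. The
  ideal axioms are then those of a principal ideal.\<close>

lemma D_eq_PIdl:
  assumes g: "g \<in> carrier G"
  shows "D g = PIdl\<^bsub>L\<^esub> (c g)"
proof
  show "D g \<subseteq> PIdl\<^bsub>L\<^esub> (c g)"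
  proof
    fix f assume "f \<in> D g"
    then show "f \<in> PIdl\<^bsub>L\<^esub> (c g)"
      using mult_c_eq[OF _ g, of f] D_carrier[of f g] unfolding cgenideal_def by force
  qed
  show "PIdl\<^bsub>L\<^esub> (c g) \<subseteq> D g"
  proof
    fix f assume "f \<in> PIdl\<^bsub>L\<^esub> (c g)"
    then obtain h where "h \<in> carrier L" "f = h \<otimes>\<^bsub>L\<^esub> c g" unfolding cgenideal_def by blast
    then show "f \<in> D g" using g by (simp add: D_iff c_closed L_eval L_closed)
  qed
qed

lemma D_ideal: "g \<in> carrier G \<Longrightarrow> ideal (D g) L"
  using Lc.cgenideal_ideal[OF c_closed] by (simp add: D_eq_PIdl)

text \<open>Where \<open>g\<inverse> \<in> \<xi>\<close> the two translations cancel; elsewhere the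
  left side is 0 by extension and \<open>f\<close> is 0 because of its domain.\<close>

lemma theta_theta_inv:
  assumes g: "g \<in> carrier G" and f: "f \<in> D (inv\<^bsub>G\<^esub> g)"
  shows "\<theta> (inv\<^bsub>G\<^esub> g) (\<theta> g f) = f"
proof (rule L_ext)
  show "\<theta> (inv\<^bsub>G\<^esub> g) (\<theta> g f) \<in> carrier L" "f \<in> carrier L"
    using theta_closed g f D_carrier by (meson G.inv_closed)+
  fix \<xi> assume \<xi>: "\<xi> \<in> \<Omega>"
  show "\<theta> (inv\<^bsub>G\<^esub> g) (\<theta> g f) \<xi> = f \<xi>"
  proof (cases "inv\<^bsub>G\<^esub> g \<in> \<xi>")
    case True
    then have "tr (inv\<^bsub>G\<^esub> g) \<xi> \<in> \<Omega>" by (rule translate_in_Omega[OF \<xi>])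
    moreover have "g \<in> tr (inv\<^bsub>G\<^esub> g) \<xi>" using g \<xi> OmegaD[OF \<xi>] by (simp only: mem_tr_iff G.inv_closed G.l_inv)
    ultimately show ?thesis
      using True g \<xi> by (simp only: theta_eval if_True tr_tr G.inv_closed G.l_inv tr_one)
  qed (use f \<xi> in \<open>simp add: theta_eval D_iff\<close>)
qed

lemma theta_hom:
  assumes "g \<in> carrier G" "f \<in> carrier L" "h \<in> carrier L"
  shows "\<theta> g (f \<otimes>\<^bsub>L\<^esub> h) = \<theta> g f \<otimes>\<^bsub>L\<^esub> \<theta> g h" "\<theta> g (f \<oplus>\<^bsub>L\<^esub> h) = \<theta> g f \<oplus>\<^bsub>L\<^esub> \<theta> g h"
    "r \<in> carrier R \<Longrightarrow> \<theta> g (r \<odot>\<^bsub>L\<^esub> f) = r \<odot>\<^bsub>L\<^esub> \<theta> g f"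
proof -
  note cl = theta_closed[OF assms(1), THEN D_carrier]
  show "\<theta> g (f \<otimes>\<^bsub>L\<^esub> h) = \<theta> g f \<otimes>\<^bsub>L\<^esub> \<theta> g h" "\<theta> g (f \<oplus>\<^bsub>L\<^esub> h) = \<theta> g f \<oplus>\<^bsub>L\<^esub> \<theta> g h"
    "r \<in> carrier R \<Longrightarrow> \<theta> g (r \<odot>\<^bsub>L\<^esub> f) = r \<odot>\<^bsub>L\<^esub> \<theta> g f"
    by (rule L_ext; use assms cl in \<open>simp add: theta_eval L_eval translate_in_Omega\<close>)+
qed

lemma algebra_partial_action_theta:
  "algebra_partial_action R G L (Lc_ideal R G \<R>) (Lc_theta R G \<R>)"
  unfolding algebra_partial_action_def
proof (intro conjI ballI)
  show "assoc_algebra R L" by (rule L_assoc_algebra)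
next
  fix g assume g: "g \<in> carrier G"
  then show "ideal (D g) L" by (rule D_ideal)
  have "bij_betw (\<theta> g) (D (inv\<^bsub>G\<^esub> g)) (D g)"
  proof (rule bij_betw_byWitness[where f' = "\<theta> (inv\<^bsub>G\<^esub> g)"])
    show "\<forall>f\<in>D (inv\<^bsub>G\<^esub> g). \<theta> (inv\<^bsub>G\<^esub> g) (\<theta> g f) = f" using theta_theta_inv[OF g] by blast
    show "\<forall>f\<in>D g. \<theta> g (\<theta> (inv\<^bsub>G\<^esub> g) f) = f"
      using theta_theta_inv[OF G.inv_closed[OF g]] g by simp
    show "\<theta> g ` D (inv\<^bsub>G\<^esub> g) \<subseteq> D g" "\<theta> (inv\<^bsub>G\<^esub> g) ` D g \<subseteq> D (inv\<^bsub>G\<^esub> g)"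
      using theta_closed[OF g] theta_closed[OF G.inv_closed[OF g]] D_carrier by blast+
  qed
  then show "ideal_iso R L (D (inv\<^bsub>G\<^esub> g)) (D g) (\<theta> g)"
    unfolding ideal_iso_def using theta_hom[OF g D_carrier D_carrier] by blast
next
  have "\<one>\<^bsub>G\<^esub> \<in> \<xi>" if "\<xi> \<in> \<Omega>" for \<xi> by (rule OmegaD(2)[OF that])
  then show "D \<one>\<^bsub>G\<^esub> = carrier L" unfolding D_iff set_eq_iff by blast
next
  fix f assume f: "f \<in> carrier L"
  show "\<theta> \<one>\<^bsub>G\<^esub> f = f"
    by (rule L_ext[OF D_carrier[OF theta_closed] f])
      (use f in \<open>simp_all add: theta_eval OmegaD(2) tr_one del: G.inv_one\<close>)
next
  fix g h assume gh: "g \<in> carrier G" "h \<in> carrier G"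
  show "\<theta> g ` (D (inv\<^bsub>G\<^esub> g) \<inter> D h) \<subseteq> D (g \<otimes>\<^bsub>G\<^esub> h)"
  proof
    fix k assume "k \<in> \<theta> g ` (D (inv\<^bsub>G\<^esub> g) \<inter> D h)"
    then obtain f where f: "f \<in> D h" "k = \<theta> g f" by blast
    have "k \<xi> = \<zero>\<^bsub>R\<^esub>" if \<xi>: "\<xi> \<in> \<Omega>" and n: "g \<otimes>\<^bsub>G\<^esub> h \<notin> \<xi>" for \<xi>
    proof (cases "g \<in> \<xi>")
      case True
      have "h \<notin> tr g \<xi>" using n gh \<xi> by (simp add: mem_tr_iff)
      then have "f (tr g \<xi>) = \<zero>\<^bsub>R\<^esub>"
        using f(1) translate_in_Omega[OF \<xi> True] unfolding D_iff by blast
      then show ?thesis using f(2) \<xi> by (simp add: theta_eval)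
    qed (use f(2) \<xi> in \<open>simp add: theta_eval\<close>)
    then show "k \<in> D (g \<otimes>\<^bsub>G\<^esub> h)"
      using theta_closed[OF gh(1) D_carrier[OF f(1)]] f(2) unfolding D_iff by blast
  qed
  fix f assume "f \<in> D (inv\<^bsub>G\<^esub> h) \<inter> D (inv\<^bsub>G\<^esub> (g \<otimes>\<^bsub>G\<^esub> h))"
  then have f: "f \<in> D (inv\<^bsub>G\<^esub> h)" "f \<in> carrier L" using D_carrier by blast+
  show "\<theta> g (\<theta> h f) = \<theta> (g \<otimes>\<^bsub>G\<^esub> h) f"
  proof (rule L_ext)
    show "\<theta> g (\<theta> h f) \<in> carrier L" "\<theta> (g \<otimes>\<^bsub>G\<^esub> h) f \<in> carrier L"
      using gh f(2) theta_closed D_carrier by (meson G.m_closed)+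
    fix \<xi> assume \<xi>: "\<xi> \<in> \<Omega>"
    show "\<theta> g (\<theta> h f) \<xi> = \<theta> (g \<otimes>\<^bsub>G\<^esub> h) f \<xi>"
    proof (cases "g \<in> \<xi>")
      case True
      then show ?thesis
        using translate_in_Omega[OF \<xi> True] gh \<xi>
        by (simp add: theta_eval mem_tr_iff tr_tr)
    next
      case False
      show ?thesis
      proof (cases "g \<otimes>\<^bsub>G\<^esub> h \<in> \<xi>")
        case True
        \<comment> \<open>Here the two sides are defined by different cases, and the domain of
          \<open>\<theta> h\<close> decides: \<open>g = (gh) h\<inverse>\<close> is not in
          \<open>\<xi>\<close>, so \<open>h\<inverse>\<close> is not in the translate by
          \<open>gh\<close>, and \<open>f\<close> vanishes there.\<close>
        have "inv\<^bsub>G\<^esub> h \<notin> tr (g \<otimes>\<^bsub>G\<^esub> h) \<xi>"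
          using False gh \<xi> mem_tr_iff[of "g \<otimes>\<^bsub>G\<^esub> h" \<xi> "inv\<^bsub>G\<^esub> h"] by (simp add: G.m_assoc)
        then have "f (tr (g \<otimes>\<^bsub>G\<^esub> h) \<xi>) = \<zero>\<^bsub>R\<^esub>"
          using f(1) translate_in_Omega[OF \<xi> True] unfolding D_iff by blast
        then show ?thesis using False True \<xi> by (simp add: theta_eval)
      qed (use False \<xi> in \<open>simp add: theta_eval\<close>)
    qed
  qed
qed

lemma theta_c:
  assumes "g \<in> carrier G" "h \<in> carrier G"
  shows "\<theta> g (c h \<otimes>\<^bsub>L\<^esub> c (inv\<^bsub>G\<^esub> g)) = c (g \<otimes>\<^bsub>G\<^esub> h) \<otimes>\<^bsub>L\<^esub> c g"
proof (rule L_ext)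
  show "\<theta> g (c h \<otimes>\<^bsub>L\<^esub> c (inv\<^bsub>G\<^esub> g)) \<in> carrier L" "c (g \<otimes>\<^bsub>G\<^esub> h) \<otimes>\<^bsub>L\<^esub> c g \<in> carrier L"
    using assms by (auto intro!: D_carrier[OF theta_closed] L.m_closed c_closed)
  fix \<xi> assume "\<xi> \<in> \<Omega>"
  then show "\<theta> g (c h \<otimes>\<^bsub>L\<^esub> c (inv\<^bsub>G\<^esub> g)) \<xi> = (c (g \<otimes>\<^bsub>G\<^esub> h) \<otimes>\<^bsub>L\<^esub> c g) \<xi>"
    using assms by (simp add: theta_eval L_eval translate_in_Omega mem_tr_iff OmegaD(2))
qed

end

section \<open>The partial skew group ring\<close>

lemma (in abelian_monoid) finsum_swap:
  assumes "finite I" "finite J" "\<And>i j. \<lbrakk>i \<in> I; j \<in> J\<rbrakk> \<Longrightarrow> f i j \<in> carrier G"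
  shows "(\<Oplus>i\<in>I. \<Oplus>j\<in>J. f i j) = (\<Oplus>j\<in>J. \<Oplus>i\<in>I. f i j)"
  using assms
proof (induction I)
  case (insert a I)
  have c: "(\<lambda>j. f a j) \<in> J \<rightarrow> carrier G" "(\<lambda>i. \<Oplus>j\<in>J. f i j) \<in> I \<rightarrow> carrier G"
      "(\<lambda>j. \<Oplus>i\<in>I. f i j) \<in> J \<rightarrow> carrier G"
    using insert.prems by (auto intro!: finsum_closed)
  have "(\<Oplus>i\<in>insert a I. \<Oplus>j\<in>J. f i j) = (\<Oplus>j\<in>J. f a j) \<oplus> (\<Oplus>j\<in>J. \<Oplus>i\<in>I. f i j)"
    using insert c by (simp add: finsum_insert)
  also have "\<dots> = (\<Oplus>j\<in>J. f a j \<oplus> (\<Oplus>i\<in>I. f i j))"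
    using c by (simp add: finsum_addf)
  also have "\<dots> = (\<Oplus>j\<in>J. \<Oplus>i\<in>insert a I. f i j)"
  proof (rule finsum_cong')
    fix j assume j: "j \<in> J"
    have "(\<lambda>i. f i j) \<in> I \<rightarrow> carrier G" "f a j \<in> carrier G" using insert.prems j by auto
    then show "f a j \<oplus> (\<Oplus>i\<in>I. f i j) = (\<Oplus>i\<in>insert a I. f i j)"
      using insert.hyps by (simp add: finsum_insert)
  qed (use insert.prems in \<open>auto intro!: finsum_closed\<close>)
  finally show ?case .
qed simp

context par_setup begin

abbreviation "S \<equiv> skew_group_ring G L (Lc_ideal R G \<R>) (Lc_theta R G \<R>)"
abbreviation "sk a g \<equiv> skew_monom G L a g"

lemma S_simps:
  "\<one>\<^bsub>S\<^esub> = sk \<one>\<^bsub>L\<^esub> \<one>\<^bsub>G\<^esub>" "\<zero>\<^bsub>S\<^esub> = (\<lambda>k\<in>carrier G. \<zero>\<^bsub>L\<^esub>)"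
  "x \<oplus>\<^bsub>S\<^esub> y = (\<lambda>k\<in>carrier G. x k \<oplus>\<^bsub>L\<^esub> y k)" "r \<odot>\<^bsub>S\<^esub> x = (\<lambda>k\<in>carrier G. r \<odot>\<^bsub>L\<^esub> x k)"
  by (simp_all add: skew_group_ring_def skew_monom_def)

lemma S_carrier_iff:
  "x \<in> carrier S \<longleftrightarrow> x \<in> (\<Pi>\<^sub>E g\<in>carrier G. D g) \<and> finite (support G L x)"
  by (simp add: skew_group_ring_def)

lemma S_coeff: "x \<in> carrier S \<Longrightarrow> g \<in> carrier G \<Longrightarrow> x g \<in> D g"
  by (auto simp: S_carrier_iff)

lemma S_coeff_L: "x \<in> carrier S \<Longrightarrow> g \<in> carrier G \<Longrightarrow> x g \<in> carrier L"
  using S_coeff D_carrier by blast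

lemma S_eval_closed: "\<lbrakk>x \<in> carrier S; g \<in> carrier G; \<xi> \<in> \<Omega>\<rbrakk> \<Longrightarrow> x g \<xi> \<in> carrier R"
  using S_coeff_L L_closed by blast

lemma S_eval_zero: "\<lbrakk>x \<in> carrier S; g \<in> carrier G; \<xi> \<in> \<Omega>; g \<notin> \<xi>\<rbrakk> \<Longrightarrow> x g \<xi> = \<zero>\<^bsub>R\<^esub>"
  using S_coeff D_iff by blast

lemma support_subset: "support G L x \<subseteq> carrier G"
  by (auto simp: support_def)

lemma S_finite_support: "x \<in> carrier S \<Longrightarrow> finite (support G L x)"
  by (simp add: S_carrier_iff)

lemma not_support: "\<lbrakk>g \<in> carrier G; g \<notin> support G L x\<rbrakk> \<Longrightarrow> x g = \<zero>\<^bsub>L\<^esub>"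
  by (auto simp: support_def)

text \<open>Elements of the skew group ring are compared through the scalars
  \<open>x k \<xi>\<close>, which turns identities in it into identities between finite sums in
  \<open>R\<close>.\<close>

lemma S_ext:
  assumes "x \<in> carrier S" "y \<in> carrier S"
    and "\<And>k \<xi>. \<lbrakk>k \<in> carrier G; \<xi> \<in> \<Omega>\<rbrakk> \<Longrightarrow> x k \<xi> = y k \<xi>"
  shows "x = y"
proof (rule PiE_ext[of x "carrier G" D y])
  show "x \<in> (\<Pi>\<^sub>E g\<in>carrier G. D g)" "y \<in> (\<Pi>\<^sub>E g\<in>carrier G. D g)"
    using assms(1,2) by (auto simp: S_carrier_iff)
  fix k assume k: "k \<in> carrier G"
  show "x k = y k"
    by (rule L_ext[OF S_coeff_L[OF assms(1) k] S_coeff_L[OF assms(2) k] assms(3)[OF k]])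
qed

lemma finsum_L_eval:
  assumes "\<xi> \<in> \<Omega>" "finite I" "f \<in> I \<rightarrow> carrier L"
  shows "finsum L f I \<xi> = (\<Oplus>\<^bsub>R\<^esub>i\<in>I. f i \<xi>)"
  using assms(2,3)
proof (induction I)
  case empty
  then show ?case using assms(1) by (simp add: L_eval)
next
  case (insert i I)
  then have "(\<lambda>j. f j \<xi>) \<in> I \<rightarrow> carrier R" "f i \<xi> \<in> carrier R"
    using L_closed assms(1) by (auto simp: Pi_iff)
  then show ?case using insert assms(1) by (simp add: L_eval)
qed

text \<open>For \<open>g \<in> \<xi>\<close> the translate \<open>tr g \<xi>\<close> contains
  \<open>g\<inverse>\<close>, and translating it back returns \<open>\<xi>\<close>. The two
  applications of \<open>\<theta>\<close> therefore cancel on the first factor and only the second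
  one is shifted.\<close>

lemma mult_term:
  assumes x: "x \<in> carrier S" and y: "y \<in> carrier S"
    and g: "g \<in> carrier G" and h: "h \<in> carrier G"
  shows "\<theta> g (\<theta> (inv\<^bsub>G\<^esub> g) (x g) \<otimes>\<^bsub>L\<^esub> y h) \<in> carrier L"
    and "\<xi> \<in> \<Omega> \<Longrightarrow> \<theta> g (\<theta> (inv\<^bsub>G\<^esub> g) (x g) \<otimes>\<^bsub>L\<^esub> y h) \<xi> =
      (if g \<in> \<xi> then x g \<xi> \<otimes>\<^bsub>R\<^esub> y h (tr g \<xi>) else \<zero>\<^bsub>R\<^esub>)"
proof -
  have cl: "\<theta> (inv\<^bsub>G\<^esub> g) (x g) \<in> carrier L" "y h \<in> carrier L"
    using S_coeff_L[OF x g] S_coeff_L[OF y h] D_carrier[OF theta_closed] g by auto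
  then show "\<theta> g (\<theta> (inv\<^bsub>G\<^esub> g) (x g) \<otimes>\<^bsub>L\<^esub> y h) \<in> carrier L"
    using D_carrier[OF theta_closed[OF g]] by simp
  assume \<xi>: "\<xi> \<in> \<Omega>"
  show "\<theta> g (\<theta> (inv\<^bsub>G\<^esub> g) (x g) \<otimes>\<^bsub>L\<^esub> y h) \<xi> =
      (if g \<in> \<xi> then x g \<xi> \<otimes>\<^bsub>R\<^esub> y h (tr g \<xi>) else \<zero>\<^bsub>R\<^esub>)"
  proof (cases "g \<in> \<xi>")
    case True
    have "inv\<^bsub>G\<^esub> g \<in> tr g \<xi>" using g OmegaD(2)[OF \<xi>] by (simp add: mem_tr_iff[OF g \<xi>])
    moreover have "tr (inv\<^bsub>G\<^esub> g) (tr g \<xi>) = \<xi>"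
      by (simp only: tr_tr g \<xi> G.inv_closed G.r_inv tr_one)
    ultimately show ?thesis
      using True \<xi> translate_in_Omega[OF \<xi> True] by (simp only: theta_eval L_eval if_True)
  qed (simp add: theta_eval \<xi>)
qed

lemma S_mult_apply:
  "k \<in> carrier G \<Longrightarrow> (x \<otimes>\<^bsub>S\<^esub> y) k = finsum L (\<lambda>(g, h). \<theta> g (\<theta> (inv\<^bsub>G\<^esub> g) (x g) \<otimes>\<^bsub>L\<^esub> y h))
    {(g, h) \<in> support G L x \<times> support G L y. g \<otimes>\<^bsub>G\<^esub> h = k}"
  by (simp add: skew_group_ring_def)

text \<open>Pointwise the product is the convolution over the pairs \<open>(g, \<xi>)\<close> with \<open>g \<in> \<xi>\<close>. The sum may run over any
  finite set that contains the support, which is what the rearrangements of sums below need.\<close>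

lemma S_mult_eval:
  assumes x: "x \<in> carrier S" and y: "y \<in> carrier S"
    and N: "finite N" "support G L x \<subseteq> N" "N \<subseteq> carrier G"
    and k: "k \<in> carrier G" and \<xi>: "\<xi> \<in> \<Omega>"
  shows "(x \<otimes>\<^bsub>S\<^esub> y) k \<xi> = (\<Oplus>\<^bsub>R\<^esub>g\<in>N \<inter> \<xi>. x g \<xi> \<otimes>\<^bsub>R\<^esub> y (inv\<^bsub>G\<^esub> g \<otimes>\<^bsub>G\<^esub> k) (tr g \<xi>))"
proof -
  let ?t = "\<lambda>(g, h). \<theta> g (\<theta> (inv\<^bsub>G\<^esub> g) (x g) \<otimes>\<^bsub>L\<^esub> y h)"
  let ?I = "{(g, h) \<in> support G L x \<times> support G L y. g \<otimes>\<^bsub>G\<^esub> h = k}"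
  let ?I' = "{g \<in> support G L x. inv\<^bsub>G\<^esub> g \<otimes>\<^bsub>G\<^esub> k \<in> support G L y}"
  let ?u = "\<lambda>g. if g \<in> \<xi> then x g \<xi> \<otimes>\<^bsub>R\<^esub> y (inv\<^bsub>G\<^esub> g \<otimes>\<^bsub>G\<^esub> k) (tr g \<xi>) else \<zero>\<^bsub>R\<^esub>"
  have fin: "finite (support G L x)" "finite (support G L y)"
    using S_finite_support x y by auto
  \<comment> \<open>The second index is forced to be \<open>g\<inverse> k\<close>, so the sum over
    pairs is a sum over \<open>g\<close> alone.\<close>
  have I: "?I = (\<lambda>g. (g, inv\<^bsub>G\<^esub> g \<otimes>\<^bsub>G\<^esub> k)) ` ?I'"
  proof (intro equalityI subsetI)
    fix p assume "p \<in> ?I"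
    then obtain g h where p: "p = (g, h)" "g \<in> support G L x" "h \<in> support G L y" "g \<otimes>\<^bsub>G\<^esub> h = k"
      by blast
    then have "inv\<^bsub>G\<^esub> g \<otimes>\<^bsub>G\<^esub> k = h"
      using support_subset[of x] support_subset[of y] by (auto simp: G.m_assoc[symmetric] subset_iff)
    then show "p \<in> (\<lambda>g. (g, inv\<^bsub>G\<^esub> g \<otimes>\<^bsub>G\<^esub> k)) ` ?I'" using p by blast
  next
    fix p assume "p \<in> (\<lambda>g. (g, inv\<^bsub>G\<^esub> g \<otimes>\<^bsub>G\<^esub> k)) ` ?I'"
    then obtain g where g: "p = (g, inv\<^bsub>G\<^esub> g \<otimes>\<^bsub>G\<^esub> k)" "g \<in> ?I'" by blast
    then have "g \<in> carrier G" using support_subset by blast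
    then have "g \<otimes>\<^bsub>G\<^esub> (inv\<^bsub>G\<^esub> g \<otimes>\<^bsub>G\<^esub> k) = k" using k by (simp add: G.m_assoc[symmetric])
    then show "p \<in> ?I" using g by blast
  qed
  have "finite (support G L x \<times> support G L y)" using fin by simp
  then have finI: "finite ?I" by (rule rev_finite_subset) auto
  have tc: "?t p \<in> carrier L" if "p \<in> ?I" for p
    using that mult_term(1)[OF x y] support_subset by (auto simp: subset_iff)
  have uc: "?u g \<in> carrier R" if "g \<in> carrier G" for g
    using that k \<xi> S_eval_closed[OF x that \<xi>]
      S_eval_closed[OF y _ translate_in_Omega[OF \<xi>], of "inv\<^bsub>G\<^esub> g \<otimes>\<^bsub>G\<^esub> k"] by simp
  have "(x \<otimes>\<^bsub>S\<^esub> y) k \<xi> = finsum L ?t ?I \<xi>"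
    using k by (simp add: skew_group_ring_def)
  also have "\<dots> = (\<Oplus>\<^bsub>R\<^esub>p\<in>?I. ?t p \<xi>)"
    by (rule finsum_L_eval[OF \<xi> finI]) (use tc in blast)
  also have "\<dots> = (\<Oplus>\<^bsub>R\<^esub>g\<in>?I'. ?t (g, inv\<^bsub>G\<^esub> g \<otimes>\<^bsub>G\<^esub> k) \<xi>)"
    unfolding I
  proof (rule R.finsum_reindex)
    show "(\<lambda>p. ?t p \<xi>) \<in> (\<lambda>g. (g, inv\<^bsub>G\<^esub> g \<otimes>\<^bsub>G\<^esub> k)) ` ?I' \<rightarrow> carrier R"
      unfolding I[symmetric] using L_closed[OF tc \<xi>] by blast
  qed (simp add: inj_on_def)
  \<comment> \<open>The two index sets differ by vanishing terms: for \<open>g\<close> in the new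
    set only, one of the two coefficients is zero; for \<open>g\<close> in the old set only,
    \<open>g \<notin> \<xi>\<close> and the term is 0 at \<open>\<xi>\<close>.\<close>
  also have "\<dots> = (\<Oplus>\<^bsub>R\<^esub>g\<in>N \<inter> \<xi>. x g \<xi> \<otimes>\<^bsub>R\<^esub> y (inv\<^bsub>G\<^esub> g \<otimes>\<^bsub>G\<^esub> k) (tr g \<xi>))"
  proof (rule R.add.finprod_mono_neutral_cong)
    show "finite (N \<inter> \<xi>)" "finite ?I'" using N fin by auto
    have t_eq: "?t (g, inv\<^bsub>G\<^esub> g \<otimes>\<^bsub>G\<^esub> k) \<xi> = ?u g" if "g \<in> carrier G" for g
      using mult_term(2)[OF x y that _ \<xi>, of "inv\<^bsub>G\<^esub> g \<otimes>\<^bsub>G\<^esub> k"] that k by simp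
    have I'G: "g \<in> carrier G" if "g \<in> ?I'" for g using that support_subset by auto
    show "(\<lambda>g. ?t (g, inv\<^bsub>G\<^esub> g \<otimes>\<^bsub>G\<^esub> k) \<xi>) \<in> ?I' \<rightarrow> carrier R"
      using t_eq uc I'G by (intro funcsetI) (simp only:)
    show "(\<lambda>g. x g \<xi> \<otimes>\<^bsub>R\<^esub> y (inv\<^bsub>G\<^esub> g \<otimes>\<^bsub>G\<^esub> k) (tr g \<xi>)) \<in> N \<inter> \<xi> \<rightarrow> carrier R"
    proof
      fix g assume "g \<in> N \<inter> \<xi>"
      then show "x g \<xi> \<otimes>\<^bsub>R\<^esub> y (inv\<^bsub>G\<^esub> g \<otimes>\<^bsub>G\<^esub> k) (tr g \<xi>) \<in> carrier R"
        using uc[of g] N by auto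
    qed
    fix g
    { assume g: "g \<in> N \<inter> \<xi> - ?I'"
      then have gG: "g \<in> carrier G" "g \<in> \<xi>" using N by auto
      have k': "inv\<^bsub>G\<^esub> g \<otimes>\<^bsub>G\<^esub> k \<in> carrier G" using gG k by simp
      have tr: "tr g \<xi> \<in> \<Omega>" by (rule translate_in_Omega[OF \<xi> gG(2)])
      have "x g = \<zero>\<^bsub>L\<^esub> \<or> y (inv\<^bsub>G\<^esub> g \<otimes>\<^bsub>G\<^esub> k) = \<zero>\<^bsub>L\<^esub>"
        using g not_support[OF gG(1), of x] not_support[OF k', of y] by blast
      then show "x g \<xi> \<otimes>\<^bsub>R\<^esub> y (inv\<^bsub>G\<^esub> g \<otimes>\<^bsub>G\<^esub> k) (tr g \<xi>) = \<zero>\<^bsub>R\<^esub>"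
        using S_eval_closed[OF x gG(1) \<xi>] S_eval_closed[OF y k' tr] \<xi> tr by (auto simp: L_eval) }
    { assume g: "g \<in> ?I' - N \<inter> \<xi>"
      then have "g \<notin> \<xi>" "g \<in> carrier G" using N I'G by auto
      then show "?t (g, inv\<^bsub>G\<^esub> g \<otimes>\<^bsub>G\<^esub> k) \<xi> = \<zero>\<^bsub>R\<^esub>" by (simp only: t_eq if_False) }
    { assume g: "g \<in> ?I' \<inter> (N \<inter> \<xi>)"
      then have "g \<in> \<xi>" "g \<in> carrier G" using I'G by auto
      then show "?t (g, inv\<^bsub>G\<^esub> g \<otimes>\<^bsub>G\<^esub> k) \<xi> =
          x g \<xi> \<otimes>\<^bsub>R\<^esub> y (inv\<^bsub>G\<^esub> g \<otimes>\<^bsub>G\<^esub> k) (tr g \<xi>)" by (simp only: t_eq if_True) }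
  qed
  finally show ?thesis .
qed

lemma S_mult_support:
  assumes "k \<in> support G L (x \<otimes>\<^bsub>S\<^esub> y)"
  obtains g h where "g \<in> support G L x" "h \<in> support G L y" "k = g \<otimes>\<^bsub>G\<^esub> h"
proof -
  let ?I = "{(g, h) \<in> support G L x \<times> support G L y. g \<otimes>\<^bsub>G\<^esub> h = k}"
  have "?I \<noteq> {}"
  proof
    assume e: "?I = {}"
    have "k \<in> carrier G" using assms support_subset by blast
    then have "(x \<otimes>\<^bsub>S\<^esub> y) k = \<zero>\<^bsub>L\<^esub>"
      by (simp only: S_mult_apply e L.M.finsum_empty)
    then show False using assms by (simp add: support_def)
  qed
  then show ?thesis using that by blast
qed

lemma S_mult_closed:
  assumes x: "x \<in> carrier S" and y: "y \<in> carrier S"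
  shows "x \<otimes>\<^bsub>S\<^esub> y \<in> carrier S"
  unfolding S_carrier_iff
proof
  have "support G L (x \<otimes>\<^bsub>S\<^esub> y) \<subseteq> (\<lambda>(g, h). g \<otimes>\<^bsub>G\<^esub> h) ` (support G L x \<times> support G L y)"
    by (auto elim!: S_mult_support)
  then show "finite (support G L (x \<otimes>\<^bsub>S\<^esub> y))"
    using S_finite_support[OF x] S_finite_support[OF y] by (meson finite_SigmaI finite_imageI finite_subset)
  have "(x \<otimes>\<^bsub>S\<^esub> y) k \<in> D k" if k: "k \<in> carrier G" for k
    unfolding D_iff
  proof (intro conjI ballI impI)
    show "(x \<otimes>\<^bsub>S\<^esub> y) k \<in> carrier L"
      using k mult_term(1)[OF x y] support_subset
      by (simp add: skew_group_ring_def) (rule L.M.finsum_closed, force simp: subset_iff)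
    fix \<xi> assume \<xi>: "\<xi> \<in> \<Omega>" and n: "k \<notin> \<xi>"
    have "x g \<xi> \<otimes>\<^bsub>R\<^esub> y (inv\<^bsub>G\<^esub> g \<otimes>\<^bsub>G\<^esub> k) (tr g \<xi>) = \<zero>\<^bsub>R\<^esub>"
      if "g \<in> support G L x \<inter> \<xi>" for g
    proof -
      have g: "g \<in> carrier G" "g \<in> \<xi>" using that support_subset by auto
      have k': "inv\<^bsub>G\<^esub> g \<otimes>\<^bsub>G\<^esub> k \<in> carrier G" using g k by simp
      \<comment> \<open>Since \<open>k \<notin> \<xi>\<close>, the translate by \<open>g\<close>
        does not contain \<open>g\<inverse> k\<close>, and the coefficient of \<open>y\<close> at
        \<open>g\<inverse> k\<close> vanishes there.\<close>
      have "inv\<^bsub>G\<^esub> g \<otimes>\<^bsub>G\<^esub> k \<notin> tr g \<xi>"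
        using n g k \<xi> by (simp add: mem_tr_iff G.m_assoc[symmetric])
      then show ?thesis
        using S_eval_zero[OF y k' translate_in_Omega[OF \<xi> g(2)]] S_eval_closed[OF x g(1) \<xi>] by simp
    qed
    then show "(x \<otimes>\<^bsub>S\<^esub> y) k \<xi> = \<zero>\<^bsub>R\<^esub>"
      unfolding S_mult_eval[OF x y S_finite_support[OF x] subset_refl support_subset k \<xi>]
      by (rule R.add.finprod_one_eqI)
  qed
  then show "x \<otimes>\<^bsub>S\<^esub> y \<in> (\<Pi>\<^sub>E g\<in>carrier G. D g)"
    by (auto simp: PiE_iff) (simp add: skew_group_ring_def)
qed

text \<open>Partial skew group rings are not associative in general. Here, at a point
  \<open>\<xi>\<close>, both sides are double sums over \<open>h\<close> and \<open>g\<close> in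
  \<open>\<xi>\<close> of the products \<open>x h\<close> at \<open>\<xi>\<close>,
  \<open>y (h\<inverse> g)\<close> at \<open>h\<inverse> \<xi>\<close>,
  \<open>z (g\<inverse> k)\<close> at \<open>g\<inverse> \<xi>\<close>; they agree by associativity
  in \<open>R\<close> and an exchange of the sums.\<close>

lemma S_mult_assoc:
  assumes x: "x \<in> carrier S" and y: "y \<in> carrier S" and z: "z \<in> carrier S"
  shows "x \<otimes>\<^bsub>S\<^esub> y \<otimes>\<^bsub>S\<^esub> z = x \<otimes>\<^bsub>S\<^esub> (y \<otimes>\<^bsub>S\<^esub> z)"
proof (rule S_ext)
  show "x \<otimes>\<^bsub>S\<^esub> y \<otimes>\<^bsub>S\<^esub> z \<in> carrier S" "x \<otimes>\<^bsub>S\<^esub> (y \<otimes>\<^bsub>S\<^esub> z) \<in> carrier S"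
    using x y z S_mult_closed by auto
  fix k \<xi> assume k: "k \<in> carrier G" and \<xi>: "\<xi> \<in> \<Omega>"
  let ?N = "support G L x"
  \<comment> \<open>It bounds the support of the product of \<open>x\<close> and \<open>y\<close>.
    With a range for \<open>g\<close> that does not depend on \<open>h\<close> the two sums can be
    exchanged.\<close>
  let ?N' = "(\<lambda>(g, h). g \<otimes>\<^bsub>G\<^esub> h) ` (?N \<times> support G L y)"
  have N: "finite ?N" "?N \<subseteq> carrier G" using x S_finite_support support_subset by auto
  have N': "finite ?N'" "?N' \<subseteq> carrier G"
    using N S_finite_support[OF y] support_subset[of y] by (auto simp: subset_iff)
  have sub: "support G L (x \<otimes>\<^bsub>S\<^esub> y) \<subseteq> ?N'" by (auto elim!: S_mult_support)
  let ?a = "\<lambda>h. x h \<xi>"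
  let ?b = "\<lambda>h g. y (inv\<^bsub>G\<^esub> h \<otimes>\<^bsub>G\<^esub> g) (tr h \<xi>)"
  let ?c = "\<lambda>g. z (inv\<^bsub>G\<^esub> g \<otimes>\<^bsub>G\<^esub> k) (tr g \<xi>)"
  have ac: "?a h \<in> carrier R" if "h \<in> ?N \<inter> \<xi>" for h
    by (rule S_eval_closed[OF x _ \<xi>]) (use that N in auto)
  have bc: "?b h g \<in> carrier R" if "h \<in> ?N \<inter> \<xi>" "g \<in> ?N' \<inter> \<xi>" for h g
    by (rule S_eval_closed[OF y _ translate_in_Omega[OF \<xi>]]) (use that subsetD[OF N(2)] subsetD[OF N'(2)] in \<open>simp_all del: image_iff\<close>)
  have cc: "?c g \<in> carrier R" if "g \<in> ?N' \<inter> \<xi>" for g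
    by (rule S_eval_closed[OF z _ translate_in_Omega[OF \<xi>]]) (use that subsetD[OF N'(2)] k in \<open>simp_all del: image_iff\<close>)
  have fin: "finite (?N \<inter> \<xi>)" "finite (?N' \<inter> \<xi>)" using N N' by auto
  have "(x \<otimes>\<^bsub>S\<^esub> y \<otimes>\<^bsub>S\<^esub> z) k \<xi> = (\<Oplus>\<^bsub>R\<^esub>g\<in>?N' \<inter> \<xi>. (x \<otimes>\<^bsub>S\<^esub> y) g \<xi> \<otimes>\<^bsub>R\<^esub> ?c g)"
    by (rule S_mult_eval[OF S_mult_closed[OF x y] z N'(1) sub N'(2) k \<xi>])
  also have "\<dots> = (\<Oplus>\<^bsub>R\<^esub>g\<in>?N' \<inter> \<xi>. \<Oplus>\<^bsub>R\<^esub>h\<in>?N \<inter> \<xi>. ?a h \<otimes>\<^bsub>R\<^esub> (?b h g \<otimes>\<^bsub>R\<^esub> ?c g))"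
  proof (rule R.finsum_cong')
    fix g assume g: "g \<in> ?N' \<inter> \<xi>"
    then have gG: "g \<in> carrier G" using N' by blast
    have "(x \<otimes>\<^bsub>S\<^esub> y) g \<xi> \<otimes>\<^bsub>R\<^esub> ?c g = (\<Oplus>\<^bsub>R\<^esub>h\<in>?N \<inter> \<xi>. ?a h \<otimes>\<^bsub>R\<^esub> ?b h g) \<otimes>\<^bsub>R\<^esub> ?c g"
      by (simp only: S_mult_eval[OF x y N(1) subset_refl N(2) gG \<xi>])
    also have "\<dots> = (\<Oplus>\<^bsub>R\<^esub>h\<in>?N \<inter> \<xi>. ?a h \<otimes>\<^bsub>R\<^esub> ?b h g \<otimes>\<^bsub>R\<^esub> ?c g)"
      by (rule R.finsum_ldistr[OF fin(1) cc[OF g]]) (use ac bc[OF _ g] in blast)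
    also have "\<dots> = (\<Oplus>\<^bsub>R\<^esub>h\<in>?N \<inter> \<xi>. ?a h \<otimes>\<^bsub>R\<^esub> (?b h g \<otimes>\<^bsub>R\<^esub> ?c g))"
      by (rule R.finsum_cong') (use R.m_assoc[OF ac bc[OF _ g] cc[OF g]] ac bc[OF _ g] cc[OF g] in \<open>auto simp del: image_iff\<close>)
    finally show "(x \<otimes>\<^bsub>S\<^esub> y) g \<xi> \<otimes>\<^bsub>R\<^esub> ?c g = (\<Oplus>\<^bsub>R\<^esub>h\<in>?N \<inter> \<xi>. ?a h \<otimes>\<^bsub>R\<^esub> (?b h g \<otimes>\<^bsub>R\<^esub> ?c g))" .
  next
    show "(\<lambda>g. \<Oplus>\<^bsub>R\<^esub>h\<in>?N \<inter> \<xi>. ?a h \<otimes>\<^bsub>R\<^esub> (?b h g \<otimes>\<^bsub>R\<^esub> ?c g)) \<in> ?N' \<inter> \<xi> \<rightarrow> carrier R"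
      using ac bc cc by (intro funcsetI R.finsum_closed) (simp del: image_iff)
  qed simp
  also have "\<dots> = (\<Oplus>\<^bsub>R\<^esub>h\<in>?N \<inter> \<xi>. \<Oplus>\<^bsub>R\<^esub>g\<in>?N' \<inter> \<xi>. ?a h \<otimes>\<^bsub>R\<^esub> (?b h g \<otimes>\<^bsub>R\<^esub> ?c g))"
    by (rule R.finsum_swap[OF fin(2,1)]) (use ac bc cc in \<open>simp del: image_iff\<close>)
  also have "\<dots> = (\<Oplus>\<^bsub>R\<^esub>h\<in>?N \<inter> \<xi>. ?a h \<otimes>\<^bsub>R\<^esub> (y \<otimes>\<^bsub>S\<^esub> z) (inv\<^bsub>G\<^esub> h \<otimes>\<^bsub>G\<^esub> k) (tr h \<xi>))"
  proof (rule R.finsum_cong')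
    fix h assume h: "h \<in> ?N \<inter> \<xi>"
    then have hG: "h \<in> carrier G" "h \<in> \<xi>" using N by auto
    \<comment> \<open>The change of variables \<open>m = h\<inverse> g\<close> identifies the
      summation index in the product of \<open>y\<close> and \<open>z\<close> at
      \<open>h\<inverse> \<xi>\<close> with the outer index \<open>g\<close> at
      \<open>\<xi>\<close>.\<close>
    let ?f = "\<lambda>g. inv\<^bsub>G\<^esub> h \<otimes>\<^bsub>G\<^esub> g"
    have M: "finite (?f ` ?N')" "?f ` ?N' \<subseteq> carrier G"
      using N' hG by (simp, blast intro: G.m_closed G.inv_closed)
    have "support G L y \<subseteq> ?f ` ?N'"
    proof
      fix m assume m: "m \<in> support G L y"
      then have "m = ?f (h \<otimes>\<^bsub>G\<^esub> m)"
        using hG support_subset[of y] by (simp add: G.m_assoc[symmetric] subset_iff)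
      then show "m \<in> ?f ` ?N'" using h m by blast
    qed
    note ev = S_mult_eval[OF y z M(1) this M(2) _ translate_in_Omega[OF \<xi> hG(2)], of "inv\<^bsub>G\<^esub> h \<otimes>\<^bsub>G\<^esub> k"]
    have im: "?f ` ?N' \<inter> tr h \<xi> = ?f ` (?N' \<inter> \<xi>)"
    proof -
      have "?f g \<in> tr h \<xi> \<longleftrightarrow> g \<in> \<xi>" if "g \<in> ?N'" for g
        using hG \<xi> subsetD[OF N'(2) that] by (simp add: mem_tr_iff G.m_assoc[symmetric])
      then show ?thesis by blast
    qed
    have rw: "y (?f g) (tr h \<xi>) \<otimes>\<^bsub>R\<^esub> z (inv\<^bsub>G\<^esub> (?f g) \<otimes>\<^bsub>G\<^esub> (inv\<^bsub>G\<^esub> h \<otimes>\<^bsub>G\<^esub> k)) (tr (?f g) (tr h \<xi>)) =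
        ?b h g \<otimes>\<^bsub>R\<^esub> ?c g" if "g \<in> ?N' \<inter> \<xi>" for g
    proof -
      have gG: "g \<in> carrier G" using that N' by blast
      have 1: "inv\<^bsub>G\<^esub> (?f g) \<otimes>\<^bsub>G\<^esub> (inv\<^bsub>G\<^esub> h \<otimes>\<^bsub>G\<^esub> k) = inv\<^bsub>G\<^esub> g \<otimes>\<^bsub>G\<^esub> k"
      proof -
        have "h \<otimes>\<^bsub>G\<^esub> (inv\<^bsub>G\<^esub> h \<otimes>\<^bsub>G\<^esub> k) = k" using hG k by (simp add: G.m_assoc[symmetric])
        then show ?thesis using gG hG k by (simp add: G.inv_mult_group G.m_assoc)
      qed
      have 2: "tr (?f g) (tr h \<xi>) = tr g \<xi>"
        using gG hG \<xi> by (simp add: tr_tr del: G.inv_mult_group) (simp add: G.m_assoc[symmetric])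
      show ?thesis unfolding 1 2 ..
    qed
    have "(y \<otimes>\<^bsub>S\<^esub> z) (inv\<^bsub>G\<^esub> h \<otimes>\<^bsub>G\<^esub> k) (tr h \<xi>) =
      (\<Oplus>\<^bsub>R\<^esub>g\<in>?N' \<inter> \<xi>. y (?f g) (tr h \<xi>) \<otimes>\<^bsub>R\<^esub> z (inv\<^bsub>G\<^esub> (?f g) \<otimes>\<^bsub>G\<^esub> (inv\<^bsub>G\<^esub> h \<otimes>\<^bsub>G\<^esub> k)) (tr (?f g) (tr h \<xi>)))"
      unfolding ev[OF G.m_closed[OF G.inv_closed[OF hG(1)] k]] im
    proof (rule R.finsum_reindex)
      show "inj_on ?f (?N' \<inter> \<xi>)"
        using N'(2) by (intro inj_on_subset[OF G.inj_on_cmult[OF G.inv_closed[OF hG(1)]]]) blast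
      show "(\<lambda>g. y g (tr h \<xi>) \<otimes>\<^bsub>R\<^esub> z (inv\<^bsub>G\<^esub> g \<otimes>\<^bsub>G\<^esub> (inv\<^bsub>G\<^esub> h \<otimes>\<^bsub>G\<^esub> k)) (tr g (tr h \<xi>)))
          \<in> ?f ` (?N' \<inter> \<xi>) \<rightarrow> carrier R"
      proof
        fix m assume "m \<in> ?f ` (?N' \<inter> \<xi>)"
        then obtain g where g: "g \<in> ?N' \<inter> \<xi>" "m = ?f g" by blast
        show "y m (tr h \<xi>) \<otimes>\<^bsub>R\<^esub> z (inv\<^bsub>G\<^esub> m \<otimes>\<^bsub>G\<^esub> (inv\<^bsub>G\<^esub> h \<otimes>\<^bsub>G\<^esub> k)) (tr m (tr h \<xi>)) \<in> carrier R"
          unfolding g(2) rw[OF g(1)] by (rule R.m_closed[OF bc[OF h g(1)] cc[OF g(1)]])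
      qed
    qed
    also have "\<dots> = (\<Oplus>\<^bsub>R\<^esub>g\<in>?N' \<inter> \<xi>. ?b h g \<otimes>\<^bsub>R\<^esub> ?c g)"
    proof (rule R.finsum_cong'[OF refl])
      show "(\<lambda>g. ?b h g \<otimes>\<^bsub>R\<^esub> ?c g) \<in> ?N' \<inter> \<xi> \<rightarrow> carrier R"
        by (intro funcsetI R.m_closed[OF bc[OF h] cc])
    qed (rule rw)
    finally have yz: "(y \<otimes>\<^bsub>S\<^esub> z) (inv\<^bsub>G\<^esub> h \<otimes>\<^bsub>G\<^esub> k) (tr h \<xi>) = \<dots>" .
    show "(\<Oplus>\<^bsub>R\<^esub>g\<in>?N' \<inter> \<xi>. ?a h \<otimes>\<^bsub>R\<^esub> (?b h g \<otimes>\<^bsub>R\<^esub> ?c g)) =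
        ?a h \<otimes>\<^bsub>R\<^esub> (y \<otimes>\<^bsub>S\<^esub> z) (inv\<^bsub>G\<^esub> h \<otimes>\<^bsub>G\<^esub> k) (tr h \<xi>)"
      unfolding yz
      by (rule R.finsum_rdistr[OF fin(2) ac[OF h], symmetric])
        (intro funcsetI R.m_closed[OF bc[OF h] cc])
  next
    show "(\<lambda>h. ?a h \<otimes>\<^bsub>R\<^esub> (y \<otimes>\<^bsub>S\<^esub> z) (inv\<^bsub>G\<^esub> h \<otimes>\<^bsub>G\<^esub> k) (tr h \<xi>)) \<in> ?N \<inter> \<xi> \<rightarrow> carrier R"
    proof
      fix h assume h: "h \<in> ?N \<inter> \<xi>"
      then have "(y \<otimes>\<^bsub>S\<^esub> z) (inv\<^bsub>G\<^esub> h \<otimes>\<^bsub>G\<^esub> k) (tr h \<xi>) \<in> carrier R"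
        using N k by (intro S_eval_closed[OF S_mult_closed[OF y z] _ translate_in_Omega[OF \<xi>]]) auto
      then show "?a h \<otimes>\<^bsub>R\<^esub> (y \<otimes>\<^bsub>S\<^esub> z) (inv\<^bsub>G\<^esub> h \<otimes>\<^bsub>G\<^esub> k) (tr h \<xi>) \<in> carrier R"
        using ac[OF h] by simp
    qed
  qed simp
  also have "\<dots> = (x \<otimes>\<^bsub>S\<^esub> (y \<otimes>\<^bsub>S\<^esub> z)) k \<xi>"
    by (rule S_mult_eval[OF x S_mult_closed[OF y z] N(1) subset_refl N(2) k \<xi>, symmetric])
  finally show "(x \<otimes>\<^bsub>S\<^esub> y \<otimes>\<^bsub>S\<^esub> z) k \<xi> = (x \<otimes>\<^bsub>S\<^esub> (y \<otimes>\<^bsub>S\<^esub> z)) k \<xi>" .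
qed

lemma S_combine_closed:
  assumes x: "x \<in> carrier S" and y: "y \<in> carrier S"
    and op: "\<And>g a b. \<lbrakk>g \<in> carrier G; a \<in> D g; b \<in> D g\<rbrakk> \<Longrightarrow> op a b \<in> D g"
    and zero: "op \<zero>\<^bsub>L\<^esub> \<zero>\<^bsub>L\<^esub> = \<zero>\<^bsub>L\<^esub>"
  shows "(\<lambda>k\<in>carrier G. op (x k) (y k)) \<in> carrier S"
  unfolding S_carrier_iff
proof
  show "(\<lambda>k\<in>carrier G. op (x k) (y k)) \<in> (\<Pi>\<^sub>E g\<in>carrier G. D g)"
    using op S_coeff[OF x] S_coeff[OF y] by auto
  have "support G L (\<lambda>k\<in>carrier G. op (x k) (y k)) \<subseteq> support G L x \<union> support G L y"
    using zero by (auto simp: support_def)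
  then show "finite (support G L (\<lambda>k\<in>carrier G. op (x k) (y k)))"
    using S_finite_support[OF x] S_finite_support[OF y] by (meson finite_UnI finite_subset)
qed

lemma skew_monom_closed:
  assumes g: "g \<in> carrier G" and a: "a \<in> D g"
  shows "sk a g \<in> carrier S"
  unfolding S_carrier_iff
proof
  have "\<zero>\<^bsub>L\<^esub> \<in> D k" for k unfolding D_iff by (simp add: L_eval)
  then show "sk a g \<in> (\<Pi>\<^sub>E g\<in>carrier G. D g)" using a by (auto simp: skew_monom_def)
  have "support G L (sk a g) \<subseteq> {g}" by (auto simp: support_def skew_monom_def)
  then show "finite (support G L (sk a g))" by (rule finite_subset) simp
qed

lemma skew_monom_eval:
  "\<lbrakk>k \<in> carrier G; \<xi> \<in> \<Omega>\<rbrakk> \<Longrightarrow> sk a g k \<xi> = (if k = g then a \<xi> else \<zero>\<^bsub>R\<^esub>)"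
  by (simp add: skew_monom_def L_eval)

lemma skew_monom_mult_eval:
  assumes g: "g \<in> carrier G" and a: "a \<in> D g" and y: "y \<in> carrier S"
    and k: "k \<in> carrier G" and \<xi>: "\<xi> \<in> \<Omega>"
  shows "(sk a g \<otimes>\<^bsub>S\<^esub> y) k \<xi> =
    (if g \<in> \<xi> then a \<xi> \<otimes>\<^bsub>R\<^esub> y (inv\<^bsub>G\<^esub> g \<otimes>\<^bsub>G\<^esub> k) (tr g \<xi>) else \<zero>\<^bsub>R\<^esub>)"
proof -
  have "support G L (sk a g) \<subseteq> {g}" by (auto simp: support_def skew_monom_def)
  note ev = S_mult_eval[OF skew_monom_closed[OF g a] y _ this _ k \<xi>]
  show ?thesis
  proof (cases "g \<in> \<xi>")
    case True
    have "a \<xi> \<otimes>\<^bsub>R\<^esub> y (inv\<^bsub>G\<^esub> g \<otimes>\<^bsub>G\<^esub> k) (tr g \<xi>) \<in> carrier R"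
      by (intro R.m_closed L_closed[OF D_carrier[OF a] \<xi>] S_eval_closed[OF y _ translate_in_Omega[OF \<xi> True]])
        (use g k in simp)
    then show ?thesis using ev g \<xi> True by (simp add: skew_monom_eval)
  next
    case False
    then show ?thesis using ev g by simp
  qed
qed

lemma S_ring: "ring S"
proof (rule ringI)
  have add: "x \<oplus>\<^bsub>S\<^esub> y \<in> carrier S" if "x \<in> carrier S" "y \<in> carrier S" for x y
    unfolding S_simps using that
    by (rule S_combine_closed) (auto simp: D_iff L_eval)
  have add_eval: "(x \<oplus>\<^bsub>S\<^esub> y) k \<xi> = x k \<xi> \<oplus>\<^bsub>R\<^esub> y k \<xi>" if "k \<in> carrier G" "\<xi> \<in> \<Omega>" for x y k \<xi>
    using that by (simp add: S_simps L_eval)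
  have zero: "\<zero>\<^bsub>S\<^esub> \<in> carrier S"
    by (auto simp: S_carrier_iff S_simps D_iff L_eval support_def)
  have zero_eval: "\<zero>\<^bsub>S\<^esub> k \<xi> = \<zero>\<^bsub>R\<^esub>" if "k \<in> carrier G" "\<xi> \<in> \<Omega>" for k \<xi>
    using that by (simp add: S_simps L_eval)
  have one: "\<one>\<^bsub>S\<^esub> \<in> carrier S"
    unfolding S_simps by (rule skew_monom_closed) (auto simp: D_iff OmegaD)
  show "abelian_group S"
  proof (rule abelian_groupI)
    fix x assume x: "x \<in> carrier S"
    have neg: "(\<lambda>k\<in>carrier G. \<ominus>\<^bsub>L\<^esub> x k) \<in> carrier S"
      by (rule S_combine_closed[OF x x, of "\<lambda>a _. \<ominus>\<^bsub>L\<^esub> a"])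
        (auto intro: additive_subgroup.a_inv_closed[OF ideal.axioms(1)[OF D_ideal]])
    have "(\<lambda>k\<in>carrier G. \<ominus>\<^bsub>L\<^esub> x k) \<oplus>\<^bsub>S\<^esub> x = \<zero>\<^bsub>S\<^esub>"
      unfolding S_simps using S_coeff_L[OF x] by (intro restrict_ext) (simp add: L.M.l_neg)
    then show "\<exists>y\<in>carrier S. y \<oplus>\<^bsub>S\<^esub> x = \<zero>\<^bsub>S\<^esub>" using neg by blast
    show "\<zero>\<^bsub>S\<^esub> \<oplus>\<^bsub>S\<^esub> x = x"
      by (rule S_ext[OF add[OF zero x] x]) (simp add: add_eval zero_eval S_eval_closed[OF x])
    fix y assume y: "y \<in> carrier S"
    show "x \<oplus>\<^bsub>S\<^esub> y \<in> carrier S" by (rule add[OF x y])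
    show "x \<oplus>\<^bsub>S\<^esub> y = y \<oplus>\<^bsub>S\<^esub> x"
      by (rule S_ext[OF add[OF x y] add[OF y x]])
        (simp add: add_eval R.a_comm S_eval_closed[OF x] S_eval_closed[OF y])
    fix z assume z: "z \<in> carrier S"
    show "x \<oplus>\<^bsub>S\<^esub> y \<oplus>\<^bsub>S\<^esub> z = x \<oplus>\<^bsub>S\<^esub> (y \<oplus>\<^bsub>S\<^esub> z)"
      by (rule S_ext[OF add[OF add[OF x y] z] add[OF x add[OF y z]]])
        (simp add: add_eval R.a_assoc S_eval_closed[OF x] S_eval_closed[OF y] S_eval_closed[OF z])
  qed (rule zero)
  show "monoid S"
  proof (rule monoidI)
    fix x assume x: "x \<in> carrier S"
    show "\<one>\<^bsub>S\<^esub> \<otimes>\<^bsub>S\<^esub> x = x"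
    proof (rule S_ext[OF S_mult_closed[OF one x] x])
      fix k \<xi> assume k: "k \<in> carrier G" and \<xi>: "\<xi> \<in> \<Omega>"
      have "\<one>\<^bsub>L\<^esub> \<in> D \<one>\<^bsub>G\<^esub>" by (auto simp: D_iff OmegaD)
      from skew_monom_mult_eval[OF _ this x k \<xi>]
      have "(\<one>\<^bsub>S\<^esub> \<otimes>\<^bsub>S\<^esub> x) k \<xi> = \<one>\<^bsub>L\<^esub> \<xi> \<otimes>\<^bsub>R\<^esub> x (inv\<^bsub>G\<^esub> \<one>\<^bsub>G\<^esub> \<otimes>\<^bsub>G\<^esub> k) (tr \<one>\<^bsub>G\<^esub> \<xi>)"
        using OmegaD(2)[OF \<xi>] by (simp only: S_simps G.one_closed if_True)
      then show "(\<one>\<^bsub>S\<^esub> \<otimes>\<^bsub>S\<^esub> x) k \<xi> = x k \<xi>"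
        using S_eval_closed[OF x k \<xi>] k \<xi>
        by (simp only: G.lcos_mult_one[OF OmegaD(1)[OF \<xi>]] G.inv_one G.l_one L_eval R.l_one)
    qed
    show "x \<otimes>\<^bsub>S\<^esub> \<one>\<^bsub>S\<^esub> = x"
    proof (rule S_ext[OF S_mult_closed[OF x one] x])
      fix k \<xi> assume k: "k \<in> carrier G" and \<xi>: "\<xi> \<in> \<Omega>"
      \<comment> \<open>Only the term \<open>g = k\<close> survives, and \<open>k\<close> is added
        so that it is present even if it lies outside the support.\<close>
      let ?N = "insert k (support G L x)"
      have N: "finite ?N" "support G L x \<subseteq> ?N" "?N \<subseteq> carrier G"
        using S_finite_support[OF x] support_subset k by auto
      have xc: "x g \<xi> \<in> carrier R" if "g \<in> ?N" for g
        by (rule S_eval_closed[OF x _ \<xi>]) (use that N(3) in blast)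
      have "(x \<otimes>\<^bsub>S\<^esub> \<one>\<^bsub>S\<^esub>) k \<xi> = (\<Oplus>\<^bsub>R\<^esub>g\<in>?N \<inter> \<xi>. x g \<xi> \<otimes>\<^bsub>R\<^esub> \<one>\<^bsub>S\<^esub> (inv\<^bsub>G\<^esub> g \<otimes>\<^bsub>G\<^esub> k) (tr g \<xi>))"
        by (rule S_mult_eval[OF x one N k \<xi>])
      also have "\<dots> = (\<Oplus>\<^bsub>R\<^esub>g\<in>?N \<inter> \<xi>. if k = g then x g \<xi> else \<zero>\<^bsub>R\<^esub>)"
      proof (rule R.finsum_cong')
        fix g assume g: "g \<in> ?N \<inter> \<xi>"
        then have gG: "g \<in> carrier G" "g \<in> \<xi>" using N(3) by auto
        have "inv\<^bsub>G\<^esub> g \<otimes>\<^bsub>G\<^esub> k = \<one>\<^bsub>G\<^esub> \<longleftrightarrow> k = g"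
          using gG k G.inv_solve_left[of "\<one>\<^bsub>G\<^esub>" g k] by auto
        then show "x g \<xi> \<otimes>\<^bsub>R\<^esub> \<one>\<^bsub>S\<^esub> (inv\<^bsub>G\<^esub> g \<otimes>\<^bsub>G\<^esub> k) (tr g \<xi>) = (if k = g then x g \<xi> else \<zero>\<^bsub>R\<^esub>)"
          using gG k translate_in_Omega[OF \<xi> gG(2)] S_eval_closed[OF x gG(1) \<xi>]
          by (simp add: S_simps(1) skew_monom_eval L_eval)
      qed (use xc in auto)
      also have "\<dots> = x k \<xi>"
      proof (cases "k \<in> \<xi>")
        case True
        show ?thesis
          by (rule R.finsum_singleton) (use True N xc in auto)
      next
        \<comment> \<open>The index \<open>k\<close> is now missing from the sum, but
          \<open>x k\<close> belongs to \<open>D k\<close> and vanishes at \<open>\<xi>\<close> as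
          well.\<close>
        case False
        then have "(\<Oplus>\<^bsub>R\<^esub>g\<in>?N \<inter> \<xi>. if k = g then x g \<xi> else \<zero>\<^bsub>R\<^esub>) = \<zero>\<^bsub>R\<^esub>"
          by (intro R.add.finprod_one_eqI) auto
        then show ?thesis using S_eval_zero[OF x k \<xi> False] by simp
      qed
      finally show "(x \<otimes>\<^bsub>S\<^esub> \<one>\<^bsub>S\<^esub>) k \<xi> = x k \<xi>" .
    qed
  qed (use S_mult_closed S_mult_assoc one in blast)+
  fix x y z assume x: "x \<in> carrier S" and y: "y \<in> carrier S" and z: "z \<in> carrier S"
  show "(x \<oplus>\<^bsub>S\<^esub> y) \<otimes>\<^bsub>S\<^esub> z = x \<otimes>\<^bsub>S\<^esub> z \<oplus>\<^bsub>S\<^esub> y \<otimes>\<^bsub>S\<^esub> z"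
  proof (rule S_ext)
    show "(x \<oplus>\<^bsub>S\<^esub> y) \<otimes>\<^bsub>S\<^esub> z \<in> carrier S" "x \<otimes>\<^bsub>S\<^esub> z \<oplus>\<^bsub>S\<^esub> y \<otimes>\<^bsub>S\<^esub> z \<in> carrier S"
      using x y z add S_mult_closed by blast+
    fix k \<xi> assume k: "k \<in> carrier G" and \<xi>: "\<xi> \<in> \<Omega>"
    let ?N = "support G L x \<union> support G L y"
    have N: "finite ?N" "?N \<subseteq> carrier G"
      using S_finite_support x y support_subset by auto
    have sub: "support G L (x \<oplus>\<^bsub>S\<^esub> y) \<subseteq> ?N" by (auto simp: support_def S_simps)
    let ?z = "\<lambda>g. z (inv\<^bsub>G\<^esub> g \<otimes>\<^bsub>G\<^esub> k) (tr g \<xi>)"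
    have cl: "x g \<xi> \<in> carrier R" "y g \<xi> \<in> carrier R" "?z g \<in> carrier R" "g \<in> carrier G"
      if "g \<in> ?N \<inter> \<xi>" for g
    proof -
      show g: "g \<in> carrier G" using that N by blast
      show "x g \<xi> \<in> carrier R" "y g \<xi> \<in> carrier R" using S_eval_closed x y g \<xi> by blast+
      show "?z g \<in> carrier R"
        by (rule S_eval_closed[OF z _ translate_in_Omega[OF \<xi>]]) (use that g k in auto)
    qed
    have "((x \<oplus>\<^bsub>S\<^esub> y) \<otimes>\<^bsub>S\<^esub> z) k \<xi> = (\<Oplus>\<^bsub>R\<^esub>g\<in>?N \<inter> \<xi>. (x \<oplus>\<^bsub>S\<^esub> y) g \<xi> \<otimes>\<^bsub>R\<^esub> ?z g)"
      by (rule S_mult_eval[OF add[OF x y] z N(1) sub N(2) k \<xi>])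
    also have "\<dots> = (\<Oplus>\<^bsub>R\<^esub>g\<in>?N \<inter> \<xi>. x g \<xi> \<otimes>\<^bsub>R\<^esub> ?z g \<oplus>\<^bsub>R\<^esub> y g \<xi> \<otimes>\<^bsub>R\<^esub> ?z g)"
      by (rule R.finsum_cong'[OF refl]) (use cl in \<open>simp_all add: add_eval \<xi> R.l_distr\<close>)
    also have "\<dots> = (\<Oplus>\<^bsub>R\<^esub>g\<in>?N \<inter> \<xi>. x g \<xi> \<otimes>\<^bsub>R\<^esub> ?z g) \<oplus>\<^bsub>R\<^esub> (\<Oplus>\<^bsub>R\<^esub>g\<in>?N \<inter> \<xi>. y g \<xi> \<otimes>\<^bsub>R\<^esub> ?z g)"
      by (rule R.finsum_addf) (use cl in simp_all)
    also have "\<dots> = (x \<otimes>\<^bsub>S\<^esub> z) k \<xi> \<oplus>\<^bsub>R\<^esub> (y \<otimes>\<^bsub>S\<^esub> z) k \<xi>"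
      by (simp only: S_mult_eval[OF x z N(1) Un_upper1 N(2) k \<xi>] S_mult_eval[OF y z N(1) Un_upper2 N(2) k \<xi>])
    finally show "((x \<oplus>\<^bsub>S\<^esub> y) \<otimes>\<^bsub>S\<^esub> z) k \<xi> = (x \<otimes>\<^bsub>S\<^esub> z \<oplus>\<^bsub>S\<^esub> y \<otimes>\<^bsub>S\<^esub> z) k \<xi>"
      using k \<xi> by (simp add: add_eval)
  qed
  show "z \<otimes>\<^bsub>S\<^esub> (x \<oplus>\<^bsub>S\<^esub> y) = z \<otimes>\<^bsub>S\<^esub> x \<oplus>\<^bsub>S\<^esub> z \<otimes>\<^bsub>S\<^esub> y"
  proof (rule S_ext)
    show "z \<otimes>\<^bsub>S\<^esub> (x \<oplus>\<^bsub>S\<^esub> y) \<in> carrier S" "z \<otimes>\<^bsub>S\<^esub> x \<oplus>\<^bsub>S\<^esub> z \<otimes>\<^bsub>S\<^esub> y \<in> carrier S"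
      using x y z add S_mult_closed by blast+
    fix k \<xi> assume k: "k \<in> carrier G" and \<xi>: "\<xi> \<in> \<Omega>"
    let ?N = "support G L z"
    have N: "finite ?N" "?N \<subseteq> carrier G" using S_finite_support z support_subset by auto
    let ?t = "\<lambda>w g. w (inv\<^bsub>G\<^esub> g \<otimes>\<^bsub>G\<^esub> k) (tr g \<xi>)"
    have cl: "z g \<xi> \<in> carrier R" "?t x g \<in> carrier R" "?t y g \<in> carrier R"
      "?t (x \<oplus>\<^bsub>S\<^esub> y) g = ?t x g \<oplus>\<^bsub>R\<^esub> ?t y g"
      if "g \<in> ?N \<inter> \<xi>" for g
    proof -
      have g: "g \<in> carrier G" "inv\<^bsub>G\<^esub> g \<otimes>\<^bsub>G\<^esub> k \<in> carrier G" using that N k by auto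
      have tr: "tr g \<xi> \<in> \<Omega>" by (rule translate_in_Omega[OF \<xi>]) (use that in blast)
      show "z g \<xi> \<in> carrier R" "?t x g \<in> carrier R" "?t y g \<in> carrier R"
        using S_eval_closed x y z g \<xi> tr by blast+
      show "?t (x \<oplus>\<^bsub>S\<^esub> y) g = ?t x g \<oplus>\<^bsub>R\<^esub> ?t y g" by (rule add_eval[OF g(2) tr])
    qed
    have "(z \<otimes>\<^bsub>S\<^esub> (x \<oplus>\<^bsub>S\<^esub> y)) k \<xi> = (\<Oplus>\<^bsub>R\<^esub>g\<in>?N \<inter> \<xi>. z g \<xi> \<otimes>\<^bsub>R\<^esub> ?t (x \<oplus>\<^bsub>S\<^esub> y) g)"
      by (rule S_mult_eval[OF z add[OF x y] N(1) subset_refl N(2) k \<xi>])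
    also have "\<dots> = (\<Oplus>\<^bsub>R\<^esub>g\<in>?N \<inter> \<xi>. z g \<xi> \<otimes>\<^bsub>R\<^esub> ?t x g \<oplus>\<^bsub>R\<^esub> z g \<xi> \<otimes>\<^bsub>R\<^esub> ?t y g)"
      by (rule R.finsum_cong'[OF refl]) (use cl in \<open>simp_all add: R.r_distr\<close>)
    also have "\<dots> = (\<Oplus>\<^bsub>R\<^esub>g\<in>?N \<inter> \<xi>. z g \<xi> \<otimes>\<^bsub>R\<^esub> ?t x g) \<oplus>\<^bsub>R\<^esub> (\<Oplus>\<^bsub>R\<^esub>g\<in>?N \<inter> \<xi>. z g \<xi> \<otimes>\<^bsub>R\<^esub> ?t y g)"
      by (rule R.finsum_addf) (use cl in simp_all)
    also have "\<dots> = (z \<otimes>\<^bsub>S\<^esub> x) k \<xi> \<oplus>\<^bsub>R\<^esub> (z \<otimes>\<^bsub>S\<^esub> y) k \<xi>"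
      by (simp only: S_mult_eval[OF z x N(1) subset_refl N(2) k \<xi>] S_mult_eval[OF z y N(1) subset_refl N(2) k \<xi>])
    finally show "(z \<otimes>\<^bsub>S\<^esub> (x \<oplus>\<^bsub>S\<^esub> y)) k \<xi> = (z \<otimes>\<^bsub>S\<^esub> x \<oplus>\<^bsub>S\<^esub> z \<otimes>\<^bsub>S\<^esub> y) k \<xi>"
      using k \<xi> by (simp add: add_eval)
  qed
qed

end

context par_setup begin

lemma S_assoc_algebra: "assoc_algebra R S"
proof (rule assoc_algebraI[OF R.is_cring S_ring])
  have eval: "(r \<odot>\<^bsub>S\<^esub> x) k \<xi> = r \<otimes>\<^bsub>R\<^esub> x k \<xi>" if "k \<in> carrier G" "\<xi> \<in> \<Omega>" for r x k \<xi>
    using that by (simp add: S_simps L_eval)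
  have add_eval: "(x \<oplus>\<^bsub>S\<^esub> y) k \<xi> = x k \<xi> \<oplus>\<^bsub>R\<^esub> y k \<xi>" if "k \<in> carrier G" "\<xi> \<in> \<Omega>" for x y k \<xi>
    using that by (simp add: S_simps L_eval)
  interpret S: ring S by (rule S_ring)
  show cl: "r \<odot>\<^bsub>S\<^esub> x \<in> carrier S" if "r \<in> carrier R" "x \<in> carrier S" for r x
    unfolding S_simps using that
    by (intro S_combine_closed[OF that(2) that(2), of "\<lambda>a _. r \<odot>\<^bsub>L\<^esub> a"]) (auto simp: D_iff L_eval)
  fix x assume x: "x \<in> carrier S"
  show "\<one>\<^bsub>R\<^esub> \<odot>\<^bsub>S\<^esub> x = x"
    by (rule S_ext[OF cl[OF R.one_closed x] x]) (simp add: eval S_eval_closed[OF x])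
  fix r s assume r: "r \<in> carrier R" and s: "s \<in> carrier R"
  show "(r \<oplus>\<^bsub>R\<^esub> s) \<odot>\<^bsub>S\<^esub> x = r \<odot>\<^bsub>S\<^esub> x \<oplus>\<^bsub>S\<^esub> s \<odot>\<^bsub>S\<^esub> x"
    by (rule S_ext[OF cl[OF R.a_closed[OF r s] x] S.a_closed[OF cl[OF r x] cl[OF s x]]])
      (simp add: eval add_eval S_eval_closed[OF x] r s R.l_distr)
  show "(r \<otimes>\<^bsub>R\<^esub> s) \<odot>\<^bsub>S\<^esub> x = r \<odot>\<^bsub>S\<^esub> (s \<odot>\<^bsub>S\<^esub> x)"
    by (rule S_ext[OF cl[OF R.m_closed[OF r s] x] cl[OF r cl[OF s x]]])
      (simp add: eval S_eval_closed[OF x] r s R.m_assoc)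
next
  fix r x y assume r: "r \<in> carrier R" and x: "x \<in> carrier S" and y: "y \<in> carrier S"
  interpret S: ring S by (rule S_ring)
  have eval: "(r \<odot>\<^bsub>S\<^esub> x) k \<xi> = r \<otimes>\<^bsub>R\<^esub> x k \<xi>" if "k \<in> carrier G" "\<xi> \<in> \<Omega>" for x k \<xi>
    using that by (simp add: S_simps L_eval)
  have add_eval: "(x \<oplus>\<^bsub>S\<^esub> y) k \<xi> = x k \<xi> \<oplus>\<^bsub>R\<^esub> y k \<xi>" if "k \<in> carrier G" "\<xi> \<in> \<Omega>" for x y k \<xi>
    using that by (simp add: S_simps L_eval)
  have cl: "r \<odot>\<^bsub>S\<^esub> x \<in> carrier S" if "x \<in> carrier S" for x
    unfolding S_simps using that r
    by (intro S_combine_closed[OF that that, of "\<lambda>a _. r \<odot>\<^bsub>L\<^esub> a"]) (auto simp: D_iff L_eval)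
  show "r \<odot>\<^bsub>S\<^esub> (x \<oplus>\<^bsub>S\<^esub> y) = r \<odot>\<^bsub>S\<^esub> x \<oplus>\<^bsub>S\<^esub> r \<odot>\<^bsub>S\<^esub> y"
    by (rule S_ext[OF cl[OF S.a_closed[OF x y]] S.a_closed[OF cl[OF x] cl[OF y]]])
      (simp add: eval add_eval S_eval_closed[OF x] S_eval_closed[OF y] r R.r_distr)
  \<comment> \<open>Serves both compatibility laws, with \<open>r\<close> attached to
    \<open>x\<close> or to \<open>y\<close>. The condition on the support allows both products to be
    computed over the support of \<open>x\<close>.\<close>
  have *: "(x' \<otimes>\<^bsub>S\<^esub> y') k \<xi> = r \<otimes>\<^bsub>R\<^esub> (x \<otimes>\<^bsub>S\<^esub> y) k \<xi>"
    if x': "x' \<in> carrier S" "y' \<in> carrier S" "support G L x' \<subseteq> support G L x"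
      and k: "k \<in> carrier G" and \<xi>: "\<xi> \<in> \<Omega>"
      and e: "\<And>g h \<zeta>. \<lbrakk>g \<in> carrier G; h \<in> carrier G; \<zeta> \<in> \<Omega>\<rbrakk> \<Longrightarrow>
        x' g \<xi> \<otimes>\<^bsub>R\<^esub> y' h \<zeta> = r \<otimes>\<^bsub>R\<^esub> (x g \<xi> \<otimes>\<^bsub>R\<^esub> y h \<zeta>)" for x' y' k \<xi>
  proof -
    let ?N = "support G L x"
    have N: "finite ?N" "?N \<subseteq> carrier G" using S_finite_support[OF x] support_subset by auto
    let ?t = "\<lambda>g. x g \<xi> \<otimes>\<^bsub>R\<^esub> y (inv\<^bsub>G\<^esub> g \<otimes>\<^bsub>G\<^esub> k) (tr g \<xi>)"
    have tc: "?t \<in> ?N \<inter> \<xi> \<rightarrow> carrier R"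
    proof
      fix g assume "g \<in> ?N \<inter> \<xi>"
      then have g: "g \<in> carrier G" "g \<in> \<xi>" "inv\<^bsub>G\<^esub> g \<otimes>\<^bsub>G\<^esub> k \<in> carrier G" using N k by auto
      then show "?t g \<in> carrier R"
        using S_eval_closed[OF x g(1) \<xi>] S_eval_closed[OF y g(3) translate_in_Omega[OF \<xi> g(2)]] by simp
    qed
    have "(x' \<otimes>\<^bsub>S\<^esub> y') k \<xi> = (\<Oplus>\<^bsub>R\<^esub>g\<in>?N \<inter> \<xi>. x' g \<xi> \<otimes>\<^bsub>R\<^esub> y' (inv\<^bsub>G\<^esub> g \<otimes>\<^bsub>G\<^esub> k) (tr g \<xi>))"
      by (rule S_mult_eval[OF x'(1,2) N(1) x'(3) N(2) k \<xi>])
    also have "\<dots> = (\<Oplus>\<^bsub>R\<^esub>g\<in>?N \<inter> \<xi>. r \<otimes>\<^bsub>R\<^esub> ?t g)"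
    proof (rule R.finsum_cong'[OF refl])
      show "(\<lambda>g. r \<otimes>\<^bsub>R\<^esub> ?t g) \<in> ?N \<inter> \<xi> \<rightarrow> carrier R"
        using tc r by (intro funcsetI R.m_closed[OF r]) (rule funcset_mem)
      fix g assume "g \<in> ?N \<inter> \<xi>"
      then show "x' g \<xi> \<otimes>\<^bsub>R\<^esub> y' (inv\<^bsub>G\<^esub> g \<otimes>\<^bsub>G\<^esub> k) (tr g \<xi>) = r \<otimes>\<^bsub>R\<^esub> ?t g"
        using N k by (intro e translate_in_Omega[OF \<xi>]) auto
    qed
    also have "\<dots> = r \<otimes>\<^bsub>R\<^esub> (\<Oplus>\<^bsub>R\<^esub>g\<in>?N \<inter> \<xi>. ?t g)"
      using N by (intro R.finsum_rdistr[OF _ r tc, symmetric]) simp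
    also have "\<dots> = r \<otimes>\<^bsub>R\<^esub> (x \<otimes>\<^bsub>S\<^esub> y) k \<xi>"
      by (simp only: S_mult_eval[OF x y N(1) subset_refl N(2) k \<xi>])
    finally show ?thesis .
  qed
  show "(r \<odot>\<^bsub>S\<^esub> x) \<otimes>\<^bsub>S\<^esub> y = r \<odot>\<^bsub>S\<^esub> (x \<otimes>\<^bsub>S\<^esub> y)"
  proof (rule S_ext[OF S_mult_closed[OF cl[OF x] y] cl[OF S_mult_closed[OF x y]]])
    fix k \<xi> assume k: "k \<in> carrier G" and \<xi>: "\<xi> \<in> \<Omega>"
    have "support G L (r \<odot>\<^bsub>S\<^esub> x) \<subseteq> support G L x"
      using r by (auto simp: support_def S_simps)
    then show "((r \<odot>\<^bsub>S\<^esub> x) \<otimes>\<^bsub>S\<^esub> y) k \<xi> = (r \<odot>\<^bsub>S\<^esub> (x \<otimes>\<^bsub>S\<^esub> y)) k \<xi>"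
      unfolding eval[OF k \<xi>]
      by (rule *[OF cl[OF x] y _ k \<xi>])
        (simp add: eval \<xi> R.m_assoc r S_eval_closed[OF x] S_eval_closed[OF y])
  qed
  show "x \<otimes>\<^bsub>S\<^esub> (r \<odot>\<^bsub>S\<^esub> y) = r \<odot>\<^bsub>S\<^esub> (x \<otimes>\<^bsub>S\<^esub> y)"
  proof (rule S_ext[OF S_mult_closed[OF x cl[OF y]] cl[OF S_mult_closed[OF x y]]])
    fix k \<xi> assume k: "k \<in> carrier G" and \<xi>: "\<xi> \<in> \<Omega>"
    show "(x \<otimes>\<^bsub>S\<^esub> (r \<odot>\<^bsub>S\<^esub> y)) k \<xi> = (r \<odot>\<^bsub>S\<^esub> (x \<otimes>\<^bsub>S\<^esub> y)) k \<xi>"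
      unfolding eval[OF k \<xi>]
      by (rule *[OF x cl[OF y] subset_refl k \<xi>])
        (simp add: eval \<xi> R.m_lcomm r S_eval_closed[OF x] S_eval_closed[OF y])
  qed
qed

sublocale S: assoc_algebra R S by (rule S_assoc_algebra)

section \<open>The representation of the partial group algebra in the skew group ring\<close>

lemma S_add_apply: "k \<in> carrier G \<Longrightarrow> (x \<oplus>\<^bsub>S\<^esub> y) k = x k \<oplus>\<^bsub>L\<^esub> y k"
  by (simp add: S_simps)

lemma D_one: "D \<one>\<^bsub>G\<^esub> = carrier L"
  using algebra_partial_action_theta by (simp add: algebra_partial_action_def)

lemma c_in_D: "g \<in> carrier G \<Longrightarrow> c g \<in> D g"
  by (auto simp: D_iff c_closed L_eval)

lemma skew_monom_one_closed: "a \<in> carrier L \<Longrightarrow> sk a \<one>\<^bsub>G\<^esub> \<in> carrier S"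
  by (rule skew_monom_closed) (simp_all add: D_one)

lemma skew_monom_one_mult:
  assumes a: "a \<in> carrier L" and g: "g \<in> carrier G" and b: "b \<in> D g"
  shows "sk a \<one>\<^bsub>G\<^esub> \<otimes>\<^bsub>S\<^esub> sk b g = sk (a \<otimes>\<^bsub>L\<^esub> b) g"
proof (rule S_ext)
  have bL: "b \<in> carrier L" by (rule D_carrier[OF b])
  show "sk a \<one>\<^bsub>G\<^esub> \<otimes>\<^bsub>S\<^esub> sk b g \<in> carrier S"
    using a b g by (intro S_mult_closed skew_monom_one_closed skew_monom_closed)
  show "sk (a \<otimes>\<^bsub>L\<^esub> b) g \<in> carrier S"
    using ideal.I_l_closed[OF D_ideal[OF g] b a] g by (intro skew_monom_closed)
  fix k \<xi> assume k: "k \<in> carrier G" and \<xi>: "\<xi> \<in> \<Omega>"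
  have "(sk a \<one>\<^bsub>G\<^esub> \<otimes>\<^bsub>S\<^esub> sk b g) k \<xi> = a \<xi> \<otimes>\<^bsub>R\<^esub> sk b g k \<xi>"
    using skew_monom_mult_eval[OF G.one_closed _ skew_monom_closed[OF g b] k \<xi>, of a] a
      OmegaD(2)[OF \<xi>] k tr_one[OF \<xi>]
    by (simp only: D_one if_True G.inv_one G.l_one)
  then show "(sk a \<one>\<^bsub>G\<^esub> \<otimes>\<^bsub>S\<^esub> sk b g) k \<xi> = sk (a \<otimes>\<^bsub>L\<^esub> b) g k \<xi>"
    using k \<xi> L_closed[OF a \<xi>] by (simp add: skew_monom_eval L_eval)
qed

text \<open>The coefficients at the unit of \<open>G\<close> form a copy of \<open>L\<close>. It
  carries the relations that hold in \<open>L\<close> into the skew group ring, and it contains the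
  image of \<open>A\<close>.\<close>

lemma skew_monom_one_hom: "algebra_hom R L S (\<lambda>a. sk a \<one>\<^bsub>G\<^esub>)"
proof (rule algebra_homI)
  fix a assume a: "a \<in> carrier L"
  show "sk a \<one>\<^bsub>G\<^esub> \<in> carrier S" by (rule skew_monom_one_closed[OF a])
  fix r assume "r \<in> carrier R"
  then show "sk (r \<odot>\<^bsub>L\<^esub> a) \<one>\<^bsub>G\<^esub> = r \<odot>\<^bsub>S\<^esub> sk a \<one>\<^bsub>G\<^esub>"
    unfolding S_simps skew_monom_def by (intro restrict_ext) simp
next
  fix a b assume ab: "a \<in> carrier L" "b \<in> carrier L"
  then show "sk (a \<oplus>\<^bsub>L\<^esub> b) \<one>\<^bsub>G\<^esub> = sk a \<one>\<^bsub>G\<^esub> \<oplus>\<^bsub>S\<^esub> sk b \<one>\<^bsub>G\<^esub>"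
    unfolding S_simps skew_monom_def by (intro restrict_ext) simp
  show "sk (a \<otimes>\<^bsub>L\<^esub> b) \<one>\<^bsub>G\<^esub> = sk a \<one>\<^bsub>G\<^esub> \<otimes>\<^bsub>S\<^esub> sk b \<one>\<^bsub>G\<^esub>"
    using ab by (intro skew_monom_one_mult[symmetric]) (simp_all add: D_one)
qed (simp add: S_simps)

lemma skew_c_mult_eval:
  assumes g: "g \<in> carrier G" and y: "y \<in> carrier S" and k: "k \<in> carrier G" and \<xi>: "\<xi> \<in> \<Omega>"
  shows "(sk (c g) g \<otimes>\<^bsub>S\<^esub> y) k \<xi> =
    (if g \<in> \<xi> then y (inv\<^bsub>G\<^esub> g \<otimes>\<^bsub>G\<^esub> k) (tr g \<xi>) else \<zero>\<^bsub>R\<^esub>)"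
proof -
  have "y (inv\<^bsub>G\<^esub> g \<otimes>\<^bsub>G\<^esub> k) (tr g \<xi>) \<in> carrier R" if "g \<in> \<xi>"
    by (rule S_eval_closed[OF y _ translate_in_Omega[OF \<xi> that]]) (use g k in simp)
  then show ?thesis
    using \<xi> by (simp add: skew_monom_mult_eval[OF g c_in_D[OF g] y k \<xi>] L_eval)
qed

lemma skew_c_closed: "g \<in> carrier G \<Longrightarrow> sk (c g) g \<in> carrier S"
  by (rule skew_monom_closed) (auto intro: c_in_D)

text \<open>In closed form the product is \<open>1_g 1_gh \<delta>_gh\<close>; the scalar version
  avoids computing with \<open>\<theta>\<close>.\<close>

lemma skew_c_mult_c:
  assumes g: "g \<in> carrier G" and h: "h \<in> carrier G" and k: "k \<in> carrier G" and \<xi>: "\<xi> \<in> \<Omega>"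
  shows "(sk (c g) g \<otimes>\<^bsub>S\<^esub> sk (c h) h) k \<xi> =
    (if g \<in> \<xi> \<and> g \<otimes>\<^bsub>G\<^esub> h \<in> \<xi> \<and> k = g \<otimes>\<^bsub>G\<^esub> h then \<one>\<^bsub>R\<^esub> else \<zero>\<^bsub>R\<^esub>)"
proof (cases "g \<in> \<xi>")
  case True
  have "inv\<^bsub>G\<^esub> g \<otimes>\<^bsub>G\<^esub> k = h \<longleftrightarrow> k = g \<otimes>\<^bsub>G\<^esub> h"
    using g h k by (metis G.inv_solve_left)
  moreover have "h \<in> tr g \<xi> \<longleftrightarrow> g \<otimes>\<^bsub>G\<^esub> h \<in> \<xi>" using g h \<xi> by (simp add: mem_tr_iff)
  ultimately show ?thesis
    using True g h k \<xi> translate_in_Omega[OF \<xi> True] skew_c_mult_eval[OF g skew_c_closed[OF h] k \<xi>]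
    by (simp add: skew_monom_eval L_eval)
next
  case False
  then show ?thesis using skew_c_mult_eval[OF g skew_c_closed[OF h] k \<xi>] by simp
qed

lemma skew_eps:
  assumes g: "g \<in> carrier G"
  shows "sk (c g) g \<otimes>\<^bsub>S\<^esub> sk (c (inv\<^bsub>G\<^esub> g)) (inv\<^bsub>G\<^esub> g) = sk (c g) \<one>\<^bsub>G\<^esub>"
proof (rule S_ext)
  show "sk (c g) g \<otimes>\<^bsub>S\<^esub> sk (c (inv\<^bsub>G\<^esub> g)) (inv\<^bsub>G\<^esub> g) \<in> carrier S" "sk (c g) \<one>\<^bsub>G\<^esub> \<in> carrier S"
    using g by (auto intro!: S_mult_closed skew_c_closed skew_monom_one_closed c_closed)
  fix k \<xi> assume k: "k \<in> carrier G" and \<xi>: "\<xi> \<in> \<Omega>"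
  then show "(sk (c g) g \<otimes>\<^bsub>S\<^esub> sk (c (inv\<^bsub>G\<^esub> g)) (inv\<^bsub>G\<^esub> g)) k \<xi> = sk (c g) \<one>\<^bsub>G\<^esub> k \<xi>"
    using g by (simp add: skew_c_mult_c skew_monom_eval L_eval OmegaD(2))
qed

text \<open>The product \<open>?y ?z\<close> is \<open>1_g 1_gh \<delta>_gh\<close>, which differs
  from \<open>?w\<close> by the factor \<open>1_g\<close>. Multiplication by \<open>?x\<close> from
  the left evaluates it at \<open>g \<xi>\<close>, a set that contains \<open>g\<close> because the
  unit lies in \<open>\<xi>\<close>, so the factor disappears.\<close>

lemma skew_c_left:
  assumes g: "g \<in> carrier G" and h: "h \<in> carrier G"
  shows "sk (c (inv\<^bsub>G\<^esub> g)) (inv\<^bsub>G\<^esub> g) \<otimes>\<^bsub>S\<^esub> sk (c g) g \<otimes>\<^bsub>S\<^esub> sk (c h) h =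
    sk (c (inv\<^bsub>G\<^esub> g)) (inv\<^bsub>G\<^esub> g) \<otimes>\<^bsub>S\<^esub> sk (c (g \<otimes>\<^bsub>G\<^esub> h)) (g \<otimes>\<^bsub>G\<^esub> h)"
    (is "?x \<otimes>\<^bsub>S\<^esub> ?y \<otimes>\<^bsub>S\<^esub> ?z = ?x \<otimes>\<^bsub>S\<^esub> ?w")
proof (rule S_ext)
  have cl: "?x \<in> carrier S" "?y \<in> carrier S" "?z \<in> carrier S" "?w \<in> carrier S"
    using g h by (auto intro!: skew_c_closed)
  show "?x \<otimes>\<^bsub>S\<^esub> ?y \<otimes>\<^bsub>S\<^esub> ?z \<in> carrier S" "?x \<otimes>\<^bsub>S\<^esub> ?w \<in> carrier S"
    using cl S_mult_closed by auto
  fix k \<xi> assume k: "k \<in> carrier G" and \<xi>: "\<xi> \<in> \<Omega>"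
  have ig: "inv\<^bsub>G\<^esub> g \<in> carrier G" using g by simp
  have "?x \<otimes>\<^bsub>S\<^esub> ?y \<otimes>\<^bsub>S\<^esub> ?z = ?x \<otimes>\<^bsub>S\<^esub> (?y \<otimes>\<^bsub>S\<^esub> ?z)" using cl by (intro S_mult_assoc)
  then show "(?x \<otimes>\<^bsub>S\<^esub> ?y \<otimes>\<^bsub>S\<^esub> ?z) k \<xi> = (?x \<otimes>\<^bsub>S\<^esub> ?w) k \<xi>"
  proof (simp only:, cases "inv\<^bsub>G\<^esub> g \<in> \<xi>")
    case True
    let ?\<zeta> = "tr (inv\<^bsub>G\<^esub> g) \<xi>" and ?k = "inv\<^bsub>G\<^esub> (inv\<^bsub>G\<^esub> g) \<otimes>\<^bsub>G\<^esub> k"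
    have \<zeta>: "?\<zeta> \<in> \<Omega>" by (rule translate_in_Omega[OF \<xi> True])
    have k': "?k \<in> carrier G" using g k by simp
    have gz: "g \<in> ?\<zeta>" using mem_tr_iff[OF ig \<xi>] g OmegaD(2)[OF \<xi>] by (simp only: G.l_inv)
    have "(?x \<otimes>\<^bsub>S\<^esub> (?y \<otimes>\<^bsub>S\<^esub> ?z)) k \<xi> = (?y \<otimes>\<^bsub>S\<^esub> ?z) ?k ?\<zeta>"
      using True by (simp only: skew_c_mult_eval[OF ig S_mult_closed[OF cl(2,3)] k \<xi>] if_True)
    also have "\<dots> = ?w ?k ?\<zeta>"
      using gz skew_c_mult_c[OF g h k' \<zeta>] skew_monom_eval[OF k' \<zeta>] \<zeta>
      by (simp only: L_eval simp_thms) (auto split: if_splits)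
    also have "\<dots> = (?x \<otimes>\<^bsub>S\<^esub> ?w) k \<xi>"
      using True by (simp only: skew_c_mult_eval[OF ig cl(4) k \<xi>] if_True)
    finally show "(?x \<otimes>\<^bsub>S\<^esub> (?y \<otimes>\<^bsub>S\<^esub> ?z)) k \<xi> = (?x \<otimes>\<^bsub>S\<^esub> ?w) k \<xi>" .
  next
    case False
    then show "(?x \<otimes>\<^bsub>S\<^esub> (?y \<otimes>\<^bsub>S\<^esub> ?z)) k \<xi> = (?x \<otimes>\<^bsub>S\<^esub> ?w) k \<xi>"
      by (simp only: skew_c_mult_eval[OF ig S_mult_closed[OF cl(2,3)] k \<xi>]
          skew_c_mult_eval[OF ig cl(4) k \<xi>] if_False)
  qed
qed

text \<open>The last two factors on the left multiply to \<open>1_h \<delta>_1\<close>. Then both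
  sides take the value 1 exactly if \<open>k = g\<close> and both \<open>g\<close> and
  \<open>gh\<close> lie in \<open>\<xi>\<close>.\<close>

lemma skew_c_right:
  assumes g: "g \<in> carrier G" and h: "h \<in> carrier G"
  shows "sk (c g) g \<otimes>\<^bsub>S\<^esub> sk (c h) h \<otimes>\<^bsub>S\<^esub> sk (c (inv\<^bsub>G\<^esub> h)) (inv\<^bsub>G\<^esub> h) =
    sk (c (g \<otimes>\<^bsub>G\<^esub> h)) (g \<otimes>\<^bsub>G\<^esub> h) \<otimes>\<^bsub>S\<^esub> sk (c (inv\<^bsub>G\<^esub> h)) (inv\<^bsub>G\<^esub> h)"
    (is "?x \<otimes>\<^bsub>S\<^esub> ?y \<otimes>\<^bsub>S\<^esub> ?z = ?w \<otimes>\<^bsub>S\<^esub> ?z")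
proof (rule S_ext)
  have cl: "?x \<in> carrier S" "?y \<in> carrier S" "?z \<in> carrier S" "?w \<in> carrier S"
    using g h by (auto intro!: skew_c_closed)
  show "?x \<otimes>\<^bsub>S\<^esub> ?y \<otimes>\<^bsub>S\<^esub> ?z \<in> carrier S" "?w \<otimes>\<^bsub>S\<^esub> ?z \<in> carrier S"
    using cl S_mult_closed by auto
  fix k \<xi> assume k: "k \<in> carrier G" and \<xi>: "\<xi> \<in> \<Omega>"
  have gh: "g \<otimes>\<^bsub>G\<^esub> h \<in> carrier G" "inv\<^bsub>G\<^esub> h \<in> carrier G" using g h by auto
  have "?x \<otimes>\<^bsub>S\<^esub> ?y \<otimes>\<^bsub>S\<^esub> ?z = ?x \<otimes>\<^bsub>S\<^esub> (?y \<otimes>\<^bsub>S\<^esub> ?z)" using cl by (intro S_mult_assoc)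
  also have "\<dots> = ?x \<otimes>\<^bsub>S\<^esub> sk (c h) \<one>\<^bsub>G\<^esub>" by (simp only: skew_eps[OF h])
  finally have 1: "?x \<otimes>\<^bsub>S\<^esub> ?y \<otimes>\<^bsub>S\<^esub> ?z = ?x \<otimes>\<^bsub>S\<^esub> sk (c h) \<one>\<^bsub>G\<^esub>" .
  have ghh: "g \<otimes>\<^bsub>G\<^esub> h \<otimes>\<^bsub>G\<^esub> inv\<^bsub>G\<^esub> h = g" using g h by (simp add: G.m_assoc)
  have 2: "(?w \<otimes>\<^bsub>S\<^esub> ?z) k \<xi> = (if g \<otimes>\<^bsub>G\<^esub> h \<in> \<xi> \<and> g \<in> \<xi> \<and> k = g then \<one>\<^bsub>R\<^esub> else \<zero>\<^bsub>R\<^esub>)"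
    using skew_c_mult_c[OF gh k \<xi>] by (simp only: ghh)
  have 3: "(?x \<otimes>\<^bsub>S\<^esub> sk (c h) \<one>\<^bsub>G\<^esub>) k \<xi> = (if g \<otimes>\<^bsub>G\<^esub> h \<in> \<xi> \<and> g \<in> \<xi> \<and> k = g then \<one>\<^bsub>R\<^esub> else \<zero>\<^bsub>R\<^esub>)"
  proof (cases "g \<in> \<xi>")
    case True
    have "inv\<^bsub>G\<^esub> g \<otimes>\<^bsub>G\<^esub> k = \<one>\<^bsub>G\<^esub> \<longleftrightarrow> k = g" using g k by (metis G.inv_solve_left G.one_closed G.r_one)
    moreover have "h \<in> tr g \<xi> \<longleftrightarrow> g \<otimes>\<^bsub>G\<^esub> h \<in> \<xi>" using g h \<xi> by (simp add: mem_tr_iff)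
    ultimately show ?thesis
      using True g h k \<xi> translate_in_Omega[OF \<xi> True]
        skew_c_mult_eval[OF g skew_monom_one_closed[OF c_closed[OF h]] k \<xi>]
      by (simp add: skew_monom_eval L_eval)
  next
    case False
    then show ?thesis
      using skew_c_mult_eval[OF g skew_monom_one_closed[OF c_closed[OF h]] k \<xi>] by simp
  qed
  show "(?x \<otimes>\<^bsub>S\<^esub> ?y \<otimes>\<^bsub>S\<^esub> ?z) k \<xi> = (?w \<otimes>\<^bsub>S\<^esub> ?z) k \<xi>" unfolding 1 2 3 ..
qed

text \<open>The condition that defines the spectrum is taken at the unit of \<open>G\<close>, where
  the translate of \<open>\<xi>\<close> is \<open>\<xi>\<close> itself.\<close>

lemma eval_relation_c:
  assumes rel: "rel \<in> \<R>"
  shows "eval_relation L (\<lambda>g. c g) rel = \<zero>\<^bsub>L\<^esub>"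
proof (rule L_ext)
  show "eval_relation L (\<lambda>g. c g) rel \<in> carrier L"
    by (rule L.eval_relation_closed) (use relation_coeff[OF rel] c_closed in auto)
  show "\<zero>\<^bsub>L\<^esub> \<in> carrier L" by simp
  fix \<xi> assume \<xi>: "\<xi> \<in> \<Omega>"
  have "eval_at R (tr \<one>\<^bsub>G\<^esub> \<xi>) rel = \<zero>\<^bsub>R\<^esub>" using \<xi> rel OmegaD(2)[OF \<xi>] unfolding Omega_iff by blast
  then show "eval_relation L (\<lambda>g. c g) rel \<xi> = \<zero>\<^bsub>L\<^esub> \<xi>"
    using \<xi> R.eval_relation_Lc[of \<xi> "Omega_top R G \<R>" rel] by (simp only: tr_one topspace_Omega_top L_eval)
qed

text \<open>The two relations of partial representations are \<open>skew_c_left\<close> and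
  \<open>skew_c_right\<close>. For a relation in \<open>\<R>\<close>, the products that stand for
  the \<open>\<epsilon>(g)\<close> are \<open>1_g \<delta>_1\<close>, so its value lies in the copy
  of \<open>L\<close>, where it is 0.\<close>

lemma Phi_ex:
  obtains \<Phi> where "algebra_hom R P S \<Phi>" "\<And>g. g \<in> carrier G \<Longrightarrow> \<Phi> (gen g) = sk (c g) g"
proof (rule R_par_universal[OF S_assoc_algebra, of "\<lambda>g. sk (c g) g"])
  show "(\<lambda>g. sk (c g) g) \<in> carrier G \<rightarrow> carrier S" by (intro funcsetI skew_c_closed)
  have "c \<one>\<^bsub>G\<^esub> = \<one>\<^bsub>L\<^esub>"
    by (rule L_ext) (simp_all add: c_closed L_eval OmegaD(2))
  then show "sk (c \<one>\<^bsub>G\<^esub>) \<one>\<^bsub>G\<^esub> = \<one>\<^bsub>S\<^esub>" by (simp add: S_simps)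
  fix rel assume rel: "rel \<in> \<R>"
  have "sk (eval_relation L (\<lambda>g. c g) rel) \<one>\<^bsub>G\<^esub> =
      eval_relation S (\<lambda>g. sk (c g) g \<otimes>\<^bsub>S\<^esub> sk (c (inv\<^bsub>G\<^esub> g)) (inv\<^bsub>G\<^esub> g)) rel"
  proof (rule algebra_hom_eval_relation[OF skew_monom_one_hom L_assoc_algebra S_assoc_algebra])
    fix l gs assume "(l, gs) \<in> set rel"
    note rc = relation_coeff[OF rel this]
    show "l \<in> carrier R \<and> (\<lambda>g. c g) ` set gs \<subseteq> carrier L" using rc c_closed by auto
    fix g assume "g \<in> set gs"
    then show "sk (c g) g \<otimes>\<^bsub>S\<^esub> sk (c (inv\<^bsub>G\<^esub> g)) (inv\<^bsub>G\<^esub> g) = sk (c g) \<one>\<^bsub>G\<^esub>"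
      by (rule skew_eps[OF rc(2)])
  qed
  then show "eval_relation S (\<lambda>g. sk (c g) g \<otimes>\<^bsub>S\<^esub> sk (c (inv\<^bsub>G\<^esub> g)) (inv\<^bsub>G\<^esub> g)) rel = \<zero>\<^bsub>S\<^esub>"
    using algebra_hom_zero[OF skew_monom_one_hom L.ring_M S.ring_M]
    by (simp only: eval_relation_c[OF rel])
next
  fix \<Phi> assume \<Phi>: "algebra_hom R P S \<Phi>" "\<And>g. g \<in> carrier G \<Longrightarrow> \<Phi> (gen g) = sk (c g) g"
  show thesis by (rule that[OF \<Phi>(1)]) (rule \<Phi>(2))
qed (rule skew_c_left skew_c_right; assumption)+

lemma Phi_eps:
  assumes "algebra_hom R P S \<Phi>" "\<And>g. g \<in> carrier G \<Longrightarrow> \<Phi> (gen g) = sk (c g) g"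
    and g: "g \<in> carrier G"
  shows "\<Phi> (eps g) = sk (c g) \<one>\<^bsub>G\<^esub>"
  unfolding par_eps_def algebra_homD(3)[OF assms(1) gen_closed[OF g] gen_closed[OF G.inv_closed[OF g]]]
    assms(2)[OF g] assms(2)[OF G.inv_closed[OF g]] by (rule skew_eps[OF g])

text \<open>The homomorphism of \<open>Phi_ex\<close> sends the \<open>eps g\<close>, hence all of
  \<open>A\<close>, into the copy of \<open>L\<close> at the unit of \<open>G\<close>;
  \<open>T\<close> is the coefficient there.\<close>

lemma T_ex:
  obtains T where "algebra_hom R A L T" "\<And>g. g \<in> carrier G \<Longrightarrow> T (eps g) = c g"
proof -
  obtain \<Phi> where \<Phi>: "algebra_hom R P S \<Phi>" "\<And>g. g \<in> carrier G \<Longrightarrow> \<Phi> (gen g) = sk (c g) g"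
    using Phi_ex by metis
  note hD = algebra_homD[OF \<Phi>(1)] and jD = algebra_homD[OF skew_monom_one_hom]
  have ex: "\<exists>f\<in>carrier L. \<Phi> a = sk f \<one>\<^bsub>G\<^esub>" if "a \<in> carrier A" for a
    using that
  proof (induction rule: A_par_induct)
    case (eps g)
    then show ?case using Phi_eps[OF \<Phi> eps] c_closed by blast
  next
    case zero
    show ?case
      using algebra_hom_zero[OF \<Phi>(1) P.ring_M S.ring_M] algebra_hom_zero[OF skew_monom_one_hom L.ring_M S.ring_M]
        L.M.zero_closed by metis
  next
    case one
    show ?case using hD(4) jD(4) L.one_closed by metis
  next
    case (add x y)
    then obtain f h where "f \<in> carrier L" "h \<in> carrier L" "\<Phi> x = sk f \<one>\<^bsub>G\<^esub>" "\<Phi> y = sk h \<one>\<^bsub>G\<^esub>" by blast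
    then show ?case
      using hD(2)[OF A_par_carrier A_par_carrier, OF add(1,2)] jD(2)[of f h] L.M.a_closed[of f h] by metis
  next
    case (mult x y)
    then obtain f h where "f \<in> carrier L" "h \<in> carrier L" "\<Phi> x = sk f \<one>\<^bsub>G\<^esub>" "\<Phi> y = sk h \<one>\<^bsub>G\<^esub>" by blast
    then show ?case
      using hD(3)[OF A_par_carrier A_par_carrier, OF mult(1,2)] jD(3)[of f h] L.m_closed[of f h] by metis
  next
    case (smult r x)
    then obtain f where "f \<in> carrier L" "\<Phi> x = sk f \<one>\<^bsub>G\<^esub>" by blast
    then show ?case
      using hD(5)[OF smult(1) A_par_carrier, OF smult(2)] jD(5)[OF smult(1), of f] L.smult_closed[OF smult(1), of f] by metis
  qed
  have sk1: "sk f \<one>\<^bsub>G\<^esub> \<one>\<^bsub>G\<^esub> = f" for f by (simp add: skew_monom_def)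
  define T where "T a = \<Phi> a \<one>\<^bsub>G\<^esub>" for a
  have T: "T a \<in> carrier L" "\<Phi> a = sk (T a) \<one>\<^bsub>G\<^esub>" if "a \<in> carrier A" for a
    using ex[OF that] by (auto simp: T_def sk1)
  have "algebra_hom R A L T"
  proof (rule algebra_homI)
    fix x assume x: "x \<in> carrier A"
    show "T x \<in> carrier L" by (rule T(1)[OF x])
    fix r assume r: "r \<in> carrier R"
    have "\<Phi> (r \<odot>\<^bsub>P\<^esub> x) = sk (r \<odot>\<^bsub>L\<^esub> T x) \<one>\<^bsub>G\<^esub>"
      using hD(5)[OF r A_par_carrier[OF x]] T[OF x] jD(5)[OF r] by simp
    then show "T (r \<odot>\<^bsub>A\<^esub> x) = r \<odot>\<^bsub>L\<^esub> T x" by (simp only: A_par_simps T_def[of "r \<odot>\<^bsub>P\<^esub> x"] sk1)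
  next
    fix x y assume x: "x \<in> carrier A" and y: "y \<in> carrier A"
    have "\<Phi> (x \<oplus>\<^bsub>P\<^esub> y) = sk (T x \<oplus>\<^bsub>L\<^esub> T y) \<one>\<^bsub>G\<^esub>"
      using hD(2)[OF A_par_carrier[OF x] A_par_carrier[OF y]] T[OF x] T[OF y] jD(2) by simp
    then show "T (x \<oplus>\<^bsub>A\<^esub> y) = T x \<oplus>\<^bsub>L\<^esub> T y" by (simp only: A_par_simps T_def[of "x \<oplus>\<^bsub>P\<^esub> y"] sk1)
    have "\<Phi> (x \<otimes>\<^bsub>P\<^esub> y) = sk (T x \<otimes>\<^bsub>L\<^esub> T y) \<one>\<^bsub>G\<^esub>"
      using hD(3)[OF A_par_carrier[OF x] A_par_carrier[OF y]] T[OF x] T[OF y] jD(3) by simp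
    then show "T (x \<otimes>\<^bsub>A\<^esub> y) = T x \<otimes>\<^bsub>L\<^esub> T y" by (simp only: A_par_simps T_def[of "x \<otimes>\<^bsub>P\<^esub> y"] sk1)
  next
    show "T \<one>\<^bsub>A\<^esub> = \<one>\<^bsub>L\<^esub>" by (simp only: A_par_simps T_def hD(4) S_simps sk1)
  qed
  moreover have "T (eps g) = c g" if "g \<in> carrier G" for g
    by (simp only: T_def Phi_eps[OF \<Phi> that] sk1)
  ultimately show ?thesis using that by blast
qed

end

section \<open>The isomorphism with the locally constant functions\<close>

context par_setup begin

text \<open>The image of the indicator function of \<open>{\<eta>. \<eta> \<inter> K = \<xi> \<inter> K}\<close> under the inverse of the
  isomorphism to be constructed; it makes sense for every \<open>\<xi>\<close>, in the spectrum or not.\<close>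

definition cutoff1 :: "'g set \<Rightarrow> 'g \<Rightarrow> ('g list \<Rightarrow> 'r) set" where
  "cutoff1 \<xi> g = (if g \<in> \<xi> then eps g else \<one>\<^bsub>A\<^esub> \<ominus>\<^bsub>A\<^esub> eps g)"

definition cutoff :: "'g set \<Rightarrow> 'g set \<Rightarrow> ('g list \<Rightarrow> 'r) set" where
  "cutoff \<xi> K = finprod A (cutoff1 \<xi>) K"

lemma cutoff1_closed: "g \<in> carrier G \<Longrightarrow> cutoff1 \<xi> g \<in> carrier A"
  using eps_in_A A.one_closed A.minus_closed by (simp add: cutoff1_def del: A_par_simps)

lemma cutoff1_funcset: "K \<subseteq> carrier G \<Longrightarrow> cutoff1 \<xi> \<in> K \<rightarrow> carrier A"
  by (intro funcsetI cutoff1_closed) blast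

lemma cutoff_closed: "K \<subseteq> carrier G \<Longrightarrow> cutoff \<xi> K \<in> carrier A"
  unfolding cutoff_def by (intro Ac.finprod_closed cutoff1_funcset)

lemma eps_mult_cutoff1:
  assumes g: "g \<in> carrier G"
  shows "eps g \<otimes>\<^bsub>A\<^esub> cutoff1 \<xi> g = (if g \<in> \<xi> then cutoff1 \<xi> g else \<zero>\<^bsub>A\<^esub>)"
proof -
  note e = eps_in_A[OF g]
  have idem: "eps g \<otimes>\<^bsub>A\<^esub> eps g = eps g" using eps_idem[OF g] by simp
  have "eps g \<otimes>\<^bsub>A\<^esub> (\<one>\<^bsub>A\<^esub> \<ominus>\<^bsub>A\<^esub> eps g) = eps g \<ominus>\<^bsub>A\<^esub> eps g"
    using e idem by (simp add: a_minus_def A.r_distr A.r_minus del: A_par_simps)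
  then show ?thesis
    using e idem by (simp add: cutoff1_def a_minus_def A.M.r_neg del: A_par_simps)
qed

lemma cutoff_insert:
  assumes "finite K" "insert g K \<subseteq> carrier G" "g \<notin> K"
  shows "cutoff \<xi> (insert g K) = cutoff1 \<xi> g \<otimes>\<^bsub>A\<^esub> cutoff \<xi> K"
  unfolding cutoff_def
  by (rule Ac.finprod_insert) (use assms cutoff1_closed cutoff1_funcset in auto)

text \<open>A cutoff over a set that contains \<open>g\<close> is an eigenvector of
  \<open>eps g\<close>, with eigenvalue 1 or 0. This is the source of the scalar action of all of
  \<open>A\<close>.\<close>

lemma eps_mult_cutoff:
  assumes K: "finite K" "K \<subseteq> carrier G" and g: "g \<in> K"
  shows "eps g \<otimes>\<^bsub>A\<^esub> cutoff \<xi> K = (if g \<in> \<xi> then cutoff \<xi> K else \<zero>\<^bsub>A\<^esub>)"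
proof -
  have gG: "g \<in> carrier G" using K g by auto
  have cl: "cutoff \<xi> (K - {g}) \<in> carrier A" using K by (intro cutoff_closed) auto
  have "cutoff \<xi> K = cutoff1 \<xi> g \<otimes>\<^bsub>A\<^esub> cutoff \<xi> (K - {g})"
    using cutoff_insert[of "K - {g}" g \<xi>] K g by (simp add: insert_absorb del: A_par_simps)
  then have "eps g \<otimes>\<^bsub>A\<^esub> cutoff \<xi> K = (eps g \<otimes>\<^bsub>A\<^esub> cutoff1 \<xi> g) \<otimes>\<^bsub>A\<^esub> cutoff \<xi> (K - {g})"
    using eps_in_A[OF gG] cutoff1_closed[OF gG] cl by (simp add: A.m_assoc del: A_par_simps)
  also have "\<dots> = (if g \<in> \<xi> then cutoff \<xi> K else \<zero>\<^bsub>A\<^esub>)"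
    using \<open>cutoff \<xi> K = _\<close> cl by (simp add: eps_mult_cutoff1[OF gG] del: A_par_simps)
  finally show ?thesis .
qed

lemma cutoff_mono:
  assumes "finite K" "K \<subseteq> carrier G" "K' \<subseteq> K"
  shows "cutoff \<xi> K = cutoff \<xi> (K - K') \<otimes>\<^bsub>A\<^esub> cutoff \<xi> K'"
proof -
  have 1: "(K - K') \<union> K' = K" "finite (K - K')" "finite K'" "(K - K') \<inter> K' = {}"
    using assms finite_subset by auto
  have "finprod A (cutoff1 \<xi>) ((K - K') \<union> K') = finprod A (cutoff1 \<xi>) (K - K') \<otimes>\<^bsub>A\<^esub> finprod A (cutoff1 \<xi>) K'"
    by (rule Ac.finprod_Un_disjoint[OF 1(2-4)]) (use assms in \<open>auto intro!: cutoff1_closed\<close>)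
  then show ?thesis by (simp only: 1(1) cutoff_def)
qed

lemma cutoff_cong:
  assumes "K \<subseteq> carrier G" "\<xi> \<inter> K = \<eta> \<inter> K"
  shows "cutoff \<xi> K = cutoff \<eta> K"
  unfolding cutoff_def
proof (rule Ac.finprod_cong'[OF refl cutoff1_funcset[OF assms(1)]])
  fix g assume "g \<in> K"
  then have "g \<in> \<xi> \<longleftrightarrow> g \<in> \<eta>" using assms(2) by blast
  then show "cutoff1 \<xi> g = cutoff1 \<eta> g" by (simp add: cutoff1_def)
qed

text \<open>The product over \<open>K\<close> has the product over \<open>K'\<close> as a factor,
  and the latter depends on \<open>\<xi>\<close> only through its trace on \<open>K'\<close>. In
  this form the neighbourhoods from the compactness argument are used.\<close>

lemma mult_cutoff_mono:
  assumes b: "b \<in> carrier A" and K: "finite K" "K \<subseteq> carrier G" "K' \<subseteq> K"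
    and eq: "\<xi> \<inter> K' = \<eta> \<inter> K'" and z: "b \<otimes>\<^bsub>A\<^esub> cutoff \<xi> K' = \<zero>\<^bsub>A\<^esub>"
  shows "b \<otimes>\<^bsub>A\<^esub> cutoff \<eta> K = \<zero>\<^bsub>A\<^esub>"
proof -
  have K': "K' \<subseteq> carrier G" using K by blast
  have c1: "cutoff \<eta> (K - K') \<in> carrier A" "cutoff \<eta> K' \<in> carrier A"
    using K by (auto intro!: cutoff_closed)
  have "b \<otimes>\<^bsub>A\<^esub> cutoff \<eta> K = cutoff \<eta> (K - K') \<otimes>\<^bsub>A\<^esub> (b \<otimes>\<^bsub>A\<^esub> cutoff \<eta> K')"
    using b c1 by (simp only: cutoff_mono[OF K] Ac.m_lcomm)
  also have "\<dots> = \<zero>\<^bsub>A\<^esub>"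
    using z c1 by (simp only: cutoff_cong[OF K' eq, symmetric] A.r_null)
  finally show ?thesis .
qed

text \<open>For each \<open>g\<close> the idempotents \<open>eps g\<close> and
  \<open>1 - eps g\<close> add up to 1, so a cutoff over \<open>K\<close> is the sum of two cutoffs
  over \<open>insert g K\<close>. Removing the elements of \<open>K\<close> one at a time ends with
  the empty product 1.\<close>

lemma mult_cutoff_zero_imp_zero:
  assumes "finite K" "K \<subseteq> carrier G" "b \<in> carrier A"
    and "\<And>\<xi>. \<xi> \<in> X \<Longrightarrow> b \<otimes>\<^bsub>A\<^esub> cutoff \<xi> K = \<zero>\<^bsub>A\<^esub>"
  shows "b = \<zero>\<^bsub>A\<^esub>"
  using assms
proof (induction K)
  case empty
  \<comment> \<open>The empty product is 1, and applying the hypothesis takes some point of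
    \<open>X\<close>.\<close>
  have "carrier G \<in> X" by (simp add: X_iff)
  from empty(3)[OF this] empty(2) show ?case by (simp add: cutoff_def del: A_par_simps)
next
  case (insert g K)
  note b = insert.prems(2)
  have gG: "g \<in> carrier G" and K: "K \<subseteq> carrier G" using insert.prems by auto
  note e = eps_in_A[OF gG]
  show ?case
  proof (rule insert.IH[OF K b])
    fix \<xi> assume \<xi>: "\<xi> \<in> X"
    let ?c = "cutoff \<xi> K"
    have c: "?c \<in> carrier A" by (rule cutoff_closed[OF K])
    have in1: "insert g \<xi> \<in> X" using \<xi> gG by (simp add: X_iff)
    have "(insert g \<xi>) \<inter> K = \<xi> \<inter> K" "(\<xi> - {g}) \<inter> K = \<xi> \<inter> K" using insert.hyps by auto
    note cc = this[THEN cutoff_cong[OF K]]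
    have "cutoff (insert g \<xi>) (insert g K) = eps g \<otimes>\<^bsub>A\<^esub> ?c"
      using cutoff_insert[OF insert.hyps(1) insert.prems(1) insert.hyps(2), of "insert g \<xi>"] cc(1)
      by (simp add: cutoff1_def del: A_par_simps)
    then have 1: "b \<otimes>\<^bsub>A\<^esub> (eps g \<otimes>\<^bsub>A\<^esub> ?c) = \<zero>\<^bsub>A\<^esub>" using insert.prems(3)[OF in1] by simp
    \<comment> \<open>If \<open>g\<close> is the unit then \<open>\<xi> - {g}\<close> leaves
      \<open>X\<close> and the hypothesis says nothing about it, but in that case
      \<open>1 - eps g\<close> is 0.\<close>
    have 2: "b \<otimes>\<^bsub>A\<^esub> ((\<one>\<^bsub>A\<^esub> \<ominus>\<^bsub>A\<^esub> eps g) \<otimes>\<^bsub>A\<^esub> ?c) = \<zero>\<^bsub>A\<^esub>"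
    proof (cases "g = \<one>\<^bsub>G\<^esub>")
      case True
      have "eps g = \<one>\<^bsub>A\<^esub>" by (simp only: True eps_one A_par_simps)
      then have "\<one>\<^bsub>A\<^esub> \<ominus>\<^bsub>A\<^esub> eps g = \<zero>\<^bsub>A\<^esub>"
        using A.one_closed by (simp add: a_minus_def A.M.r_neg del: A_par_simps)
      then show ?thesis using b c by (simp only: A.l_null A.r_null)
    next
      case False
      then have in2: "\<xi> - {g} \<in> X" using \<xi> by (auto simp: X_iff)
      have "cutoff (\<xi> - {g}) (insert g K) = (\<one>\<^bsub>A\<^esub> \<ominus>\<^bsub>A\<^esub> eps g) \<otimes>\<^bsub>A\<^esub> ?c"
        using cutoff_insert[OF insert.hyps(1) insert.prems(1) insert.hyps(2), of "\<xi> - {g}"] cc(2)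
        by (simp add: cutoff1_def del: A_par_simps)
      then show ?thesis using insert.prems(3)[OF in2] by simp
    qed
    have "eps g \<oplus>\<^bsub>A\<^esub> (\<one>\<^bsub>A\<^esub> \<ominus>\<^bsub>A\<^esub> eps g) = \<one>\<^bsub>A\<^esub>"
      using e A.one_closed A.M.a_lcomm[OF e A.one_closed A.M.a_inv_closed[OF e]]
      by (simp add: a_minus_def A.M.r_neg del: A_par_simps)
    then have "?c = eps g \<otimes>\<^bsub>A\<^esub> ?c \<oplus>\<^bsub>A\<^esub> (\<one>\<^bsub>A\<^esub> \<ominus>\<^bsub>A\<^esub> eps g) \<otimes>\<^bsub>A\<^esub> ?c"
      using A.l_distr[OF e A.minus_closed[OF A.one_closed e] c] A.l_one[OF c] by metis
    then have "b \<otimes>\<^bsub>A\<^esub> ?c = b \<otimes>\<^bsub>A\<^esub> (eps g \<otimes>\<^bsub>A\<^esub> ?c) \<oplus>\<^bsub>A\<^esub> b \<otimes>\<^bsub>A\<^esub> ((\<one>\<^bsub>A\<^esub> \<ominus>\<^bsub>A\<^esub> eps g) \<otimes>\<^bsub>A\<^esub> ?c)"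
      using b e c A.minus_closed[OF A.one_closed e] by (metis A.m_closed A.r_distr)
    then show "b \<otimes>\<^bsub>A\<^esub> ?c = \<zero>\<^bsub>A\<^esub>" unfolding 1 2 by (simp del: A_par_simps)
  qed
qed

text \<open>Each generator acts on fine cutoffs by the value of its image, and this property is
  inherited by sums, products and multiples. The claim covers all \<open>K'\<close> above
  \<open>K\<close> so that the sets belonging to two elements can be joined. The points are those of
  the spectrum, on which \<open>T a\<close> is a function.\<close>

lemma mult_cutoff_eq_smult:
  assumes T: "algebra_hom R A L T" "\<And>g. g \<in> carrier G \<Longrightarrow> T (eps g) = c g"
    and a: "a \<in> carrier A"
  shows "\<exists>K. finite K \<and> K \<subseteq> carrier G \<and> (\<forall>K'. finite K' \<longrightarrow> K' \<subseteq> carrier G \<longrightarrow> K \<subseteq> K' \<longrightarrow>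
    (\<forall>\<xi>\<in>\<Omega>. a \<otimes>\<^bsub>A\<^esub> cutoff \<xi> K' = T a \<xi> \<odot>\<^bsub>A\<^esub> cutoff \<xi> K'))"
    (is "\<exists>K. ?Q a K")
  using a
proof (induction rule: A_par_induct)
  have TD: "T (x \<oplus>\<^bsub>P\<^esub> y) = T x \<oplus>\<^bsub>L\<^esub> T y" "T (x \<otimes>\<^bsub>P\<^esub> y) = T x \<otimes>\<^bsub>L\<^esub> T y" "T \<one>\<^bsub>P\<^esub> = \<one>\<^bsub>L\<^esub>"
    "T \<zero>\<^bsub>P\<^esub> = \<zero>\<^bsub>L\<^esub>"
    if "x \<in> carrier A" "y \<in> carrier A" for x y
    using algebra_homD(2-4)[OF T(1)] that algebra_hom_zero[OF T(1) A.ring_M L.ring_M] by simp_all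
  have TR: "T (r \<odot>\<^bsub>P\<^esub> x) = r \<odot>\<^bsub>L\<^esub> T x" if "r \<in> carrier R" "x \<in> carrier A" for r x
    using algebra_homD(5)[OF T(1)] that by simp
  have Tc: "T x \<xi> \<in> carrier R" if "x \<in> carrier A" "\<xi> \<in> \<Omega>" for x \<xi>
    using L_closed[OF algebra_homD(1)[OF T(1) that(1)] that(2)] .
  {
    case (eps g)
    show ?case
    proof (intro exI[of _ "{g}"] conjI allI impI ballI)
      fix K' \<xi> assume "finite K'" "K' \<subseteq> carrier G" "{g} \<subseteq> K'" "\<xi> \<in> \<Omega>"
      then show "eps g \<otimes>\<^bsub>A\<^esub> cutoff \<xi> K' = T (eps g) \<xi> \<odot>\<^bsub>A\<^esub> cutoff \<xi> K'"
        using cutoff_closed[of K' \<xi>] eps by (simp add: eps_mult_cutoff T(2) L_eval del: A_par_simps)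
    qed (use eps in auto)
  next
    case zero
    show ?case
    proof (intro exI[of _ "{}"] conjI allI impI ballI)
      fix K' \<xi> assume "K' \<subseteq> carrier G" "\<xi> \<in> \<Omega>"
      then show "\<zero>\<^bsub>P\<^esub> \<otimes>\<^bsub>A\<^esub> cutoff \<xi> K' = T \<zero>\<^bsub>P\<^esub> \<xi> \<odot>\<^bsub>A\<^esub> cutoff \<xi> K'"
        using cutoff_closed[of K' \<xi>] TD(4)[OF A_par_one A_par_one] A_par_carrier by (simp add: L_eval)
    qed auto
  next
    case one
    show ?case
    proof (intro exI[of _ "{}"] conjI allI impI ballI)
      fix K' \<xi> assume "K' \<subseteq> carrier G" "\<xi> \<in> \<Omega>"
      then show "\<one>\<^bsub>P\<^esub> \<otimes>\<^bsub>A\<^esub> cutoff \<xi> K' = T \<one>\<^bsub>P\<^esub> \<xi> \<odot>\<^bsub>A\<^esub> cutoff \<xi> K'"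
        using cutoff_closed[of K' \<xi>] TD(3)[OF A_par_one A_par_one] A_par_carrier by (simp add: L_eval)
    qed auto
  next
    case (add x y)
    obtain K1 where K1: "?Q x K1" using add(3) by (rule exE)
    obtain K2 where K2: "?Q y K2" using add(4) by (rule exE)
    note K = K1[THEN conjunct1] K1[THEN conjunct2, THEN conjunct1]
      K2[THEN conjunct1] K2[THEN conjunct2, THEN conjunct1]
    note ev = K1[THEN conjunct2, THEN conjunct2, rule_format]
      K2[THEN conjunct2, THEN conjunct2, rule_format]
    show ?case
    proof (intro exI[of _ "K1 \<union> K2"] conjI allI impI ballI)
      fix K' \<xi> assume K': "finite K'" "K' \<subseteq> carrier G" "K1 \<union> K2 \<subseteq> K'" and \<xi>: "\<xi> \<in> \<Omega>"
      note c = cutoff_closed[OF K'(2), of \<xi>]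
      have "x \<otimes>\<^bsub>A\<^esub> cutoff \<xi> K' = T x \<xi> \<odot>\<^bsub>A\<^esub> cutoff \<xi> K'" "y \<otimes>\<^bsub>A\<^esub> cutoff \<xi> K' = T y \<xi> \<odot>\<^bsub>A\<^esub> cutoff \<xi> K'"
        by (rule ev(1)[OF K'(1,2) _ \<xi>] ev(2)[OF K'(1,2) _ \<xi>], use K'(3) in blast)+
      then have "(x \<oplus>\<^bsub>A\<^esub> y) \<otimes>\<^bsub>A\<^esub> cutoff \<xi> K' = (T x \<xi> \<oplus>\<^bsub>R\<^esub> T y \<xi>) \<odot>\<^bsub>A\<^esub> cutoff \<xi> K'"
        using A.l_distr[OF add(1,2) c] A.smult_l_distr[OF Tc[OF add(1) \<xi>] Tc[OF add(2) \<xi>] c] by metis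
      then show "(x \<oplus>\<^bsub>P\<^esub> y) \<otimes>\<^bsub>A\<^esub> cutoff \<xi> K' = T (x \<oplus>\<^bsub>P\<^esub> y) \<xi> \<odot>\<^bsub>A\<^esub> cutoff \<xi> K'"
        using TD(1)[OF add(1,2)] \<xi> by (simp add: L_eval)
    qed (use K in auto)
  next
    case (mult x y)
    obtain K1 where K1: "?Q x K1" using mult(3) by (rule exE)
    obtain K2 where K2: "?Q y K2" using mult(4) by (rule exE)
    note K = K1[THEN conjunct1] K1[THEN conjunct2, THEN conjunct1]
      K2[THEN conjunct1] K2[THEN conjunct2, THEN conjunct1]
    note ev = K1[THEN conjunct2, THEN conjunct2, rule_format]
      K2[THEN conjunct2, THEN conjunct2, rule_format]
    show ?case
    proof (intro exI[of _ "K1 \<union> K2"] conjI allI impI ballI)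
      fix K' \<xi> assume K': "finite K'" "K' \<subseteq> carrier G" "K1 \<union> K2 \<subseteq> K'" and \<xi>: "\<xi> \<in> \<Omega>"
      note c = cutoff_closed[OF K'(2), of \<xi>]
      have e: "x \<otimes>\<^bsub>A\<^esub> cutoff \<xi> K' = T x \<xi> \<odot>\<^bsub>A\<^esub> cutoff \<xi> K'" "y \<otimes>\<^bsub>A\<^esub> cutoff \<xi> K' = T y \<xi> \<odot>\<^bsub>A\<^esub> cutoff \<xi> K'"
        by (rule ev(1)[OF K'(1,2) _ \<xi>] ev(2)[OF K'(1,2) _ \<xi>], use K'(3) in blast)+
      have "(x \<otimes>\<^bsub>A\<^esub> y) \<otimes>\<^bsub>A\<^esub> cutoff \<xi> K' = x \<otimes>\<^bsub>A\<^esub> (T y \<xi> \<odot>\<^bsub>A\<^esub> cutoff \<xi> K')"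
        by (simp only: A.m_assoc[OF mult(1,2) c] e(2))
      also have "\<dots> = T y \<xi> \<odot>\<^bsub>A\<^esub> (T x \<xi> \<odot>\<^bsub>A\<^esub> cutoff \<xi> K')"
        by (simp only: A.smult_mult_right[OF Tc[OF mult(2) \<xi>] mult(1) c] e(1))
      also have "\<dots> = (T x \<xi> \<otimes>\<^bsub>R\<^esub> T y \<xi>) \<odot>\<^bsub>A\<^esub> cutoff \<xi> K'"
        by (simp only: A.smult_assoc1[OF Tc[OF mult(2) \<xi>] Tc[OF mult(1) \<xi>] c, symmetric]
            R.m_comm[OF Tc[OF mult(2) \<xi>] Tc[OF mult(1) \<xi>]])
      finally show "(x \<otimes>\<^bsub>P\<^esub> y) \<otimes>\<^bsub>A\<^esub> cutoff \<xi> K' = T (x \<otimes>\<^bsub>P\<^esub> y) \<xi> \<odot>\<^bsub>A\<^esub> cutoff \<xi> K'"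
        using TD(2)[OF mult(1,2)] \<xi> by (simp add: L_eval)
    qed (use K in auto)
  next
    case (smult r x)
    obtain K where K1: "?Q x K" using smult(3) by (rule exE)
    note K = K1[THEN conjunct1] K1[THEN conjunct2, THEN conjunct1]
    show ?case
    proof (intro exI[of _ K] conjI allI impI ballI)
      fix K' \<xi> assume K': "finite K'" "K' \<subseteq> carrier G" "K \<subseteq> K'" and \<xi>: "\<xi> \<in> \<Omega>"
      note c = cutoff_closed[OF K'(2), of \<xi>]
      have e: "x \<otimes>\<^bsub>A\<^esub> cutoff \<xi> K' = T x \<xi> \<odot>\<^bsub>A\<^esub> cutoff \<xi> K'"
        by (rule K1[THEN conjunct2, THEN conjunct2, rule_format, OF K' \<xi>])
      have "(r \<odot>\<^bsub>A\<^esub> x) \<otimes>\<^bsub>A\<^esub> cutoff \<xi> K' = (r \<otimes>\<^bsub>R\<^esub> T x \<xi>) \<odot>\<^bsub>A\<^esub> cutoff \<xi> K'"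
        by (simp only: A.smult_mult_left[OF smult(1,2) c] e A.smult_assoc1[OF smult(1) Tc[OF smult(2) \<xi>] c])
      then show "(r \<odot>\<^bsub>P\<^esub> x) \<otimes>\<^bsub>A\<^esub> cutoff \<xi> K' = T (r \<odot>\<^bsub>P\<^esub> x) \<xi> \<odot>\<^bsub>A\<^esub> cutoff \<xi> K'"
        using TR[OF smult(1,2)] \<xi> by (simp add: L_eval)
    qed (use K in auto)
  }
qed

text \<open>The consequence of the separation hypothesis from which injectivity is derived. If
  \<open>\<R>\<close> is empty it holds vacuously, which is how \<open>Theta\<close> is obtained
  from the same lemmas.\<close>

definition cutoffs_vanish :: bool where
  "cutoffs_vanish \<longleftrightarrow>
     (\<forall>\<xi>\<in>X - \<Omega>. \<exists>K. finite K \<and> K \<subseteq> carrier G \<and> cutoff \<xi> K = \<zero>\<^bsub>A\<^esub>)"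

text \<open>At points of the spectrum \<open>a\<close> acts on fine cutoffs by the scalar 0, and
  outside it the cutoffs themselves become 0. Compactness is applied to \<open>X\<close> rather than
  to the spectrum, since the cutoffs add up to 1 only over all points of \<open>X\<close>.\<close>

lemma T_kernel:
  assumes T: "algebra_hom R A L T" "\<And>g. g \<in> carrier G \<Longrightarrow> T (eps g) = c g"
    and van: cutoffs_vanish and a: "a \<in> carrier A" and z: "T a = \<zero>\<^bsub>L\<^esub>"
  shows "a = \<zero>\<^bsub>A\<^esub>"
proof -
  obtain K1 where K1: "finite K1" "K1 \<subseteq> carrier G"
    "\<And>\<xi>. \<xi> \<in> \<Omega> \<Longrightarrow> a \<otimes>\<^bsub>A\<^esub> cutoff \<xi> K1 = T a \<xi> \<odot>\<^bsub>A\<^esub> cutoff \<xi> K1"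
    using mult_cutoff_eq_smult[OF T a] by (metis subset_refl)
  have "\<exists>K. finite K \<and> K \<subseteq> carrier G \<and> a \<otimes>\<^bsub>A\<^esub> cutoff \<xi> K = \<zero>\<^bsub>A\<^esub>" if \<xi>: "\<xi> \<in> X" for \<xi>
  proof (cases "\<xi> \<in> \<Omega>")
    case True
    have "a \<otimes>\<^bsub>A\<^esub> cutoff \<xi> K1 = \<zero>\<^bsub>A\<^esub>"
      using K1(3)[OF True] z True cutoff_closed[OF K1(2)] by (simp add: L_eval del: A_par_simps)
    then show ?thesis using K1 by blast
  next
    case False
    then obtain K where "finite K" "K \<subseteq> carrier G" "cutoff \<xi> K = \<zero>\<^bsub>A\<^esub>"
      using van \<xi> unfolding cutoffs_vanish_def by blast
    moreover from this have "a \<otimes>\<^bsub>A\<^esub> cutoff \<xi> K = \<zero>\<^bsub>A\<^esub>" using a by (simp only: A.r_null)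
    ultimately show ?thesis by blast
  qed
  then obtain K where K: "finite K" "K \<subseteq> carrier G"
    "\<And>\<eta>. \<eta> \<in> X \<Longrightarrow> \<exists>\<xi>\<in>X. \<exists>K'\<subseteq>K. a \<otimes>\<^bsub>A\<^esub> cutoff \<xi> K' = \<zero>\<^bsub>A\<^esub> \<and> \<eta> \<inter> K' = \<xi> \<inter> K'"
    using X_top_uniform[OF closedin_topspace, of G "\<lambda>\<xi> K. a \<otimes>\<^bsub>A\<^esub> cutoff \<xi> K = \<zero>\<^bsub>A\<^esub>"] by metis
  show ?thesis
  proof (rule mult_cutoff_zero_imp_zero[OF K(1,2) a])
    fix \<eta> assume "\<eta> \<in> X"
    then obtain \<xi> K' where "K' \<subseteq> K" "a \<otimes>\<^bsub>A\<^esub> cutoff \<xi> K' = \<zero>\<^bsub>A\<^esub>" "\<xi> \<inter> K' = \<eta> \<inter> K'"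
      using K(3) by metis
    then show "a \<otimes>\<^bsub>A\<^esub> cutoff \<eta> K = \<zero>\<^bsub>A\<^esub>" using mult_cutoff_mono[OF a K(1,2)] by blast
  qed
qed

lemma T_inj_on:
  assumes T: "algebra_hom R A L T" "\<And>g. g \<in> carrier G \<Longrightarrow> T (eps g) = c g"
    and van: cutoffs_vanish
  shows "inj_on T (carrier A)"
proof (rule inj_onI)
  fix a b assume ab: "a \<in> carrier A" "b \<in> carrier A" and eq: "T a = T b"
  have "T (a \<ominus>\<^bsub>A\<^esub> b) = T b \<ominus>\<^bsub>L\<^esub> T b"
    by (simp only: algebra_hom_minus[OF T(1) A.ring_M L.ring_M ab] eq)
  then have "T (a \<ominus>\<^bsub>A\<^esub> b) = \<zero>\<^bsub>L\<^esub>"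
    using algebra_homD(1)[OF T(1) ab(2)] by (simp add: a_minus_def L.M.r_neg)
  then have "a \<ominus>\<^bsub>A\<^esub> b = \<zero>\<^bsub>A\<^esub>" using T_kernel[OF T van A.minus_closed[OF ab]] by simp
  then have "a \<oplus>\<^bsub>A\<^esub> \<ominus>\<^bsub>A\<^esub> b = b \<oplus>\<^bsub>A\<^esub> \<ominus>\<^bsub>A\<^esub> b"
    using ab by (simp add: a_minus_def A.M.r_neg del: A_par_simps)
  then show "a = b" using ab by (simp del: A_par_simps)
qed

text \<open>Induction on a set \<open>K\<close> that determines \<open>f\<close>: splitting off
  \<open>g\<close>, the function agrees with one function on the sets containing \<open>g\<close>
  and with another one on the rest, both determined by the smaller set. They are glued with
  \<open>eps g\<close> and \<open>1 - eps g\<close>.\<close>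

lemma T_surj:
  assumes T: "algebra_hom R A L T" "\<And>g. g \<in> carrier G \<Longrightarrow> T (eps g) = c g"
  shows "T ` carrier A = carrier L"
proof
  show "T ` carrier A \<subseteq> carrier L" using algebra_homD(1)[OF T(1)] by blast
  note TD = algebra_homD[OF T(1)]
  have "f \<in> T ` carrier A" if "finite K" "f \<in> carrier L" "determined_by f K" for f K
    using that
  proof (induction K arbitrary: f)
    case empty
    note D = determined_byD(3)[OF empty(2)]
    \<comment> \<open>A function determined by the empty set has a single value; the default 0 is
      for an empty spectrum.\<close>
    define r where "r = (if \<Omega> = {} then \<zero>\<^bsub>R\<^esub> else f (SOME \<xi>. \<xi> \<in> \<Omega>))"
    have r: "r \<in> carrier R" "\<And>\<xi>. \<xi> \<in> \<Omega> \<Longrightarrow> f \<xi> = r"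
    proof -
      have s: "(SOME \<xi>. \<xi> \<in> \<Omega>) \<in> \<Omega>" if "\<Omega> \<noteq> {}" using that by (simp add: some_in_eq)
      show "r \<in> carrier R" using s L_closed[OF empty(1)] by (simp add: r_def)
      fix \<xi> assume "\<xi> \<in> \<Omega>"
      then show "f \<xi> = r" using s D[of \<xi> "SOME \<xi>. \<xi> \<in> \<Omega>"] by (auto simp: r_def)
    qed
    have "T (r \<odot>\<^bsub>A\<^esub> \<one>\<^bsub>A\<^esub>) = r \<odot>\<^bsub>L\<^esub> \<one>\<^bsub>L\<^esub>" using TD(5)[OF r(1) A.one_closed] TD(4) by simp
    also have "\<dots> = f"
      by (rule L_ext[OF L.smult_closed[OF r(1) L.one_closed] empty(1)]) (use r in \<open>simp add: L_eval\<close>)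
    finally show ?case using A.smult_closed[OF r(1) A.one_closed] by (metis imageI)
  next
    case (insert g K)
    note D = determined_byD[OF insert.prems(2)]
    have gG: "g \<in> carrier G" and K: "K \<subseteq> carrier G" using D(2) by auto
    \<comment> \<open>Adding \<open>g\<close> to \<open>\<xi>\<close> or removing it may lead out of
      the spectrum, so some other point with the same trace on \<open>K\<close> is chosen. Where
      there is none, \<open>part Q\<close> is 0; this does no harm, because for
      \<open>Q = (g \<in> \<xi>)\<close> the point \<open>\<xi>\<close> itself is a candidate, and
      the other part is multiplied by 0. The choice depends on \<open>\<xi>\<close> only through its
      trace on \<open>K\<close>.\<close>
    define pick where "pick Q \<xi> = (SOME \<eta>. \<eta> \<in> \<Omega> \<and> \<eta> \<inter> K = \<xi> \<inter> K \<and> (g \<in> \<eta>) = Q)" for Q \<xi>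
    define part where "part Q = (\<lambda>\<xi>\<in>\<Omega>. if \<exists>\<eta>. \<eta> \<in> \<Omega> \<and> \<eta> \<inter> K = \<xi> \<inter> K \<and> (g \<in> \<eta>) = Q
      then f (pick Q \<xi>) else \<zero>\<^bsub>R\<^esub>)" for Q
    have pick: "pick Q \<xi> \<in> \<Omega> \<and> pick Q \<xi> \<inter> K = \<xi> \<inter> K \<and> (g \<in> pick Q \<xi>) = Q"
      if "\<exists>\<eta>. \<eta> \<in> \<Omega> \<and> \<eta> \<inter> K = \<xi> \<inter> K \<and> (g \<in> \<eta>) = Q" for Q \<xi>
      unfolding pick_def using that by (rule someI_ex)
    have det: "determined_by (part Q) K" for Q
    proof (rule determined_byI[OF insert.hyps(1) K])
      fix \<xi> \<eta> assume "\<xi> \<in> \<Omega>" "\<eta> \<in> \<Omega>" "\<xi> \<inter> K = \<eta> \<inter> K"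
      then show "part Q \<xi> = part Q \<eta>"
        by (simp only: part_def pick_def restrict_apply if_True)
    qed
    have "part Q \<xi> \<in> carrier R" if "\<xi> \<in> \<Omega>" for Q \<xi>
      using that L_closed[OF insert.prems(1)] pick[of \<xi> Q] by (auto simp: part_def)
    then have part_L: "part Q \<in> carrier L" for Q
      using det[of Q] unfolding L_carrier_iff by (auto simp: part_def)
    have part_eq: "part (g \<in> \<xi>) \<xi> = f \<xi>" if \<xi>: "\<xi> \<in> \<Omega>" for \<xi>
    proof -
      have ex: "\<exists>\<eta>. \<eta> \<in> \<Omega> \<and> \<eta> \<inter> K = \<xi> \<inter> K \<and> (g \<in> \<eta>) = (g \<in> \<xi>)" using \<xi> by blast
      note p = pick[OF this]
      have "pick (g \<in> \<xi>) \<xi> \<inter> insert g K = \<xi> \<inter> insert g K" using p by blast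
      then have "f (pick (g \<in> \<xi>) \<xi>) = f \<xi>" using D(3) p \<xi> by blast
      then show ?thesis using ex \<xi> by (simp add: part_def)
    qed
    obtain a1 where a1: "a1 \<in> carrier A" "part True = T a1"
      using insert.IH[OF part_L det, of True] by (rule imageE)
    obtain a0 where a0: "a0 \<in> carrier A" "part False = T a0"
      using insert.IH[OF part_L det, of False] by (rule imageE)
    note a = a1(1) a1(2)[symmetric] a0(1) a0(2)[symmetric]
    note e = eps_in_A[OF gG]
    let ?a = "a1 \<otimes>\<^bsub>A\<^esub> eps g \<oplus>\<^bsub>A\<^esub> a0 \<otimes>\<^bsub>A\<^esub> (\<one>\<^bsub>A\<^esub> \<ominus>\<^bsub>A\<^esub> eps g)"
    have cl: "a1 \<otimes>\<^bsub>A\<^esub> eps g \<in> carrier A" "\<one>\<^bsub>A\<^esub> \<ominus>\<^bsub>A\<^esub> eps g \<in> carrier A" "a0 \<otimes>\<^bsub>A\<^esub> (\<one>\<^bsub>A\<^esub> \<ominus>\<^bsub>A\<^esub> eps g) \<in> carrier A"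
      using A.m_closed[OF a(1) e] A.minus_closed[OF A.one_closed e]
        A.m_closed[OF a(3) A.minus_closed[OF A.one_closed e]] by blast+
    have "T ?a = part True \<otimes>\<^bsub>L\<^esub> c g \<oplus>\<^bsub>L\<^esub> part False \<otimes>\<^bsub>L\<^esub> (\<one>\<^bsub>L\<^esub> \<ominus>\<^bsub>L\<^esub> c g)"
      by (simp only: TD(2)[OF cl(1,3)] TD(3)[OF a(1) e] TD(3)[OF a(3) cl(2)]
          algebra_hom_minus[OF T(1) A.ring_M L.ring_M A.one_closed e] TD(4) T(2)[OF gG] a(2,4))
    also have "\<dots> = f"
    proof (rule L_ext[OF _ insert.prems(1)])
      note cg = c_closed[OF gG]
      show "part True \<otimes>\<^bsub>L\<^esub> c g \<oplus>\<^bsub>L\<^esub> part False \<otimes>\<^bsub>L\<^esub> (\<one>\<^bsub>L\<^esub> \<ominus>\<^bsub>L\<^esub> c g) \<in> carrier L"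
        using part_L cg by (intro L.M.a_closed L.m_closed L.minus_closed L.one_closed)
      fix \<xi> assume \<xi>: "\<xi> \<in> \<Omega>"
      have m: "(\<one>\<^bsub>L\<^esub> \<ominus>\<^bsub>L\<^esub> c g) \<xi> = (if g \<in> \<xi> then \<zero>\<^bsub>R\<^esub> else \<one>\<^bsub>R\<^esub>)"
      proof -
        have "(\<one>\<^bsub>L\<^esub> \<ominus>\<^bsub>L\<^esub> c g) \<oplus>\<^bsub>L\<^esub> c g = \<one>\<^bsub>L\<^esub>"
          using cg by (simp add: a_minus_def L.M.a_assoc L.M.l_neg)
        then have "(\<one>\<^bsub>L\<^esub> \<ominus>\<^bsub>L\<^esub> c g) \<xi> \<oplus>\<^bsub>R\<^esub> c g \<xi> = \<one>\<^bsub>R\<^esub>"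
          by (metis L_eval(2,4) \<xi>)
        moreover have "(\<one>\<^bsub>L\<^esub> \<ominus>\<^bsub>L\<^esub> c g) \<xi> \<in> carrier R"
          by (rule L_closed[OF L.minus_closed[OF L.one_closed cg] \<xi>])
        ultimately show ?thesis
          using \<xi> by (cases "g \<in> \<xi>") (simp_all add: L_eval)
      qed
      show "(part True \<otimes>\<^bsub>L\<^esub> c g \<oplus>\<^bsub>L\<^esub> part False \<otimes>\<^bsub>L\<^esub> (\<one>\<^bsub>L\<^esub> \<ominus>\<^bsub>L\<^esub> c g)) \<xi> = f \<xi>"
        using part_eq[OF \<xi>] \<xi> L_closed[OF part_L \<xi>, of True] L_closed[OF part_L \<xi>, of False]
        by (cases "g \<in> \<xi>") (simp_all add: L_eval m)
    qed
    finally show ?case using A.M.a_closed[OF cl(1,3)] by (metis imageI)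
  qed
  note surj = this
  show "carrier L \<subseteq> T ` carrier A"
  proof
    fix f assume f: "f \<in> carrier L"
    then obtain K where "determined_by f K" using L_carrier_iff by blast
    then show "f \<in> T ` carrier A" using surj[OF determined_byD(1) f] by blast
  qed
qed

lemma algebra_iso_T:
  assumes "algebra_hom R A L T" "\<And>g. g \<in> carrier G \<Longrightarrow> T (eps g) = c g" cutoffs_vanish
  shows "algebra_iso R A L T"
  unfolding algebra_iso_iff bij_betw_def
  using A.assoc_algebra_axioms L_assoc_algebra assms T_inj_on[OF assms] T_surj[OF assms(1,2)] by blast

end

section \<open>Conjugation by the generators\<close>

context par_setup begin

text \<open>The partial action on \<open>A\<close>, realized inside \<open>P\<close> and extended to
  all of \<open>A\<close>, just as \<open>\<theta> g\<close> is to all of \<open>L\<close>.\<close>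

definition conj_gen :: "'g \<Rightarrow> ('g list \<Rightarrow> 'r) set \<Rightarrow> ('g list \<Rightarrow> 'r) set" where
  "conj_gen g a = gen g \<otimes>\<^bsub>P\<^esub> a \<otimes>\<^bsub>P\<^esub> gen (inv\<^bsub>G\<^esub> g)"

lemma gen_eps_inv:
  assumes "g \<in> carrier G"
  shows "gen g \<otimes>\<^bsub>P\<^esub> eps (inv\<^bsub>G\<^esub> g) = gen g"
  using gen_eps[OF assms G.inv_closed[OF assms]] assms by (simp add: eps_one)

lemma eps_inv: "g \<in> carrier G \<Longrightarrow> eps (inv\<^bsub>G\<^esub> g) = gen (inv\<^bsub>G\<^esub> g) \<otimes>\<^bsub>P\<^esub> gen g"
  by (simp add: par_eps_def)

text \<open>The product \<open>[g\<inverse>][g]\<close> is \<open>eps (g\<inverse>)\<close>, which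
  commutes with \<open>a\<close> and is absorbed by a \<open>[g]\<close> standing before it.\<close>

lemma gen_mult_eq_conj_gen:
  assumes g: "g \<in> carrier G" and a: "a \<in> carrier A"
  shows "conj_gen g a \<otimes>\<^bsub>P\<^esub> gen g = gen g \<otimes>\<^bsub>P\<^esub> a"
proof -
  have aP: "a \<in> carrier P" by (rule A_par_carrier[OF a])
  have g': "inv\<^bsub>G\<^esub> g \<in> carrier G" using g by simp
  note cl = aP gen_closed[OF g] gen_closed[OF g'] eps_closed[OF g']
  have "conj_gen g a \<otimes>\<^bsub>P\<^esub> gen g = gen g \<otimes>\<^bsub>P\<^esub> (a \<otimes>\<^bsub>P\<^esub> eps (inv\<^bsub>G\<^esub> g))"
    using cl by (simp add: conj_gen_def eps_inv[OF g] P.m_assoc)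
  also have "\<dots> = gen g \<otimes>\<^bsub>P\<^esub> (eps (inv\<^bsub>G\<^esub> g) \<otimes>\<^bsub>P\<^esub> a)"
    by (simp only: A_par_commute[OF a eps_in_A[OF g']])
  also have "\<dots> = (gen g \<otimes>\<^bsub>P\<^esub> eps (inv\<^bsub>G\<^esub> g)) \<otimes>\<^bsub>P\<^esub> a"
    using cl by (simp add: P.m_assoc)
  finally show ?thesis by (simp only: gen_eps_inv[OF g])
qed

text \<open>Conjugation is multiplicative on \<open>A\<close> although \<open>[g]\<close> need not
  be invertible: \<open>[g] a\<close> is rewritten as the conjugate of \<open>a\<close> times
  \<open>[g]\<close>, and this \<open>[g]\<close> then conjugates \<open>b\<close>.\<close>

lemma conj_gen_hom:
  assumes g: "g \<in> carrier G" and a: "a \<in> carrier A" and b: "b \<in> carrier A"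
  shows "conj_gen g (a \<otimes>\<^bsub>P\<^esub> b) = conj_gen g a \<otimes>\<^bsub>P\<^esub> conj_gen g b"
    and "conj_gen g (a \<oplus>\<^bsub>P\<^esub> b) = conj_gen g a \<oplus>\<^bsub>P\<^esub> conj_gen g b"
    and "r \<in> carrier R \<Longrightarrow> conj_gen g (r \<odot>\<^bsub>P\<^esub> a) = r \<odot>\<^bsub>P\<^esub> conj_gen g a"
proof -
  have ab: "a \<in> carrier P" "b \<in> carrier P" using A_par_carrier a b by auto
  have g': "inv\<^bsub>G\<^esub> g \<in> carrier G" using g by simp
  note cl = ab gen_closed[OF g] gen_closed[OF g']
  have c: "conj_gen g a \<in> carrier P" using cl by (simp add: conj_gen_def)
  have "conj_gen g (a \<otimes>\<^bsub>P\<^esub> b) = (gen g \<otimes>\<^bsub>P\<^esub> a) \<otimes>\<^bsub>P\<^esub> (b \<otimes>\<^bsub>P\<^esub> gen (inv\<^bsub>G\<^esub> g))"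
    using cl by (simp add: conj_gen_def P.m_assoc)
  also have "\<dots> = conj_gen g a \<otimes>\<^bsub>P\<^esub> gen g \<otimes>\<^bsub>P\<^esub> (b \<otimes>\<^bsub>P\<^esub> gen (inv\<^bsub>G\<^esub> g))"
    by (simp only: gen_mult_eq_conj_gen[OF g a])
  also have "\<dots> = conj_gen g a \<otimes>\<^bsub>P\<^esub> conj_gen g b"
    using cl c unfolding conj_gen_def[of g b] by (simp add: P.m_assoc)
  finally show "conj_gen g (a \<otimes>\<^bsub>P\<^esub> b) = conj_gen g a \<otimes>\<^bsub>P\<^esub> conj_gen g b" .
  show "conj_gen g (a \<oplus>\<^bsub>P\<^esub> b) = conj_gen g a \<oplus>\<^bsub>P\<^esub> conj_gen g b"
    using cl by (simp add: conj_gen_def P.r_distr P.l_distr)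
  show "r \<in> carrier R \<Longrightarrow> conj_gen g (r \<odot>\<^bsub>P\<^esub> a) = r \<odot>\<^bsub>P\<^esub> conj_gen g a"
    using cl by (simp add: conj_gen_def P.smult_mult_left P.smult_mult_right)
qed

text \<open>On \<open>eps h\<close> conjugation gives \<open>eps (gh) eps g\<close>, and both claims
  pass to the generated algebra. \<open>T\<close> is any homomorphism with the right values, so that
  the stability of \<open>A\<close> under conjugation can be used before \<open>T\<close> is known
  to be bijective.\<close>

lemma conj_gen_T:
  assumes T: "algebra_hom R A L T" "\<And>g. g \<in> carrier G \<Longrightarrow> T (eps g) = c g"
    and g: "g \<in> carrier G" and a: "a \<in> carrier A"
  shows "conj_gen g a \<in> carrier A \<and> T (conj_gen g a) = \<theta> g (T a)"
  using a
proof (induction rule: A_par_induct)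
  note TD = algebra_homD[OF T(1), unfolded A_par_simps]
  have Tz: "T \<zero>\<^bsub>P\<^esub> = \<zero>\<^bsub>L\<^esub>" using algebra_hom_zero[OF T(1) A.ring_M L.ring_M] by simp
  {
    case (eps h)
    have 1: "conj_gen g (eps h) = eps (g \<otimes>\<^bsub>G\<^esub> h) \<otimes>\<^bsub>P\<^esub> eps g"
      unfolding conj_gen_def by (rule gen_eps_gen[OF g eps])
    have gh: "g \<otimes>\<^bsub>G\<^esub> h \<in> carrier G" using g eps by simp
    have "T (conj_gen g (eps h)) = \<theta> g (T (eps h))"
    proof (rule L_ext)
      have "T (conj_gen g (eps h)) = c (g \<otimes>\<^bsub>G\<^esub> h) \<otimes>\<^bsub>L\<^esub> c g"
        by (simp only: 1 TD(3)[OF eps_in_A[OF gh] eps_in_A[OF g]] T(2)[OF gh] T(2)[OF g])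
      then show "T (conj_gen g (eps h)) \<in> carrier L" using c_closed[OF gh] c_closed[OF g] by simp
      show "\<theta> g (T (eps h)) \<in> carrier L"
        using D_carrier[OF theta_closed[OF g TD(1)[OF eps_in_A[OF eps]]]] .
      fix \<xi> assume \<xi>: "\<xi> \<in> \<Omega>"
      show "T (conj_gen g (eps h)) \<xi> = \<theta> g (T (eps h)) \<xi>"
        using \<open>T (conj_gen g (eps h)) = _\<close> \<xi> g eps
        by (simp add: T(2) theta_eval L_eval translate_in_Omega mem_tr_iff)
    qed
    then show ?case unfolding 1 using A_par_closed(2)[OF eps_in_A[OF gh] eps_in_A[OF g]] by simp
  next
    case zero
    have "conj_gen g \<zero>\<^bsub>P\<^esub> = \<zero>\<^bsub>P\<^esub>" using g by (simp add: conj_gen_def)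
    moreover have "\<theta> g \<zero>\<^bsub>L\<^esub> = \<zero>\<^bsub>L\<^esub>"
      by (rule L_ext[OF D_carrier[OF theta_closed[OF g]]]) (simp_all add: theta_eval L_eval translate_in_Omega)
    ultimately show ?case using Tz A_par_zero by simp
  next
    case one
    have "conj_gen g \<one>\<^bsub>P\<^esub> = eps g" using g by (simp add: conj_gen_def par_eps_def)
    moreover have "\<theta> g \<one>\<^bsub>L\<^esub> = c g"
      by (rule L_ext[OF D_carrier[OF theta_closed[OF g]] c_closed[OF g]])
        (simp_all add: theta_eval L_eval translate_in_Omega)
    ultimately show ?case using TD(4) eps_in_A[OF g] T(2)[OF g] by simp
  next
    case (add x y)
    then show ?case
      using conj_gen_hom(2)[OF g add(1,2)] TD(1,2) theta_hom(2)[OF g] A_par_closed(1) by simp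
  next
    case (mult x y)
    then show ?case
      using conj_gen_hom(1)[OF g mult(1,2)] TD(1,3) theta_hom(1)[OF g] A_par_closed(2) by simp
  next
    case (smult r x)
    then show ?case
      using conj_gen_hom(3)[OF g smult(2,2,1)] TD(1,5) theta_hom(3)[OF g TD(1)[OF smult(2)] TD(1)[OF smult(2)] smult(1)] A_par_closed(3) by simp
  }
qed

lemma hom_eq_on_A:
  assumes h: "algebra_hom R A B h" and k: "algebra_hom R A B k" and B: "assoc_algebra R B"
    and eq: "\<And>g. g \<in> carrier G \<Longrightarrow> h (eps g) = k (eps g)" and x: "x \<in> carrier A"
  shows "h x = k x"
proof -
  interpret B: assoc_algebra R B by (rule B)
  note hD = algebra_homD[OF h, unfolded A_par_simps] and kD = algebra_homD[OF k, unfolded A_par_simps]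
  show ?thesis using x
  proof (induction rule: A_par_induct)
    case zero
    show ?case
      using algebra_hom_zero[OF h A.ring_M B.ring_M] algebra_hom_zero[OF k A.ring_M B.ring_M] by simp
  qed (simp_all add: hD kD eq)
qed

lemma eval_relation_eps_in_A:
  assumes rel: "\<And>l gs. (l, gs) \<in> set rel \<Longrightarrow> l \<in> carrier R \<and> set gs \<subseteq> carrier G"
  shows "eval_relation A (\<lambda>g. eps g) rel \<in> carrier A"
  by (rule A.eval_relation_closed) (use rel eps_in_A in blast)

end

section \<open>The canonical map and the separation hypothesis\<close>

context par_setup begin

text \<open>The algebra without additional relations: the domain of \<open>\<rho>\<close> and of
  \<open>Theta\<close>.\<close>

interpretation E: par_setup R G "{}"
  by unfold_locales (simp add: eps_relations_on_def)

abbreviation "\<rho> \<equiv> par_rho R G \<R>"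

lemma par_ideal_empty_subset: "par_ideal R G {} \<subseteq> par_ideal R G \<R>"
proof -
  have "par_relators R G {} \<subseteq> par_relators R G \<R>" by (auto simp: par_relators_def Let_def)
  also have "\<dots> \<subseteq> par_ideal R G \<R>"
    unfolding par_ideal_def by (rule F.genideal_self[OF par_relators_closed])
  finally show ?thesis
    unfolding par_ideal_def[of R G "{}"] by (rule F.genideal_minimal[OF par_ideal])
qed

text \<open>With the smaller ideal contained in the larger one, the sum of the larger ideal and a
  coset of the smaller one is a single coset.\<close>

lemma par_rho_coset:
  assumes x: "x \<in> carrier F"
  shows "\<rho> (par_ideal R G {} +>\<^bsub>F\<^esub> x) = par_ideal R G \<R> +>\<^bsub>F\<^esub> x"
proof -
  interpret I: ideal "par_ideal R G \<R>" F by (rule par_ideal)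
  interpret I0: ideal "par_ideal R G {}" F by (rule E.par_ideal)
  have "y \<in> \<rho> (par_ideal R G {} +>\<^bsub>F\<^esub> x) \<longleftrightarrow> y \<in> par_ideal R G \<R> +>\<^bsub>F\<^esub> x" for y
  proof
    assume "y \<in> \<rho> (par_ideal R G {} +>\<^bsub>F\<^esub> x)"
    then obtain i j where ij: "i \<in> par_ideal R G \<R>" "j \<in> par_ideal R G {}" "y = i \<oplus>\<^bsub>F\<^esub> (j \<oplus>\<^bsub>F\<^esub> x)"
      by (auto simp: par_rho_def set_add_def' a_r_coset_def')
    have j: "j \<in> par_ideal R G \<R>" using ij par_ideal_empty_subset by blast
    have "y = (i \<oplus>\<^bsub>F\<^esub> j) \<oplus>\<^bsub>F\<^esub> x"
      using ij(3) I.Icarr[OF ij(1)] I.Icarr[OF j] x by (simp add: F.M.a_assoc)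
    moreover have "i \<oplus>\<^bsub>F\<^esub> j \<in> par_ideal R G \<R>" by (rule I.a_closed[OF ij(1) j])
    ultimately show "y \<in> par_ideal R G \<R> +>\<^bsub>F\<^esub> x" by (auto simp: a_r_coset_def')
  next
    assume "y \<in> par_ideal R G \<R> +>\<^bsub>F\<^esub> x"
    then obtain i where i: "i \<in> par_ideal R G \<R>" "y = i \<oplus>\<^bsub>F\<^esub> x" by (auto simp: a_r_coset_def')
    have "x \<in> par_ideal R G {} +>\<^bsub>F\<^esub> x" by (rule I0.a_rcos_self[OF x])
    then show "y \<in> \<rho> (par_ideal R G {} +>\<^bsub>F\<^esub> x)" using i by (auto simp: par_rho_def set_add_def')
  qed
  then show ?thesis by blast
qed

lemma E_carrierE:
  assumes "Z \<in> carrier E.P"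
  obtains x where "x \<in> carrier F" "Z = par_ideal R G {} +>\<^bsub>F\<^esub> x"
  using assms unfolding R_par_def
  by (rule quotient_algebra_carrierE[OF F.assoc_algebra_axioms E.par_ideal])

lemma par_rho_hom: "algebra_hom R E.P P \<rho>"
proof -
  note hE = algebra_homD(2-5)[OF E.coset_hom, symmetric] and h = algebra_homD[OF coset_hom]
  show ?thesis
  proof (rule algebra_homI)
    fix Z assume "Z \<in> carrier E.P"
    then obtain x where x: "x \<in> carrier F" "Z = par_ideal R G {} +>\<^bsub>F\<^esub> x" by (rule E_carrierE)
    show "\<rho> Z \<in> carrier P" unfolding x(2) par_rho_coset[OF x(1)] by (rule h(1)[OF x(1)])
    fix r assume r: "r \<in> carrier R"
    show "\<rho> (r \<odot>\<^bsub>E.P\<^esub> Z) = r \<odot>\<^bsub>P\<^esub> \<rho> Z"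
      by (simp only: x hE(4)[OF r x(1)] par_rho_coset[OF F.smult_closed[OF r x(1)]] par_rho_coset h(5)[OF r x(1)])
  next
    fix Z W assume "Z \<in> carrier E.P" "W \<in> carrier E.P"
    then obtain x y where x: "x \<in> carrier F" "Z = par_ideal R G {} +>\<^bsub>F\<^esub> x"
        and y: "y \<in> carrier F" "W = par_ideal R G {} +>\<^bsub>F\<^esub> y"
      by (elim E_carrierE)
    show "\<rho> (Z \<oplus>\<^bsub>E.P\<^esub> W) = \<rho> Z \<oplus>\<^bsub>P\<^esub> \<rho> W"
      by (simp only: x y hE(1)[OF x(1) y(1)] par_rho_coset[OF F.M.a_closed[OF x(1) y(1)]]
          par_rho_coset h(2)[OF x(1) y(1)])
    show "\<rho> (Z \<otimes>\<^bsub>E.P\<^esub> W) = \<rho> Z \<otimes>\<^bsub>P\<^esub> \<rho> W"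
      by (simp only: x y hE(2)[OF x(1) y(1)] par_rho_coset[OF F.m_closed[OF x(1) y(1)]]
          par_rho_coset h(3)[OF x(1) y(1)])
  next
    show "\<rho> \<one>\<^bsub>E.P\<^esub> = \<one>\<^bsub>P\<^esub>"
      by (simp only: hE(3) par_rho_coset[OF F.one_closed] h(4))
  qed
qed

lemma par_rho_gen: "g \<in> carrier G \<Longrightarrow> \<rho> (E.gen g) = gen g"
  by (simp add: par_gen_def par_rho_coset free_gen_closed)

lemma par_rho_eps: "g \<in> carrier G \<Longrightarrow> \<rho> (E.eps g) = eps g"
  by (simp add: par_eps_def algebra_homD(3)[OF par_rho_hom] par_rho_gen)

lemma par_rho_hom_A: "algebra_hom R E.A A \<rho>"
proof -
  note h = algebra_homD[OF par_rho_hom]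
  note Ec = E.A_par_carrier
  have "\<rho> x \<in> carrier A" if "x \<in> carrier E.A" for x
    using that
  proof (induction rule: E.A_par_induct)
    case (eps g)
    then show ?case by (simp add: par_rho_eps eps_in_A)
  next
    case zero
    show ?case
      unfolding algebra_hom_zero[OF par_rho_hom E.P.ring_M P.ring_M] by (rule A_par_zero)
  next
    case one
    show ?case unfolding h(4) by (rule A_par_one)
  next
    case (add x y)
    then show ?case using h(2)[OF Ec Ec, OF add(1,2)] A_par_closed(1) by simp
  next
    case (mult x y)
    then show ?case using h(3)[OF Ec Ec, OF mult(1,2)] A_par_closed(2) by simp
  next
    case (smult r x)
    then show ?case using h(5)[OF smult(1) Ec[OF smult(2)]] A_par_closed(3) by simp
  qed
  then show ?thesis
    by (intro algebra_homI) (simp_all add: h Ec)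
qed

subsection \<open>The isomorphism without additional relations\<close>

lemma Omega_empty: "Omega R G {} = X"
  using E.Omega_iff by blast

lemma Omega_top_empty: "Omega_top R G {} = X_top G"
  by (simp add: Omega_top_def Omega_empty)

text \<open>The choice in the definition of \<open>Theta\<close> has a witness, namely the
  homomorphism \<open>T\<close> for the empty set of relations: its spectrum is \<open>X\<close>, so
  no cutoff has to vanish and it is an isomorphism.\<close>

lemma Theta:
  "algebra_hom R E.A E.L (Theta R G)" "g \<in> carrier G \<Longrightarrow> Theta R G (E.eps g) = E.c g"
proof -
  obtain T where T: "algebra_hom R E.A E.L T" "\<And>g. g \<in> carrier G \<Longrightarrow> T (E.eps g) = E.c g"
    using E.T_ex by metis
  have "E.cutoffs_vanish" by (simp add: E.cutoffs_vanish_def Omega_empty)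
  from E.algebra_iso_T[OF T this]
  have "\<exists>T. algebra_iso R E.A (Lc (X_top G) R) T \<and>
      (\<forall>g\<in>carrier G. T (E.eps g) = char_fun (X_top G) R g)"
    using T(2) unfolding Omega_top_empty by blast
  from someI_ex[OF this] have "algebra_iso R E.A (Lc (X_top G) R) (Theta R G) \<and>
      (\<forall>g\<in>carrier G. Theta R G (E.eps g) = char_fun (X_top G) R g)"
    unfolding Theta_def .
  then show "algebra_hom R E.A E.L (Theta R G)" "g \<in> carrier G \<Longrightarrow> Theta R G (E.eps g) = E.c g"
    unfolding Omega_top_empty algebra_iso_iff by blast+
qed

lemma par_rho_cutoff:
  assumes K: "K \<subseteq> carrier G"
  shows "\<rho> (E.cutoff \<xi> K) = cutoff \<xi> K"
proof -
  interpret \<rho>: ring_hom_cring E.A A \<rho>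
    using algebra_hom_ring_hom_ring[OF par_rho_hom_A E.A.ring_M A.ring_M] E.Ac.is_cring Ac.is_cring
    by (intro ring_hom_cringI)
  have "\<rho> (E.cutoff \<xi> K) = finprod A (\<rho> \<circ> E.cutoff1 \<xi>) K"
    unfolding E.cutoff_def by (rule \<rho>.hom_finprod[OF E.cutoff1_funcset[OF K]])
  also have "\<dots> = cutoff \<xi> K"
    unfolding cutoff_def
  proof (rule Ac.finprod_cong'[OF refl cutoff1_funcset[OF K]])
    fix g assume "g \<in> K"
    then have g: "g \<in> carrier G" using K by auto
    have "\<rho> (\<one>\<^bsub>E.A\<^esub> \<ominus>\<^bsub>E.A\<^esub> E.eps g) = \<one>\<^bsub>A\<^esub> \<ominus>\<^bsub>A\<^esub> eps g"
      by (simp only: algebra_hom_minus[OF par_rho_hom_A E.A.ring_M A.ring_M E.A.one_closed E.eps_in_A[OF g]]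
          algebra_homD(4)[OF par_rho_hom_A] par_rho_eps[OF g])
    then show "(\<rho> \<circ> E.cutoff1 \<xi>) g = cutoff1 \<xi> g"
      unfolding comp_apply E.cutoff1_def cutoff1_def using par_rho_eps[OF g] by (simp only: split: if_split) simp
  qed
  finally show ?thesis .
qed

text \<open>Let \<open>a\<close> in the kernel of \<open>\<rho>\<close> have the value 1 at
  \<open>\<xi>\<close>. Before relations are imposed, \<open>a\<close> acts on a fine cutoff
  \<open>e\<close> at \<open>\<xi>\<close> by this value, so \<open>a e = e\<close>, and applying
  \<open>\<rho>\<close> turns this into \<open>0 = e\<close>.\<close>

lemma kernel_separates_imp_cutoffs_vanish:
  assumes "kernel_separates R G \<R>"
  shows cutoffs_vanish
  unfolding cutoffs_vanish_def
proof
  fix \<xi> assume \<xi>: "\<xi> \<in> X - \<Omega>"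
  obtain f where f: "f \<in> Theta R G ` a_kernel E.A A \<rho>" "f \<xi> = \<one>\<^bsub>R\<^esub>"
    using assms \<xi> unfolding kernel_separates_def by blast
  obtain a where a: "a \<in> carrier E.A" "\<rho> a = \<zero>\<^bsub>A\<^esub>" "Theta R G a \<xi> = \<one>\<^bsub>R\<^esub>"
    using f unfolding a_kernel_def' by blast
  have \<xi>X: "\<xi> \<in> Omega R G {}" using \<xi> Omega_empty by blast
  obtain K where K: "finite K" "K \<subseteq> carrier G"
      "a \<otimes>\<^bsub>E.A\<^esub> E.cutoff \<xi> K = Theta R G a \<xi> \<odot>\<^bsub>E.A\<^esub> E.cutoff \<xi> K"
    using E.mult_cutoff_eq_smult[OF Theta a(1)] \<xi>X by (metis subset_refl)
  note cE = E.cutoff_closed[OF K(2), of \<xi>]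
  have "a \<otimes>\<^bsub>E.A\<^esub> E.cutoff \<xi> K = E.cutoff \<xi> K"
    by (simp only: K(3) a(3) E.A.smult_one[OF cE])
  then have "\<rho> a \<otimes>\<^bsub>A\<^esub> cutoff \<xi> K = cutoff \<xi> K"
    using algebra_homD(3)[OF par_rho_hom_A a(1) cE] by (simp only: par_rho_cutoff[OF K(2)])
  then have "cutoff \<xi> K = \<zero>\<^bsub>A\<^esub>"
    using cutoff_closed[OF K(2), of \<xi>] by (simp only: a(2) A.l_null)
  then show "\<exists>K. finite K \<and> K \<subseteq> carrier G \<and> cutoff \<xi> K = \<zero>\<^bsub>A\<^esub>" using K by blast
qed

text \<open>Outside the spectrum some relation has a nonzero value at a translate
  \<open>g\<inverse> \<xi>\<close>. The element of the kernel that it defines is conjugated by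
  \<open>[g]\<close> and divided by that value.\<close>

lemma field_imp_kernel_separates:
  assumes "field R"
  shows "kernel_separates R G \<R>"
  unfolding kernel_separates_def
proof
  fix \<xi> assume \<xi>: "\<xi> \<in> X - \<Omega>"
  then obtain rel g where rg: "rel \<in> \<R>" "g \<in> \<xi>" "eval_at R (tr g \<xi>) rel \<noteq> \<zero>\<^bsub>R\<^esub>"
    using Omega_iff by blast
  have \<xi>X: "\<xi> \<in> Omega R G {}" using \<xi> Omega_empty by blast
  have g: "g \<in> carrier G" using rg(2) E.OmegaD(1)[OF \<xi>X] by blast
  have rc: "l \<in> carrier R \<and> set gs \<subseteq> carrier G" if "(l, gs) \<in> set rel" for l gs
    using relation_coeff[OF rg(1) that] by blast
  let ?r = "eval_at R (tr g \<xi>) rel"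
  let ?e = "eval_relation E.A (\<lambda>g. E.eps g) rel"
  have e: "?e \<in> carrier E.A" by (rule E.eval_relation_eps_in_A[OF rc])
  have tr: "tr g \<xi> \<in> Omega R G {}" by (rule E.translate_in_Omega[OF \<xi>X rg(2)])
  have "Theta R G ?e = eval_relation E.L (\<lambda>g. E.c g) rel"
  proof (rule algebra_hom_eval_relation[OF Theta(1) E.A.assoc_algebra_axioms E.L_assoc_algebra])
    show "l \<in> carrier R \<and> (\<lambda>g. E.eps g) ` set gs \<subseteq> carrier E.A" if "(l, gs) \<in> set rel" for l gs
      using rc[OF that] E.eps_in_A by blast
    show "E.c h = Theta R G (E.eps h)" if "(l, gs) \<in> set rel" "h \<in> set gs" for l gs h
      by (rule Theta(2)[symmetric]) (use rc[OF that(1)] that(2) in blast)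
  qed
  then have ev: "Theta R G ?e (tr g \<xi>) = ?r"
    using R.eval_relation_Lc[of "tr g \<xi>" "Omega_top R G {}" rel] tr by (simp only: E.topspace_Omega_top)
  note conj = E.conj_gen_T[OF Theta g e]
  \<comment> \<open>Because of \<open>g \<in> \<xi>\<close>, the partial action carries the value at
    \<open>g\<inverse> \<xi>\<close> over to \<open>\<xi>\<close>.\<close>
  have conj_ev: "Theta R G (E.conj_gen g ?e) \<xi> = ?r"
    using conj ev rg(2) by (simp add: E.theta_eval[OF \<xi>X])
  have "\<rho> ?e = eval_relation A (\<lambda>g. eps g) rel"
  proof (rule algebra_hom_eval_relation[OF par_rho_hom_A E.A.assoc_algebra_axioms A.assoc_algebra_axioms])
    show "l \<in> carrier R \<and> (\<lambda>g. E.eps g) ` set gs \<subseteq> carrier E.A" if "(l, gs) \<in> set rel" for l gs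
      using rc[OF that] E.eps_in_A by blast
    show "eps h = \<rho> (E.eps h)" if "(l, gs) \<in> set rel" "h \<in> set gs" for l gs h
      by (rule par_rho_eps[symmetric]) (use rc[OF that(1)] that(2) in blast)
  qed
  also have "\<dots> = eval_relation P (\<lambda>g. eps g) rel"
    by (simp add: eval_relation_def)
  also have "\<dots> = \<zero>\<^bsub>P\<^esub>" by (rule eval_relation_eps[OF rg(1)])
  finally have \<rho>e: "\<rho> ?e = \<zero>\<^bsub>P\<^esub>" .
  note eP = E.A_par_carrier[OF e]
  \<comment> \<open>The kernel is stable under conjugation since \<open>\<rho>\<close> is a
    homomorphism on all of \<open>E.P\<close>, where the \<open>[g]\<close> live, and not merely on
    \<open>E.A\<close>.\<close>
  have "\<rho> (E.conj_gen g ?e) = gen g \<otimes>\<^bsub>P\<^esub> \<rho> ?e \<otimes>\<^bsub>P\<^esub> gen (inv\<^bsub>G\<^esub> g)"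
    using g eP by (simp add: E.conj_gen_def algebra_homD(3)[OF par_rho_hom] par_rho_gen)
  then have \<rho>c: "\<rho> (E.conj_gen g ?e) = \<zero>\<^bsub>A\<^esub>" using g by (simp add: \<rho>e)
  have rR: "?r \<in> carrier R"
    unfolding ev[symmetric] by (rule E.L_closed[OF algebra_homD(1)[OF Theta(1) e] tr])
  then have "?r \<in> Units R" using field.field_Units[OF assms] rg(3) by blast
  then obtain s where s: "s \<in> carrier R" "s \<otimes>\<^bsub>R\<^esub> ?r = \<one>\<^bsub>R\<^esub>" by (auto simp: Units_def)
  let ?a = "s \<odot>\<^bsub>E.A\<^esub> E.conj_gen g ?e"
  have a: "?a \<in> carrier E.A" using conj s by (intro E.A.smult_closed) auto
  have "\<rho> ?a = s \<odot>\<^bsub>A\<^esub> \<zero>\<^bsub>A\<^esub>"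
    using algebra_homD(5)[OF par_rho_hom_A s(1)] conj by (simp only: \<rho>c)
  then have "\<rho> ?a = \<zero>\<^bsub>A\<^esub>" using s by (simp only: A.smult_r_null)
  then have "?a \<in> a_kernel E.A A \<rho>" unfolding a_kernel_def' using a by blast
  moreover have "Theta R G ?a \<xi> = \<one>\<^bsub>R\<^esub>"
    by (simp only: algebra_homD(5)[OF Theta(1) s(1) conj[THEN conjunct1]] E.L_eval[OF \<xi>X] conj_ev s(2))
  ultimately show "\<exists>f\<in>Theta R G ` a_kernel E.A A \<rho>. f \<xi> = \<one>\<^bsub>R\<^esub>" by blast
qed

end

section \<open>Equivalence of the partial actions and bijectivity onto the skew group ring\<close>

lemma algebra_hom_finsum:
  assumes h: "algebra_hom R A B h" and A: "ring A" and B: "ring B"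
    and I: "finite I" "f \<in> I \<rightarrow> carrier A"
  shows "h (finsum A f I) = finsum B (\<lambda>i. h (f i)) I"
  using I
proof (induction I)
  interpret A: ring A by (rule A)
  interpret B: ring B by (rule B)
  {
    case empty
    show ?case by (simp add: algebra_hom_zero[OF h A B])
  next
    case (insert i I)
    have f: "f \<in> I \<rightarrow> carrier A" "f i \<in> carrier A" using insert.prems by auto
    have hf: "(\<lambda>i. h (f i)) \<in> I \<rightarrow> carrier B" "h (f i) \<in> carrier B"
      using f algebra_homD(1)[OF h] by auto
    have "h (finsum A f (insert i I)) = h (f i \<oplus>\<^bsub>A\<^esub> finsum A f I)"
      by (simp only: A.finsum_insert[OF insert.hyps f])
    also have "\<dots> = h (f i) \<oplus>\<^bsub>B\<^esub> finsum B (\<lambda>i. h (f i)) I"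
      by (simp only: algebra_homD(2)[OF h f(2) A.finsum_closed[OF f(1)]] insert.IH[OF f(1)])
    also have "\<dots> = finsum B (\<lambda>i. h (f i)) (insert i I)"
      by (simp only: B.finsum_insert[OF insert.hyps hf])
    finally show ?case .
  }
qed

context par_setup begin

text \<open>Members of \<open>D g\<close> are fixed by multiplication with \<open>c g\<close>, and
  injectivity of \<open>T\<close> pulls this back to \<open>x eps g = x\<close>.\<close>

lemma A_par_ideal_iff:
  assumes T: "algebra_iso R A L T" and Tc: "\<And>g. g \<in> carrier G \<Longrightarrow> T (eps g) = c g"
    and g: "g \<in> carrier G" and x: "x \<in> carrier A"
  shows "x \<in> A_par_ideal R G \<R> g \<longleftrightarrow> T x \<in> D g"
proof -
  have h: "algebra_hom R A L T" and inj: "inj_on T (carrier A)"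
    using T by (auto simp: algebra_iso_iff bij_betw_def)
  note e = eps_in_A[OF g]
  have Te: "T (y \<otimes>\<^bsub>A\<^esub> eps g) = T y \<otimes>\<^bsub>L\<^esub> c g" if "y \<in> carrier A" for y
    by (simp only: algebra_homD(3)[OF h that e] Tc[OF g])
  show ?thesis
  proof
    assume "x \<in> A_par_ideal R G \<R> g"
    then obtain y where y: "y \<in> carrier A" "x = y \<otimes>\<^bsub>A\<^esub> eps g"
      unfolding A_par_ideal_def cgenideal_def by blast
    show "T x \<in> D g"
      unfolding y(2) Te[OF y(1)]
      by (rule ideal.I_l_closed[OF D_ideal[OF g] c_in_D[OF g] algebra_homD(1)[OF h y(1)]])
  next
    assume "T x \<in> D g"
    then have "T (x \<otimes>\<^bsub>A\<^esub> eps g) = T x" unfolding Te[OF x] by (rule mult_c_eq[OF _ g])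
    then have "x \<otimes>\<^bsub>A\<^esub> eps g = x" using inj_onD[OF inj _ A.m_closed[OF x e] x] by blast
    then show "x \<in> A_par_ideal R G \<R> g"
      unfolding A_par_ideal_def cgenideal_def using x by (metis (mono_tags, lifting) mem_Collect_eq)
  qed
qed

lemma A_par_ideal_carrier:
  assumes "g \<in> carrier G" "x \<in> A_par_ideal R G \<R> g"
  shows "x \<in> carrier A"
  using ideal.Icarr[OF Ac.cgenideal_ideal[OF eps_in_A[OF assms(1)]]] assms(2)
  by (simp only: A_par_ideal_def)

text \<open>\<open>T\<close> carries conjugation by \<open>[g]\<close> to \<open>\<theta> g\<close>
  and the ideals of \<open>A\<close> to the \<open>D g\<close>, so the axioms about inverses,
  domains and composition are pulled back along the injective \<open>T\<close>; that conjugation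
  respects the operations is \<open>conj_gen_hom\<close>.\<close>

lemma A_par_action_ex:
  assumes T: "algebra_iso R A L T" and Tc: "\<And>g. g \<in> carrier G \<Longrightarrow> T (eps g) = c g"
  shows "A_par_action R G \<R> conj_gen"
proof -
  have h: "algebra_hom R A L T" and inj: "inj_on T (carrier A)"
    using T by (auto simp: algebra_iso_iff bij_betw_def)
  note hD = algebra_homD[OF h]
  have iff: "x \<in> A_par_ideal R G \<R> g \<longleftrightarrow> T x \<in> D g" if "g \<in> carrier G" "x \<in> carrier A" for g x
    by (rule A_par_ideal_iff[OF T _ that]) (rule Tc)
  note IC = A_par_ideal_carrier
  have cA: "conj_gen g x \<in> carrier A" and cT: "T (conj_gen g x) = \<theta> g (T x)"
    if "g \<in> carrier G" "x \<in> carrier A" for g x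
    using conj_gen_T[OF h Tc that] by blast+
  have eqI: "x = y" if "x \<in> carrier A" "y \<in> carrier A" "T x = T y" for x y
    using inj_onD[OF inj that(3,1,2)] .
  note pa = algebra_partial_action_theta[unfolded algebra_partial_action_def]
  have cI: "conj_gen g x \<in> A_par_ideal R G \<R> g" if "g \<in> carrier G" "x \<in> carrier A" for g x
    unfolding iff[OF that(1) cA[OF that]] cT[OF that] by (rule theta_closed[OF that(1) hD(1)[OF that(2)]])
  have cc: "conj_gen (inv\<^bsub>G\<^esub> g) (conj_gen g x) = x"
    if g: "g \<in> carrier G" and x: "x \<in> A_par_ideal R G \<R> (inv\<^bsub>G\<^esub> g)" for g x
  proof -
    have g': "inv\<^bsub>G\<^esub> g \<in> carrier G" using g by simp
    note xA = IC[OF g' x]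
    show ?thesis
    proof (rule eqI[OF cA[OF g' cA[OF g xA]] xA])
      show "T (conj_gen (inv\<^bsub>G\<^esub> g) (conj_gen g x)) = T x"
        unfolding cT[OF g' cA[OF g xA]] cT[OF g xA]
        using x unfolding iff[OF g' xA] by (rule theta_theta_inv[OF g])
    qed
  qed
  have action: "algebra_partial_action R G A (A_par_ideal R G \<R>) conj_gen"
    unfolding algebra_partial_action_def
  proof (intro conjI ballI)
    show "assoc_algebra R A" by (rule A.assoc_algebra_axioms)
  next
    fix g assume g: "g \<in> carrier G"
    have g': "inv\<^bsub>G\<^esub> g \<in> carrier G" using g by simp
    show "ideal (A_par_ideal R G \<R> g) A"
      unfolding A_par_ideal_def by (rule Ac.cgenideal_ideal[OF eps_in_A[OF g]])
    have "bij_betw (conj_gen g) (A_par_ideal R G \<R> (inv\<^bsub>G\<^esub> g)) (A_par_ideal R G \<R> g)"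
    proof (rule bij_betw_byWitness[where f' = "conj_gen (inv\<^bsub>G\<^esub> g)"])
      show "\<forall>x\<in>A_par_ideal R G \<R> (inv\<^bsub>G\<^esub> g). conj_gen (inv\<^bsub>G\<^esub> g) (conj_gen g x) = x"
        using cc[OF g] by blast
      show "\<forall>x\<in>A_par_ideal R G \<R> g. conj_gen g (conj_gen (inv\<^bsub>G\<^esub> g) x) = x"
        using cc[OF g'] unfolding G.inv_inv[OF g] by blast
      show "conj_gen g ` A_par_ideal R G \<R> (inv\<^bsub>G\<^esub> g) \<subseteq> A_par_ideal R G \<R> g"
        using cI[OF g] IC[OF g'] by blast
      show "conj_gen (inv\<^bsub>G\<^esub> g) ` A_par_ideal R G \<R> g \<subseteq> A_par_ideal R G \<R> (inv\<^bsub>G\<^esub> g)"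
        using cI[OF g'] IC[OF g] by blast
    qed
    then show "ideal_iso R A (A_par_ideal R G \<R> (inv\<^bsub>G\<^esub> g)) (A_par_ideal R G \<R> g) (conj_gen g)"
      unfolding ideal_iso_def A_par_simps using conj_gen_hom[OF g IC[OF g'] IC[OF g']] by blast
  next
    have "x \<in> A_par_ideal R G \<R> \<one>\<^bsub>G\<^esub> \<longleftrightarrow> x \<in> carrier A" for x
      using IC[OF G.one_closed] iff[OF G.one_closed] hD(1) D_one by blast
    then show "A_par_ideal R G \<R> \<one>\<^bsub>G\<^esub> = carrier A" by blast
  next
    fix x assume x: "x \<in> carrier A"
    show "conj_gen \<one>\<^bsub>G\<^esub> x = x"
      by (rule eqI[OF cA[OF G.one_closed x] x]) (use cT[OF G.one_closed x] pa hD(1)[OF x] in metis)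
  next
    fix g k assume g: "g \<in> carrier G" and k: "k \<in> carrier G"
    have gk: "g \<otimes>\<^bsub>G\<^esub> k \<in> carrier G" "inv\<^bsub>G\<^esub> g \<in> carrier G" "inv\<^bsub>G\<^esub> k \<in> carrier G"
      "inv\<^bsub>G\<^esub> (g \<otimes>\<^bsub>G\<^esub> k) \<in> carrier G" using g k by auto
    show "conj_gen g ` (A_par_ideal R G \<R> (inv\<^bsub>G\<^esub> g) \<inter> A_par_ideal R G \<R> k) \<subseteq> A_par_ideal R G \<R> (g \<otimes>\<^bsub>G\<^esub> k)"
    proof
      fix y assume "y \<in> conj_gen g ` (A_par_ideal R G \<R> (inv\<^bsub>G\<^esub> g) \<inter> A_par_ideal R G \<R> k)"
      then obtain x where x: "x \<in> A_par_ideal R G \<R> (inv\<^bsub>G\<^esub> g)" "x \<in> A_par_ideal R G \<R> k" "y = conj_gen g x"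
        by blast
      note xA = IC[OF k x(2)]
      have "T x \<in> D (inv\<^bsub>G\<^esub> g) \<inter> D k" using x iff[OF gk(2) xA] iff[OF k xA] by blast
      then have "\<theta> g (T x) \<in> D (g \<otimes>\<^bsub>G\<^esub> k)" using pa g k by blast
      then show "y \<in> A_par_ideal R G \<R> (g \<otimes>\<^bsub>G\<^esub> k)"
        unfolding x(3) iff[OF gk(1) cA[OF g xA]] cT[OF g xA] .
    qed
    fix x assume "x \<in> A_par_ideal R G \<R> (inv\<^bsub>G\<^esub> k) \<inter> A_par_ideal R G \<R> (inv\<^bsub>G\<^esub> (g \<otimes>\<^bsub>G\<^esub> k))"
    then have x: "x \<in> A_par_ideal R G \<R> (inv\<^bsub>G\<^esub> k)" "x \<in> A_par_ideal R G \<R> (inv\<^bsub>G\<^esub> (g \<otimes>\<^bsub>G\<^esub> k))" by auto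
    note xA = IC[OF gk(3) x(1)]
    have "T x \<in> D (inv\<^bsub>G\<^esub> k) \<inter> D (inv\<^bsub>G\<^esub> (g \<otimes>\<^bsub>G\<^esub> k))"
      using x iff[OF gk(3) xA] iff[OF gk(4) xA] by blast
    then have "\<theta> g (\<theta> k (T x)) = \<theta> (g \<otimes>\<^bsub>G\<^esub> k) (T x)" using pa g k by blast
    then show "conj_gen g (conj_gen k x) = conj_gen (g \<otimes>\<^bsub>G\<^esub> k) x"
      by (intro eqI[OF cA[OF g cA[OF k xA]] cA[OF gk(1) xA]])
        (simp only: cT[OF g cA[OF k xA]] cT[OF k xA] cT[OF gk(1) xA])
  qed
  have "conj_gen g (eps k \<otimes>\<^bsub>A\<^esub> eps (inv\<^bsub>G\<^esub> g)) = eps (g \<otimes>\<^bsub>G\<^esub> k) \<otimes>\<^bsub>A\<^esub> eps g"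
    if g: "g \<in> carrier G" and k: "k \<in> carrier G" for g k
  proof -
    have gk: "g \<otimes>\<^bsub>G\<^esub> k \<in> carrier G" and g': "inv\<^bsub>G\<^esub> g \<in> carrier G" using g k by auto
    note m = A.m_closed[OF eps_in_A[OF k] eps_in_A[OF g']]
    show ?thesis
      by (rule eqI[OF cA[OF g m] A.m_closed[OF eps_in_A[OF gk] eps_in_A[OF g]]])
        (simp only: cT[OF g m] hD(3)[OF eps_in_A[OF k] eps_in_A[OF g']]
          hD(3)[OF eps_in_A[OF gk] eps_in_A[OF g]] Tc[OF g] Tc[OF k] Tc[OF gk] Tc[OF g'] theta_c[OF g k])
  qed
  then show ?thesis using action unfolding A_par_action_def by blast
qed

text \<open>The domain of \<open>\<eta> g\<close> consists of the products \<open>a ?e\<close> with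
  \<open>a\<close> in \<open>A\<close>, and the values are prescribed when \<open>a\<close> is a
  generator. Induction on \<open>a\<close> extends the agreement with \<open>\<theta> g\<close> to
  the whole domain, whichever \<open>\<eta>\<close> meets the description.\<close>

lemma A_par_action_equivalent:
  assumes T: "algebra_iso R A L T" and Tc: "\<And>g. g \<in> carrier G \<Longrightarrow> T (eps g) = c g"
    and \<eta>: "A_par_action R G \<R> \<eta>"
  shows "equivalent_under G T (A_par_ideal R G \<R>) \<eta> (Lc_ideal R G \<R>) (Lc_theta R G \<R>)"
  unfolding equivalent_under_def
proof (intro conjI ballI)
  have h: "algebra_hom R A L T" and surj: "T ` carrier A = carrier L"
    using T by (auto simp: algebra_iso_iff bij_betw_def)
  note hD = algebra_homD[OF h]
  fix g assume g: "g \<in> carrier G"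
  show "T ` A_par_ideal R G \<R> g = D g"
  proof
    show "T ` A_par_ideal R G \<R> g \<subseteq> D g"
      using A_par_ideal_iff[OF T Tc g] A_par_ideal_carrier[OF g] by blast
    show "D g \<subseteq> T ` A_par_ideal R G \<R> g"
    proof
      fix f assume f: "f \<in> D g"
      then have "f \<in> T ` carrier A" unfolding surj by (rule D_carrier)
      then obtain x where "x \<in> carrier A" "f = T x" by blast
      then show "f \<in> T ` A_par_ideal R G \<R> g" using f A_par_ideal_iff[OF T Tc g] by blast
    qed
  qed
  have g': "inv\<^bsub>G\<^esub> g \<in> carrier G" using g by simp
  let ?I = "A_par_ideal R G \<R>" and ?e = "eps (inv\<^bsub>G\<^esub> g)"
  note e = eps_in_A[OF g']
  interpret I: ideal "?I (inv\<^bsub>G\<^esub> g)" A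
    unfolding A_par_ideal_def by (rule Ac.cgenideal_ideal[OF e])
  note \<eta>_def = \<eta>[unfolded A_par_action_def]
  note iso = \<eta>_def[THEN conjunct1, unfolded algebra_partial_action_def, THEN conjunct2, THEN conjunct2,
      THEN conjunct1, rule_format, OF g]
  note act = \<eta>_def[THEN conjunct2, rule_format, OF g]
  have \<eta>h: "\<eta> g x \<in> carrier A" "\<eta> g (x \<oplus>\<^bsub>A\<^esub> y) = \<eta> g x \<oplus>\<^bsub>A\<^esub> \<eta> g y"
    "\<eta> g (x \<otimes>\<^bsub>A\<^esub> y) = \<eta> g x \<otimes>\<^bsub>A\<^esub> \<eta> g y" "r \<in> carrier R \<Longrightarrow> \<eta> g (r \<odot>\<^bsub>A\<^esub> x) = r \<odot>\<^bsub>A\<^esub> \<eta> g x"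
    if "x \<in> ?I (inv\<^bsub>G\<^esub> g)" "y \<in> ?I (inv\<^bsub>G\<^esub> g)" for x y r
    using iso that bij_betwE[of "\<eta> g"] A_par_ideal_carrier[OF g] unfolding ideal_iso_def by blast+
  have eI: "?e \<in> ?I (inv\<^bsub>G\<^esub> g)" unfolding A_par_ideal_def by (rule A.cgenideal_self[OF e])
  have ideal: "a \<otimes>\<^bsub>A\<^esub> ?e \<in> ?I (inv\<^bsub>G\<^esub> g)" if "a \<in> carrier A" for a
    by (rule I.I_l_closed[OF eI that])
  have idem: "?e \<otimes>\<^bsub>A\<^esub> ?e = ?e" using eps_idem[OF g'] by simp
  \<comment> \<open>Stated ahead of the induction because the case of zero is derived from it too,
    as the multiple \<open>0 1\<close>.\<close>
  have smult: "T (\<eta> g ((r \<odot>\<^bsub>A\<^esub> a) \<otimes>\<^bsub>A\<^esub> ?e)) = \<theta> g (T ((r \<odot>\<^bsub>A\<^esub> a) \<otimes>\<^bsub>A\<^esub> ?e))"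
    if r: "r \<in> carrier R" and a: "a \<in> carrier A" and IH: "T (\<eta> g (a \<otimes>\<^bsub>A\<^esub> ?e)) = \<theta> g (T (a \<otimes>\<^bsub>A\<^esub> ?e))" for r a
  proof -
    note m = A.m_closed[OF a e] and i = ideal[OF a]
    show ?thesis
      by (simp only: A.smult_mult_left[OF r a e] \<eta>h(4)[OF i i r] hD(5)[OF r \<eta>h(1)[OF i i]] IH
          hD(5)[OF r m] theta_hom(3)[OF g hD(1)[OF m] hD(1)[OF m] r])
  qed
  have one: "T (\<eta> g (\<one>\<^bsub>A\<^esub> \<otimes>\<^bsub>A\<^esub> ?e)) = \<theta> g (T (\<one>\<^bsub>A\<^esub> \<otimes>\<^bsub>A\<^esub> ?e))"
    and gens: "\<And>k. k \<in> carrier G \<Longrightarrow> T (\<eta> g (eps k \<otimes>\<^bsub>A\<^esub> ?e)) = \<theta> g (T (eps k \<otimes>\<^bsub>A\<^esub> ?e))"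
  proof -
    show gens: "T (\<eta> g (eps k \<otimes>\<^bsub>A\<^esub> ?e)) = \<theta> g (T (eps k \<otimes>\<^bsub>A\<^esub> ?e))" if k: "k \<in> carrier G" for k
    proof -
      have gk: "g \<otimes>\<^bsub>G\<^esub> k \<in> carrier G" using g k by simp
      show ?thesis
        by (simp only: act[OF k] hD(3)[OF eps_in_A[OF gk] eps_in_A[OF g]] hD(3)[OF eps_in_A[OF k] e]
            Tc[OF gk] Tc[OF g] Tc[OF k] Tc[OF g'] theta_c[OF g k])
    qed
    \<comment> \<open>The unit of \<open>A\<close> is itself a generator, namely \<open>eps\<close>
      at the unit of \<open>G\<close>.\<close>
    show "T (\<eta> g (\<one>\<^bsub>A\<^esub> \<otimes>\<^bsub>A\<^esub> ?e)) = \<theta> g (T (\<one>\<^bsub>A\<^esub> \<otimes>\<^bsub>A\<^esub> ?e))"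
      using gens[OF G.one_closed] by (simp only: eps_one A_par_simps)
  qed
  have main: "T (\<eta> g (a \<otimes>\<^bsub>A\<^esub> ?e)) = \<theta> g (T (a \<otimes>\<^bsub>A\<^esub> ?e))" if "a \<in> carrier A" for a
    using that
  proof (induction rule: A_par_induct)
    case (eps k)
    then show ?case by (rule gens)
  next
    case zero
    have "\<zero>\<^bsub>P\<^esub> = \<zero>\<^bsub>R\<^esub> \<odot>\<^bsub>A\<^esub> \<one>\<^bsub>A\<^esub>" using A.smult_l_null[OF A.one_closed] by simp
    then show ?case using smult[OF R.zero_closed A.one_closed one] by (simp only:)
  next
    case one
    show ?case using \<open>T (\<eta> g (\<one>\<^bsub>A\<^esub> \<otimes>\<^bsub>A\<^esub> ?e)) = _\<close> by (simp only: A_par_simps)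
  next
    case (add x y)
    note i = ideal[OF add(1)] ideal[OF add(2)]
    note m = A.m_closed[OF add(1) e] A.m_closed[OF add(2) e]
    have eq: "(x \<oplus>\<^bsub>A\<^esub> y) \<otimes>\<^bsub>A\<^esub> ?e = x \<otimes>\<^bsub>A\<^esub> ?e \<oplus>\<^bsub>A\<^esub> y \<otimes>\<^bsub>A\<^esub> ?e" by (rule A.l_distr[OF add(1,2) e])
    have "T (\<eta> g ((x \<oplus>\<^bsub>A\<^esub> y) \<otimes>\<^bsub>A\<^esub> ?e)) = \<theta> g (T ((x \<oplus>\<^bsub>A\<^esub> y) \<otimes>\<^bsub>A\<^esub> ?e))"
      by (simp only: eq \<eta>h(2)[OF i] hD(2)[OF \<eta>h(1)[OF i(1,1)] \<eta>h(1)[OF i(2,2)]] add(3,4)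
          hD(2)[OF m] theta_hom(2)[OF g hD(1)[OF m(1)] hD(1)[OF m(2)]])
    then show ?case by (simp only: A_par_simps)
  next
    case (mult x y)
    note i = ideal[OF mult(1)] ideal[OF mult(2)]
    note m = A.m_closed[OF mult(1) e] A.m_closed[OF mult(2) e]
    \<comment> \<open>As \<open>?e\<close> is idempotent it can be given to both factors, which then
      lie in the ideal on which \<open>\<eta> g\<close> is multiplicative.\<close>
    have "(x \<otimes>\<^bsub>A\<^esub> ?e) \<otimes>\<^bsub>A\<^esub> (y \<otimes>\<^bsub>A\<^esub> ?e) = (x \<otimes>\<^bsub>A\<^esub> y) \<otimes>\<^bsub>A\<^esub> (?e \<otimes>\<^bsub>A\<^esub> ?e)"
      using mult(1,2) e by (simp add: Ac.m_ac del: A_par_simps)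
    then have eq: "(x \<otimes>\<^bsub>A\<^esub> y) \<otimes>\<^bsub>A\<^esub> ?e = (x \<otimes>\<^bsub>A\<^esub> ?e) \<otimes>\<^bsub>A\<^esub> (y \<otimes>\<^bsub>A\<^esub> ?e)" by (simp only: idem)
    have "T (\<eta> g ((x \<otimes>\<^bsub>A\<^esub> y) \<otimes>\<^bsub>A\<^esub> ?e)) = \<theta> g (T ((x \<otimes>\<^bsub>A\<^esub> y) \<otimes>\<^bsub>A\<^esub> ?e))"
      by (simp only: eq \<eta>h(3)[OF i] hD(3)[OF \<eta>h(1)[OF i(1,1)] \<eta>h(1)[OF i(2,2)]] mult(3,4)
          hD(3)[OF m] theta_hom(1)[OF g hD(1)[OF m(1)] hD(1)[OF m(2)]])
    then show ?case by (simp only: A_par_simps)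
  next
    case (smult r x)
    then show ?case using \<open>\<And>r a. _ \<Longrightarrow> _ \<Longrightarrow> _ \<Longrightarrow> T (\<eta> g ((r \<odot>\<^bsub>A\<^esub> a) \<otimes>\<^bsub>A\<^esub> ?e)) = _\<close>[of r x]
      by (simp only: A_par_simps)
  qed
  fix x assume "x \<in> ?I (inv\<^bsub>G\<^esub> g)"
  then obtain a where "a \<in> carrier A" "x = a \<otimes>\<^bsub>A\<^esub> ?e" unfolding A_par_ideal_def cgenideal_def by blast
  then show "T (\<eta> g x) = \<theta> g (T x)" using main by simp
qed

text \<open>The sums of this form are stable under left multiplication by generators: moving
  \<open>[h]\<close> past a coefficient conjugates the coefficient, and \<open>[h][g]\<close> is
  \<open>eps h [hg]\<close>. The representation is not unique.\<close>

lemma R_par_sum_representation: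
  assumes "x \<in> carrier P"
  shows "\<exists>N a. finite N \<and> N \<subseteq> carrier G \<and> a \<in> N \<rightarrow> carrier A \<and>
    x = (\<Oplus>\<^bsub>P\<^esub>g\<in>N. a g \<otimes>\<^bsub>P\<^esub> gen g)"
  using assms
proof (induction rule: R_par_induct)
  have tc: "a g \<otimes>\<^bsub>P\<^esub> gen g \<in> carrier P" if "a \<in> N \<rightarrow> carrier A" "N \<subseteq> carrier G" "g \<in> N" for a N g
    using A_par_carrier[OF funcset_mem[OF that(1,3)]] gen_closed[OF subsetD[OF that(2,3)]] by simp
  {
    case zero
    show ?case by (intro exI[of _ "{}"]) simp
  next
    case one
    show ?case
      by (intro exI[of _ "{\<one>\<^bsub>G\<^esub>}"] exI[of _ "\<lambda>_. \<one>\<^bsub>P\<^esub>"]) (simp add: gen_one A_par_one)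
  next
    case (gen h x)
    then obtain N a where N: "finite N" "N \<subseteq> carrier G" "a \<in> N \<rightarrow> carrier A"
      "x = (\<Oplus>\<^bsub>P\<^esub>g\<in>N. a g \<otimes>\<^bsub>P\<^esub> gen g)" by blast
    have h: "h \<in> carrier G" by fact
    \<comment> \<open>From \<open>[h] a [g] = conj_gen h a [h][g] = conj_gen h a eps h [hg]\<close>:
      the term at \<open>g\<close> moves to \<open>k = hg\<close>, and \<open>g\<close> is recovered
      as \<open>h\<inverse> k\<close>.\<close>
    let ?N = "(\<lambda>g. h \<otimes>\<^bsub>G\<^esub> g) ` N" and ?a = "\<lambda>k. conj_gen h (a (inv\<^bsub>G\<^esub> h \<otimes>\<^bsub>G\<^esub> k)) \<otimes>\<^bsub>P\<^esub> eps h"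
    have hinv: "inv\<^bsub>G\<^esub> h \<otimes>\<^bsub>G\<^esub> (h \<otimes>\<^bsub>G\<^esub> g) = g" if "g \<in> N" for g
      using that N(2) h by (simp add: G.m_assoc[symmetric] subset_iff)
    obtain T where T: "algebra_hom R A L T" "\<And>g. g \<in> carrier G \<Longrightarrow> T (eps g) = c g"
      using T_ex by metis
    have cA: "conj_gen h (a g) \<in> carrier A" if "g \<in> N" for g
      using conj_gen_T[OF T h funcset_mem[OF N(3) that]] by blast
    have aA: "?a \<in> ?N \<rightarrow> carrier A"
    proof
      fix k assume "k \<in> ?N"
      then obtain g where g: "g \<in> N" "k = h \<otimes>\<^bsub>G\<^esub> g" by blast
      show "?a k \<in> carrier A"
        unfolding g(2) hinv[OF g(1)] by (rule A_par_closed(2)[OF cA[OF g(1)] eps_in_A[OF h]])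
    qed
    have NG: "?N \<subseteq> carrier G" using N(2) h by (auto intro: G.m_closed)
    have "(\<Oplus>\<^bsub>P\<^esub>k\<in>?N. ?a k \<otimes>\<^bsub>P\<^esub> par_gen R G \<R> k) = (\<Oplus>\<^bsub>P\<^esub>g\<in>N. ?a (h \<otimes>\<^bsub>G\<^esub> g) \<otimes>\<^bsub>P\<^esub> par_gen R G \<R> (h \<otimes>\<^bsub>G\<^esub> g))"
    proof (rule P.finsum_reindex)
      show "(\<lambda>k. ?a k \<otimes>\<^bsub>P\<^esub> par_gen R G \<R> k) \<in> ?N \<rightarrow> carrier P"
        using tc[OF aA NG] by (rule funcsetI)
      show "inj_on (\<lambda>g. h \<otimes>\<^bsub>G\<^esub> g) N" by (rule inj_on_subset[OF G.inj_on_cmult[OF h] N(2)])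
    qed
    also have "\<dots> = (\<Oplus>\<^bsub>P\<^esub>g\<in>N. par_gen R G \<R> h \<otimes>\<^bsub>P\<^esub> (a g \<otimes>\<^bsub>P\<^esub> par_gen R G \<R> g))"
    proof (rule P.finsum_cong'[OF refl])
      show "(\<lambda>g. par_gen R G \<R> h \<otimes>\<^bsub>P\<^esub> (a g \<otimes>\<^bsub>P\<^esub> par_gen R G \<R> g)) \<in> N \<rightarrow> carrier P"
        by (intro funcsetI P.m_closed[OF gen_closed[OF h]] tc[OF N(3,2)])
      fix g assume g: "g \<in> N"
      then have gG: "g \<in> carrier G" and gA: "a g \<in> carrier A" using N by auto
      have hg: "h \<otimes>\<^bsub>G\<^esub> g \<in> carrier G" using h gG by simp
      note cl = A_par_carrier[OF cA[OF g]] A_par_carrier[OF gA] gen_closed[OF gG] gen_closed[OF h]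
        gen_closed[OF hg] eps_closed[OF h]
      have "conj_gen h (a g) \<otimes>\<^bsub>P\<^esub> eps h \<otimes>\<^bsub>P\<^esub> par_gen R G \<R> (h \<otimes>\<^bsub>G\<^esub> g) =
          conj_gen h (a g) \<otimes>\<^bsub>P\<^esub> (eps h \<otimes>\<^bsub>P\<^esub> par_gen R G \<R> (h \<otimes>\<^bsub>G\<^esub> g))"
        using cl by (simp only: P.m_assoc)
      also have "\<dots> = conj_gen h (a g) \<otimes>\<^bsub>P\<^esub> par_gen R G \<R> h \<otimes>\<^bsub>P\<^esub> par_gen R G \<R> g"
        using cl by (simp only: gen_mult_gen[OF h gG, symmetric] P.m_assoc)
      also have "\<dots> = par_gen R G \<R> h \<otimes>\<^bsub>P\<^esub> (a g \<otimes>\<^bsub>P\<^esub> par_gen R G \<R> g)"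
        using cl by (simp only: gen_mult_eq_conj_gen[OF h gA] P.m_assoc)
      finally show "?a (h \<otimes>\<^bsub>G\<^esub> g) \<otimes>\<^bsub>P\<^esub> par_gen R G \<R> (h \<otimes>\<^bsub>G\<^esub> g) =
          par_gen R G \<R> h \<otimes>\<^bsub>P\<^esub> (a g \<otimes>\<^bsub>P\<^esub> par_gen R G \<R> g)"
        by (simp only: hinv[OF g])
    qed
    also have "\<dots> = par_gen R G \<R> h \<otimes>\<^bsub>P\<^esub> x"
      unfolding N(4) using tc[OF N(3,2)]
      by (intro P.finsum_rdistr[OF N(1) gen_closed[OF h], symmetric] funcsetI)
    finally show ?case using N(1) NG aA by (intro exI[of _ ?N] exI[of _ ?a]) simp
  next
    case (add x y)
    obtain N a where N: "finite N" "N \<subseteq> carrier G" "a \<in> N \<rightarrow> carrier A"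
        "x = (\<Oplus>\<^bsub>P\<^esub>g\<in>N. a g \<otimes>\<^bsub>P\<^esub> gen g)" using add(3) by blast
    obtain M b where M: "finite M" "M \<subseteq> carrier G" "b \<in> M \<rightarrow> carrier A"
        "y = (\<Oplus>\<^bsub>P\<^esub>g\<in>M. b g \<otimes>\<^bsub>P\<^esub> gen g)" using add(4) by blast
    let ?U = "N \<union> M"
    \<comment> \<open>Padding by 0 brings both sums to the common index set, where they can be added
      termwise.\<close>
    let ?a = "\<lambda>g. if g \<in> N then a g else \<zero>\<^bsub>P\<^esub>" and ?b = "\<lambda>g. if g \<in> M then b g else \<zero>\<^bsub>P\<^esub>"
    have U: "finite ?U" "?U \<subseteq> carrier G" using N M by auto
    have abA: "?a \<in> ?U \<rightarrow> carrier A" "?b \<in> ?U \<rightarrow> carrier A" using N(3) M(3) A_par_zero by auto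
    have x: "x = (\<Oplus>\<^bsub>P\<^esub>g\<in>?U. ?a g \<otimes>\<^bsub>P\<^esub> gen g)"
      unfolding N(4)
      by (rule P.add.finprod_mono_neutral_cong_left[OF U(1)])
        (use U(2) tc[OF abA(1) U(2)] in \<open>auto simp del: Un_iff\<close>)
    have y: "y = (\<Oplus>\<^bsub>P\<^esub>g\<in>?U. ?b g \<otimes>\<^bsub>P\<^esub> gen g)"
      unfolding M(4)
      by (rule P.add.finprod_mono_neutral_cong_left[OF U(1)])
        (use U(2) tc[OF abA(2) U(2)] in \<open>auto simp del: Un_iff\<close>)
    have "x \<oplus>\<^bsub>P\<^esub> y = (\<Oplus>\<^bsub>P\<^esub>g\<in>?U. ?a g \<otimes>\<^bsub>P\<^esub> gen g \<oplus>\<^bsub>P\<^esub> ?b g \<otimes>\<^bsub>P\<^esub> gen g)"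
      unfolding x y
      by (rule P.finsum_addf[OF funcsetI funcsetI, symmetric]) (rule tc[OF abA(1) U(2)] tc[OF abA(2) U(2)]; assumption)+
    also have "\<dots> = (\<Oplus>\<^bsub>P\<^esub>g\<in>?U. (?a g \<oplus>\<^bsub>P\<^esub> ?b g) \<otimes>\<^bsub>P\<^esub> gen g)"
    proof (rule P.finsum_cong'[OF refl])
      have sA: "(\<lambda>g. ?a g \<oplus>\<^bsub>P\<^esub> ?b g) \<in> ?U \<rightarrow> carrier A"
        by (intro funcsetI A_par_closed(1) funcset_mem[OF abA(1)] funcset_mem[OF abA(2)])
      show "(\<lambda>g. (?a g \<oplus>\<^bsub>P\<^esub> ?b g) \<otimes>\<^bsub>P\<^esub> gen g) \<in> ?U \<rightarrow> carrier P"
        by (rule funcsetI) (rule tc[OF sA U(2)])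
      fix g assume g: "g \<in> ?U"
      show "?a g \<otimes>\<^bsub>P\<^esub> gen g \<oplus>\<^bsub>P\<^esub> ?b g \<otimes>\<^bsub>P\<^esub> gen g = (?a g \<oplus>\<^bsub>P\<^esub> ?b g) \<otimes>\<^bsub>P\<^esub> gen g"
        by (rule P.l_distr[OF A_par_carrier[OF funcset_mem[OF abA(1) g]]
              A_par_carrier[OF funcset_mem[OF abA(2) g]] gen_closed[OF subsetD[OF U(2) g]], symmetric])
    qed
    finally show ?case
      by (intro exI[of _ ?U] exI[of _ "\<lambda>g. ?a g \<oplus>\<^bsub>P\<^esub> ?b g"] conjI U)
        (intro funcsetI A_par_closed(1) funcset_mem[OF abA(1)] funcset_mem[OF abA(2)])
  next
    case (smult r x)
    then obtain N a where N: "finite N" "N \<subseteq> carrier G" "a \<in> N \<rightarrow> carrier A"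
      "x = (\<Oplus>\<^bsub>P\<^esub>g\<in>N. a g \<otimes>\<^bsub>P\<^esub> gen g)" by blast
    have r: "r \<in> carrier R" by fact
    have rA: "(\<lambda>g. r \<odot>\<^bsub>P\<^esub> a g) \<in> N \<rightarrow> carrier A"
      by (intro funcsetI A_par_closed(3)[OF r] funcset_mem[OF N(3)])
    have "r \<odot>\<^bsub>P\<^esub> x = (\<Oplus>\<^bsub>P\<^esub>g\<in>N. r \<odot>\<^bsub>P\<^esub> (a g \<otimes>\<^bsub>P\<^esub> gen g))"
      unfolding N(4) by (rule P.finsum_smult_ldistr[OF N(1) r funcsetI]) (rule tc[OF N(3,2)])
    also have "\<dots> = (\<Oplus>\<^bsub>P\<^esub>g\<in>N. (r \<odot>\<^bsub>P\<^esub> a g) \<otimes>\<^bsub>P\<^esub> gen g)"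
    proof (rule P.finsum_cong'[OF refl funcsetI])
      fix g assume g: "g \<in> N"
      show "(r \<odot>\<^bsub>P\<^esub> a g) \<otimes>\<^bsub>P\<^esub> gen g \<in> carrier P" by (rule tc[OF rA N(2) g])
      show "r \<odot>\<^bsub>P\<^esub> (a g \<otimes>\<^bsub>P\<^esub> gen g) = (r \<odot>\<^bsub>P\<^esub> a g) \<otimes>\<^bsub>P\<^esub> gen g"
        by (rule P.smult_mult_left[OF r A_par_carrier[OF funcset_mem[OF N(3) g]]
              gen_closed[OF subsetD[OF N(2) g]], symmetric])
    qed
    finally show ?case using N(1,2) rA by blast
  }
qed

lemma finsum_S_apply:
  assumes "k \<in> carrier G" "finite I" "f \<in> I \<rightarrow> carrier S"
  shows "finsum S f I k = (\<Oplus>\<^bsub>L\<^esub>i\<in>I. f i k)"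
  using assms(2,3)
proof (induction I)
  case empty
  then show ?case using assms(1) by (simp add: S_simps)
next
  case (insert i I)
  then have f: "f \<in> I \<rightarrow> carrier S" "f i \<in> carrier S" by auto
  have fk: "(\<lambda>i. f i k) \<in> I \<rightarrow> carrier L" "f i k \<in> carrier L"
    using f S_coeff_L[OF _ assms(1)] by auto
  show ?case
    by (simp only: S.M.finsum_insert[OF insert.hyps f] L.M.finsum_insert[OF insert.hyps fk]
        S_add_apply[OF assms(1)] insert.IH[OF f(1)])
qed

text \<open>Each term is mapped to a monomial of its own degree \<open>g\<close>, so nothing mixes.
  The factor \<open>c k\<close> reflects that a coefficient matters only through
  \<open>a k eps k\<close>.\<close>

lemma Phi_sum:
  assumes \<Phi>: "algebra_hom R P S \<Phi>" "\<And>g. g \<in> carrier G \<Longrightarrow> \<Phi> (gen g) = sk (c g) g"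
    and T: "algebra_hom R A L T" "\<And>g. g \<in> carrier G \<Longrightarrow> T (eps g) = c g"
    and N: "finite N" "N \<subseteq> carrier G" "a \<in> N \<rightarrow> carrier A" and k: "k \<in> carrier G"
  shows "\<Phi> (\<Oplus>\<^bsub>P\<^esub>g\<in>N. a g \<otimes>\<^bsub>P\<^esub> gen g) k = (if k \<in> N then T (a k) \<otimes>\<^bsub>L\<^esub> c k else \<zero>\<^bsub>L\<^esub>)"
proof -
  have "algebra_hom R A S \<Phi>"
    by (rule algebra_homI) (simp_all add: algebra_homD[OF \<Phi>(1)] A_par_carrier)
  then have \<Phi>A: "\<Phi> x = sk (T x) \<one>\<^bsub>G\<^esub>" if "x \<in> carrier A" for x
    using hom_eq_on_A[OF _ algebra_hom_comp[OF T(1) skew_monom_one_hom] S_assoc_algebra _ that]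
      Phi_eps[OF \<Phi>] T(2) by (simp add: comp_def)
  have monomial: "\<Phi> (a g \<otimes>\<^bsub>P\<^esub> gen g) = sk (T (a g) \<otimes>\<^bsub>L\<^esub> c g) g" if g: "g \<in> N" for g
  proof -
    have gG: "g \<in> carrier G" and ag: "a g \<in> carrier A" using g N by auto
    show ?thesis
      by (simp only: algebra_homD(3)[OF \<Phi>(1) A_par_carrier[OF ag] gen_closed[OF gG]] \<Phi>A[OF ag] \<Phi>(2)[OF gG]
          skew_monom_one_mult[OF algebra_homD(1)[OF T(1) ag] gG c_in_D[OF gG]])
  qed
  have tP: "(\<lambda>g. a g \<otimes>\<^bsub>P\<^esub> gen g) \<in> N \<rightarrow> carrier P"
    using N by (intro funcsetI P.m_closed A_par_carrier[OF funcset_mem[OF N(3)]] gen_closed) auto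
  have tL: "(\<lambda>g. T (a g) \<otimes>\<^bsub>L\<^esub> c g) \<in> N \<rightarrow> carrier L"
    using N by (intro funcsetI L.m_closed algebra_homD(1)[OF T(1) funcset_mem[OF N(3)]] c_closed) auto
  have tS: "(\<lambda>g. \<Phi> (a g \<otimes>\<^bsub>P\<^esub> gen g)) \<in> N \<rightarrow> carrier S"
    by (intro funcsetI algebra_homD(1)[OF \<Phi>(1)] funcset_mem[OF tP])
  have "\<Phi> (\<Oplus>\<^bsub>P\<^esub>g\<in>N. a g \<otimes>\<^bsub>P\<^esub> gen g) k = (\<Oplus>\<^bsub>L\<^esub>g\<in>N. \<Phi> (a g \<otimes>\<^bsub>P\<^esub> gen g) k)"
    by (simp only: algebra_hom_finsum[OF \<Phi>(1) P.ring_M S.ring_M N(1) tP] finsum_S_apply[OF k N(1) tS])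
  also have "\<dots> = (\<Oplus>\<^bsub>L\<^esub>g\<in>N. if k = g then T (a g) \<otimes>\<^bsub>L\<^esub> c g else \<zero>\<^bsub>L\<^esub>)"
  proof (rule L.M.finsum_cong'[OF refl funcsetI])
    fix g assume g: "g \<in> N"
    show "(if k = g then T (a g) \<otimes>\<^bsub>L\<^esub> c g else \<zero>\<^bsub>L\<^esub>) \<in> carrier L" using funcset_mem[OF tL g] by simp
    show "\<Phi> (a g \<otimes>\<^bsub>P\<^esub> gen g) k = (if k = g then T (a g) \<otimes>\<^bsub>L\<^esub> c g else \<zero>\<^bsub>L\<^esub>)"
      unfolding monomial[OF g] using k by (simp only: skew_monom_def restrict_apply if_True)
  qed
  also have "\<dots> = (if k \<in> N then T (a k) \<otimes>\<^bsub>L\<^esub> c k else \<zero>\<^bsub>L\<^esub>)"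
  proof (cases "k \<in> N")
    case True
    then show ?thesis using L.M.finsum_singleton[OF True N(1) tL] by simp
  next
    case False
    then have "(\<Oplus>\<^bsub>L\<^esub>g\<in>N. if k = g then T (a g) \<otimes>\<^bsub>L\<^esub> c g else \<zero>\<^bsub>L\<^esub>) = \<zero>\<^bsub>L\<^esub>"
      by (intro L.M.add.finprod_one_eqI) auto
    then show ?thesis using False by simp
  qed
  finally show ?thesis .
qed

text \<open>A vanishing image gives \<open>T (a g) c g = 0\<close> for every \<open>g\<close>, hence
  \<open>a g eps g = 0\<close>, and this suffices because \<open>[g] = eps g [g]\<close> makes the
  term \<open>a g [g]\<close> vanish. For surjectivity the coefficients are lifted along
  \<open>T\<close> one by one; the factor \<open>c k\<close> does not change them, as they lie in
  \<open>D k\<close>.\<close>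

lemma algebra_iso_Phi:
  assumes \<Phi>: "algebra_hom R P S \<Phi>" "\<And>g. g \<in> carrier G \<Longrightarrow> \<Phi> (gen g) = sk (c g) g"
    and T: "algebra_iso R A L T" "\<And>g. g \<in> carrier G \<Longrightarrow> T (eps g) = c g"
  shows "algebra_iso R P S \<Phi>"
proof -
  have h: "algebra_hom R A L T" and inj: "inj_on T (carrier A)" and surj: "T ` carrier A = carrier L"
    using T(1) by (auto simp: algebra_iso_iff bij_betw_def)
  interpret \<Phi>: ring_hom_ring P S \<Phi> by (rule algebra_hom_ring_hom_ring[OF \<Phi>(1) P.ring_M S.ring_M])
  have ev: "\<Phi> (\<Oplus>\<^bsub>P\<^esub>g\<in>N. a g \<otimes>\<^bsub>P\<^esub> gen g) k = (if k \<in> N then T (a k) \<otimes>\<^bsub>L\<^esub> c k else \<zero>\<^bsub>L\<^esub>)"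
    if "finite N" "N \<subseteq> carrier G" "a \<in> N \<rightarrow> carrier A" "k \<in> carrier G" for N a k
    by (rule Phi_sum[OF \<Phi>(1) _ h _ that]) (rule \<Phi>(2) T(2); assumption)+
  have "x = \<zero>\<^bsub>P\<^esub>" if x: "x \<in> carrier P" and z: "\<Phi> x = \<zero>\<^bsub>S\<^esub>" for x
  proof -
    obtain N a where N: "finite N" "N \<subseteq> carrier G" "a \<in> N \<rightarrow> carrier A"
      and x_eq: "x = (\<Oplus>\<^bsub>P\<^esub>g\<in>N. a g \<otimes>\<^bsub>P\<^esub> gen g)" using R_par_sum_representation[OF x] by blast
    have "a g \<otimes>\<^bsub>P\<^esub> gen g = \<zero>\<^bsub>P\<^esub>" if g: "g \<in> N" for g
    proof -
      have gG: "g \<in> carrier G" and ag: "a g \<in> carrier A" using g N by auto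
      have "T (a g) \<otimes>\<^bsub>L\<^esub> c g = \<Phi> x g" using ev[OF N gG] g unfolding x_eq by simp
      then have "T (a g) \<otimes>\<^bsub>L\<^esub> c g = \<zero>\<^bsub>L\<^esub>" unfolding z using gG by (simp add: S_simps)
      then have "T (a g \<otimes>\<^bsub>A\<^esub> eps g) = T \<zero>\<^bsub>A\<^esub>"
        by (simp only: algebra_homD(3)[OF h ag eps_in_A[OF gG]] T(2)[OF gG]
            algebra_hom_zero[OF h A.ring_M L.ring_M])
      then have "a g \<otimes>\<^bsub>A\<^esub> eps g = \<zero>\<^bsub>A\<^esub>"
        using inj_onD[OF inj _ A.m_closed[OF ag eps_in_A[OF gG]] A.M.zero_closed] by blast
      then have z': "a g \<otimes>\<^bsub>P\<^esub> eps g = \<zero>\<^bsub>P\<^esub>" by simp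
      have "a g \<otimes>\<^bsub>P\<^esub> gen g = a g \<otimes>\<^bsub>P\<^esub> eps g \<otimes>\<^bsub>P\<^esub> gen g"
        by (simp only: P.m_assoc[OF A_par_carrier[OF ag] eps_closed[OF gG] gen_closed[OF gG]] eps_gen[OF gG])
      also have "\<dots> = \<zero>\<^bsub>P\<^esub>" unfolding z' using gG by simp
      finally show ?thesis .
    qed
    then show ?thesis unfolding x_eq by (rule P.add.finprod_one_eqI)
  qed
  then have "a_kernel P S \<Phi> = {\<zero>\<^bsub>P\<^esub>}"
    unfolding a_kernel_def' using \<Phi>.hom_zero P.M.zero_closed by blast
  then have "inj_on \<Phi> (carrier P)" by (rule \<Phi>.trivial_ker_imp_inj)
  moreover have "\<Phi> ` carrier P = carrier S"
  proof
    show "\<Phi> ` carrier P \<subseteq> carrier S" using \<Phi>.hom_closed by blast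
    show "carrier S \<subseteq> \<Phi> ` carrier P"
    proof
      fix y assume y: "y \<in> carrier S"
      let ?N = "support G L y"
      have N: "finite ?N" "?N \<subseteq> carrier G" using S_finite_support[OF y] support_subset by auto
      have "\<exists>b\<in>carrier A. T b = y g" if "g \<in> ?N" for g
        using S_coeff_L[OF y subsetD[OF N(2) that]] surj by (metis imageE)
      then obtain a where a: "\<And>g. g \<in> ?N \<Longrightarrow> a g \<in> carrier A \<and> T (a g) = y g" by metis
      then have aA: "a \<in> ?N \<rightarrow> carrier A" by blast
      let ?x = "\<Oplus>\<^bsub>P\<^esub>g\<in>?N. a g \<otimes>\<^bsub>P\<^esub> gen g"
      have xP: "?x \<in> carrier P"
        using N(2) by (intro P.finsum_closed funcsetI P.m_closed A_par_carrier[OF funcset_mem[OF aA]] gen_closed) auto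
      have "\<Phi> ?x = y"
      proof (rule S_ext[OF \<Phi>.hom_closed[OF xP] y])
        fix k \<xi> assume k: "k \<in> carrier G" and "\<xi> \<in> \<Omega>"
        have "\<Phi> ?x k = y k"
        proof (cases "k \<in> ?N")
          case True
          then have "\<Phi> ?x k = T (a k) \<otimes>\<^bsub>L\<^esub> c k" using ev[OF N aA k] by simp
          also have "\<dots> = y k" using a[OF True] mult_c_eq[OF S_coeff[OF y k] k] by simp
          finally show ?thesis .
        next
          case False
          then show ?thesis using ev[OF N aA k] not_support[OF k False] by simp
        qed
        then show "\<Phi> ?x k \<xi> = y k \<xi>" by simp
      qed
      then show "y \<in> \<Phi> ` carrier P" by (intro rev_image_eqI[OF xP sym])
    qed
  qed
  ultimately show ?thesis
    unfolding algebra_iso_iff bij_betw_def using P.assoc_algebra_axioms S_assoc_algebra \<Phi>(1) by blast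
qed

end

theorem theorem4p4:
  fixes R :: "('r, 'k) ring_scheme"
    and G :: "('g, 'l) monoid_scheme"
    and \<R> :: "('r, 'g) eps_relation set"
  assumes "cring R" and "\<one>\<^bsub>R\<^esub> \<noteq> \<zero>\<^bsub>R\<^esub>" and "indecomposable R"
    and "group G"
    and "eps_relations_on R G \<R>"
  shows
    "(field R \<longrightarrow> kernel_separates R G \<R>) \<and>
     (kernel_separates R G \<R> \<longrightarrow>
       (let \<Omega> = Omega_top R G \<R>;
            L = Lc \<Omega> R;
            c = char_fun \<Omega> R;
            D = Lc_ideal R G \<R>;
            \<theta> = Lc_theta R G \<R>
        in \<exists>T.
         algebra_iso R (A_par R G \<R>) L T \<and>
         (\<forall>g\<in>carrier G. T (par_eps R G \<R> g) = c g) \<and>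

         topological_partial_action G \<Omega> (Omega_at R G \<R>) (theta_hat G) \<and>

         algebra_partial_action R G L D \<theta> \<and>
         (\<forall>g\<in>carrier G. \<forall>h\<in>carrier G.
            \<theta> g (c h \<otimes>\<^bsub>L\<^esub> c (inv\<^bsub>G\<^esub> g)) = c (g \<otimes>\<^bsub>G\<^esub> h) \<otimes>\<^bsub>L\<^esub> c g) \<and>
         (\<exists>\<eta>. A_par_action R G \<R> \<eta>) \<and>
         (\<forall>\<eta>. A_par_action R G \<R> \<eta> \<longrightarrow>
            equivalent_under G T (A_par_ideal R G \<R>) \<eta> D \<theta>) \<and>

         (\<exists>\<Phi>. algebra_iso R (R_par R G \<R>) (skew_group_ring G L D \<theta>) \<Phi> \<and>
              (\<forall>g\<in>carrier G. \<Phi> (par_gen R G \<R> g) = skew_monom G L (c g) g))))"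
proof -
  interpret par_setup R G \<R>
    by (intro par_setup.intro par_setup_axioms.intro assms)
  show ?thesis
    unfolding Let_def
  proof (intro conjI impI)
    show "kernel_separates R G \<R>" if "field R" by (rule field_imp_kernel_separates[OF that])
  next
    assume "kernel_separates R G \<R>"
    note van = kernel_separates_imp_cutoffs_vanish[OF this]
    obtain T where T: "algebra_hom R A L T" "\<And>g. g \<in> carrier G \<Longrightarrow> T (eps g) = c g"
      using T_ex by metis
    obtain \<Phi> where \<Phi>: "algebra_hom R P S \<Phi>" "\<And>g. g \<in> carrier G \<Longrightarrow> \<Phi> (gen g) = sk (c g) g"
      using Phi_ex by metis
    have iso: "algebra_iso R A L T" by (rule algebra_iso_T[OF T van])
    show "\<exists>T. algebra_iso R A L T \<and> (\<forall>g\<in>carrier G. T (eps g) = c g) \<and>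
        topological_partial_action G (Omega_top R G \<R>) (Omega_at R G \<R>) (theta_hat G) \<and>
        algebra_partial_action R G L (Lc_ideal R G \<R>) (Lc_theta R G \<R>) \<and>
        (\<forall>g\<in>carrier G. \<forall>h\<in>carrier G.
          \<theta> g (c h \<otimes>\<^bsub>L\<^esub> c (inv\<^bsub>G\<^esub> g)) = c (g \<otimes>\<^bsub>G\<^esub> h) \<otimes>\<^bsub>L\<^esub> c g) \<and>
        (\<exists>\<eta>. A_par_action R G \<R> \<eta>) \<and>
        (\<forall>\<eta>. A_par_action R G \<R> \<eta> \<longrightarrow>
          equivalent_under G T (A_par_ideal R G \<R>) \<eta> (Lc_ideal R G \<R>) (Lc_theta R G \<R>)) \<and>
        (\<exists>\<Phi>. algebra_iso R P S \<Phi> \<and> (\<forall>g\<in>carrier G. \<Phi> (gen g) = sk (c g) g))"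
    proof (intro exI[of _ T] conjI ballI allI impI)
      show "\<exists>\<eta>. A_par_action R G \<R> \<eta>" using A_par_action_ex[OF iso T(2)] by blast
      show "\<exists>\<Phi>. algebra_iso R P S \<Phi> \<and> (\<forall>g\<in>carrier G. \<Phi> (gen g) = sk (c g) g)"
        using algebra_iso_Phi[OF \<Phi> iso T(2)] \<Phi>(2) by blast
      show "algebra_iso R A L T" by (rule iso)
      show "topological_partial_action G (Omega_top R G \<R>) (Omega_at R G \<R>) (theta_hat G)"
        by (rule topological_partial_action_theta_hat)
      show "algebra_partial_action R G L (Lc_ideal R G \<R>) (Lc_theta R G \<R>)"
        by (rule algebra_partial_action_theta)
      show "equivalent_under G T (A_par_ideal R G \<R>) \<eta> (Lc_ideal R G \<R>) (Lc_theta R G \<R>)"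
        if "A_par_action R G \<R> \<eta>" for \<eta>
        by (rule A_par_action_equivalent[OF iso T(2) that])
    qed (simp_all only: T(2) theta_c)
  qed
qed

end
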